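(* Let $G$ be a planar hamiltonian graph with $|E(G)| \geq (2 + \gamma)|V(G)|$ for some real number $-1 \leq \gamma < 1$. Let $k, g$ be positive integers such that $g + \lceil \gamma |V(G)| \rceil + 2 > 0$, $3 \leq k \leq |V(G)|$ and $\lfloor \frac{(1-\gamma)|V(G)|}{2} \rfloor \leq k \leq \frac{\lceil (1+\gamma)|V(G)| \rceil}{2} + 2g + \frac{3}{2}$. Then there exists a cycle $K$ in $G$ with $k - g + 1 \leq |V(K)| \leq k$, and such a $K$ can be found in linear time if a Hamilton cycle of $G$ is given.
   Context: Graphs are finite and simple. A graph is hamiltonian if it has a cycle through all vertices (a Hamilton cycle). *)

theory Defs
  imports "HOL-Analysis.Analysis"
begin

section \<open>Graphs\<close>

definition simple_graph :: "'a set \<Rightarrow> 'a set set \<Rightarrow> bool" where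
  "simple_graph V E \<longleftrightarrow> finite V \<and> (\<forall>e\<in>E. e \<subseteq> V \<and> card e = 2)"

text \<open>A cycle is given by the list of its vertices in cyclic order; it has no repeated
  vertex and length at least 3.\<close>

definition is_cycle :: "'a set \<Rightarrow> 'a set set \<Rightarrow> 'a list \<Rightarrow> bool" where
  "is_cycle V E C \<longleftrightarrow> 3 \<le> length C \<and> distinct C \<and> set C \<subseteq> V \<and>
     (\<forall>i<length C. {C ! i, C ! (Suc i mod length C)} \<in> E)"

definition hamilton_cycle :: "'a set \<Rightarrow> 'a set set \<Rightarrow> 'a list \<Rightarrow> bool" where
  "hamilton_cycle V E C \<longleftrightarrow> is_cycle V E C \<and> set C = V"

definition hamiltonian :: "'a set \<Rightarrow> 'a set set \<Rightarrow> bool" where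
  "hamiltonian V E \<longleftrightarrow> (\<exists>C. hamilton_cycle V E C)"

text \<open>Topological planarity: there is a drawing in the plane in which vertices are distinct
  points, every edge is an arc joining its two end vertices and passing through no other
  vertex, and two different edges meet only in common end vertices.\<close>

definition planar :: "'a set \<Rightarrow> 'a set set \<Rightarrow> bool" where
  "planar V E \<longleftrightarrow> (\<exists>(pos :: 'a \<Rightarrow> complex) (crv :: 'a set \<Rightarrow> real \<Rightarrow> complex).
     inj_on pos V \<and>
     (\<forall>e\<in>E. arc (crv e) \<and> {pathstart (crv e), pathfinish (crv e)} = pos ` e \<and>
        path_image (crv e) \<inter> pos ` V = pos ` e) \<and>
     (\<forall>e\<in>E. \<forall>f\<in>E. e \<noteq> f \<longrightarrow>
        path_image (crv e) \<inter> path_image (crv f) \<subseteq> pos ` (e \<inter> f)))"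

text \<open>The numerical hypotheses for a graph with \<open>n\<close> vertices and \<open>m\<close> edges.\<close>

definition admissible :: "nat \<Rightarrow> nat \<Rightarrow> real \<Rightarrow> nat \<Rightarrow> nat \<Rightarrow> bool" where
  "admissible n m \<gamma> k g \<longleftrightarrow>
     -1 \<le> \<gamma> \<and> \<gamma> < 1 \<and> (2 + \<gamma>) * real n \<le> real m \<and>
     0 < k \<and> 0 < g \<and>
     int g + \<lceil>\<gamma> * real n\<rceil> + 2 > 0 \<and>
     3 \<le> k \<and> k \<le> n \<and>
     \<lfloor>(1 - \<gamma>) * real n / 2\<rfloor> \<le> int k \<and>
     real k \<le> real_of_int \<lceil>(1 + \<gamma>) * real n\<rceil> / 2 + 2 * real g + 3 / 2"

text \<open>The cycle \<open>K\<close> has between \<open>k - g + 1\<close> (possibly nonpositive) and \<open>k\<close> vertices.\<close>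

definition cycle_in_range :: "'a set \<Rightarrow> 'a set set \<Rightarrow> nat \<Rightarrow> nat \<Rightarrow> 'a list \<Rightarrow> bool" where
  "cycle_in_range V E k g K \<longleftrightarrow> is_cycle V E K \<and>
     int k - int g + 1 \<le> int (card (set K)) \<and> card (set K) \<le> k"


section \<open>Machine model\<close>

text \<open>Running time refers to a word RAM, programmed in a while language whose memory consists
  of finitely many registers and arrays of natural numbers. Each command and each test costs
  one time unit; this is adequate up to a constant factor depending on the program, since the
  size of the expressions is fixed by the program. Subtraction is truncated.

  The parameter \<open>W\<close> of the semantics is the largest number that fits into a machine word:
  there is no execution that stores a larger value. This rules out
  packing large amounts of data into a single number.\<close>

datatype aexp =
    Const nat
  | Var string
  | Get string aexp
  | Plus aexp aexp
  | Minus aexp aexp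

datatype bexp =
    Less aexp aexp
  | Not bexp
  | And bexp bexp

datatype com =
    Skip
  | Assign string aexp
  | Put string aexp aexp
  | Seq com com
  | If bexp com com
  | While bexp com

type_synonym state = "(string \<Rightarrow> nat) \<times> (string \<Rightarrow> nat \<Rightarrow> nat)"

fun aval :: "aexp \<Rightarrow> state \<Rightarrow> nat" where
  "aval (Const c) s = c"
| "aval (Var x) s = fst s x"
| "aval (Get a i) s = snd s a (aval i s)"
| "aval (Plus d e) s = aval d s + aval e s"
| "aval (Minus d e) s = aval d s - aval e s"

fun bval :: "bexp \<Rightarrow> state \<Rightarrow> bool" where
  "bval (Less d e) s \<longleftrightarrow> aval d s < aval e s"
| "bval (Not b) s \<longleftrightarrow> \<not> bval b s"
| "bval (And b c) s \<longleftrightarrow> bval b s \<and> bval c s"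

text \<open>\<open>exec W p s t s'\<close>: started in \<open>s\<close>, the program \<open>p\<close> terminates in \<open>s'\<close> after exactly \<open>t\<close>
  time units.\<close>

inductive exec :: "nat \<Rightarrow> com \<Rightarrow> state \<Rightarrow> nat \<Rightarrow> state \<Rightarrow> bool" for W :: nat where
  Skip: "exec W Skip s 1 s"
| Assign: "aval e s \<le> W \<Longrightarrow>
    exec W (Assign x e) s 1 ((fst s)(x := aval e s), snd s)"
| Put: "aval e s \<le> W \<Longrightarrow>
    exec W (Put a i e) s 1 (fst s, (snd s)(a := (snd s a)(aval i s := aval e s)))"
| Seq: "exec W p s t s' \<Longrightarrow> exec W q s' u s'' \<Longrightarrow> exec W (Seq p q) s (t + u) s''"
| IfTrue: "bval b s \<Longrightarrow> exec W p s t s' \<Longrightarrow> exec W (If b p q) s (1 + t) s'"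
| IfFalse: "\<not> bval b s \<Longrightarrow> exec W q s t s' \<Longrightarrow> exec W (If b p q) s (1 + t) s'"
| WhileFalse: "\<not> bval b s \<Longrightarrow> exec W (While b p) s 1 s"
| WhileTrue: "bval b s \<Longrightarrow> exec W p s t s' \<Longrightarrow> exec W (While b p) s' u s'' \<Longrightarrow>
    exec W (While b p) s (1 + t + u) s''"

text \<open>Graphs on \<open>{..<n}\<close> are passed to programs as lists of edges: each edge occurs
  exactly once, in either orientation, and the order is arbitrary.\<close>

definition edge_list :: "nat set set \<Rightarrow> (nat \<times> nat) list \<Rightarrow> bool" where
  "edge_list E es \<longleftrightarrow> distinct (map (\<lambda>(u, v). {u, v}) es) \<and> set (map (\<lambda>(u, v). {u, v}) es) = E"

definition to_array :: "nat list \<Rightarrow> nat \<Rightarrow> nat" where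
  "to_array xs i = (if i < length xs then xs ! i else 0)"

definition input_state :: "nat \<Rightarrow> (nat \<times> nat) list \<Rightarrow> nat list \<Rightarrow> nat \<Rightarrow> nat \<Rightarrow> state" where
  "input_state n es H k g =
     ((\<lambda>_. 0)(''n'' := n, ''m'' := length es, ''k'' := k, ''g'' := g),
      (\<lambda>_ _. 0)(''src'' := to_array (map fst es), ''dst'' := to_array (map snd es),
                ''ham'' := to_array H))"

definition output_list :: "state \<Rightarrow> nat list" where
  "output_list s = map (snd s ''out'') [0..<fst s ''len'']"

end

theory Submission
  imports Defs
begin

text \<open>Place the Hamilton cycle on a circle. By planarity the remaining edges (chords) fall into an inside
  and an outside class, neither of which contains a crossing pair; keep the larger class, which has
  \<open>q\<close> chords with \<open>2 * q \<ge> m - n\<close>. It cuts the disk into \<open>q + 1\<close> faces forming a tree, and walking around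
  the disk visits these faces in a closed tour. A window of the tour determines a connected set of
  faces, whose boundary is a cycle with two more vertices than the sum of the weights (size minus
  two) of the faces. Moving the two ends of the window, one either meets a sum in the required
  range, or every starting point has a jump across that range at a later end point. The latter is
  impossible: a double count of the jumps by the face at which they happen contradicts the
  numerical hypotheses.

  The linear-time program sorts the chord ends with two bucket passes. It finds a two-colouring of
  the chords without constructing the possibly quadratically many crossings: a scan over the ends
  keeps the active chords in a linked list and records only parities between neighbouring chords;
  the colours are then read off in reverse order.\<close>

text \<open>What makes the double count work: call a step of the tour heavy (\<open>loss\<close>)
  when the face it leaves, together with the branch it enters, weighs more than the upper bound. The
  edge into the jump face, walked back out of that face, is always heavy, so jumps map heavy steps
  to heavy steps. The sums reached by the jumps of heavy starts at one edge are pairwise distinct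
  integers above the bound, so their number is limited by the weight of the jump face. This caps the
  number of heavy steps by weights, while sorting heavy steps by the face they leave relates it to
  the number of faces. Faces with two or more heavy steps obstruct the direct comparison; they form
  a connected core, which gets its own count. Weights are sizes minus two because gluing two
  polygons along a chord loses two sides, so these weights add up. On the algorithmic side the
  program never sees the drawing: planarity only provides a proper colouring for the correctness
  proof. The existence claim is obtained from the output of the program, after numbering the
  vertices along the Hamilton cycle.\<close>

section \<open>Closed tours around a tree\<close>

text \<open>Step i of the tour, lifted to the integers with period \<open>L\<close>, leaves face
  \<open>v i\<close> for \<open>v (i + 1)\<close>; \<open>m i\<close> is the next step over the same
  tree edge, in the opposite direction. The places \<open>i + 1..m i\<close> are the branch behind
  step i, and \<open>v_neq_sides\<close> says that cutting the edge separates this branch from all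
  other faces. \<open>L_card\<close> expresses that every tree edge is walked twice.\<close>

locale tree_tour =
  fixes L :: int and m :: "int \<Rightarrow> int" and v :: "int \<Rightarrow> 'f"
  assumes L_pos: "0 < L"
    and m_gt: "i < m i" and m_lt: "m i < i + L"
    and m_m: "m (m i) = i + L"
    and v_per: "v (i + L) = v i"
    and v_next: "v (m i + 1) = v i"
    and v_neq_sides: "i < x \<Longrightarrow> x \<le> m i \<Longrightarrow> m i < y \<Longrightarrow> y \<le> i + L \<Longrightarrow> v x \<noteq> v y"
    and L_card: "L = 2 * (int (card (v ` {0..<L})) - 1)"
begin

lemma m_per: "m (i + L) = m i + L"
  using m_m[of "m i"] m_m[of i] by simp

lemma per_mult: fixes f :: "int \<Rightarrow> 'x" assumes "\<And>i. f (i + L) = f i" shows "f (i + t * L) = f i"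
proof (induction t rule: int_induct[of _ 0])
  case base then show ?case by simp
next
  case (step1 t) then show ?case using assms[of "i + t * L"] by (simp add: algebra_simps)
next
  case (step2 t) then show ?case using assms[of "i + (t - 1) * L"] by (simp add: algebra_simps)
qed

lemma v_per_mult: "v (i + t * L) = v i" using per_mult[of v, OF v_per] .

lemma m_per_mult: "m (i + t * L) = m i + t * L"
  using per_mult[of "\<lambda>i. m i - i" i t] m_per by simp

lemma v_mod: "v (i mod L) = v i"
  using v_per_mult[of i "- (i div L)"] by (simp add: minus_div_mult_eq_mod)

lemma m_mod: "m (i mod L) = m i - (i div L) * L"
  using m_per_mult[of i "- (i div L)"] by (simp add: minus_div_mult_eq_mod)

lemma v_neq: "i < x \<Longrightarrow> x \<le> m i \<Longrightarrow> v x \<noteq> v i"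
  using v_neq_sides[of i x "i + L"] m_lt[of i] v_per by simp

lemma v_m: "v (m i) = v (i + 1)"
  using v_next[of "m i"] m_m[of i] v_per[of "i + 1"] by (simp add: algebra_simps)

definition faces where "faces = v ` {0..<L}"

lemma v_in_faces [simp]: "v i \<in> faces"
  unfolding faces_def using L_pos by (auto intro!: image_eqI[of _ _ "i mod L"] simp: v_mod)

lemma finite_faces [simp]: "finite faces"
  unfolding faces_def by simp

lemma shift_into: "\<exists>t. x < i + t * L \<and> i + t * L \<le> x + L"
proof -
  have "x + 1 + (i - (x + 1)) mod L = i + (- ((i - (x + 1)) div L)) * L"
    by (simp add: minus_div_mult_eq_mod[symmetric] algebra_simps)
  moreover have "0 \<le> (i - (x + 1)) mod L" "(i - (x + 1)) mod L < L" using L_pos by simp_all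
  ultimately show ?thesis by (intro exI[of _ "- ((i - (x + 1)) div L)"]) linarith
qed

lemma faces_period: "v ` {x + 1..x + L} = faces"
proof
  show "v ` {x + 1..x + L} \<subseteq> faces" by auto
  show "faces \<subseteq> v ` {x + 1..x + L}"
  proof
    fix f assume "f \<in> faces"
    then obtain i where i: "f = v i" unfolding faces_def by auto
    obtain t where "x < i + t * L" "i + t * L \<le> x + L" using shift_into by blast
    then show "f \<in> v ` {x + 1..x + L}" using i v_per_mult[of i t] by (intro image_eqI[of _ _ "i + t * L"]) auto
  qed
qed

text \<open>The step from \<open>f\<close> towards \<open>v x\<close> is the last visit to
  \<open>f\<close> before x: had the walk returned from the branch earlier, it would be at
  \<open>f\<close> again at \<open>m s + 1\<close>, a later visit.\<close>

lemma direction: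
  assumes "f \<in> faces" "f \<noteq> v x"
  shows "\<exists>s. x - L \<le> s \<and> s < x \<and> x \<le> m s \<and> v s = f"
proof -
  let ?S = "{s \<in> {x - L..<x}. v s = f}"
  have "f \<in> v ` {x - L - 1 + 1..x - L - 1 + L}" using assms(1) unfolding faces_period .
  then obtain s0 where "s0 \<in> {x - L - 1 + 1..x - L - 1 + L}" "v s0 = f" by (elim imageE) simp
  then have "s0 \<in> ?S" by simp
  then have ne: "?S \<noteq> {}" by (simp only: ex_in_conv[symmetric]) (rule exI)
  have fin: "finite ?S" by (rule finite_subset[of _ "{x - L..<x}"]) auto
  define s where "s = Max ?S"
  have s: "s \<in> ?S" and smax: "\<And>t. t \<in> ?S \<Longrightarrow> t \<le> s"
    unfolding s_def using Max_in[OF fin ne] Max_ge[OF fin] by blast+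
  have "x \<le> m s"
  proof (rule ccontr)
    assume "\<not> x \<le> m s"
    moreover have "v (m s + 1) = f" using v_next s by simp
    ultimately have "m s + 1 \<in> ?S" using assms(2) m_gt[of s] s by (auto simp: less_le)
    then show False using smax m_gt[of s] by fastforce
  qed
  then show ?thesis using s by auto
qed

lemma v_period: "v ` {i + 1..m i} \<union> v ` {m i + 1..i + L} = faces"
proof -
  have "{i + 1..m i} \<union> {m i + 1..i + L} = {i + 1..i + L}" using m_gt[of i] m_lt[of i] by auto
  then show ?thesis using faces_period[of i] by (metis image_Un)
qed

lemma v_sides_disjoint: "v ` {i + 1..m i} \<inter> v ` {m i + 1..i + L} = {}"
  using v_neq_sides[of i] by force

lemma v_inside_iff:
  assumes "v x \<in> v ` {i + 1..m i}" "i < x" "x \<le> i + L" shows "x \<le> m i"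
proof (rule ccontr)
  assume "\<not> x \<le> m i"
  moreover obtain y where "y \<in> {i + 1..m i}" "v x = v y" using assms(1) by (elim imageE) simp
  ultimately show False using v_neq_sides[of i y x] assms by simp
qed

lemma v_behind: "v i \<notin> v ` {i + 1..m i}"
proof
  assume "v i \<in> v ` {i + 1..m i}"
  then obtain x where "x \<in> {i + 1..m i}" "v x = v i" by auto
  then show False using v_neq[of i x] by simp
qed

lemma interval_mod_image: "v ` {i mod L + 1..m (i mod L)} = v ` {i + 1..m i}"
proof -
  define a t where "a = i mod L" and "t = i div L"
  have i: "i = a + t * L" unfolding a_def t_def by simp
  have "m i = m a + t * L" unfolding i m_per_mult ..
  then have "{i + 1..m i} = (\<lambda>x. x + t * L) ` {a + 1..m a}"
  proof -
    assume "m i = m a + t * L"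
    moreover have "i + 1 = a + 1 + t * L" using i by simp
    ultimately show ?thesis unfolding image_add_atLeastAtMost' by metis
  qed
  then have "v ` {i + 1..m i} = (\<lambda>x. v (x + t * L)) ` {a + 1..m a}" by (simp only: image_image)
  then have "v ` {i + 1..m i} = v ` {a + 1..m a}" by (simp only: v_per_mult)
  then show ?thesis unfolding a_def ..
qed

lemma L_card_faces: "L = 2 * (int (card faces) - 1)"
  using L_card unfolding faces_def .

end

section \<open>Noncrossing circular words give tree tours\<close>

text \<open>Here \<open>e i\<close> is the chord that has an end at place i, and \<open>v i\<close>
  encodes a face by a set of chords: passing an end toggles membership of that chord. With this
  encoding the two sides of a chord differ visibly, in that chord.\<close>

locale circular_word =
  fixes e :: "int \<Rightarrow> 'c" and L :: int and m :: "int \<Rightarrow> int" and v :: "int \<Rightarrow> 'c set"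
  assumes L_pos: "0 < L"
    and m_gt: "i < m i" and m_lt: "m i < i + L"
    and e_m: "e (m i) = e i"
    and e_eqD: "e j = e i \<Longrightarrow> i < j \<Longrightarrow> j < i + L \<Longrightarrow> j = m i"
    and e_per: "e (i + L) = e i"
    and noncrossing: "i < j \<Longrightarrow> j < m i \<Longrightarrow> m i < m j \<Longrightarrow> \<not> m j < i + L"
    and v_step: "x \<in> v (i + 1) \<longleftrightarrow> (x \<in> v i) \<noteq> (e i = x)"
    and v_per: "v (i + L) = v i"
begin

lemma m_m: "m (m i) = i + L"
  using e_eqD[of "i + L" "m i"] m_gt[of i] m_lt[of i] e_per e_m by simp

lemma m_per: "m (i + L) = m i + L"
  using m_m[of "m i"] m_m[of i] by simp

lemma v_range: "i \<le> j \<Longrightarrow> x \<in> v j \<longleftrightarrow> (x \<in> v i) \<noteq> odd (card {t\<in>{i..<j}. e t = x})"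
proof (induction j rule: int_ge_induct)
  case base then show ?case by simp
next
  case (step j)
  have fin: "finite {t\<in>{i..<j}. e t = x}" by (rule finite_subset[of _ "{i..<j}"]) auto
  have "{i..<j + 1} = insert j {i..<j}" using step(1) by auto
  then have "{t\<in>{i..<j + 1}. e t = x} = (if e j = x then insert j {t\<in>{i..<j}. e t = x} else {t\<in>{i..<j}. e t = x})"
    by auto
  then have "card {t\<in>{i..<j + 1}. e t = x} = (if e j = x then Suc (card {t\<in>{i..<j}. e t = x}) else card {t\<in>{i..<j}. e t = x})"
    using fin by auto
  then show ?case using step v_step[of x j] by auto
qed

lemma v_const: assumes "i \<le> j" "\<And>t. i \<le> t \<Longrightarrow> t < j \<Longrightarrow> e t \<noteq> x" shows "x \<in> v j \<longleftrightarrow> x \<in> v i"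
proof -
  have "{t\<in>{i..<j}. e t = x} = {}" using assms(2) by auto
  then show ?thesis using v_range[OF assms(1), of x] by (metis card.empty even_zero)
qed

lemma side_in: assumes "i < x" "x \<le> m i" shows "e i \<in> v x \<longleftrightarrow> e i \<notin> v i"
proof -
  have "e i \<in> v x \<longleftrightarrow> e i \<in> v (i + 1)"
    by (rule v_const) (use assms e_eqD[of _ i] m_lt[of i] in force)+
  then show ?thesis using v_step[of "e i" i] by simp
qed

lemma side_out: assumes "m i < x" "x \<le> i + L" shows "e i \<in> v x \<longleftrightarrow> e i \<in> v i"
  using side_in[of "m i" x] assms by (metis e_m m_m side_in[of i "m i"] m_gt order_refl)

lemma v_neq_sides:
  assumes "i < x" "x \<le> m i" "m i < y" "y \<le> i + L" shows "v x \<noteq> v y"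
proof
  assume "v x = v y"
  then show False using side_in[OF assms(1,2)] side_out[OF assms(3,4)] by metis
qed

text \<open>Chords other than \<open>e i\<close> have either no end or both ends between the two
  ends of \<open>e i\<close>, so their toggles cancel; \<open>e i\<close> itself is toggled
  twice.\<close>

lemma v_next: "v (m i + 1) = v i"
proof (rule set_eqI)
  fix x
  show "x \<in> v (m i + 1) \<longleftrightarrow> x \<in> v i"
  proof (cases "x = e i")
    case True
    then show ?thesis using v_step[of x "m i"] side_in[of i "m i"] m_gt[of i] e_m[of i] by auto
  next
    case False
    let ?S = "{t\<in>{i..<m i + 1}. e t = x}"
    have "even (card ?S)"
    proof (cases "?S = {}")
      case True then show ?thesis by (metis card.empty even_zero)
    next
      case ne: False
      have fin: "finite ?S" by (rule finite_subset[of _ "{i..<m i + 1}"]) auto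
      define j where "j = Min ?S"
      have j: "j \<in> ?S" and jmin: "\<And>t. t \<in> ?S \<Longrightarrow> j \<le> t"
        unfolding j_def using Min_in[OF fin ne] Min_le[OF fin] by blast+
      have ij: "i < j" "j < m i" using j False e_m[of i] by (auto simp: less_le)
      have ej: "e j = x" using j by simp
      have "m j < m i"
      proof (rule ccontr)
        assume a: "\<not> m j < m i"
        have "m j \<noteq> m i" using e_m[of i] e_m[of j] ej False by metis
        with a have g: "m i < m j" by simp
        \<comment> \<open>A partner beyond \<open>m i\<close> lies beyond the whole period; moved
          back by \<open>L\<close> it is an occurrence of \<open>x\<close> in the interval before
          the minimal one.\<close>
        have "i + L \<le> m j" using noncrossing[OF ij g] by simp
        moreover have "m j \<noteq> i + L" using e_m[of j] e_per[of i] ej False by metis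
        ultimately have "m j - L > i" "m j - L < j" using m_lt[of j] by auto
        moreover have "e (m j - L) = x" using e_per[of "m j - L"] e_m[of j] ej by simp
        ultimately have "m j - L \<in> ?S" using ij by auto
        then show False using jmin \<open>m j - L < j\<close> by force
      qed
      have "?S = {j, m j}"
      proof (intro equalityI subsetI)
        fix t assume t: "t \<in> ?S"
        then have "j \<le> t" using jmin by blast
        moreover have "t < j + L" using t m_lt[of i] ij by auto
        ultimately show "t \<in> {j, m j}" using e_eqD[of t j] t ej by (cases "t = j") auto
      qed (use ij ej m_gt[of j] e_m[of j] \<open>m j < m i\<close> in auto)
      then show ?thesis using m_gt[of j] by (simp add: card_insert_if)
    qed
    then show ?thesis using v_range[of i "m i + 1" x] m_gt[of i] by simp
  qed
qed

definition opens where "opens = {t\<in>{0..<L}. m t < L}"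

lemma finite_opens [simp]: "finite opens"
  unfolding opens_def by (rule finite_subset[of _ "{0..<L}"]) auto

lemma card_opens: "L = 2 * int (card opens)"
proof -
  let ?C = "{t\<in>{0..<L}. \<not> m t < L}"
  have mback: "m (a - L) = m a - L" for a using m_per[of "a - L"] by simp
  have "bij_betw m opens ?C"
  proof (rule bij_betw_byWitness[where f' = "\<lambda>t. m t - L"])
    show "\<forall>a\<in>opens. m (m a) - L = a" using m_m by simp
    show "\<forall>a\<in>?C. m (m a - L) = a" using m_m mback by simp
    show "m ` opens \<subseteq> ?C"
    proof
      fix x assume "x \<in> m ` opens"
      then obtain t where t: "x = m t" "0 \<le> t" "t < L" "m t < L" unfolding opens_def by auto
      then show "x \<in> ?C" using m_gt[of t] m_m[of t] by simp
    qed
    show "(\<lambda>t. m t - L) ` ?C \<subseteq> opens"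
    proof
      fix x assume "x \<in> (\<lambda>t. m t - L) ` ?C"
      then obtain t where t: "x = m t - L" "0 \<le> t" "t < L" "L \<le> m t" by auto
      then show "x \<in> opens" using m_lt[of t] m_m[of t] mback[of "m t"] unfolding opens_def by simp
    qed
  qed
  then have "card opens = card ?C" by (rule bij_betw_same_card)
  moreover have "{0..<L} = opens \<union> ?C" "opens \<inter> ?C = {}" unfolding opens_def by auto
  ultimately have "card {0..<L} = 2 * card opens"
    by (metis (no_types, lifting) card_Un_disjoint finite_Un finite_atLeastLessThan_int mult_2)
  then show ?thesis using L_pos by simp
qed

text \<open>An opening end in the base period leads to a face not visited since place 0, and a
  closing end leads back to the face in front of its partner. So the faces are \<open>v 0\<close>
  and one for each chord.\<close>

lemma card_faces: "L = 2 * (int (card (v ` {0..<L})) - 1)"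
proof -
  let ?F = "v ` {0..<L}"
  have fresh: "v i \<noteq> v (t + 1)" if "t \<in> opens" "0 \<le> i" "i \<le> t" for i t
  proof -
    have t: "m t < L" using that unfolding opens_def by simp
    have "e t \<in> v t \<longleftrightarrow> e t \<in> v i"
    proof (rule v_const[OF that(3)])
      fix s assume s: "i \<le> s" "s < t"
      show "e s \<noteq> e t"
      proof
        assume "e s = e t"
        then have "t = m s" using e_eqD[of t s] s that t m_gt[of t] by auto
        then have "m t = s + L" using m_m by simp
        then show False using t s that by simp
      qed
    qed
    then show ?thesis using v_step[of "e t" t] by auto
  qed
  have "?F = insert (v 0) ((\<lambda>t. v (t + 1)) ` opens)"
  proof
    have "v i \<in> insert (v 0) ((\<lambda>t. v (t + 1)) ` opens)" if "0 \<le> i" "i < L" for i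
      using that
    proof (induction "nat i" arbitrary: i rule: less_induct)
      case less
      show ?case
      proof (cases "i = 0")
        case True then show ?thesis by simp
      next
        case False
        define t where "t = i - 1"
        show ?thesis
        proof (cases "m t < L")
          case True
          then have "t \<in> opens" using less.prems False unfolding opens_def t_def by simp
          then show ?thesis unfolding t_def by (intro insertI2 image_eqI[of _ _ "i - 1"]) simp_all
        next
          case F2: False
          define s where "s = m t - L"
          have ms: "m s = t" unfolding s_def using m_m[of t] m_per[of "m t - L"] by simp
          have "s < t" "0 \<le> s" using m_gt[of s] ms F2 unfolding s_def by auto
          moreover have "v i = v s" using v_next[of s] ms unfolding t_def by simp
          ultimately show ?thesis using less.hyps[of s] less.prems unfolding t_def by auto
        qed
      qed
    qed
    then show "?F \<subseteq> insert (v 0) ((\<lambda>t. v (t + 1)) ` opens)" by (intro image_subsetI) simp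
    show "insert (v 0) ((\<lambda>t. v (t + 1)) ` opens) \<subseteq> ?F"
    proof -
      have "v (t + 1) \<in> ?F" if "t \<in> opens" for t
        using that m_gt[of t] unfolding opens_def by (intro image_eqI[of _ _ "t + 1"]) auto
      then show ?thesis using L_pos by (auto simp del: set_eq_iff)
    qed
  qed
  moreover have "v 0 \<notin> (\<lambda>t. v (t + 1)) ` opens" using fresh[of _ 0] unfolding opens_def by auto
  moreover have "inj_on (\<lambda>t. v (t + 1)) opens"
  proof (rule linorder_inj_onI)
    fix x y assume "x < y" "x \<in> opens" "y \<in> opens"
    then show "v (x + 1) \<noteq> v (y + 1)" using fresh[of y "x + 1"] unfolding opens_def by auto
  qed linarith
  ultimately have "card ?F = Suc (card opens)" by (simp add: card_image)
  then show ?thesis using card_opens by simp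
qed

lemma tree_tour: "tree_tour L m v"
  by unfold_locales (use L_pos m_gt m_lt m_m v_per v_next v_neq_sides card_faces in auto)

end

section \<open>The double count of jumps\<close>

text \<open>The situation to be refuted: from every start i the window sum leaps from at most
  \<open>k - g\<close> to more than \<open>k\<close> when the single place \<open>p i\<close> is
  added. Here \<open>k\<close> bounds weights; in the application it is two less than the bound on
  the number of vertices.\<close>

locale unbalanced_weights = tree_tour L m v
  for L :: int and m :: "int \<Rightarrow> int" and v :: "int \<Rightarrow> 'f" +
  fixes c :: "'f \<Rightarrow> int" and k g :: int and p :: "int \<Rightarrow> int"
  assumes c_pos: "f \<in> faces \<Longrightarrow> 1 \<le> c f" and c_le: "f \<in> faces \<Longrightarrow> c f \<le> k" and g_pos: "1 \<le> g"
    and p_gt: "i < p i"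
    and p_above: "k < sum c (v ` {i..p i})"
    and p_below: "sum c (v ` {i..p i - 1}) \<le> k - g"
begin

abbreviation W where "W i j \<equiv> sum c (v ` {i..j})"

text \<open>The places \<open>i..m i\<close> visit the tail \<open>v i\<close> once and then exactly
  the branch behind step i. By \<open>loss_iff\<close> a loss is a start whose jump happens before
  the walk comes back to its tail.\<close>

definition loss where "loss i \<longleftrightarrow> k < W i (m i)"

lemma c_nonneg: "f \<in> faces \<Longrightarrow> 0 \<le> c f" using c_pos[of f] by simp

lemma sum_c_mono: "F \<subseteq> G \<Longrightarrow> G \<subseteq> faces \<Longrightarrow> sum c F \<le> sum c G"
  by (intro sum_mono2) (auto intro: finite_subset[OF _ finite_faces] c_nonneg)

lemma W_mono: "i' \<le> i \<Longrightarrow> j \<le> j' \<Longrightarrow> W i j \<le> W i' j'"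
  by (intro sum_c_mono image_mono) auto

lemma image_shift: "v ` {i + t * L..j + t * L} = v ` {i..j}"
proof -
  have "{i + t * L..j + t * L} = (\<lambda>x. x + t * L) ` {i..j}" by (simp only: image_add_atLeastAtMost')
  then have "v ` {i + t * L..j + t * L} = (\<lambda>x. v (x + t * L)) ` {i..j}" by (simp only: image_image)
  then show ?thesis by (simp only: v_per_mult)
qed

lemma loss_per: "loss (i + t * L) \<longleftrightarrow> loss i"
  unfolding loss_def m_per_mult image_shift ..

lemma loss_mod: "loss (i mod L) \<longleftrightarrow> loss i"
  using loss_per[of "i mod L" "i div L"] by simp

lemma loss_mono: "i \<le> j \<Longrightarrow> m j \<le> m i \<Longrightarrow> loss j \<Longrightarrow> loss i"
  unfolding loss_def using W_mono[of i j "m j" "m i"] by simp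

lemma W_iff: "k < W i j \<longleftrightarrow> p i \<le> j"
proof
  show "p i \<le> j \<Longrightarrow> k < W i j" using W_mono[of i i "p i" j] p_above[of i] by simp
  show "k < W i j \<Longrightarrow> p i \<le> j"
    using W_mono[of i i j "p i - 1"] p_below[of i] g_pos by (cases "p i \<le> j") auto
qed

lemma loss_iff: "loss i \<longleftrightarrow> p i \<le> m i"
  unfolding loss_def W_iff ..

lemma not_lossD: "\<not> loss i \<Longrightarrow> W i (m i) \<le> k - g"
  using W_mono[of i i "m i" "p i - 1"] p_below[of i] unfolding loss_iff by simp

text \<open>Up to \<open>m i\<close> the walk stays in the branch and does not meet
  \<open>v i\<close> again, so moving the start past i loses its full weight.\<close>

lemma W_drop:
  assumes "i < i'" "i \<le> j" "j \<le> m i" shows "W i' j + c (v i) \<le> W i j"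
proof -
  have "v i \<notin> v ` {i'..j}" using v_behind[of i] assms by (auto simp: image_iff)
  then have "W i' j + c (v i) = sum c (insert (v i) (v ` {i'..j}))" by simp
  also have "\<dots> \<le> W i j" using assms by (intro sum_c_mono) auto
  finally show ?thesis .
qed

lemma W_start: "W i (m i) = c (v i) + sum c (v ` {i + 1..m i})"
proof -
  have "{i..m i} = insert i {i + 1..m i}" using m_gt[of i] by auto
  then have "v ` {i..m i} = insert (v i) (v ` {i + 1..m i})" by simp
  then show ?thesis using v_behind[of i] by simp
qed

definition A where "A = {i\<in>{0..<L}. loss i}"

text \<open>Step \<open>p i - 1\<close> enters the face at which the jump happens;
  \<open>r i\<close> is the same edge walked back out of that face, reduced to the base
  period.\<close>

definition r where "r i = m (p i - 1) mod L"

definition u where "u \<rho> = card {i\<in>A. r i = \<rho>}"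

lemma finite_A [simp]: "finite A"
  unfolding A_def by (rule finite_subset[of _ "{0..<L}"]) auto

lemma mod_in_A: "loss i \<Longrightarrow> i mod L \<in> A"
  unfolding A_def using L_pos loss_mod by simp

lemma v_p_new: "v (p i) \<notin> v ` {i..p i - 1}"
proof
  assume a: "v (p i) \<in> v ` {i..p i - 1}"
  have "{i..p i} = insert (p i) {i..p i - 1}" using p_gt[of i] by auto
  then have "v ` {i..p i} = v ` {i..p i - 1}" using a by auto
  then show False using p_above[of i] p_below[of i] g_pos by simp
qed

lemma W_p: "W i (p i) \<le> k - g + c (v (p i))"
proof -
  have "{i..p i} = insert (p i) {i..p i - 1}" using p_gt[of i] by auto
  then have "v ` {i..p i} = insert (v (p i)) (v ` {i..p i - 1})" by simp
  then show ?thesis using p_below[of i] v_p_new[of i] by simp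
qed

lemma v_r: "v (r i) = v (p i)"
  unfolding r_def v_mod v_m by simp

text \<open>The face at \<open>p i\<close> is new in the window, so the preceding step
  \<open>?s\<close> over the jump edge, out of that face, lies before i. The branch behind
  \<open>?s\<close> ends at \<open>p i - 1\<close> and therefore contains the rest of the
  window.\<close>

lemma W_r: "W i (p i) \<le> W (r i) (m (r i))"
proof -
  let ?t = "p i - 1"
  let ?s = "m ?t - L"
  have vs: "v ?s = v (p i)" using v_per[of ?s] v_m[of ?t] by simp
  have "?s < i"
  proof (rule ccontr)
    assume "\<not> ?s < i"
    then have "?s \<in> {i..p i - 1}" using m_lt[of ?t] by simp
    then show False using v_p_new[of i] vs by (metis imageI)
  qed
  have ms: "m ?s = ?t" using m_per[of ?s] m_m[of ?t] by simp
  have "{i..p i} = insert (p i) {i..?t}" using p_gt[of i] by auto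
  then have "v ` {i..p i} = insert (v ?s) (v ` {i..?t})" using vs by simp
  also have "\<dots> \<subseteq> v ` {?s..?t}" using \<open>?s < i\<close> p_gt[of i] by auto
  finally have "W i (p i) \<le> W ?s (m ?s)" unfolding ms by (intro sum_c_mono) auto
  also have "W ?s (m ?s) = W (r i) (m (r i))"
    using image_shift[of "r i" "?s div L" "m (r i)"] m_per_mult[of "r i" "?s div L"]
    by (simp add: r_def mod_diff_eq minus_mod_eq_div_mult) (metis mod_mult_div_eq add.commute minus_mod_self2 div_mult_mod_eq)
  finally show ?thesis .
qed

lemma loss_r: "loss (r i)"
  using W_r[of i] p_above[of i] unfolding loss_def by simp

lemma r_in_A: "r i \<in> A"
  using loss_r[of i] L_pos unfolding A_def r_def by simp

text \<open>Equal values of \<open>r\<close> mean that the jumps happen at the same place up to a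
  period. Two losses with a common jump place and different starts have different sums, because the
  earlier start includes a face of positive weight that the later one misses
  (\<open>W_drop\<close>).\<close>

lemma inj_W_p: "inj_on (\<lambda>i. W i (p i)) {i\<in>A. r i = \<rho>}"
proof (rule inj_onI)
  have key: "\<not> i < i'" if "loss i" "W i (p i) = W i' (p i)" for i i'
    using W_drop[of i i' "p i"] c_pos[of "v i"] p_gt[of i] that unfolding loss_iff by auto
  fix i1 i2 assume "i1 \<in> {i\<in>A. r i = \<rho>}" "i2 \<in> {i\<in>A. r i = \<rho>}"
  then have i: "i1 \<in> A" "i2 \<in> A" "r i1 = r i2" by auto
  assume eq: "W i1 (p i1) = W i2 (p i2)"
  \<comment> \<open>The number of periods by which the two jump places differ; the second start is
    shifted by it before the comparison.\<close>
  define z where "z = m (p i1 - 1) div L - m (p i2 - 1) div L"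
  have "m (p i1 - 1) = m (p i2 - 1) + z * L"
    using i(3) div_mult_mod_eq[of "m (p i1 - 1)" L] div_mult_mod_eq[of "m (p i2 - 1)" L]
    unfolding r_def z_def left_diff_distrib by linarith
  then have "m (m (p i1 - 1)) = m (m (p i2 - 1)) + z * L" by (simp add: m_per_mult)
  then have pz: "p i1 = p i2 + z * L" by (simp add: m_m)
  have W2: "W (i2 + z * L) (p i1) = W i1 (p i1)" unfolding pz image_shift eq[unfolded pz] ..
  have "p (i2 + z * L) = p i1"
  proof -
    have "k < W (i2 + z * L) (p i1)" using p_above[of i1] W2 by simp
    moreover have "W (i2 + z * L) (p i1 - 1) \<le> k - g"
      using p_below[of i2] image_shift[of i2 z "p i2 - 1"] unfolding pz by (simp add: algebra_simps)
    then have "\<not> k < W (i2 + z * L) (p i1 - 1)" using g_pos by simp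
    ultimately show ?thesis unfolding W_iff by simp
  qed
  moreover have "loss i1" "loss (i2 + z * L)" using i loss_per unfolding A_def by auto
  ultimately have "i1 = i2 + z * L" using key[of i1 "i2 + z * L"] key[of "i2 + z * L" i1] W2 by auto
  then have "i1 mod L = i2 mod L" by simp
  then show "i1 = i2" using i unfolding A_def by simp
qed

text \<open>Pigeonhole: by \<open>inj_W_p\<close> the jumps counted by \<open>u \<rho>\<close> reach
  distinct integers in \<open>{k + 1..b}\<close>. The two upper bounds on \<open>u\<close> below are
  instances with different \<open>b\<close>.\<close>

lemma u_le: "int (u \<rho>) \<le> b - k" if "\<And>i. i \<in> A \<Longrightarrow> r i = \<rho> \<Longrightarrow> W i (p i) \<le> b" "k \<le> b"
proof -
  have "(\<lambda>i. W i (p i)) ` {i\<in>A. r i = \<rho>} \<subseteq> {k + 1..b}" using that p_above by (force simp: add1_zle_eq)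
  then have "card ((\<lambda>i. W i (p i)) ` {i\<in>A. r i = \<rho>}) \<le> card {k + 1..b}" by (intro card_mono) auto
  then show ?thesis using that(2) unfolding u_def card_image[OF inj_W_p] by simp
qed

lemma u_le_W: "\<rho> \<in> A \<Longrightarrow> int (u \<rho>) \<le> W \<rho> (m \<rho>) - k"
  using u_le[of \<rho> "W \<rho> (m \<rho>)"] W_r unfolding A_def loss_def by fastforce

text \<open>The sum before the jump is at most \<open>k - g\<close> and only the weight of the jump
  face is added, so \<open>b\<close> can be \<open>k - g + c (v \<rho>)\<close>.\<close>

lemma u_le_c: assumes "0 < u \<rho>" shows "int (u \<rho>) \<le> c (v \<rho>) - g"
proof -
  have "{i\<in>A. r i = \<rho>} \<noteq> {}" using assms unfolding u_def by (metis card.empty less_irrefl)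
  then obtain i where i: "r i = \<rho>" by auto
  have le: "W i (p i) \<le> k - g + c (v \<rho>)" if "r i = \<rho>" for i using W_p[of i] v_r[of i] that by simp
  have "k \<le> k - g + c (v \<rho>)" using le[OF i] p_above[of i] by simp
  then have "int (u \<rho>) \<le> k - g + c (v \<rho>) - k" by (intro u_le le)
  then show ?thesis by simp
qed

lemma sum_u: "card A = (\<Sum>\<rho>\<in>A. u \<rho>)"
  unfolding u_def using sum.group[of A A r "\<lambda>_. 1::nat"] r_in_A by (auto simp: image_subset_iff)

lemma u_r_pos: "i \<in> A \<Longrightarrow> 0 < u (r i)"
  unfolding u_def by (auto simp: card_gt_0_iff)

lemma v_r_inside: "i \<in> A \<Longrightarrow> v (r i) \<in> v ` {i + 1..m i}"
  unfolding v_r using p_gt[of i] by (intro imageI) (auto simp: A_def loss_iff)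

text \<open>The number of heavy directions out of \<open>f\<close>; the case distinction of the
  final contradiction is on whether it ever exceeds one.\<close>

definition d where "d f = card {i\<in>A. v i = f}"

lemma sum_d: "card A = (\<Sum>f\<in>faces. d f)"
  unfolding d_def using sum.group[of A faces v "\<lambda>_. 1::nat"] by (simp add: image_subset_iff)

lemma sum_u_inj:
  assumes "B \<subseteq> A" "inj_on v B"
  shows "(\<Sum>\<rho>\<in>B. int (u \<rho>)) \<le> (\<Sum>f\<in>v ` {\<rho>\<in>B. 0 < u \<rho>}. c f - g)"
proof -
  have fin: "finite B" using assms(1) by (rule finite_subset) simp
  have "(\<Sum>\<rho>\<in>B. int (u \<rho>)) = (\<Sum>\<rho>\<in>{\<rho>\<in>B. 0 < u \<rho>}. int (u \<rho>))"
    using fin by (intro sum.mono_neutral_right) auto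
  also have "\<dots> \<le> (\<Sum>\<rho>\<in>{\<rho>\<in>B. 0 < u \<rho>}. c (v \<rho>) - g)" by (intro sum_mono) (auto intro: u_le_c)
  also have "\<dots> = (\<Sum>f\<in>v ` {\<rho>\<in>B. 0 < u \<rho>}. c f - g)"
    using assms(2) by (subst sum.reindex) (auto simp: o_def elim!: inj_on_subset)
  finally show ?thesis .
qed

text \<open>Split \<open>c f - g\<close> into \<open>c f - 1\<close>, which is nonnegative and may
  be summed over all of \<open>G\<close>, and a loss of \<open>g - 1\<close> for each member of
  \<open>K\<close>.\<close>

lemma sum_excess:
  assumes "K \<subseteq> G" "G \<subseteq> faces"
  shows "(\<Sum>f\<in>K. c f - g) \<le> (\<Sum>f\<in>G. c f) - int (card G) - (g - 1) * int (card K)"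
proof -
  have fin: "finite G" "finite K" using assms finite_subset[OF _ finite_faces] by blast+
  have "(\<Sum>f\<in>K. c f - g) = (\<Sum>f\<in>K. c f - 1) - (g - 1) * int (card K)"
    by (simp add: sum_subtractf algebra_simps)
  also have "(\<Sum>f\<in>K. c f - 1) \<le> (\<Sum>f\<in>G. c f - 1)"
  proof (intro sum_mono2)
    show "0 \<le> c b - 1" if "b \<in> G - K" for b using c_pos[of b] that assms by auto
  qed (use assms fin in auto)
  finally show ?thesis by (simp add: sum_subtractf)
qed

lemma losses_distinct:
  assumes "loss s" "loss t" "v s = f" "v t = f" "s mod L \<noteq> t mod L" shows "2 \<le> d f"
proof -
  have "{s mod L, t mod L} \<subseteq> {i\<in>A. v i = f}" using assms by (simp add: mod_in_A v_mod)
  then have "card {s mod L, t mod L} \<le> d f" unfolding d_def by (intro card_mono) auto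
  then show ?thesis using assms(5) by simp
qed

lemma loss_d_pos: assumes "loss s" "v s = f" shows "1 \<le> d f"
proof -
  have "{s mod L} \<subseteq> {i\<in>A. v i = f}" using assms by (simp add: mod_in_A v_mod)
  then have "card {s mod L} \<le> d f" unfolding d_def by (intro card_mono) auto
  then show ?thesis by simp
qed

text \<open>Take a step with \<open>Q\<close> whose branch with tail contains the most faces of
  \<open>Z\<close>. If some \<open>y\<close> in \<open>Z\<close> were missed, the step from
  \<open>y\<close> towards \<open>v i\<close> would have a strictly richer branch, and
  \<open>up\<close> passes \<open>Q\<close> on to it.\<close>

lemma extremal_direction:
  assumes ex: "\<exists>i. Q i" and Z: "\<And>i. Q i \<Longrightarrow> v i \<in> Z" "Z \<subseteq> faces"
    and up: "\<And>i s. Q i \<Longrightarrow> v s \<in> Z \<Longrightarrow> s \<le> i \<Longrightarrow> m i \<le> m s \<Longrightarrow> Q s"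
  shows "\<exists>i. Q i \<and> Z \<subseteq> v ` {i..m i}"
proof -
  have finZ: "finite Z" using Z(2) by (rule finite_subset) simp
  define h where "h i = card (Z \<inter> v ` {i..m i})" for i
  have "\<forall>i. Q i \<longrightarrow> h i < Suc (card Z)" unfolding h_def using finZ by (auto simp: less_Suc_eq_le intro: card_mono)
  then obtain i where i: "Q i" "\<And>s. Q s \<Longrightarrow> h s \<le> h i" using ex ex_has_greatest_nat[of Q _ h] by meson
  have "Z \<subseteq> v ` {i..m i}"
  proof (rule ccontr)
    assume "\<not> Z \<subseteq> v ` {i..m i}"
    then obtain y where y: "y \<in> Z" "y \<notin> v ` {i..m i}" by auto
    have "y \<noteq> v i" using y(2) m_gt[of i] by auto
    then obtain s where s: "s < i" "i \<le> m s" "v s = y" using direction[of y i] y(1) Z(2) by auto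
    have ge: "m i \<le> m s"
    proof (rule ccontr)
      assume "\<not> m i \<le> m s"
      then have "m s + 1 \<in> {i..m i}" using s by simp
      then show False using y(2) v_next[of s] s(3) by (metis imageI)
    qed
    have "Q s" using up[OF i(1), of s] s y ge by simp
    moreover have "h i < h s"
    proof -
      have "v ` {i..m i} \<subseteq> v ` {s..m s}" using s ge by (intro image_mono) auto
      moreover have "y \<in> v ` {s..m s}" using s m_gt[of s] by auto
      ultimately have "Z \<inter> v ` {i..m i} \<subset> Z \<inter> v ` {s..m s}" using y by blast
      then show ?thesis unfolding h_def using finZ by (intro psubset_card_mono) auto
    qed
    ultimately show False using i(2)[of s] by simp
  qed
  then show ?thesis using i(1) by auto
qed

abbreviation "N \<equiv> int (card faces)"
abbreviation "M \<equiv> sum c faces"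

text \<open>Without losses every walk returns to its first face before its jump, so moving the start
  by one changes neither the set of faces nor the jump place. Then \<open>p\<close> is constant from
  0 on, which contradicts \<open>i < p i\<close>.\<close>

lemma A_nonempty: assumes "k \<le> M" shows "A \<noteq> {}"
proof
  assume "A = {}"
  then have "\<not> loss i" for i using mod_in_A by auto
  then have pm: "m i < p i" for i unfolding loss_iff by (simp add: not_le)
  have "p i = p 0" if "0 \<le> i" for i
    using that
  proof (induction i rule: int_ge_induct)
    case base then show ?case by simp
  next
    case (step i)
    have "{i..p i} = insert i {i + 1..p i}" using p_gt[of i] by auto
    moreover have "v i \<in> v ` {i + 1..p i}" using v_next[of i] pm[of i] m_gt[of i] by (intro image_eqI[of _ _ "m i + 1"]) auto
    ultimately have eq: "v ` {i..p i} = v ` {i + 1..p i}" by auto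
    then have "p (i + 1) \<le> p i" using W_iff[of "i + 1" "p i"] p_above[of i] by simp
    moreover have "p i \<le> p (i + 1)"
      using W_iff[of i "p (i + 1)"] p_above[of "i + 1"] W_mono[of i "i + 1" "p (i + 1)" "p (i + 1)"] by simp
    ultimately show ?case using step by simp
  qed
  from this[of "p 0"] show False using p_gt[of 0] p_gt[of "p 0"] by simp
qed

text \<open>The jump face of \<open>r i\<close> lies strictly inside the branch behind
  \<open>r i\<close>, so it differs from the tail \<open>v (r i)\<close>, which is itself a jump
  face.\<close>

lemma two_heavy: assumes "A \<noteq> {}" shows "2 \<le> card (v ` {\<rho>\<in>A. 0 < u \<rho>})"
proof -
  obtain i where i: "i \<in> A" using assms by auto
  have "{v (r i), v (r (r i))} \<subseteq> v ` {\<rho>\<in>A. 0 < u \<rho>}"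
    using i r_in_A u_r_pos by auto
  then have "card {v (r i), v (r (r i))} \<le> card (v ` {\<rho>\<in>A. 0 < u \<rho>})" by (intro card_mono) auto
  moreover have "v (r i) \<noteq> v (r (r i))" using v_r_inside[OF r_in_A] v_behind by metis
  ultimately show ?thesis by simp
qed

text \<open>No step out of a face in \<open>Z\<close> is heavy. Two such steps are found whose
  branches together cover the tree and each contain \<open>Z\<close>. Each weighs at most
  \<open>k - g\<close>, and their sum counts \<open>Z\<close> twice.\<close>

lemma idle_weight:
  assumes Z: "Z = {f\<in>faces. d f = 0}" and card: "2 \<le> card Z"
  shows "M + sum c Z \<le> 2 * (k - g)"
proof -
  have nl: "\<not> loss i" if "v i \<in> Z" for i using loss_d_pos[of i] that Z by auto
  have sub: "Z \<subseteq> faces" using Z by auto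
  then have finZ: "finite Z" by (rule finite_subset) simp
  have "Z \<noteq> {}" using card by auto
  then obtain z where z: "z \<in> Z" by auto
  then obtain z0 where "z = v z0" using sub unfolding faces_def by auto
  then have "\<exists>i. v i \<in> Z" using z by auto
  then obtain i where i: "v i \<in> Z" "Z \<subseteq> v ` {i..m i}"
    using extremal_direction[of "\<lambda>i. v i \<in> Z" Z] sub by blast
  have "\<not> Z \<subseteq> {v i}" using card card_mono[of "{v i}" Z] by auto
  then obtain z2 where z2: "z2 \<in> Z" "z2 \<noteq> v i" by auto
  have "{i..m i} = insert i {i + 1..m i}" using m_gt[of i] by auto
  then have z2i: "z2 \<in> v ` {i + 1..m i}" using i(2) z2 by auto
  \<comment> \<open>The step from \<open>z2\<close> back towards \<open>v i\<close>. It starts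
    inside the branch behind i and that branch runs past \<open>i + L\<close>, so the two branches
    cover a full period.\<close>
  obtain s where s: "i \<le> s" "s < i + L" "i + L \<le> m s" "v s = z2"
    using direction[of z2 "i + L"] z2 sub v_per by auto
  have "s \<noteq> i" using s z2 by auto
  then have "s \<le> m i" using v_inside_iff[of s i] z2i s by auto
  \<comment> \<open>Covering together with the branch of i is inherited by larger branches, so the
    extremal argument applies once more and makes the second branch contain \<open>Z\<close> as
    well.\<close>
  define Q where "Q t \<longleftrightarrow> v t \<in> Z \<and> faces \<subseteq> v ` {i..m i} \<union> v ` {t..m t}" for t
  have "faces \<subseteq> v ` {i..m i} \<union> v ` {s..m s}"
    unfolding v_period[of i, symmetric] using \<open>s \<le> m i\<close> s by (intro Un_mono image_mono) auto
  then have "Q s" unfolding Q_def using s z2 by simp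
  moreover have "Q b" if "Q a" "v b \<in> Z" "b \<le> a" "m a \<le> m b" for a b
  proof -
    have "v ` {i..m i} \<union> v ` {a..m a} \<subseteq> v ` {i..m i} \<union> v ` {b..m b}" using that by (intro Un_mono image_mono) auto
    then show ?thesis using that unfolding Q_def by (meson order_trans)
  qed
  moreover have "v t \<in> Z" if "Q t" for t using that unfolding Q_def by simp
  ultimately obtain t where t: "Q t" "Z \<subseteq> v ` {t..m t}"
    using extremal_direction[of Q Z] sub by blast
  have "M + sum c Z \<le> sum c (v ` {i..m i} \<union> v ` {t..m t}) + sum c (v ` {i..m i} \<inter> v ` {t..m t})"
    using t i unfolding Q_def by (intro add_mono sum_c_mono) auto
  also have "\<dots> = W i (m i) + W t (m t)" by (rule sum.union_inter) auto
  also have "\<dots> \<le> 2 * (k - g)" using not_lossD[OF nl[of i]] not_lossD[OF nl[of t]] i t unfolding Q_def by simp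
  finally show ?thesis .
qed

text \<open>With at most one loss per face, \<open>card A\<close> is \<open>N - card Z\<close> for
  the set \<open>Z\<close> of faces without loss, and the losses sit on distinct faces, so
  \<open>sum_u_inj\<close> and \<open>sum_excess\<close> bound the same number from above. If
  \<open>Z\<close> has two members, \<open>idle_weight\<close> and the bound on \<open>k\<close>
  contradict this; otherwise the bound on \<open>M\<close> does.\<close>

lemma no_branching_contradiction:
  assumes d: "\<And>f. f \<in> faces \<Longrightarrow> d f \<le> 1"
    and kM: "k \<le> M" and MN: "M \<le> 2 * N + g - 3" and kN: "k \<le> N + 2 * g - 2"
  shows False
proof -
  define Z where "Z = {f\<in>faces. d f = 0}"
  define H where "H = v ` {\<rho>\<in>A. 0 < u \<rho>}"
  have sub: "Z \<subseteq> faces" unfolding Z_def by auto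
  then have finZ: "finite Z" by (rule finite_subset) simp
  have HZ: "H \<subseteq> faces - Z" unfolding H_def Z_def using loss_d_pos unfolding A_def by fastforce
  have inj: "inj_on v A"
  proof (rule inj_onI)
    fix a b assume ab: "a \<in> A" "b \<in> A" "v a = v b"
    then show "a = b" using losses_distinct[of a b "v b"] d[of "v b"] unfolding A_def by force
  qed
  have "int (card A) = (\<Sum>f\<in>faces. int (d f))" using sum_d by simp
  also have "\<dots> = (\<Sum>f\<in>faces - Z. 1)"
  proof (rule sum.mono_neutral_cong_right)
    fix f assume "f \<in> faces - Z"
    then show "int (d f) = 1" using d[of f] unfolding Z_def by auto
  qed (auto simp: Z_def)
  also have "\<dots> = N - int (card Z)" using sub finZ card_mono[OF finite_faces sub] by (simp add: card_Diff_subset of_nat_diff)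
  finally have cA: "int (card A) = N - int (card Z)" .
  have "int (card A) = (\<Sum>\<rho>\<in>A. int (u \<rho>))" using sum_u by simp
  also have "\<dots> \<le> (\<Sum>f\<in>H. c f - g)" unfolding H_def by (rule sum_u_inj) (auto simp: inj)
  also have "\<dots> \<le> (\<Sum>f\<in>faces - Z. c f) - int (card (faces - Z)) - (g - 1) * int (card H)"
    using HZ by (intro sum_excess) auto
  also have "(\<Sum>f\<in>faces - Z. c f) = M - sum c Z" using sub by (simp add: sum_diff)
  also have "int (card (faces - Z)) = N - int (card Z)"
    using sub finZ card_mono[OF finite_faces sub] by (simp add: card_Diff_subset of_nat_diff)
  finally have main: "2 * (N - int (card Z)) \<le> M - sum c Z - (g - 1) * int (card H)" using cA by simp
  have H2: "2 \<le> int (card H)" using two_heavy[OF A_nonempty[OF kM]] unfolding H_def by simp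
  have "(g - 1) * 2 \<le> (g - 1) * int (card H)" using H2 g_pos by (intro mult_left_mono) auto
  with main have main: "2 * N + 2 * (g - 1) \<le> M + 2 * int (card Z) - sum c Z" by simp
  have "(\<Sum>f\<in>Z. 1) \<le> sum c Z" using sub c_pos by (intro sum_mono) auto
  then have cZ: "int (card Z) \<le> sum c Z" by simp
  show False
  proof (cases "2 \<le> card Z")
    case True
    have "M + sum c Z \<le> 2 * (k - g)" using idle_weight[OF Z_def True] .
    then show False using main cZ kN by simp
  next
    case False
    then have "int (card Z) \<le> 1" by simp
    then show False using main MN cZ g_pos by simp
  qed
qed

end

section \<open>The core of faces with two or more losses\<close>

context unbalanced_weights
begin

lemma branching_directions:
  assumes "2 \<le> d f"
  obtains a b where "a \<in> A" "b \<in> A" "v a = f" "v b = f" "a \<noteq> b"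
proof -
  let ?S = "{i\<in>A. v i = f}"
  have "\<not> ?S \<subseteq> {a}" for a
  proof
    assume "?S \<subseteq> {a}"
    then have "card ?S \<le> card {a}" by (intro card_mono) auto
    then show False using assms unfolding d_def by simp
  qed
  then obtain a b where "a \<in> ?S" "b \<in> ?S" "a \<noteq> b" by blast
  then show thesis using that by blast
qed

lemma mod_neq_shift: "a \<in> A \<Longrightarrow> b \<in> A \<Longrightarrow> a \<noteq> b \<Longrightarrow> (a + s * L) mod L \<noteq> (b + t * L) mod L"
  unfolding A_def by simp

lemma next_occurrence: assumes "i < j" "v j = v i" shows "m i < j"
  using v_neq[of i j] assms by (metis not_le)

text \<open>Of two losses out of \<open>y\<close> within the period after i, the first has returned
  to \<open>y\<close> before the second starts. Its branch is thus nested in the branch behind i,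
  which inherits the heaviness.\<close>

lemma loss_towards_branching:
  assumes y: "2 \<le> d y" and i: "y \<in> v ` {i + 1..m i}" shows "loss i"
proof -
  have key: "loss i" if "loss a" "loss b" "v a = y" "v b = y" "i < a" "a < b" "b \<le> i + L" for a b
  proof -
    have "b \<le> m i" using v_inside_iff[of b i] i that by auto
    moreover have "m a < b" using next_occurrence[of a b] that by simp
    ultimately show ?thesis using loss_mono[of i a] that by simp
  qed
  obtain a b where ab: "a \<in> A" "b \<in> A" "v a = y" "v b = y" "a \<noteq> b" by (rule branching_directions[OF y])
  obtain s t where st: "i < a + s * L" "a + s * L \<le> i + L" "i < b + t * L" "b + t * L \<le> i + L"
    using shift_into by meson
  have "a + s * L \<noteq> b + t * L" using mod_neq_shift[OF ab(1,2,5), of s t] by metis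
  then consider "a + s * L < b + t * L" | "b + t * L < a + s * L" by linarith
  moreover have "loss (a + s * L)" "loss (b + t * L)" "v (a + s * L) = y" "v (b + t * L) = y"
    using ab unfolding A_def by (simp_all add: loss_per v_per_mult)
  ultimately show ?thesis
    using key[of "a + s * L" "b + t * L"] key[of "b + t * L" "a + s * L"] st by cases blast+
qed

text \<open>Another loss out of \<open>v i\<close> leads into a branch on the near side of the edge,
  hence inside the branch of the reversed step \<open>m i\<close>.\<close>

lemma loss_back:
  assumes f: "2 \<le> d (v i)" and i: "loss i" shows "loss (m i)"
proof -
  obtain a b where ab: "a \<in> A" "b \<in> A" "v a = v i" "v b = v i" "a \<noteq> b" by (rule branching_directions[OF f])
  then have "\<exists>x\<in>A. v x = v i \<and> x \<noteq> i mod L" by metis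
  then obtain x where x: "x \<in> A" "v x = v i" "x \<noteq> i mod L" by auto
  obtain t where t: "i < x + t * L" "x + t * L \<le> i + L" using shift_into by meson
  let ?x = "x + t * L"
  have lx: "loss ?x" "v ?x = v i" using x unfolding A_def by (auto simp: loss_per v_per_mult)
  have "?x \<noteq> i + L"
  proof
    assume "?x = i + L"
    then have "x mod L = i mod L" by (metis mod_mult_self1 mod_add_self2)
    then show False using x unfolding A_def by simp
  qed
  moreover have "m i < ?x" using next_occurrence[of i ?x] lx t by simp
  ultimately have "m ?x < i + L" using next_occurrence[of ?x "i + L"] lx t v_per by simp
  then show ?thesis using loss_mono[of "m i" ?x] \<open>m i < ?x\<close> lx m_m by simp
qed

text \<open>This gives connectedness of the core: the next face has the loss back over the edge and,
  unless it is \<open>y\<close> itself, a second loss towards \<open>y\<close>.\<close>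

lemma branching_ahead:
  assumes l: "loss (m i)" and y: "2 \<le> d y" "y \<in> v ` {i + 1..m i}" shows "2 \<le> d (v (i + 1))"
proof (cases "y = v (i + 1)")
  case True then show ?thesis using y by simp
next
  case False
  obtain x where x: "x \<in> {i + 1..m i}" "y = v x" using y(2) by auto
  obtain s where s: "s < x" "x \<le> m s" "x - L \<le> s" "v s = v (i + 1)"
    using direction[of "v (i + 1)" x] False x by auto
  have ys: "y \<in> v ` {s + 1..m s}" using s x by auto
  have "s mod L \<noteq> m i mod L"
  proof
    assume eq: "s mod L = m i mod L"
    have "v ` {s + 1..m s} = v ` {m i + 1..m (m i)}"
      using interval_mod_image[of s] interval_mod_image[of "m i"] eq by simp
    then show False using ys y(2) v_sides_disjoint[of i] m_m[of i] by auto
  qed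
  then show ?thesis using losses_distinct[of s "m i"] loss_towards_branching[OF y(1) ys] l s v_m by simp
qed

text \<open>Losses are split by their position relative to the core \<open>I\<close>: those starting
  outside (\<open>Out\<close>), those leaving it (\<open>Leaf\<close>), those staying in it
  (\<open>Inn\<close>). Each class has its own bound on \<open>u\<close>, and the size of
  \<open>Leaf\<close> follows from a degree count. In the sum the weights of the core
  cancel.\<close>

lemma branching_contradiction:
  assumes y: "y \<in> faces" "2 \<le> d y" and kM: "2 * M \<le> 2 * k + 2 * N + g - 2"
  shows False
proof -
  define I where "I = {f\<in>faces. 2 \<le> d f}"
  have yI: "y \<in> I" using y unfolding I_def by simp
  have Isub: "I \<subseteq> faces" unfolding I_def by auto
  then have finI: "finite I" by (rule finite_subset) simp
  have inI: "v i \<in> I \<longleftrightarrow> 2 \<le> d (v i)" for i unfolding I_def by simp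
  \<comment> \<open>Every face other than \<open>y\<close> has a step towards \<open>y\<close>,
    which is a loss.\<close>
  have d1: "1 \<le> d f" if ff: "f \<in> faces" for f
  proof (cases "f = y")
    case True then show ?thesis using y by simp
  next
    case False
    obtain x where x: "y = v x" using y(1) unfolding faces_def by auto
    obtain s where s: "s < x" "x \<le> m s" "v s = f" using direction[of f x] False ff x by auto
    then have "y \<in> v ` {s + 1..m s}" using x by auto
    then show ?thesis using loss_d_pos[of s f] loss_towards_branching[OF y(2)] s by simp
  qed
  \<comment> \<open>One of the two directions of an edge points towards \<open>y\<close>.\<close>
  have one_loss: "loss i \<or> loss (m i)" for i
  proof -
    have "y \<in> v ` {i + 1..m i} \<union> v ` {m i + 1..m (m i)}" using y(1) v_period[of i] m_m[of i] by simp
    then show ?thesis using loss_towards_branching[OF y(2)] by blast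
  qed
  define Out where "Out = {\<rho>\<in>A. v \<rho> \<notin> I}"
  define Leaf where "Leaf = {\<rho>\<in>A. v \<rho> \<in> I \<and> v (\<rho> + 1) \<notin> I}"
  define Inn where "Inn = {\<rho>\<in>A. v \<rho> \<in> I \<and> v (\<rho> + 1) \<in> I}"
  have finA: "finite Out" "finite Leaf" "finite Inn" unfolding Out_def Leaf_def Inn_def by auto
  define l where "l = int (card Leaf)"
  define P where "P = (\<Sum>f\<in>I. int (d f))"
  have cA: "int (card A) = P + (N - int (card I))"
  proof -
    have "int (card A) = (\<Sum>f\<in>faces. int (d f))" using sum_d by simp
    also have "\<dots> = P + (\<Sum>f\<in>faces - I. int (d f))"
      unfolding P_def using Isub sum.subset_diff[OF Isub finite_faces, of "\<lambda>f. int (d f)"] by simp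
    also have "(\<Sum>f\<in>faces - I. int (d f)) = (\<Sum>f\<in>faces - I. 1)"
    proof (rule sum.cong)
      fix f assume "f \<in> faces - I"
      then show "int (d f) = 1" using d1[of f] unfolding I_def by force
    qed simp
    also have "\<dots> = N - int (card I)"
      using finI Isub card_mono[OF finite_faces Isub] by (simp add: card_Diff_subset of_nat_diff)
    finally show ?thesis .
  qed
  \<comment> \<open>Reversal of a step within the base period; it is an involution there.\<close>
  define m' where "m' i = m i mod L" for i
  have m'_m': "m' (m' i) = i mod L" for i
  proof -
    have "m (m i mod L) = i + (1 - m i div L) * L" unfolding m_mod m_m by (simp add: left_diff_distrib)
    then show ?thesis unfolding m'_def by (metis mod_mult_self1)
  qed
  have loss_m': "loss (m' i) \<longleftrightarrow> loss (m i)" for i unfolding m'_def by (rule loss_mod)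
  have v_m': "v (m' i) = v (i + 1)" for i unfolding m'_def v_mod v_m ..
  have v_m'1: "v (m' i + 1) = v i" for i
  proof -
    have "v (m' i + 1) = v ((m' i + 1) mod L)" by (simp add: v_mod)
    also have "(m' i + 1) mod L = (m i + 1) mod L" unfolding m'_def by (simp add: mod_add_left_eq)
    finally show ?thesis by (simp add: v_mod v_next)
  qed
  have m'_range: "0 \<le> m' i" "m' i < L" for i unfolding m'_def using L_pos by simp_all
  define A2 where "A2 = {i\<in>A. loss (m i)}"
  have lm'm: "loss (m (m' i)) \<longleftrightarrow> loss i" for i
  proof -
    have "loss (m (m' i)) \<longleftrightarrow> loss (m' (m' i))" by (simp add: loss_m')
    then show ?thesis unfolding m'_m' loss_mod .
  qed
  \<comment> \<open>Reversal matches the losses that are heavy in one direction only with the steps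
    that are not losses.\<close>
  have cA2: "int (card A2) = 2 * int (card A) - L"
  proof -
    have "bij_betw m' (A - A2) ({0..<L} - A)"
    proof (rule bij_betw_byWitness[where f' = m'])
      show "\<forall>a\<in>A - A2. m' (m' a) = a" "\<forall>a\<in>{0..<L} - A. m' (m' a) = a"
        unfolding m'_m' A_def by auto
      show "m' ` (A - A2) \<subseteq> {0..<L} - A" using m'_range loss_m' unfolding A2_def A_def by auto
      show "m' ` ({0..<L} - A) \<subseteq> A - A2"
      proof (rule image_subsetI)
        fix x assume "x \<in> {0..<L} - A"
        then have "\<not> loss x" unfolding A_def by auto
        then show "m' x \<in> A - A2" using m'_range loss_m' lm'm one_loss[of x] unfolding A2_def A_def by simp
      qed
    qed
    then have "card (A - A2) = card ({0..<L} - A)" by (rule bij_betw_same_card)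
    moreover have "A2 \<subseteq> A" "A \<subseteq> {0..<L}" unfolding A2_def A_def by auto
    then have "int (card (A - A2)) = int (card A) - int (card A2)" "int (card ({0..<L} - A)) = L - int (card A)"
      using card_mono[of A A2] card_mono[of "{0..<L}" A] L_pos finite_subset[of A2 A]
      by (simp_all add: card_Diff_subset of_nat_diff)
    ultimately show ?thesis by simp
  qed
  \<comment> \<open>A degree count. Edges heavy both ways are entered from the core, which gives
    \<open>P\<close> steps by \<open>loss_back\<close>, or from outside, and the latter are the
    reversals of \<open>Leaf\<close>. Comparing \<open>P + l\<close> with
    \<open>2 * card A - L\<close> and \<open>L = 2 * (N - 1)\<close> leaves the formula.\<close>
  have l_eq: "l = P - 2 * int (card I) + 2"
  proof -
    have "{i\<in>A. v i \<in> I} \<subseteq> A2" unfolding A2_def using loss_back inI unfolding A_def by auto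
    then have A2_split: "A2 = {i\<in>A. v i \<in> I} \<union> {i\<in>A2. v i \<notin> I}" unfolding A2_def by auto
    have "bij_betw m' {i\<in>A2. v i \<notin> I} Leaf"
    proof (rule bij_betw_byWitness[where f' = m'])
      show "\<forall>a\<in>{i\<in>A2. v i \<notin> I}. m' (m' a) = a" "\<forall>a\<in>Leaf. m' (m' a) = a"
        unfolding m'_m' A2_def Leaf_def A_def by auto
      show "m' ` {i\<in>A2. v i \<notin> I} \<subseteq> Leaf"
      proof (rule image_subsetI)
        fix i assume "i \<in> {i\<in>A2. v i \<notin> I}"
        then have i: "loss i" "loss (m i)" "v i \<notin> I" unfolding A2_def A_def by auto
        \<comment> \<open>Otherwise the step from \<open>v i\<close> towards \<open>y\<close> would
          be a second loss out of \<open>v i\<close>, which is not in the core.\<close>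
        have "y \<in> v ` {i + 1..m i}"
        proof (rule ccontr)
          assume n: "y \<notin> v ` {i + 1..m i}"
          have ne: "v i \<noteq> y" using i(3) yI by auto
          obtain x where x: "y = v x" using y(1) unfolding faces_def by auto
          obtain s where s: "s < x" "x \<le> m s" "v s = v i" using direction[of "v i" x] ne x by auto
          then have ys: "y \<in> v ` {s + 1..m s}" using x by auto
          have "s mod L \<noteq> i mod L"
            using ys n interval_mod_image[of s] interval_mod_image[of i] by auto
          then show False
            using losses_distinct[of s i] loss_towards_branching[OF y(2) ys] i s inI by simp
        qed
        then have "v (i + 1) \<in> I" using branching_ahead[OF i(2) y(2)] inI by simp
        then show "m' i \<in> Leaf" unfolding Leaf_def A_def using i m'_range loss_m' v_m' v_m'1 by simp
      qed
      show "m' ` Leaf \<subseteq> {i\<in>A2. v i \<notin> I}"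
        using m'_range loss_m' v_m' lm'm loss_back inI unfolding A2_def Leaf_def A_def by auto
    qed
    then have "card {i\<in>A2. v i \<notin> I} = card Leaf" by (rule bij_betw_same_card)
    moreover have "card A2 = card {i\<in>A. v i \<in> I} + card {i\<in>A2. v i \<notin> I}"
      by (subst A2_split, rule card_Un_disjoint) (auto simp: A2_def)
    moreover have "int (card {i\<in>A. v i \<in> I}) = P"
    proof -
      have "(\<Sum>f\<in>I. card {x \<in> {i\<in>A. v i \<in> I}. v x = f}) = card {i\<in>A. v i \<in> I}"
        using sum.group[of "{i\<in>A. v i \<in> I}" I v "\<lambda>_. 1::nat"] finI by (simp add: image_subset_iff)
      moreover have "card {x \<in> {i\<in>A. v i \<in> I}. v x = f} = d f" if "f \<in> I" for f
        unfolding d_def using that by (intro arg_cong[of _ _ card]) auto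
      ultimately have "(\<Sum>f\<in>I. d f) = card {i\<in>A. v i \<in> I}" by simp
      then show ?thesis unfolding P_def by (metis of_nat_sum)
    qed
    ultimately show ?thesis using cA2 cA L_card_faces unfolding l_def by simp
  qed
  define Br where "Br \<rho> = v ` {\<rho> + 1..m \<rho>}" for \<rho>
  have Br_sub: "Br \<rho> \<subseteq> faces" for \<rho> unfolding Br_def by auto
  \<comment> \<open>By connectedness a branching face in this branch would make its first face
    branching as well.\<close>
  have leaf_no_I: "Br \<rho> \<inter> I = {}" if "\<rho> \<in> Leaf" for \<rho>
  proof (rule ccontr)
    assume "Br \<rho> \<inter> I \<noteq> {}"
    then obtain z where z: "z \<in> v ` {\<rho> + 1..m \<rho>}" "2 \<le> d z" unfolding I_def Br_def by auto
    have "loss (m \<rho>)" using loss_back[of \<rho>] that inI unfolding Leaf_def A_def by auto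
    then show False using branching_ahead[of \<rho> z] z that inI unfolding Leaf_def by simp
  qed
  \<comment> \<open>If two branches shared a face, the tail of one leaf, a core face, would lie in
    the branch of the other.\<close>
  have leaf_disj: "Br a \<inter> Br b = {}" if ab: "a \<in> Leaf" "b \<in> Leaf" "a \<noteq> b" for a b
  proof (rule ccontr)
    assume "Br a \<inter> Br b \<noteq> {}"
    then obtain w where "w \<in> Br a" "w \<in> Br b" by (meson disjoint_iff)
    then obtain x z where x: "x \<in> {a + 1..m a}" and z: "z \<in> {b + 1..m b}" "v z = v x"
      unfolding Br_def by (elim imageE) metis
    obtain t where t: "x - 1 < b + t * L" "b + t * L \<le> x - 1 + L" using shift_into by blast
    define b' where "b' = b + (t - 1) * L"
    have b': "b' < x" "x - L \<le> b'" using t unfolding b'_def by (auto simp: algebra_simps)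
    have vb: "v b' = v b" "v ` {b' + 1..m b'} = Br b"
      unfolding b'_def Br_def v_per_mult m_per_mult
      using image_shift[of "b + 1" "t - 1" "m b"] by (simp_all add: algebra_simps)
    have "x \<le> m b'"
      using v_inside_iff[of x b'] vb z b' unfolding Br_def by (metis imageI le_diff_eq diff_le_eq)
    have "b' \<noteq> a"
    proof
      assume "b' = a"
      then have "b mod L = a mod L" unfolding b'_def by (metis mod_mult_self1)
      then show False using ab unfolding Leaf_def A_def by simp
    qed
    then consider "a < b'" | "b' < a" by linarith
    then show False
    proof cases
      case 1
      then have "v b' \<in> Br a" unfolding Br_def using b' x by (intro imageI) auto
      then show False using leaf_no_I[OF ab(1)] vb(1) ab(2) unfolding Leaf_def by auto
    next
      case 2
      then have "v a \<in> Br b" unfolding vb(2)[symmetric] using \<open>x \<le> m b'\<close> x by (intro imageI) auto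
      then show False using leaf_no_I[OF ab(2)] ab(1) unfolding Leaf_def by auto
    qed
  qed
  have l2: "2 \<le> l"
  proof -
    have "(\<Sum>f\<in>I. 2) \<le> P" unfolding P_def by (intro sum_mono) (auto simp: I_def)
    then show ?thesis unfolding l_eq by simp
  qed
  define H where "H = v ` {\<rho>\<in>Out. 0 < u \<rho>}"
  \<comment> \<open>The jump of a leaf happens inside its branch. The branches are disjoint and
    avoid the core, so there are at least \<open>l\<close> jump faces outside it, each paying
    \<open>g - 1\<close> in \<open>S_out\<close>.\<close>
  have H_l: "l \<le> int (card H)"
  proof -
    have inBr: "v (r \<rho>) \<in> Br \<rho>" if "\<rho> \<in> Leaf" for \<rho>
      using v_r_inside that unfolding Br_def Leaf_def by auto
    have "inj_on (\<lambda>\<rho>. v (r \<rho>)) Leaf"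
      by (rule inj_onI) (metis leaf_disj inBr disjoint_iff)
    moreover have "(\<lambda>\<rho>. v (r \<rho>)) ` Leaf \<subseteq> H"
    proof (rule image_subsetI)
      fix \<rho> assume \<rho>: "\<rho> \<in> Leaf"
      then have "v (r \<rho>) \<notin> I" using inBr leaf_no_I by blast
      then have "r \<rho> \<in> Out" unfolding Out_def using r_in_A by simp
      moreover have "0 < u (r \<rho>)" using u_r_pos \<rho> unfolding Leaf_def by auto
      ultimately show "v (r \<rho>) \<in> H" unfolding H_def by auto
    qed
    moreover have "finite H" unfolding H_def using finA by simp
    ultimately have "card Leaf \<le> card H" by (metis card_image card_mono)
    then show ?thesis unfolding l_def by simp
  qed
  have inj_Out: "inj_on v Out"
  proof (rule inj_onI)
    fix a b assume ab: "a \<in> Out" "b \<in> Out" "v a = v b"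
    then show "a = b" using losses_distinct[of a b "v b"] inI[of b] unfolding Out_def A_def by force
  qed
  have split: "(\<Sum>\<rho>\<in>A. h \<rho>) = (\<Sum>\<rho>\<in>Out. h \<rho>) + (\<Sum>\<rho>\<in>Leaf. h \<rho>) + (\<Sum>\<rho>\<in>Inn. h \<rho>)" for h :: "int \<Rightarrow> int"
  proof -
    have "A = (Out \<union> Leaf) \<union> Inn" unfolding Out_def Leaf_def Inn_def by auto
    moreover have "(Out \<union> Leaf) \<inter> Inn = {}" "Out \<inter> Leaf = {}" unfolding Out_def Leaf_def Inn_def by auto
    ultimately show ?thesis using finA by (simp add: sum.union_disjoint)
  qed
  have S_out: "(\<Sum>\<rho>\<in>Out. int (u \<rho>)) \<le> (M - sum c I) - (N - int (card I)) - (g - 1) * int (card H)"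
  proof -
    have "(\<Sum>\<rho>\<in>Out. int (u \<rho>)) \<le> (\<Sum>f\<in>H. c f - g)"
      unfolding H_def by (rule sum_u_inj[OF _ inj_Out]) (auto simp: Out_def)
    also have "\<dots> \<le> (\<Sum>f\<in>faces - I. c f) - int (card (faces - I)) - (g - 1) * int (card H)"
      by (intro sum_excess) (auto simp: H_def Out_def)
    finally show ?thesis using Isub finI card_mono[OF finite_faces Isub]
      by (simp add: sum_diff card_Diff_subset of_nat_diff)
  qed
  \<comment> \<open>For leaves \<open>u_le_W\<close> is the right bound: the disjoint branches weigh
    at most \<open>M - sum c I\<close> in total, and every leaf saves a full
    \<open>k\<close>.\<close>
  have S_leaf: "(\<Sum>\<rho>\<in>Leaf. int (u \<rho>)) \<le> (\<Sum>\<rho>\<in>Leaf. c (v \<rho>)) + (M - sum c I) - l * k"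
  proof -
    have "(\<Sum>\<rho>\<in>Leaf. int (u \<rho>)) \<le> (\<Sum>\<rho>\<in>Leaf. c (v \<rho>) + sum c (Br \<rho>) - k)"
      by (intro sum_mono) (use u_le_W W_start in \<open>auto simp: Br_def Leaf_def\<close>)
    also have "\<dots> = (\<Sum>\<rho>\<in>Leaf. c (v \<rho>)) + (\<Sum>\<rho>\<in>Leaf. sum c (Br \<rho>)) - l * k"
      by (simp add: sum.distrib sum_subtractf l_def)
    also have "(\<Sum>\<rho>\<in>Leaf. sum c (Br \<rho>)) = sum c (\<Union>\<rho>\<in>Leaf. Br \<rho>)"
      by (rule sum.UNION_disjoint[symmetric]) (use finA leaf_disj in \<open>auto simp: Br_def\<close>)
    also have "\<dots> \<le> sum c (faces - I)" using leaf_no_I Br_sub by (intro sum_c_mono) blast+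
    finally show ?thesis using Isub by (simp add: sum_diff)
  qed
  have S_int: "(\<Sum>\<rho>\<in>Inn. int (u \<rho>)) \<le> (\<Sum>\<rho>\<in>Inn. c (v \<rho>))"
  proof (rule sum_mono)
    fix \<rho>
    show "int (u \<rho>) \<le> c (v \<rho>)" using u_le_c[of \<rho>] g_pos c_nonneg[of "v \<rho>"] by (cases "u \<rho> = 0") auto
  qed
  have S_I: "(\<Sum>\<rho>\<in>Leaf. c (v \<rho>)) + (\<Sum>\<rho>\<in>Inn. c (v \<rho>)) = (\<Sum>f\<in>I. int (d f) * c f)"
  proof -
    have fin: "finite {i\<in>A. v i \<in> I}" by simp
    have "(\<Sum>f\<in>I. \<Sum>\<rho>\<in>{x \<in> {i\<in>A. v i \<in> I}. v x = f}. c (v \<rho>)) = (\<Sum>\<rho>\<in>{i\<in>A. v i \<in> I}. c (v \<rho>))"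
      using finI by (intro sum.group) auto
    moreover have "(\<Sum>\<rho>\<in>{x \<in> {i\<in>A. v i \<in> I}. v x = f}. c (v \<rho>)) = int (d f) * c f" if "f \<in> I" for f
    proof -
      have "{x \<in> {i\<in>A. v i \<in> I}. v x = f} = {i\<in>A. v i = f}" using that by auto
      then show ?thesis by (simp add: d_def)
    qed
    then have "(\<Sum>f\<in>I. \<Sum>\<rho>\<in>{x \<in> {i\<in>A. v i \<in> I}. v x = f}. c (v \<rho>)) = (\<Sum>f\<in>I. int (d f) * c f)"
      by (intro sum.cong) auto
    moreover have "{i\<in>A. v i \<in> I} = Leaf \<union> Inn" "Leaf \<inter> Inn = {}" unfolding Leaf_def Inn_def by auto
    then have "(\<Sum>\<rho>\<in>{i\<in>A. v i \<in> I}. c (v \<rho>)) = (\<Sum>\<rho>\<in>Leaf. c (v \<rho>)) + (\<Sum>\<rho>\<in>Inn. c (v \<rho>))"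
      using finA by (simp add: sum.union_disjoint)
    ultimately show ?thesis by simp
  qed
  \<comment> \<open>Every core face has at least two losses, so the surplus factor
    \<open>d f - 2\<close> is nonnegative and \<open>c f\<close> can be replaced by \<open>k\<close>
    there. The surplus sums to \<open>l - 2\<close>, nearly what the term \<open>l * k\<close> of
    \<open>S_leaf\<close> takes away.\<close>
  have S_d: "(\<Sum>f\<in>I. int (d f) * c f) \<le> 2 * sum c I + (l - 2) * k"
  proof -
    have "(\<Sum>f\<in>I. int (d f) * c f) = (\<Sum>f\<in>I. (int (d f) - 2) * c f) + 2 * sum c I"
      by (simp add: left_diff_distrib sum_subtractf sum_distrib_left)
    also have "(\<Sum>f\<in>I. (int (d f) - 2) * c f) \<le> (\<Sum>f\<in>I. (int (d f) - 2) * k)"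
      by (intro sum_mono mult_left_mono) (auto simp: I_def c_le)
    also have "\<dots> = (l - 2) * k"
      unfolding l_eq P_def sum_distrib_right[symmetric] by (simp add: sum_subtractf)
    finally show ?thesis by simp
  qed
  \<comment> \<open>The weights combine to
    \<open>2 * (M - sum c I) + 2 * sum c I + (l - 2) * k - l * k\<close>, that is
    \<open>2 * M - 2 * k\<close>; neither the core nor \<open>l\<close> remains.\<close>
  have "int (card A) = (\<Sum>\<rho>\<in>A. int (u \<rho>))" using sum_u by simp
  also have "\<dots> \<le> M - (N - int (card I)) - (g - 1) * int (card H) + M - 2 * k"
    unfolding split using S_out S_leaf S_int S_I S_d by (simp add: algebra_simps)
  finally have "P + 2 * N - 2 * int (card I) + (g - 1) * int (card H) \<le> 2 * M - 2 * k" unfolding cA by simp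
  moreover have "(g - 1) * l \<le> (g - 1) * int (card H)" using H_l g_pos by (intro mult_left_mono) auto
  moreover have "(g - 1) * 2 \<le> (g - 1) * l" using l2 g_pos by (intro mult_left_mono) auto
  ultimately show False using l_eq l2 kM g_pos by simp
qed

theorem contradiction:
  assumes "k \<le> M" "M \<le> 2 * N + g - 3" "k \<le> N + 2 * g - 2" "2 * M \<le> 2 * k + 2 * N + g - 2"
  shows False
proof (cases "\<exists>y\<in>faces. 2 \<le> d y")
  case True then show ?thesis using branching_contradiction assms(4) by auto
next
  case False
  have "d f \<le> 1" if "f \<in> faces" for f using False that by force
  then show ?thesis using no_branching_contradiction assms by blast
qed

end

section \<open>Planarity: crossing chords lie on different sides of the Hamilton cycle\<close>

text \<open>The arc \<open>c\<close> splits the inside of the closed curve into the insides of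
  \<open>c1\<close> with \<open>c\<close> and of \<open>c2\<close> with \<open>c\<close>. The open
  arc of \<open>f\<close> is connected and avoids all three arcs, so it stays in one part, and the
  closure of that part contains only one of the ends \<open>x\<close> and \<open>y\<close>.\<close>

lemma chords_not_both_inside:
  fixes c c1 c2 f :: "real \<Rightarrow> complex"
  assumes c1: "simple_path c1" "pathstart c1 = a" "pathfinish c1 = b"
    and c2: "simple_path c2" "pathstart c2 = a" "pathfinish c2 = b"
    and c: "simple_path c" "pathstart c = a" "pathfinish c = b"
    and ab: "a \<noteq> b" and c12: "path_image c1 \<inter> path_image c2 = {a,b}"
    and c1c: "path_image c1 \<inter> path_image c = {a,b}" and c2c: "path_image c2 \<inter> path_image c = {a,b}"
    and f: "arc f" "pathstart f = x" "pathfinish f = y"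
    and x: "x \<in> path_image c1" "x \<notin> {a,b}" and y: "y \<in> path_image c2" "y \<notin> {a,b}"
    and fc12: "path_image f \<inter> (path_image c1 \<union> path_image c2) \<subseteq> {x,y}" and fc: "path_image f \<inter> path_image c = {}"
    and c_in: "path_image c \<inter> inside (path_image c1 \<union> path_image c2) \<noteq> {}"
    and f_in: "path_image f \<inter> inside (path_image c1 \<union> path_image c2) \<noteq> {}"
  shows False
proof -
  let ?G = "path_image c1 \<union> path_image c2"
  define S where "S = path_image f - {x, y}"
  have S: "S = f ` {0<..<1}"
    unfolding S_def f(2,3)[symmetric] by (rule simple_path_endless[OF arc_imp_simple_path[OF f(1)]])
  have contf: "continuous_on {0..1} f" using arc_imp_path[OF f(1)] unfolding path_def .
  have conS: "connected S" unfolding S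
    by (rule connected_continuous_image[OF continuous_on_subset[OF contf]]) auto
  have clS: "path_image f \<subseteq> closure S"
  proof -
    have "f ` closure {0<..<1} \<subseteq> closure S"
      by (rule image_closure_subset) (auto simp: contf S closure_subset[THEN subsetD])
    then show ?thesis unfolding path_image_def by simp
  qed
  then have xS: "x \<in> closure S" and yS: "y \<in> closure S"
    using f pathstart_in_path_image[of f] pathfinish_in_path_image[of f] by auto
  have compG: "compact ?G" using c1 c2 by (simp add: compact_simple_path_image compact_Un)
  have opin: "open (inside ?G)" "open (outside ?G)"
    using compG by (simp_all add: open_inside open_outside compact_imp_closed)
  have SG: "S \<inter> ?G = {}" using fc12 unfolding S_def by auto
  have xyG: "x \<in> ?G" "y \<in> ?G" using x y by auto
  have Sin: "S \<inter> inside ?G \<noteq> {}"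
  proof -
    obtain z where z: "z \<in> path_image f" "z \<in> inside ?G" using f_in by auto
    moreover have "z \<notin> ?G" using z(2) inside_no_overlap[of ?G] by blast
    ultimately have "z \<in> S" using xyG unfolding S_def by blast
    then show ?thesis using z by blast
  qed
  have Sinside: "S \<subseteq> inside ?G"
  proof (rule ccontr)
    assume "\<not> S \<subseteq> inside ?G"
    then have "S \<inter> outside ?G \<noteq> {}" using SG inside_Un_outside[of ?G] by blast
    moreover have "S \<subseteq> inside ?G \<union> outside ?G" using SG inside_Un_outside[of ?G] by blast
    moreover have "inside ?G \<inter> outside ?G \<inter> S = {}" using inside_Int_outside[of ?G] by blast
    ultimately show False using connectedD[OF conS opin] Sin by blast
  qed
  obtain disj: "inside(path_image c1 \<union> path_image c) \<inter> inside(path_image c2 \<union> path_image c) = {}"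
    and un: "inside(path_image c1 \<union> path_image c) \<union> inside(path_image c2 \<union> path_image c) \<union>
           (path_image c - {a,b}) = inside ?G"
    using split_inside_simple_closed_curve[OF c1 c2 c ab c12 c1c c2c c_in] by blast
  let ?U1 = "inside(path_image c1 \<union> path_image c)" and ?U2 = "inside(path_image c2 \<union> path_image c)"
  have comp: "compact (path_image c1 \<union> path_image c)" "compact (path_image c2 \<union> path_image c)"
    using c1 c2 c by (simp_all add: compact_simple_path_image compact_Un)
  have op: "open ?U1" "open ?U2" using comp by (simp_all add: open_inside compact_imp_closed)
  have Sc: "S \<subseteq> ?U1 \<union> ?U2" using Sinside un fc unfolding S_def by blast
  have "S \<subseteq> ?U1 \<or> S \<subseteq> ?U2"
    using connectedD[OF conS op] disj Sc by blast
  then show False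
  proof
    assume "S \<subseteq> ?U1"
    then have "y \<in> closure ?U1" using yS closure_mono by blast
    then have "y \<in> (path_image c1 \<union> path_image c) \<union> ?U1"
      using closure_inside_subset[of "path_image c1 \<union> path_image c"] comp by (auto simp: compact_imp_closed)
    moreover have "y \<notin> path_image c1 \<union> path_image c" using y c12 c2c by blast
    ultimately have "y \<in> inside ?G" using un by blast
    then show False using xyG inside_no_overlap[of ?G] by blast
  next
    assume "S \<subseteq> ?U2"
    then have "x \<in> closure ?U2" using xS closure_mono by blast
    then have "x \<in> (path_image c2 \<union> path_image c) \<union> ?U2"
      using closure_inside_subset[of "path_image c2 \<union> path_image c"] comp by (auto simp: compact_imp_closed)
    moreover have "x \<notin> path_image c2 \<union> path_image c" using x c12 c1c by blast
    ultimately have "x \<in> inside ?G" using un by blast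
    then show False using xyG inside_no_overlap[of ?G] by blast
  qed
qed

text \<open>Points near \<open>z0\<close> are sent far away, so by connectedness the punctured
  inside lands outside the image curve; what lies inside the image curve must then come from the
  outside of the original. Only an inclusion holds, because 0 is the image of no finite
  point.\<close>

lemma inversion_outside:
  fixes \<gamma> :: "real \<Rightarrow> complex"
  assumes g: "simple_path \<gamma>" "pathfinish \<gamma> = pathstart \<gamma>" and z0: "z0 \<in> inside (path_image \<gamma>)"
  defines "\<phi> \<equiv> \<lambda>w. inverse (w - z0)"
  shows "\<phi> ` outside (path_image \<gamma>) \<subseteq> inside (\<phi> ` path_image \<gamma>)"
proof -
  let ?G = "path_image \<gamma>"
  let ?H = "\<phi> ` ?G"
  have z0G: "z0 \<notin> ?G" "z0 \<notin> outside ?G" using z0 inside_no_overlap[of ?G] inside_Int_outside[of ?G] by blast+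
  have cont: "continuous_on (- {z0}) \<phi>" unfolding \<phi>_def by (intro continuous_intros) auto
  have inj: "inj_on \<phi> (- {z0})" unfolding \<phi>_def by (rule inj_onI) simp
  note J = Jordan_inside_outside[OF g]
  have sub: "?G \<subseteq> - {z0}" using z0G by auto
  have sp: "simple_path (\<phi> \<circ> \<gamma>)"
    by (rule simple_path_continuous_image[OF g(1)]) (use cont inj sub in \<open>auto intro: continuous_on_subset inj_on_subset\<close>)
  have H: "path_image (\<phi> \<circ> \<gamma>) = ?H" by (simp add: path_image_compose)
  have loop: "pathfinish (\<phi> \<circ> \<gamma>) = pathstart (\<phi> \<circ> \<gamma>)" using g(2) by (simp add: pathfinish_compose pathstart_compose)
  note J' = Jordan_inside_outside[OF sp loop, unfolded H]
  have opH: "open (inside ?H)" "open (outside ?H)" using J' by blast+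
  have conn_out: "connected (\<phi> ` outside ?G)"
    using J z0G by (intro connected_continuous_image continuous_on_subset[OF cont]) auto
  have out_disj: "\<phi> ` outside ?G \<inter> ?H = {}"
    using inj_on_image_Int[OF inj, of "outside ?G" ?G] sub z0G outside_no_overlap[of ?G]
    by (metis Int_commute image_empty subset_Compl_singleton)
  have in_disj: "\<phi> ` (inside ?G - {z0}) \<inter> ?H = {}"
  proof -
    have "(inside ?G - {z0}) \<inter> ?G = {}" using inside_no_overlap[of ?G] by blast
    moreover have "inside ?G - {z0} \<subseteq> - {z0}" by blast
    ultimately show ?thesis using inj_on_image_Int[OF inj _ sub] by (metis image_empty)
  qed
  have conn_in: "connected (\<phi> ` (inside ?G - {z0}))"
  proof (intro connected_continuous_image continuous_on_subset[OF cont])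
    show "connected (inside ?G - {z0})" using J by (intro connected_open_delete) auto
  qed auto
  obtain B where B: "\<And>w. w \<in> ?H \<union> inside ?H \<Longrightarrow> norm w \<le> B"
  proof -
    have "compact ?H" using sp H by (metis compact_simple_path_image)
    then have "bounded (?H \<union> inside ?H)" using J' by (auto dest: compact_imp_bounded)
    then show thesis using that unfolding bounded_iff by blast
  qed
  have in_out: "\<phi> ` (inside ?G - {z0}) \<subseteq> outside ?H"
  proof -
    have "open (inside ?G)" using J by blast
    then obtain r where r: "0 < r" "ball z0 r \<subseteq> inside ?G" using z0 by (rule openE)
    \<comment> \<open>Small enough for the point at distance \<open>t\<close> from \<open>z0\<close>
      to lie in the ball inside the curve, and for its image, of norm \<open>1 / t\<close>, to
      exceed the bound \<open>B\<close>.\<close>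
    define t where "t = min (r / 2) (1 / (\<bar>B\<bar> + 1))"
    have t: "0 < t" "t < r" "t \<le> 1 / (\<bar>B\<bar> + 1)" unfolding t_def using r by auto
    define w where "w = z0 + of_real t"
    have "w \<in> ball z0 r" using t by (simp add: w_def dist_norm)
    then have w: "w \<in> inside ?G - {z0}" using t r by (auto simp: w_def)
    have "norm (\<phi> w) = 1 / t" unfolding \<phi>_def w_def using t by (simp add: norm_inverse divide_inverse)
    moreover have "\<bar>B\<bar> + 1 \<le> 1 / t" using t by (simp add: field_simps)
    ultimately have "\<phi> w \<notin> ?H \<union> inside ?H" using B[of "\<phi> w"] by auto
    then have "\<phi> w \<in> outside ?H" using inside_Un_outside[of ?H] by blast
    then have ne: "\<phi> ` (inside ?G - {z0}) \<inter> outside ?H \<noteq> {}" using w by blast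
    show ?thesis
    proof (rule ccontr)
      assume "\<not> ?thesis"
      then have "\<phi> ` (inside ?G - {z0}) \<inter> inside ?H \<noteq> {}" using in_disj inside_Un_outside[of ?H] by blast
      moreover have "\<phi> ` (inside ?G - {z0}) \<subseteq> inside ?H \<union> outside ?H" using in_disj inside_Un_outside[of ?H] by blast
      moreover have "inside ?H \<inter> outside ?H \<inter> \<phi> ` (inside ?G - {z0}) = {}" using inside_Int_outside[of ?H] by blast
      ultimately show False using connectedD[OF conn_in opH] ne by (simp add: Int_commute)
    qed
  qed
  have "\<phi> ` outside ?G \<inter> inside ?H \<noteq> {}"
  proof -
    have "open (inside ?H)" "inside ?H \<noteq> {}" using J' by blast+
    \<comment> \<open>A point other than 0 is wanted, since only such points have a preimage under
      the inversion.\<close>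
    then have "inside ?H \<noteq> {0}" using not_open_singleton[of "0::complex"] by metis
    then obtain w where w: "w \<in> inside ?H" "w \<noteq> 0" using \<open>inside ?H \<noteq> {}\<close> by blast
    define z where "z = z0 + inverse w"
    have zw: "\<phi> z = w" "z \<noteq> z0" unfolding z_def \<phi>_def using w by auto
    have "z \<notin> ?G" using w zw inside_no_overlap[of ?H] by blast
    moreover have "z \<notin> inside ?G" using in_out w zw inside_Int_outside[of ?H] by blast
    ultimately have "z \<in> outside ?G" using inside_Un_outside[of ?G] by blast
    then show ?thesis using w zw by blast
  qed
  then show ?thesis
  proof (rule_tac ccontr)
    assume ne: "\<phi> ` outside ?G \<inter> inside ?H \<noteq> {}" and "\<not> \<phi> ` outside ?G \<subseteq> inside ?H"
    then have "\<phi> ` outside ?G \<inter> outside ?H \<noteq> {}" using out_disj inside_Un_outside[of ?H] by blast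
    moreover have "\<phi> ` outside ?G \<subseteq> inside ?H \<union> outside ?H" using out_disj inside_Un_outside[of ?H] by blast
    moreover have "inside ?H \<inter> outside ?H \<inter> \<phi> ` outside ?G = {}" using inside_Int_outside[of ?H] by blast
    ultimately show False using connectedD[OF conn_out opH] ne by (simp add: Int_commute)
  qed
qed

text \<open>Reduction to the inside case by an inversion about a point inside the closed curve,
  which is off both chords.\<close>

lemma chords_not_both_outside:
  fixes c c1 c2 f :: "real \<Rightarrow> complex"
  assumes c1: "simple_path c1" "pathstart c1 = a" "pathfinish c1 = b"
    and c2: "simple_path c2" "pathstart c2 = a" "pathfinish c2 = b"
    and c: "simple_path c" "pathstart c = a" "pathfinish c = b"
    and ab: "a \<noteq> b" and c12: "path_image c1 \<inter> path_image c2 = {a,b}"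
    and c1c: "path_image c1 \<inter> path_image c = {a,b}" and c2c: "path_image c2 \<inter> path_image c = {a,b}"
    and f: "arc f" "pathstart f = x" "pathfinish f = y"
    and x: "x \<in> path_image c1" "x \<notin> {a,b}" and y: "y \<in> path_image c2" "y \<notin> {a,b}"
    and fc12: "path_image f \<inter> (path_image c1 \<union> path_image c2) \<subseteq> {x,y}" and fc: "path_image f \<inter> path_image c = {}"
    and c_out: "path_image c \<inter> inside (path_image c1 \<union> path_image c2) = {}"
    and f_out: "path_image f \<inter> inside (path_image c1 \<union> path_image c2) = {}"
  shows False
proof -
  let ?G = "path_image c1 \<union> path_image c2"
  define \<gamma> where "\<gamma> = c1 +++ reversepath c2"
  have arcs: "arc c1" "arc c2" "arc c" using c1 c2 c ab by (simp_all add: arc_simple_path)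
  have g: "simple_path \<gamma>" "pathfinish \<gamma> = pathstart \<gamma>" unfolding \<gamma>_def
    using arcs c1 c2 c12 by (auto intro!: simple_path_join_loop simp: arc_reversepath)
  have G: "path_image \<gamma> = ?G" unfolding \<gamma>_def using c1 c2 by (simp add: path_image_join path_image_reversepath)
  obtain z0 where z0: "z0 \<in> inside ?G" using Jordan_inside_outside[OF g] unfolding G by blast
  define \<phi> where "\<phi> w = inverse (w - z0)" for w :: complex
  have z0n: "z0 \<notin> ?G" "z0 \<notin> path_image c" "z0 \<notin> path_image f"
    using z0 inside_no_overlap[of ?G] c_out f_out by blast+
  have cont: "continuous_on (- {z0}) \<phi>" unfolding \<phi>_def by (intro continuous_intros) auto
  have inj: "inj_on \<phi> (- {z0})" unfolding \<phi>_def by (rule inj_onI) simp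
  have sub: "path_image c1 \<subseteq> - {z0}" "path_image c2 \<subseteq> - {z0}" "path_image c \<subseteq> - {z0}" "path_image f \<subseteq> - {z0}"
    using z0n by auto
  have out: "\<phi> ` outside ?G \<subseteq> inside (\<phi> ` ?G)"
    using inversion_outside[OF g] z0 unfolding G \<phi>_def by blast
  have pim: "path_image (\<phi> \<circ> q) = \<phi> ` path_image q" for q by (simp add: path_image_compose)
  have int: "\<phi> ` S \<inter> \<phi> ` T = \<phi> ` (S \<inter> T)" if "S \<subseteq> - {z0}" "T \<subseteq> - {z0}" for S T
    using inj_on_image_Int[OF inj that] by simp
  have im: "\<phi> ` path_image c1 \<union> \<phi> ` path_image c2 = \<phi> ` ?G" by blast
  have abG: "a \<in> ?G" "b \<in> ?G" "x \<in> ?G" "y \<in> ?G" using c12 x y by auto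
  have nab: "\<phi> p \<noteq> \<phi> q" if "p \<in> ?G" "q \<in> ?G" "p \<noteq> q" for p q
    using inj_onD[OF inj, of p q] that z0n by auto
  \<comment> \<open>The midpoint of the arc is neither of its ends, so it is off the curve and in
    the outside, whose image is inside the image curve.\<close>
  have meets: "\<phi> ` path_image q \<inter> inside (\<phi> ` ?G) \<noteq> {}" if q: "arc q" "path_image q \<inter> ?G \<subseteq> {pathstart q, pathfinish q}" "path_image q \<inter> inside ?G = {}" for q
  proof -
    have "q (1/2) \<in> path_image q - {pathstart q, pathfinish q}"
      using simple_path_endless[OF arc_imp_simple_path[OF q(1)]] by auto
    then have "q (1/2) \<in> path_image q" "q (1/2) \<in> outside ?G"
      using q inside_Un_outside[of ?G] by blast+
    then show ?thesis using out by blast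
  qed
  show False
  proof (rule chords_not_both_inside[of "\<phi> \<circ> c1" "\<phi> a" "\<phi> b" "\<phi> \<circ> c2" "\<phi> \<circ> c" "\<phi> \<circ> f" "\<phi> x" "\<phi> y"])
    show "simple_path (\<phi> \<circ> c1)" "simple_path (\<phi> \<circ> c2)" "simple_path (\<phi> \<circ> c)"
      using c1 c2 c sub cont inj
      by (auto intro!: simple_path_continuous_image intro: continuous_on_subset inj_on_subset)
    show "arc (\<phi> \<circ> f)"
      unfolding arc_simple_path
    proof
      show "simple_path (\<phi> \<circ> f)"
        using arc_imp_simple_path[OF f(1)] sub cont inj
        by (auto intro!: simple_path_continuous_image intro: continuous_on_subset inj_on_subset)
      have "x \<noteq> y" using x y c12 by blast
      then show "pathfinish (\<phi> \<circ> f) \<noteq> pathstart (\<phi> \<circ> f)"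
        using nab[of y x] abG f by (simp add: pathstart_compose pathfinish_compose)
    qed
    show "path_image (\<phi> \<circ> f) \<inter> path_image (\<phi> \<circ> c) = {}" unfolding pim using int sub fc by simp
    show "path_image (\<phi> \<circ> f) \<inter> (path_image (\<phi> \<circ> c1) \<union> path_image (\<phi> \<circ> c2)) \<subseteq> {\<phi> x, \<phi> y}"
      unfolding pim im using int[of "path_image f" ?G] sub fc12 by auto
    show "path_image (\<phi> \<circ> c1) \<inter> path_image (\<phi> \<circ> c2) = {\<phi> a, \<phi> b}" unfolding pim using int sub c12 by simp
    show "path_image (\<phi> \<circ> c1) \<inter> path_image (\<phi> \<circ> c) = {\<phi> a, \<phi> b}" unfolding pim using int sub c1c by simp
    show "path_image (\<phi> \<circ> c2) \<inter> path_image (\<phi> \<circ> c) = {\<phi> a, \<phi> b}" unfolding pim using int sub c2c by simp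
    show "path_image (\<phi> \<circ> c) \<inter> inside (path_image (\<phi> \<circ> c1) \<union> path_image (\<phi> \<circ> c2)) \<noteq> {}"
      unfolding pim im using meets[of c] arcs c c1c c2c c_out by blast
    show "path_image (\<phi> \<circ> f) \<inter> inside (path_image (\<phi> \<circ> c1) \<union> path_image (\<phi> \<circ> c2)) \<noteq> {}"
      unfolding pim im using meets[of f] f fc12 f_out by blast
    show "\<phi> x \<notin> {\<phi> a, \<phi> b}" "\<phi> y \<notin> {\<phi> a, \<phi> b}" "\<phi> a \<noteq> \<phi> b" using nab abG x y ab by blast+
  qed (use c1 c2 c f x y in \<open>auto simp: pathstart_compose pathfinish_compose pim\<close>)
qed

lemma oriented_arc:
  assumes "arc q" "{pathstart q, pathfinish q} = {a, b}"
  shows "\<exists>q'. arc q' \<and> pathstart q' = a \<and> pathfinish q' = b \<and> path_image q' = path_image q"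
proof (cases "pathstart q = a")
  case True
  then have "pathfinish q = b" using assms by (metis doubleton_eq_iff arc_distinct_ends)
  then show ?thesis using True assms by blast
next
  case False
  then have "pathstart q = b" "pathfinish q = a" using assms by (metis doubleton_eq_iff)+
  then show ?thesis using assms(1) by (intro exI[of _ "reversepath q"]) (simp add: arc_reversepath)
qed

lemma UN_Int_subset: "(\<And>i. i \<in> S \<Longrightarrow> A i \<inter> B \<subseteq> D) \<Longrightarrow> (\<Union>i\<in>S. A i) \<inter> B \<subseteq> D"
  by blast

text \<open>The side of a chord is whether its curve enters the inside of the drawn Hamilton cycle.
  The ends of the first chord cut the cycle into two arcs, and the second chord has one end on each,
  which is the situation of the two preceding lemmas.\<close>

lemma planar_two_sides:
  assumes G: "simple_graph V E" and pl: "planar V E" and ham: "hamilton_cycle V E C"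
  shows "\<exists>side :: 'a set \<Rightarrow> bool. \<forall>a c b d. a < c \<and> c < b \<and> b < d \<and> d < length C \<and>
    {C ! a, C ! b} \<in> E \<and> {C ! c, C ! d} \<in> E \<longrightarrow> side {C ! a, C ! b} \<noteq> side {C ! c, C ! d}"
proof -
  obtain pos :: "'a \<Rightarrow> complex" and crv :: "'a set \<Rightarrow> real \<Rightarrow> complex" where
    inj: "inj_on pos V" and
    crv': "\<forall>e\<in>E. arc (crv e) \<and> {pathstart (crv e), pathfinish (crv e)} = pos ` e \<and>
        path_image (crv e) \<inter> pos ` V = pos ` e" and
    meet': "\<forall>e\<in>E. \<forall>f\<in>E. e \<noteq> f \<longrightarrow> path_image (crv e) \<inter> path_image (crv f) \<subseteq> pos ` (e \<inter> f)"
    using pl unfolding planar_def by (elim exE conjE)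
  have crv: "arc (crv e)" "{pathstart (crv e), pathfinish (crv e)} = pos ` e" if "e \<in> E" for e
    using crv' that by simp_all
  have meet: "path_image (crv e) \<inter> path_image (crv f) \<subseteq> pos ` (e \<inter> f)" if "e \<in> E" "f \<in> E" "e \<noteq> f" for e f
    using meet' that by simp
  define n where "n = length C"
  have n3: "3 \<le> n" and dist: "distinct C" and setC: "set C = V"
    and HE: "\<And>i. i < n \<Longrightarrow> {C ! i, C ! (Suc i mod n)} \<in> E"
    using ham unfolding hamilton_cycle_def is_cycle_def n_def by auto
  \<comment> \<open>Cyclic indices, so that the arc from \<open>b\<close> around to \<open>a\<close>
    is also a range of consecutive edges.\<close>
  define w where "w i = C ! (i mod n)" for i
  define h where "h i = {w i, w (Suc i)}" for i
  have w_eq: "w i = w j \<longleftrightarrow> i mod n = j mod n" for i j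
  proof -
    have "i mod n < length C" "j mod n < length C" using n3 by (simp_all add: n_def[symmetric])
    then show ?thesis unfolding w_def using nth_eq_iff_index_eq[OF dist] by blast
  qed
  have wV: "w i \<in> V" for i unfolding w_def
  proof -
    have "i mod n < length C" using n3 by (simp add: n_def[symmetric])
    then show "C ! (i mod n) \<in> V" using setC nth_mem by blast
  qed
  have hE: "h i \<in> E" for i
  proof -
    have "{C ! (i mod n), C ! (Suc (i mod n) mod n)} \<in> E" using n3 by (intro HE) simp
    then show ?thesis unfolding h_def w_def by (simp add: mod_Suc_eq)
  qed
  have pos_eq: "pos (w i) = pos (w j) \<longleftrightarrow> i mod n = j mod n" for i j
    using inj_on_eq_iff[OF inj wV wV] w_eq by simp
  have mod_win: "i mod n = j mod n \<longleftrightarrow> i = j" if "s \<le> i" "i < s + n" "s \<le> j" "j < s + n" for i j s :: nat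
  proof -
    have "x = y" if "x \<le> y" "y < x + n" "x mod n = y mod n" for x y
    proof (rule ccontr)
      assume "x \<noteq> y"
      moreover have "n dvd y - x" using mod_eq_dvd_iff_nat[OF that(1), of n] that(3) by simp
      ultimately have "n \<le> y - x" using that(1) by (intro dvd_imp_le) auto
      then show False using that by simp
    qed
    then show ?thesis using that by (metis add_le_cancel_right nat_le_linear order_less_le_trans)
  qed
  define im where "im i = path_image (crv (h i))" for i
  have im_meet: "im i \<inter> im j \<subseteq> pos ` (h i \<inter> h j)" if "h i \<noteq> h j" for i j
    unfolding im_def using meet[OF hE hE that] .
  have h_eq: "h i \<noteq> h j" if "s \<le> i" "i < j" "j < s + n" for i j s
  proof
    assume "h i = h j"
    then have "(w i = w j \<and> w (Suc i) = w (Suc j)) \<or> (w i = w (Suc j) \<and> w (Suc i) = w j)"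
      unfolding h_def by (metis doubleton_eq_iff)
    then have "w i = w (Suc j)" "w (Suc i) = w j"
      using mod_win[of s i j] that unfolding w_eq by auto
    then have "Suc i = j" using mod_win[of s "Suc i" j] that unfolding w_eq by auto
    then have "i mod n = (i + 2) mod n" using \<open>w i = w (Suc j)\<close> unfolding w_eq by simp
    then show False using mod_win[of i i "i + 2"] n3 by simp
  qed
  \<comment> \<open>Fewer than \<open>n\<close> consecutive edges form an arc: each new edge meets
    the previous ones only in the vertex at which it is attached.\<close>
  have seg: "\<exists>q. arc q \<and> pathstart q = pos (w s) \<and> pathfinish q = pos (w (s + l)) \<and> path_image q = (\<Union>i\<in>{s..<s + l}. im i)"
    if "0 < l" "l < n" for s l
    using that
  proof (induction l rule: nat_induct_non_zero)
    case 1
    have "{pathstart (crv (h s)), pathfinish (crv (h s))} = {pos (w s), pos (w (Suc s))}"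
      using crv(2)[OF hE, of s] unfolding h_def by simp
    then show ?case using oriented_arc[OF crv(1)[OF hE]] unfolding im_def by simp
  next
    case (Suc l)
    then obtain q where q: "arc q" "pathstart q = pos (w s)" "pathfinish q = pos (w (s + l))" "path_image q = (\<Union>i\<in>{s..<s + l}. im i)"
      by auto
    have "{pathstart (crv (h (s + l))), pathfinish (crv (h (s + l)))} = {pos (w (s + l)), pos (w (s + Suc l))}"
      using crv(2)[OF hE, of "s + l"] unfolding h_def by simp
    then obtain q' where q': "arc q'" "pathstart q' = pos (w (s + l))" "pathfinish q' = pos (w (s + Suc l))" "path_image q' = im (s + l)"
      using oriented_arc[OF crv(1)[OF hE]] unfolding im_def by blast
    have "im i \<inter> im (s + l) \<subseteq> {pos (w (s + l))}" if i: "s \<le> i" "i < s + l" for i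
    proof -
      have "h i \<inter> h (s + l) \<subseteq> {w (s + l)}"
        using i Suc.prems mod_win[of s i "s + l"] mod_win[of s i "Suc (s + l)"] mod_win[of s "Suc i" "Suc (s + l)"]
        unfolding h_def by (auto simp: w_eq)
      then have "pos ` (h i \<inter> h (s + l)) \<subseteq> {pos (w (s + l))}" by auto
      moreover have "h i \<noteq> h (s + l)" using h_eq[of s i "s + l"] i Suc.prems by simp
      ultimately show ?thesis using im_meet by (meson order_trans)
    qed
    then have "path_image q \<inter> path_image q' \<subseteq> {pathstart q'}" unfolding q q' by (intro UN_Int_subset) simp
    then have "arc (q +++ q')" using q q' by (intro arc_join) auto
    moreover have "{s..<s + Suc l} = insert (s + l) {s..<s + l}" by auto
    then have "path_image (q +++ q') = (\<Union>i\<in>{s..<s + Suc l}. im i)" using q q' by (simp add: path_image_join Un_commute)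
    ultimately show ?case using q q' by (intro exI[of _ "q +++ q'"]) simp
  qed
  define \<Gamma> where "\<Gamma> = (\<Union>i<n. im i)"
  define side where "side e \<longleftrightarrow> path_image (crv e) \<inter> inside \<Gamma> \<noteq> {}" for e
  have "side {C ! a, C ! b} \<noteq> side {C ! c, C ! d}"
    if ord: "a < c" "c < b" "b < d" "d < n" and E: "{C ! a, C ! b} \<in> E" "{C ! c, C ! d} \<in> E" for a b c d
  proof -
    have wC: "C ! i = w i" if "i < n" for i using that unfolding w_def by simp
    let ?e = "{w a, w b}" and ?f = "{w c, w d}"
    have ee: "?e \<in> E" "?f \<in> E" "{C ! a, C ! b} = ?e" "{C ! c, C ! d} = ?f" using E ord wC by auto
    have len: "0 < b - a" "b - a < n" "a + (b - a) = b" "0 < n + a - b" "n + a - b < n" "b + (n + a - b) = n + a"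
      using ord by linarith+
    obtain q1 where q1: "arc q1" "pathstart q1 = pos (w a)" "pathfinish q1 = pos (w b)" "path_image q1 = (\<Union>i\<in>{a..<b}. im i)"
      using seg[OF len(1,2), of a] unfolding len by blast
    obtain q0 where q0: "arc q0" "pathstart q0 = pos (w b)" "pathfinish q0 = pos (w (n + a))" "path_image q0 = (\<Union>i\<in>{b..<n + a}. im i)"
      using seg[OF len(4,5), of b] unfolding len by blast
    have wna: "w (n + a) = w a" unfolding w_def by simp
    define q2 where "q2 = reversepath q0"
    have q2: "arc q2" "pathstart q2 = pos (w a)" "pathfinish q2 = pos (w b)" "path_image q2 = (\<Union>i\<in>{b..<n + a}. im i)"
      unfolding q2_def using q0 wna by (auto simp: arc_reversepath)
    have h_n: "h (n + i) = h i" for i unfolding h_def w_def by simp (metis add_Suc_right mod_add_self1)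
    then have im_n: "im (n + i) = im i" for i unfolding im_def by simp
    have \<Gamma>: "path_image q1 \<union> path_image q2 = \<Gamma>"
    proof -
      have "im i \<subseteq> path_image q1 \<union> path_image q2" if "i < n" for i
      proof (cases "i < a")
        case True
        then have "im (n + i) \<subseteq> path_image q2" unfolding q2 using ord by (intro UN_upper) auto
        then show ?thesis using im_n by auto
      next
        case False
        then show ?thesis using that ord unfolding q1 q2 by (cases "i < b") auto
      qed
      moreover have "im i \<subseteq> \<Gamma>" if "i < n + n" for i
      proof (cases "i < n")
        case True then show ?thesis unfolding \<Gamma>_def by auto
      next
        case False
        then have "im i = im (i - n)" using im_n[of "i - n"] by simp
        then show ?thesis using False that unfolding \<Gamma>_def by (simp only:) (intro UN_upper; simp)
      qed
      then have "path_image q1 \<union> path_image q2 \<subseteq> \<Gamma>" unfolding q1 q2 using ord by (intro Un_least UN_least) auto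
      ultimately show ?thesis unfolding \<Gamma>_def by blast
    qed
    have pne: "pos (w i) \<noteq> pos (w j)" if "i < n" "j < n" "i \<noteq> j" for i j using that pos_eq by simp
    have wne: "w i \<noteq> w j" if "i < n" "j < n" "i \<noteq> j" for i j using that w_eq by simp
    \<comment> \<open>There is a vertex \<open>c\<close> strictly between \<open>a\<close> and
      \<open>b\<close> and a vertex \<open>d\<close> beyond \<open>b\<close>, so neither chord is an
      edge of the cycle, including the edge between the last and the first vertex.\<close>
    have he: "h i \<noteq> ?e" "h i \<noteq> ?f" if iN: "i < n" for i
    proof -
      have gen: "h i \<noteq> {w x, w y}" if xy: "Suc x < y" "y < n" "x \<noteq> 0 \<or> Suc y \<noteq> n" for x y
      proof
        assume "h i = {w x, w y}"
        then have "(w i = w x \<and> w (Suc i) = w y) \<or> (w i = w y \<and> w (Suc i) = w x)"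
          unfolding h_def by (metis doubleton_eq_iff)
        moreover have "x < n" "i mod n = i" using xy iN by simp_all
        ultimately show False using xy iN unfolding w_eq by (cases "Suc i = n") auto
      qed
      show "h i \<noteq> ?e" "h i \<noteq> ?f" using ord by (intro gen; simp)+
    qed
    have im_mod: "\<exists>j<n. im i = im j \<and> h i = h j" if "i < n + n" for i
    proof (cases "i < n")
      case False
      then have "h i = h (i - n)" using h_n[of "i - n"] by simp
      then show ?thesis using False that unfolding im_def by (intro exI[of _ "i - n"]) auto
    qed auto
    have oe: "{pathstart (crv ?e), pathfinish (crv ?e)} = {pos (w a), pos (w b)}" using crv(2)[OF ee(1)] by simp
    have off: "{pathstart (crv ?f), pathfinish (crv ?f)} = {pos (w c), pos (w d)}" using crv(2)[OF ee(2)] by simp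
    obtain qe where qe: "arc qe" "pathstart qe = pos (w a)" "pathfinish qe = pos (w b)" "path_image qe = path_image (crv ?e)"
      using oriented_arc[OF crv(1)[OF ee(1)] oe] by blast
    obtain qf where qf: "arc qf" "pathstart qf = pos (w c)" "pathfinish qf = pos (w d)" "path_image qf = path_image (crv ?f)"
      using oriented_arc[OF crv(1)[OF ee(2)] off] by blast
    have ends: "{pos (w a), pos (w b)} \<subseteq> path_image q" if "pathstart q = pos (w a)" "pathfinish q = pos (w b)" for q
      using that pathstart_in_path_image[of q] pathfinish_in_path_image[of q] by simp
    have im_e: "im i \<inter> path_image qe \<subseteq> {pos (w a), pos (w b)}" "im i \<inter> path_image qf \<subseteq> {pos (w c), pos (w d)}" if iN: "i < n + n" for i
    proof -
      obtain j where j: "j < n" "im i = im j" "h i = h j" using im_mod[OF iN] by auto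
      show "im i \<inter> path_image qe \<subseteq> {pos (w a), pos (w b)}"
        using meet[OF hE ee(1) he(1)[OF j(1)]] unfolding j qe im_def by blast
      show "im i \<inter> path_image qf \<subseteq> {pos (w c), pos (w d)}"
        using meet[OF hE ee(2) he(2)[OF j(1)]] unfolding j qf im_def by blast
    qed
    have c12: "path_image q1 \<inter> path_image q2 = {pos (w a), pos (w b)}"
    proof
      show "path_image q1 \<inter> path_image q2 \<subseteq> {pos (w a), pos (w b)}"
      proof -
        have "im i \<inter> im j \<subseteq> {pos (w a), pos (w b)}" if ij: "a \<le> i" "i < b" "b \<le> j" "j < n + a" for i j
        proof -
          have "x \<in> {w a, w b}" if "x \<in> h i \<inter> h j" for x
          proof -
            have "x = w i \<or> x = w (Suc i)" "x = w j \<or> x = w (Suc j)" using that unfolding h_def by auto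
            then consider "w i = w j" | "x = w i" "w i = w (Suc j)" | "x = w (Suc i)" "w (Suc i) = w j" | "w (Suc i) = w (Suc j)"
              by metis
            then show ?thesis
            proof cases
              case 1
              then show ?thesis using mod_win[of a i j] ij unfolding w_eq by simp
            next
              case 2
              have "i = a"
              proof (cases "Suc j < a + n")
                case True
                then show ?thesis using 2(2) mod_win[of a i "Suc j"] ij unfolding w_eq by simp
              next
                case False
                then have "Suc j = a + n" using ij by simp
                then have "i mod n = a mod n" using 2(2) unfolding w_eq by simp
                then show ?thesis using mod_win[of a i a] ij by simp
              qed
              then show ?thesis using 2 by simp
            next
              case 3
              then have "Suc i = j" using mod_win[of a "Suc i" j] ij ord unfolding w_eq by simp
              then have "j = b" using ij by linarith
              then show ?thesis using 3 by simp
            next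
              case 4
              then show ?thesis using mod_win[of "Suc a" "Suc i" "Suc j"] ij unfolding w_eq by simp
            qed
          qed
          then have "pos ` (h i \<inter> h j) \<subseteq> {pos (w a), pos (w b)}" by auto
          moreover have "h i \<noteq> h j" using h_eq[of a i j] ij by simp
          ultimately show ?thesis using im_meet by (meson order_trans)
        qed
        then show ?thesis unfolding q1 q2
          by (intro UN_Int_subset, subst Int_commute, intro UN_Int_subset) (auto simp: add.commute Int_commute)
      qed
      show "{pos (w a), pos (w b)} \<subseteq> path_image q1 \<inter> path_image q2" using ends[OF q1(2,3)] ends[OF q2(2,3)] by blast
    qed
    have c1c: "path_image q1 \<inter> path_image qe = {pos (w a), pos (w b)}"
    proof
      show "path_image q1 \<inter> path_image qe \<subseteq> {pos (w a), pos (w b)}"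
        unfolding q1 using im_e(1) ord by (intro UN_Int_subset) auto
    qed (use ends[OF q1(2,3)] ends[OF qe(2,3)] in blast)
    have c2c: "path_image q2 \<inter> path_image qe = {pos (w a), pos (w b)}"
    proof
      show "path_image q2 \<inter> path_image qe \<subseteq> {pos (w a), pos (w b)}"
        unfolding q2 using im_e(1) ord by (intro UN_Int_subset) auto
    qed (use ends[OF q2(2,3)] ends[OF qe(2,3)] in blast)
    have fc12: "path_image qf \<inter> (path_image q1 \<union> path_image q2) \<subseteq> {pos (w c), pos (w d)}"
      unfolding \<Gamma> \<Gamma>_def Int_commute[of "path_image qf"] using im_e(2) by (intro UN_Int_subset) simp
    have fc: "path_image qf \<inter> path_image qe = {}"
    proof -
      have "?f \<inter> ?e = {}" using wne ord by auto
      then show ?thesis using meet[OF ee(2,1)] unfolding qe qf by blast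
    qed
    have w_im: "pos (w i) \<in> im i" for i
      using crv(2)[OF hE, of i] pathstart_in_path_image[of "crv (h i)"] pathfinish_in_path_image[of "crv (h i)"]
      unfolding im_def h_def by (metis image_insert insertCI insertE singletonD)
    have x: "pos (w c) \<in> path_image q1" "pos (w c) \<notin> {pos (w a), pos (w b)}"
      using w_im[of c] ord pne unfolding q1 by auto
    have y: "pos (w d) \<in> path_image q2" "pos (w d) \<notin> {pos (w a), pos (w b)}"
      using w_im[of d] ord pne unfolding q2 by auto
    have ab: "pos (w a) \<noteq> pos (w b)" using pne ord by simp
    note args = arc_imp_simple_path[OF q1(1)] q1(2,3) arc_imp_simple_path[OF q2(1)] q2(2,3)
      arc_imp_simple_path[OF qe(1)] qe(2,3) ab c12 c1c c2c qf(1-3) x y fc12 fc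
    show ?thesis
      unfolding ee side_def
      using chords_not_both_inside[OF args] chords_not_both_outside[OF args] unfolding \<Gamma> qe qf by blast
  qed
  then show ?thesis unfolding n_def by blast
qed

section \<open>Weakest preconditions with running time\<close>

inductive_cases exec_SkipE: "exec W Skip s t s'"
inductive_cases exec_AssignE: "exec W (Assign x e) s t s'"
inductive_cases exec_PutE: "exec W (Put a i e) s t s'"
inductive_cases exec_SeqE: "exec W (Seq p q) s t s'"
inductive_cases exec_IfE: "exec W (If b p q) s t s'"

text \<open>The postcondition receives the time accumulated since the start, \<open>a\<close> being
  the time already spent; time bounds thus become part of loop invariants. Termination is included,
  and the word size shows up as the side conditions \<open>aval e s \<le> W\<close>.\<close>

definition wp :: "nat \<Rightarrow> com \<Rightarrow> (state \<Rightarrow> nat \<Rightarrow> bool) \<Rightarrow> state \<Rightarrow> nat \<Rightarrow> bool" where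
  "wp W p Q s a \<longleftrightarrow> (\<exists>t s'. exec W p s t s' \<and> Q s' (a + t))"

lemma wp_Skip [simp]: "wp W Skip Q s a \<longleftrightarrow> Q s (a + 1)"
  unfolding wp_def by (metis exec.Skip exec_SkipE)

lemma wp_Assign [simp]: "wp W (Assign x e) Q s a \<longleftrightarrow> aval e s \<le> W \<and> Q ((fst s)(x := aval e s), snd s) (a + 1)"
proof
  assume "wp W (Assign x e) Q s a"
  then obtain t s' where "exec W (Assign x e) s t s'" "Q s' (a + t)" unfolding wp_def by auto
  then show "aval e s \<le> W \<and> Q ((fst s)(x := aval e s), snd s) (a + 1)" by (elim exec_AssignE) simp
next
  assume *: "aval e s \<le> W \<and> Q ((fst s)(x := aval e s), snd s) (a + 1)"
  then show "wp W (Assign x e) Q s a" unfolding wp_def using exec.Assign[of e s W x] by blast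
qed

lemma wp_Put [simp]: "wp W (Put x i e) Q s a \<longleftrightarrow>
    aval e s \<le> W \<and> Q (fst s, (snd s)(x := (snd s x)(aval i s := aval e s))) (a + 1)"
proof
  assume "wp W (Put x i e) Q s a"
  then obtain t s' where "exec W (Put x i e) s t s'" "Q s' (a + t)" unfolding wp_def by auto
  then show "aval e s \<le> W \<and> Q (fst s, (snd s)(x := (snd s x)(aval i s := aval e s))) (a + 1)"
    by (elim exec_PutE) simp
next
  assume *: "aval e s \<le> W \<and> Q (fst s, (snd s)(x := (snd s x)(aval i s := aval e s))) (a + 1)"
  then show "wp W (Put x i e) Q s a" unfolding wp_def using exec.Put[of e s W x i] by blast
qed

lemma wp_Seq [simp]: "wp W (Seq p q) Q s a \<longleftrightarrow> wp W p (\<lambda>s' a'. wp W q Q s' a') s a"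
proof
  assume "wp W (Seq p q) Q s a"
  then obtain t s' where "exec W (Seq p q) s t s'" and Q: "Q s' (a + t)" unfolding wp_def by auto
  then obtain t1 t2 s1 where "exec W p s t1 s1" "exec W q s1 t2 s'" "t = t1 + t2" by (elim exec_SeqE) blast
  then show "wp W p (\<lambda>s' a'. wp W q Q s' a') s a" using Q unfolding wp_def by (metis add.assoc)
next
  assume "wp W p (\<lambda>s' a'. wp W q Q s' a') s a"
  then obtain t1 s1 t2 s2 where "exec W p s t1 s1" "exec W q s1 t2 s2" "Q s2 (a + t1 + t2)" unfolding wp_def by auto
  then show "wp W (Seq p q) Q s a" using exec.Seq unfolding wp_def by (metis add.assoc)
qed

lemma wp_If [simp]: "wp W (If b p q) Q s a \<longleftrightarrow> (if bval b s then wp W p Q s (a + 1) else wp W q Q s (a + 1))"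
proof
  assume "wp W (If b p q) Q s a"
  then obtain t s' where "exec W (If b p q) s t s'" and Q: "Q s' (a + t)" unfolding wp_def by auto
  then consider u where "bval b s" "exec W p s u s'" "t = Suc u" | u where "\<not> bval b s" "exec W q s u s'" "t = Suc u"
    by (elim exec_IfE) blast+
  then show "if bval b s then wp W p Q s (a + 1) else wp W q Q s (a + 1)"
  proof cases
    case (1 u)
    then have "exec W p s u s'" "Q s' (a + 1 + u)" using Q by simp_all
    then have "wp W p Q s (a + 1)" unfolding wp_def by blast
    then show ?thesis using 1 by simp
  next
    case (2 u)
    then have "exec W q s u s'" "Q s' (a + 1 + u)" using Q by simp_all
    then have "wp W q Q s (a + 1)" unfolding wp_def by blast
    then show ?thesis using 2 by simp
  qed
next
  assume *: "if bval b s then wp W p Q s (a + 1) else wp W q Q s (a + 1)"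
  show "wp W (If b p q) Q s a"
  proof (cases "bval b s")
    case True
    then obtain t s' where "exec W p s t s'" "Q s' (a + 1 + t)" using * unfolding wp_def by auto
    then show ?thesis using exec.IfTrue[OF True] unfolding wp_def by (metis add.assoc)
  next
    case False
    then obtain t s' where "exec W q s t s'" "Q s' (a + 1 + t)" using * unfolding wp_def by auto
    then show ?thesis using exec.IfFalse[OF False] unfolding wp_def by (metis add.assoc)
  qed
qed

lemma wp_mono: "wp W p Q s a \<Longrightarrow> (\<And>s a. Q s a \<Longrightarrow> R s a) \<Longrightarrow> wp W p R s a"
  unfolding wp_def by blast

lemma wp_While:
  fixes V :: "state \<Rightarrow> nat"
  assumes "I s a"
    and body: "\<And>s a. I s a \<Longrightarrow> bval b s \<Longrightarrow> wp W p (\<lambda>s' a'. I s' a' \<and> V s' < V s) s (a + 1)"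
    and exit: "\<And>s a. I s a \<Longrightarrow> \<not> bval b s \<Longrightarrow> Q s (a + 1)"
  shows "wp W (While b p) Q s a"
  using assms(1)
proof (induction "V s" arbitrary: s a rule: less_induct)
  case less
  show ?case
  proof (cases "bval b s")
    case True
    obtain t s' where e: "exec W p s t s'" "I s' (a + 1 + t)" "V s' < V s"
      using body[OF less.prems True] unfolding wp_def by auto
    obtain u s'' where "exec W (While b p) s' u s''" "Q s'' (a + 1 + t + u)"
      using less.hyps[OF e(3,2)] unfolding wp_def by auto
    then show ?thesis using exec.WhileTrue[where W = W, OF True e(1)] unfolding wp_def
      by (metis (no_types, lifting) add.assoc)
  next
    case False
    then show ?thesis using exit[OF less.prems] exec.WhileFalse unfolding wp_def by blast
  qed
qed

abbreviation eq_test :: "aexp \<Rightarrow> aexp \<Rightarrow> bexp" where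
  "eq_test d e \<equiv> And (Not (Less d e)) (Not (Less e d))"

abbreviation inc :: "string \<Rightarrow> com" where
  "inc x \<equiv> Assign x (Plus (Var x) (Const 1))"

primrec seqs :: "com list \<Rightarrow> com" where
  "seqs [] = Skip"
| "seqs (p # ps) = (if ps = [] then p else Seq p (seqs ps))"

definition for_loop :: "string \<Rightarrow> aexp \<Rightarrow> com \<Rightarrow> com" where
  "for_loop i N p = Seq (Assign i (Const 0)) (While (Less (Var i) N) (Seq p (inc i)))"

lemma wp_for_loop:
  assumes init: "J 0 (r(i := 0), h) (a + 1)"
    and var: "\<And>j r h a. J j (r, h) a \<Longrightarrow> r i = j \<and> aval N (r, h) = n"
    and body: "\<And>j r h a. j < n \<Longrightarrow> J j (r, h) a \<Longrightarrow>
      wp W p (\<lambda>s' a'. fst s' i = j \<and> J (Suc j) ((fst s')(i := Suc j), snd s') (a' + 1)) (r, h) (a + 1)"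
    and exit: "\<And>r h a. J n (r, h) a \<Longrightarrow> Q (r, h) (a + 1)" and "n \<le> W"
  shows "wp W (for_loop i N p) Q (r, h) a"
  unfolding for_loop_def wp_Seq wp_Assign
proof (intro conjI)
  show "wp W (While (Less (Var i) N) (Seq p (inc i))) Q
      ((fst (r, h))(i := aval (Const 0) (r, h)), snd (r, h)) (a + 1)"
  proof (rule wp_While[where V = "\<lambda>s. n - fst s i" and I = "\<lambda>s a. \<exists>j\<le>n. J j s a"])
    show "\<exists>j\<le>n. J j ((fst (r, h))(i := aval (Const 0) (r, h)), snd (r, h)) (a + 1)"
      using init by (auto intro!: exI[of _ 0])
  next
    fix s a assume "\<exists>j\<le>n. J j s a" "bval (Less (Var i) N) s"
    then obtain j where j: "j \<le> n" "J j s a" "j < n" using var[of _ "fst s" "snd s"] by fastforce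
    have ij: "fst s i = j" using var[of j "fst s" "snd s" a] j by simp
    show "wp W (Seq p (inc i)) (\<lambda>s' a'. (\<exists>j\<le>n. J j s' a') \<and> n - fst s' i < n - fst s i) s (a + 1)"
      unfolding wp_Seq
    proof (rule wp_mono)
      show "wp W p (\<lambda>s' a'. fst s' i = j \<and> J (Suc j) ((fst s')(i := Suc j), snd s') (a' + 1)) s (a + 1)"
        using body[of j "fst s" "snd s" a] j by simp
    qed (use j \<open>n \<le> W\<close> ij in \<open>auto intro!: exI[of _ "Suc j"]\<close>)
  next
    fix s a assume "\<exists>j\<le>n. J j s a" "\<not> bval (Less (Var i) N) s"
    then obtain j where j: "j \<le> n" "J j s a" "\<not> j < n" using var[of _ "fst s" "snd s"] by fastforce
    then have "J n s a" by (simp add: not_less le_antisym)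
    then show "Q s (a + 1)" using exit[of "fst s" "snd s" a] by simp
  qed
qed simp

definition load_positions :: com where
  "load_positions = for_loop ''i'' (Var ''n'') (Put ''pos'' (Get ''ham'' (Var ''i'')) (Var ''i''))"

lemma wp_load_positions:
  assumes H: "distinct H" "length H = r ''n''" "\<And>j. j < r ''n'' \<Longrightarrow> h ''ham'' j = H ! j" and "r ''n'' \<le> W"
    and Q: "\<And>r' h' a'. (\<forall>x. x \<noteq> ''i'' \<longrightarrow> r' x = r x) \<Longrightarrow> (\<forall>x. x \<noteq> ''pos'' \<longrightarrow> h' x = h x) \<Longrightarrow>
      (\<forall>j<r ''n''. h' ''pos'' (H ! j) = j) \<Longrightarrow> a' \<le> a + 3 * r ''n'' + 2 \<Longrightarrow> Q (r', h') a'"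
  shows "wp W load_positions Q (r, h) a"
  unfolding load_positions_def
proof (rule wp_for_loop[where n = "r ''n''" and J = "\<lambda>j s b. fst s ''i'' = j \<and> (\<forall>x. x \<noteq> ''i'' \<longrightarrow> fst s x = r x) \<and>
    (\<forall>x. x \<noteq> ''pos'' \<longrightarrow> snd s x = h x) \<and> (\<forall>t<j. snd s ''pos'' (H ! t) = t) \<and> b \<le> a + 1 + 3 * j"], goal_cases)
  case (3 j r' h' b)
  then show ?case using assms(1-4) by (auto simp: less_Suc_eq nth_eq_iff_index_eq)
next
  case (4 r' h' b)
  then show ?case by (intro Q) auto
qed (use assms in auto)

section \<open>Two-colouring a chord diagram by a scan over its ends\<close>

text \<open>A double occurrence word: a chord diagram cut open at one point, each chord being named
  at its first and at its last end.\<close>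

definition end_word :: "nat \<Rightarrow> nat set \<Rightarrow> (nat \<Rightarrow> nat) \<Rightarrow> (nat \<Rightarrow> nat) \<Rightarrow> (nat \<Rightarrow> nat) \<Rightarrow> bool" where
  "end_word T X e fi la \<longleftrightarrow>
    (\<forall>x\<in>X. fi x < la x \<and> la x < T \<and> e (fi x) = x \<and> e (la x) = x) \<and>
    (\<forall>t<T. e t \<in> X \<and> (t = fi (e t) \<or> t = la (e t)))"

text \<open>Crossing, in the orientation in which \<open>x\<close> both opens and closes
  first.\<close>

definition interlaced :: "(nat \<Rightarrow> nat) \<Rightarrow> (nat \<Rightarrow> nat) \<Rightarrow> nat \<Rightarrow> nat \<Rightarrow> bool" where
  "interlaced fi la x y \<longleftrightarrow> fi x < fi y \<and> fi y < la x \<and> la x < la y"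

fun adjacent :: "'b list \<Rightarrow> ('b \<times> 'b) set" where
  "adjacent (x # y # zs) = insert (x, y) (adjacent (y # zs))"
| "adjacent _ = {}"

lemma adjacent_append: "adjacent (us @ x # vs) = adjacent (us @ [x]) \<union> adjacent (x # vs)"
proof (induction us)
  case Nil then show ?case by simp
next
  case (Cons u us) then show ?case by (cases us) auto
qed

lemma adjacent_snoc: "adjacent (us @ [x, y]) = insert (x, y) (adjacent (us @ [x]))"
  using adjacent_append[of us x "[y]"] by auto

lemma adjacent_prefix: "(p, y) \<in> adjacent us \<Longrightarrow> (p, y) \<in> adjacent (us @ vs)"
  by (induction us rule: adjacent.induct) auto

lemma adjacent_junction: "us \<noteq> [] \<Longrightarrow> (last us, y) \<in> adjacent (us @ y # vs)"
  by (cases us rule: rev_cases) (auto simp: adjacent_append[of _ _ "_ # _"])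

lemma adjacent_in: "(p, y) \<in> adjacent zs \<Longrightarrow> p \<in> set zs \<and> y \<in> set zs"
  by (induction zs rule: adjacent.induct) auto

lemma adjacent_tl: "(p, y) \<in> adjacent zs \<Longrightarrow> y \<in> set (tl zs)"
proof (induction zs rule: adjacent.induct)
  case (1 a b zs) then show ?case by (auto dest: adjacent_in)
qed auto

lemma adjacent_butlast: "(p, y) \<in> adjacent zs \<Longrightarrow> p \<in> set (butlast zs)"
proof (induction zs rule: adjacent.induct)
  case (1 a b zs) then show ?case by (cases zs) auto
qed auto

lemma adjacent_unique_right: "distinct zs \<Longrightarrow> (p, y) \<in> adjacent zs \<Longrightarrow> (p', y) \<in> adjacent zs \<Longrightarrow> p = p'"
proof (induction zs rule: adjacent.induct)
  case (1 a b zs) then show ?case by (auto dest: adjacent_tl)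
qed auto

lemma adjacent_const:
  assumes "\<And>p y. (p, y) \<in> adjacent zs \<Longrightarrow> f p = f y" "z \<in> set zs" shows "f z = f (hd zs)"
  using assms
proof (induction zs rule: adjacent.induct)
  case (1 a b zs)
  have "f a = f b" using 1(2) by simp
  moreover have "z = a \<or> f z = f b" using 1 by auto
  ultimately show ?case by auto
qed auto

definition parity :: "(nat \<Rightarrow> nat) \<Rightarrow> nat \<Rightarrow> nat \<Rightarrow> nat" where
  "parity f p y = (if f p = f y then 0 else 1)"

text \<open>Zero must not name a chord: it is the sentinel of the linked list and the value of a
  missing reference.\<close>

locale end_word_loc =
  fixes T :: nat and X :: "nat set" and e fi la :: "nat \<Rightarrow> nat"
  assumes word: "end_word T X e fi la" and zero: "0 \<notin> X"
begin

lemma wordD: "x \<in> X \<Longrightarrow> fi x < la x" "x \<in> X \<Longrightarrow> la x < T" "x \<in> X \<Longrightarrow> e (fi x) = x" "x \<in> X \<Longrightarrow> e (la x) = x"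
  "t < T \<Longrightarrow> e t \<in> X" "t < T \<Longrightarrow> t = fi (e t) \<or> t = la (e t)"
  using word unfolding end_word_def by auto

primrec active :: "nat \<Rightarrow> nat list" where
  "active 0 = []"
| "active (Suc i) = (if i = fi (e i) then active i @ [e i] else filter (\<lambda>y. y \<noteq> e i) (active i))"

lemma set_active: "i \<le> T \<Longrightarrow> set (active i) = {x\<in>X. fi x < i \<and> i \<le> la x}"
proof (induction i)
  case 0 then show ?case by auto
next
  case (Suc i)
  then have IH: "set (active i) = {x\<in>X. fi x < i \<and> i \<le> la x}" and i: "i < T" by auto
  note w = wordD(5,6)[OF i]
  show ?case
  proof (cases "i = fi (e i)")
    case True
    have "i < la (e i)" using wordD(1)[of "e i"] w True by simp
    moreover have "la x \<noteq> i" "x \<noteq> e i \<longrightarrow> fi x \<noteq> i" if "x \<in> X" for x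
      using wordD(1)[of "e i"] wordD(3,4)[of x] that w True by auto
    ultimately show ?thesis using True w IH by (auto simp: less_Suc_eq Suc_le_eq le_less)
  next
    case False
    then have l: "i = la (e i)" using w by simp
    have k: "la y = i \<longleftrightarrow> y = e i" "fi y \<noteq> i" if "y \<in> X" for y
      using wordD(3,4)[OF that] l False by metis+
    show ?thesis
    proof (rule set_eqI)
      fix y
      have "y \<in> set (active (Suc i)) \<longleftrightarrow> y \<noteq> e i \<and> y \<in> X \<and> fi y < i \<and> i \<le> la y" using IH False by auto
      also have "\<dots> \<longleftrightarrow> y \<in> X \<and> fi y < Suc i \<and> Suc i \<le> la y"
        using k[of y] by (cases "y \<in> X") (auto simp: less_Suc_eq Suc_le_eq le_less)
      finally show "y \<in> set (active (Suc i)) \<longleftrightarrow> y \<in> {x\<in>X. fi x < Suc i \<and> Suc i \<le> la x}" by simp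
    qed
  qed
qed

lemma sorted_active: "i \<le> T \<Longrightarrow> sorted_wrt (\<lambda>a b. fi a < fi b) (active i)"
proof (induction i)
  case (Suc i)
  then show ?case using set_active[of i] by (auto simp: sorted_wrt_append sorted_wrt_filter)
qed simp

lemma distinct_active: "i \<le> T \<Longrightarrow> distinct (active i)"
  using sorted_active[of i] by (induction "active i" rule: rev_induct)
    (metis (mono_tags, lifting) distinct_conv_nth less_irrefl linorder_neqE_nat sorted_wrt_iff_nth_less)+

lemma active_pos: "i \<le> T \<Longrightarrow> x \<in> set (active i) \<Longrightarrow> 0 < x"
  using set_active zero by (auto intro: gr0I)

text \<open>A gap lies between neighbours in the list of active chords and is named by its right end
  \<open>y\<close>. \<open>st y\<close> is the recorded colour difference across it;
  \<open>Op\<close> holds the gaps about which nothing is known yet.\<close>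

definition gaps_ok where
  "gaps_ok f zs Op st \<longleftrightarrow> (\<forall>p y. (p, y) \<in> adjacent zs \<longrightarrow> y \<notin> Op \<longrightarrow> st y = parity f p y)"

text \<open>For two colours the formula says that \<open>x\<close> has the colour of its reference
  \<open>rf x\<close>, flipped exactly if \<open>pr x\<close> is 1.\<close>

definition refs_ok where
  "refs_ok col i rf pr \<longleftrightarrow> (\<forall>x\<in>X. la x < i \<longrightarrow> col x = (if col (rf x) = pr x then 0 else 1 :: nat))"

definition separated where
  "separated col i \<longleftrightarrow> (\<forall>x\<in>X. \<forall>y\<in>X. la x < i \<and> interlaced fi la x y \<longrightarrow> col x \<noteq> (col y :: nat))"

definition refs_later where
  "refs_later i rf \<longleftrightarrow> (\<forall>x\<in>X. la x < i \<longrightarrow> rf x = 0 \<or> (rf x \<in> X \<and> la x < la (rf x)))"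

text \<open>The records are sound, as the given proper colouring \<open>\<kappa>\<close> satisfies
  the recorded gaps, and complete, as every two-colouring that satisfies gaps and references
  separates all crossings whose first chord has closed. By the last part references close later, so
  a backward pass finds them coloured.\<close>

definition col_inv where
  "col_inv \<kappa> i Op st rf pr \<longleftrightarrow> gaps_ok \<kappa> (active i) Op st \<and>
    (\<forall>col. (\<forall>z. col z \<le> 1) \<and> refs_ok col i rf pr \<and> gaps_ok col (active i) Op st \<longrightarrow> separated col i) \<and>
    refs_later i rf"

lemma col_inv_0: "col_inv \<kappa> 0 Op st rf pr"
  unfolding col_inv_def gaps_ok_def separated_def refs_later_def by simp

lemma col_inv_open:
  assumes i: "i < T" "i = fi (e i)" and inv: "col_inv \<kappa> i Op st rf pr"
  shows "col_inv \<kappa> (Suc i) (insert (e i) Op) st rf pr"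
proof -
  have la: "la x < Suc i \<longleftrightarrow> la x < i" if "x \<in> X" for x
  proof -
    have "la x \<noteq> i" using wordD(1)[OF that] wordD(4)[OF that] i(2) by (metis less_irrefl)
    then show ?thesis by (auto simp: less_Suc_eq)
  qed
  have "(p, y) \<in> adjacent (active i) \<and> y \<notin> Op" if "(p, y) \<in> adjacent (active (Suc i))" "y \<notin> insert (e i) Op" for p y
  proof -
    have "(p, y) \<in> adjacent (active i @ [e i])" using that i by simp
    then show ?thesis using that(2) by (cases "active i" rule: rev_cases) (auto simp: adjacent_snoc)
  qed
  moreover have "(p, y) \<in> adjacent (active (Suc i)) \<and> y \<notin> insert (e i) Op" if "(p, y) \<in> adjacent (active i)" "y \<notin> Op" for p y
  proof -
    have "y \<in> set (active i)" using that(1) adjacent_in by fastforce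
    then have "y \<noteq> e i" using set_active[of i] i by auto
    moreover have "(p, y) \<in> adjacent (active i @ [e i])"
      using that(1) by (cases "active i" rule: rev_cases) (auto simp: adjacent_snoc)
    ultimately show ?thesis using that i by simp
  qed
  ultimately have adj: "gaps_ok f (active (Suc i)) (insert (e i) Op) st \<longleftrightarrow> gaps_ok f (active i) Op st" for f
    unfolding gaps_ok_def by meson
  have "refs_ok col (Suc i) rf pr \<longleftrightarrow> refs_ok col i rf pr" "separated col (Suc i) \<longleftrightarrow> separated col i"
    "refs_later (Suc i) rf \<longleftrightarrow> refs_later i rf" for col
    using la unfolding refs_ok_def separated_def refs_later_def by auto
  then show ?thesis using inv unfolding col_inv_def adj by simp
qed

text \<open>When \<open>x\<close> closes, the active chords opened after \<open>x\<close> are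
  exactly those still to be recorded as crossing it, and all of them have the other colour. So the
  gap in front of \<open>y\<close> is known: it is 1 if the left neighbour is \<open>x\<close>
  itself, and 0 if that neighbour crosses \<open>x\<close> too.\<close>

lemma col_inv_pop:
  assumes i: "i < T" "i = la x" "x \<in> X" and inv: "col_inv \<kappa> i Op st rf pr"
    and ch: "\<And>a b. a \<in> X \<Longrightarrow> b \<in> X \<Longrightarrow> interlaced fi la a b \<Longrightarrow> \<kappa> a \<noteq> \<kappa> b" "\<And>z. \<kappa> z \<le> 1"
    and y: "y \<in> Op" "fi x < fi y" "(p, y) \<in> adjacent (0 # active i)"
  shows "col_inv \<kappa> i (Op - {y}) (st(y := if p = x then 1 else 0)) rf pr"
proof -
  have iT: "i \<le> T" using i by simp
  have cross: "\<kappa> x \<noteq> \<kappa> z" if "z \<in> set (active i)" "fi x < fi z" for z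
  proof -
    have z: "z \<in> X" "fi z < i" "i \<le> la z" using that(1) set_active[OF iT] by auto
    have "i \<noteq> la z" using wordD(4)[OF z(1)] wordD(4)[OF i(3)] i(2) that(2) by (metis less_irrefl)
    then have "interlaced fi la x z" unfolding interlaced_def using z i that(2) by simp
    then show ?thesis using ch(1) z i by blast
  qed
  have dist0: "distinct (0 # active i)" using distinct_active[OF iT] active_pos[OF iT] by auto
  have px: "parity \<kappa> p' y = (if p = x then 1 else 0)" if a: "(p', y) \<in> adjacent (active i)" for p'
  proof -
    have "(p', y) \<in> adjacent (0 # active i)" using a by (cases "active i") auto
    then have pp: "p' = p" using adjacent_unique_right[OF dist0] y(3) by blast
    have yin: "y \<in> set (active i)" "p \<in> set (active i)" using adjacent_in[OF a] pp by auto
    show ?thesis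
    proof (cases "p = x")
      case True then show ?thesis using cross[OF yin(1) y(2)] pp unfolding parity_def by simp
    next
      case False
      have "fi x < fi p"
      proof (rule ccontr)
        assume "\<not> fi x < fi p"
        moreover have "p \<in> X" using yin set_active[OF iT] by simp
        then have "fi p \<noteq> fi x" using False wordD(3)[of p] wordD(3)[OF i(3)] by metis
        ultimately have px: "fi p < fi x" by simp
        have xin: "x \<in> set (active i)" using set_active[OF iT] i wordD(1)[of x] by simp
        obtain us vs where s: "active i = us @ x # vs" using split_list[OF xin] by blast
        have so: "sorted_wrt (\<lambda>a b. fi a < fi b) (us @ x # vs)" using sorted_active[OF iT] s by simp
        have "(p, y) \<in> adjacent (us @ [x]) \<union> adjacent (x # vs)" using a pp unfolding s by (simp add: adjacent_append[of us x vs])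
        then show False
        proof
          assume "(p, y) \<in> adjacent (us @ [x])"
          then have "y \<in> set (us @ [x])" using adjacent_in by fastforce
          then show False using so y(2) by (auto simp: sorted_wrt_append)
        next
          assume "(p, y) \<in> adjacent (x # vs)"
          then have "p \<in> set (x # vs)" using adjacent_in by fastforce
          then show False using so px by (auto simp: sorted_wrt_append)
        qed
      qed
      then have "\<kappa> x \<noteq> \<kappa> p" "\<kappa> x \<noteq> \<kappa> y" using cross yin y(2) by auto
      then have "\<kappa> p = \<kappa> y" using ch(2)[of x] ch(2)[of p] ch(2)[of y] by linarith
      then show ?thesis using pp False unfolding parity_def by simp
    qed
  qed
  let ?st = "st(y := if p = x then 1 else 0)"
  \<comment> \<open>Closing a gap adds a constraint, so colourings that satisfy the new records
    satisfy the old ones.\<close>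
  have old: "gaps_ok f (active i) Op st" if "gaps_ok f (active i) (Op - {y}) ?st" for f
    unfolding gaps_ok_def
  proof (intro allI impI)
    fix p' y' assume a: "(p', y') \<in> adjacent (active i)" "y' \<notin> Op"
    then have "y' \<noteq> y" using y(1) by auto
    then show "st y' = parity f p' y'" using that a unfolding gaps_ok_def by fastforce
  qed
  have "gaps_ok \<kappa> (active i) (Op - {y}) ?st"
    unfolding gaps_ok_def
  proof (intro allI impI)
    fix p' y' assume a: "(p', y') \<in> adjacent (active i)" "y' \<notin> Op - {y}"
    show "?st y' = parity \<kappa> p' y'"
    proof (cases "y' = y")
      case True then show ?thesis using px a by simp
    next
      case False then show ?thesis using inv a unfolding col_inv_def gaps_ok_def by simp
    qed
  qed
  then show ?thesis using inv old unfolding col_inv_def by blast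
qed

text \<open>Removing \<open>x\<close> merges the gaps on its two sides. If there is a right
  neighbour, it crosses \<open>x\<close>: \<open>x\<close> refers to it with parity 1, and the
  merged gap has parity \<open>1 - st x\<close>, or is open if the gap of \<open>x\<close> was. If
  there is none, \<open>x\<close> refers to its left neighbour with parity \<open>st x\<close>, or
  to 0 and hence to nothing if that gap is open.\<close>

lemma col_inv_close:
  assumes i: "i < T" "i = la x" "x \<in> X" and inv: "col_inv \<kappa> i Op st rf pr"
    and ch: "\<And>a b. a \<in> X \<Longrightarrow> b \<in> X \<Longrightarrow> interlaced fi la a b \<Longrightarrow> \<kappa> a \<noteq> \<kappa> b" "\<And>z. \<kappa> z \<le> 1"
    and act: "active i = us @ x # vs" and noOp: "set vs \<inter> Op = {}"
    and new: "vs \<noteq> [] \<Longrightarrow> rf' = rf(x := hd vs) \<and> pr' = pr(x := 1) \<and>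
        (if x \<in> Op then st' = st \<and> Op' = insert (hd vs) (Op - {x}) else st' = st(hd vs := 1 - st x) \<and> Op' = Op)"
      "vs = [] \<Longrightarrow> st' = st \<and> Op' = Op - {x} \<and>
        (x \<in> Op \<longrightarrow> rf' = rf(x := 0)) \<and> (x \<notin> Op \<longrightarrow> rf' = rf(x := last (0 # us)) \<and> pr' = pr(x := st x))
        \<and> (\<forall>z. z \<noteq> x \<longrightarrow> pr' z = pr z)"
  shows "col_inv \<kappa> (Suc i) Op' st' rf' pr'"
proof -
  have iT: "i \<le> T" using i by simp
  have ex: "e i = x" using i wordD(4) by simp
  have nfi: "i \<noteq> fi (e i)" using ex i wordD(1)[of x] by simp
  have dist: "distinct (us @ x # vs)" using distinct_active[OF iT] act by simp
  have so: "sorted_wrt (\<lambda>a b. fi a < fi b) (us @ x # vs)" using sorted_active[OF iT] act by simp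
  have act': "active (Suc i) = us @ vs"
  proof -
    have "active (Suc i) = filter (\<lambda>y. y \<noteq> x) us @ filter (\<lambda>y. y \<noteq> x) vs" using nfi ex act by simp
    moreover have "filter (\<lambda>y. y \<noteq> x) us = us" "filter (\<lambda>y. y \<noteq> x) vs = vs" using dist by (auto intro!: filter_True)
    ultimately show ?thesis by simp
  qed
  have inX: "z \<in> X" "la z \<noteq> i" "i < la z" if "z \<in> set us \<union> set vs" for z
  proof -
    have z: "z \<in> X" "i \<le> la z" using that set_active[OF iT] act by auto
    then show "z \<in> X" by simp
    show "la z \<noteq> i" using wordD(4)[OF z(1)] ex that dist by auto
    then show "i < la z" using z by simp
  qed
  have laS: "la z < Suc i \<longleftrightarrow> la z < i \<or> z = x" if "z \<in> X" for z
    using wordD(4)[OF that] ex i by (auto simp: less_Suc_eq)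
  have vs_cross: "interlaced fi la x z" if "z \<in> set vs" for z
    using that so set_active[OF iT] act i inX(2)[of z] unfolding interlaced_def
    by (auto simp: sorted_wrt_append le_less)
  have cross_vs: "z \<in> set vs" if "z \<in> X" "interlaced fi la x z" for z
  proof -
    have "z \<in> set (us @ x # vs)" using that set_active[OF iT] act i unfolding interlaced_def by auto
    then show ?thesis using that so unfolding interlaced_def by (auto simp: sorted_wrt_append)
  qed
  have ch_vs: "\<kappa> z = 1 - \<kappa> x" if "z \<in> set vs" for z
    using ch(1)[OF i(3) inX(1)[of z] vs_cross[OF that]] that ch(2)[of z] ch(2)[of x] by simp
  have I3: "\<And>p y. (p, y) \<in> adjacent (us @ x # vs) \<Longrightarrow> y \<notin> Op \<Longrightarrow> st y = parity \<kappa> p y"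
    using inv act unfolding col_inv_def gaps_ok_def by simp
  have I4: "separated col i" if "\<forall>z. col z \<le> 1" "refs_ok col i rf pr" "gaps_ok col (us @ x # vs) Op st" for col
    using inv that unfolding col_inv_def act by blast
  have I5: "\<forall>x\<in>X. la x < i \<longrightarrow> rf x = 0 \<or> (rf x \<in> X \<and> la x < la (rf x))"
    using inv unfolding col_inv_def refs_later_def by blast
  have adj_old: "adjacent (us @ x # vs) = adjacent (us @ [x]) \<union> adjacent (x # vs)" by (rule adjacent_append)
  have I5': "\<forall>z\<in>X. la z < Suc i \<longrightarrow> rf' z = 0 \<or> (rf' z \<in> X \<and> la z < la (rf' z))"
  proof (intro ballI impI)
    fix z assume z: "z \<in> X" "la z < Suc i"
    show "rf' z = 0 \<or> (rf' z \<in> X \<and> la z < la (rf' z))"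
    proof (cases "z = x")
      case False
      then have "la z < i" "rf' z = rf z" using z laS[of z] new by (cases "vs = []"; auto split: if_splits)+
      then show ?thesis using I5 z by simp
    next
      case True
      show ?thesis
      proof (cases "vs = []")
        case True
        show ?thesis
        proof (cases "x \<in> Op \<or> us = []")
          case True
          then have "rf' x = 0" using new(2)[OF \<open>vs = []\<close>] by (metis fun_upd_same last.simps)
          then show ?thesis using \<open>z = x\<close> by simp
        next
          case False
          then have us: "x \<notin> Op" "us \<noteq> []" by blast+
          have "rf' = rf(x := last (0 # us))" using new(2)[OF \<open>vs = []\<close>] us(1) by blast
          then have "rf' x = last us" "last us \<in> set us" using us(2) by simp_all
          moreover have "last us \<in> X" "i < la (last us)"
            using \<open>last us \<in> set us\<close> inX(1,3)[of "last us"] by simp_all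
          ultimately show ?thesis using \<open>z = x\<close> i by simp
        qed
      next
        case False
        then have "rf' x = hd vs" "hd vs \<in> set vs" using new(1)[OF False] by simp_all
        then show ?thesis using \<open>z = x\<close> vs_cross[of "hd vs"] inX[of "hd vs"] unfolding interlaced_def by auto
      qed
    qed
  qed
  have I3': "st' y = parity \<kappa> p y" if a: "(p, y) \<in> adjacent (us @ vs)" "y \<notin> Op'" for p y
  proof (cases vs)
    case Nil
    have "(p, y) \<in> adjacent (us @ x # vs)" using a Nil unfolding adj_old by (cases us rule: rev_cases) (auto simp: adjacent_snoc)
    moreover have "y \<noteq> x" using a adjacent_in[OF a(1)] dist Nil by auto
    ultimately show ?thesis using I3 a new(2) Nil by simp
  next
    case (Cons y1 vs')
    have hdv: "hd vs = y1" using Cons by simp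
    have "adjacent (us @ vs) = adjacent (us @ [y1]) \<union> adjacent vs" unfolding Cons by (rule adjacent_append)
    then consider "(p, y) \<in> adjacent (us @ [y1])" | "(p, y) \<in> adjacent vs" using a by blast
    then show ?thesis
    proof cases
      case 2
      then have "(p, y) \<in> adjacent (x # vs)" using Cons by simp
      then have "(p, y) \<in> adjacent (us @ x # vs)" unfolding adj_old by blast
      moreover have "y \<in> set (tl vs)" using adjacent_tl[OF 2] .
      then have "y \<noteq> y1" "y \<notin> Op" "y \<noteq> x" using dist Cons noOp by auto
      ultimately show ?thesis using I3 new(1) Cons hdv by (auto split: if_splits)
    next
      case 1
      then consider "us \<noteq> []" "p = last us" "y = y1" | "(p, y) \<in> adjacent us"
        by (cases us rule: rev_cases) (auto simp: adjacent_snoc)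
      then show ?thesis
      proof cases
        case 2
        then have "(p, y) \<in> adjacent (us @ [x])" by (cases us rule: rev_cases) (auto simp: adjacent_snoc)
        then have "(p, y) \<in> adjacent (us @ x # vs)" unfolding adj_old by simp
        moreover have "y \<in> set us" using adjacent_in[OF 2] by simp
        then have "y \<noteq> y1" "y \<noteq> x" using dist Cons by auto
        ultimately show ?thesis using I3 new(1) Cons hdv a(2) by (auto split: if_splits)
      next
        case 1
        then have nx: "x \<notin> Op" using a(2) new(1) Cons hdv by (auto split: if_splits)
        then have s: "st' y = 1 - st x" using new(1) Cons hdv 1 by simp
        have "(p, x) \<in> adjacent (us @ [x])" using 1 by (cases us rule: rev_cases) (auto simp: adjacent_snoc)
        then have "st x = parity \<kappa> p x" using I3 nx unfolding adj_old by blast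
        then show ?thesis using s 1 ch_vs[of y1] Cons ch(2)[of x] ch(2)[of p] unfolding parity_def by (auto simp: le_Suc_eq)
      qed
    qed
  qed
  have I4': "separated col (Suc i)"
    if c1: "\<forall>z. col z \<le> 1" and R': "refs_ok col (Suc i) rf' pr'" and gap': "gaps_ok col (us @ vs) Op' st'" for col
  proof -
    have R: "\<And>x. x \<in> X \<Longrightarrow> la x < Suc i \<Longrightarrow> col x = (if col (rf' x) = pr' x then 0 else 1)"
      using R' unfolding refs_ok_def by blast
    have gap: "\<And>p y. (p, y) \<in> adjacent (us @ vs) \<Longrightarrow> y \<notin> Op' \<Longrightarrow> st' y = parity col p y"
      using gap' unfolding gaps_ok_def by blast
    have Rold: "refs_ok col i rf pr"
      unfolding refs_ok_def
    proof (intro ballI impI)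
      fix z assume z: "z \<in> X" "la z < i"
      then have "z \<noteq> x" using i by auto
      then have "rf' z = rf z" "pr' z = pr z" using new by (cases "vs = []"; auto split: if_splits)+
      then show "col z = (if col (rf z) = pr z then 0 else 1)" using R z laS[of z] by simp
    qed
    have Rx: "col x = (if col (rf' x) = pr' x then 0 else 1)" using R laS[of x] i by simp
    \<comment> \<open>Neighbours inside \<open>vs\<close> both cross \<open>x\<close>, so their
      recorded parity is 0 and \<open>vs\<close> is monochromatic; the reference of \<open>x\<close>
      ties it to the head of \<open>vs\<close> with parity 1.\<close>
    have xvs: "col z = 1 - col x" if zv: "z \<in> set vs" for z
    proof -
      obtain y1 vs' where vs: "vs = y1 # vs'" using zv by (cases vs) auto
      have "adjacent (us @ vs) = adjacent (us @ [y1]) \<union> adjacent vs" unfolding vs by (rule adjacent_append)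
      have "col p = col y" if py: "(p, y) \<in> adjacent vs" for p y
      proof -
        have yt: "y \<in> set (tl vs)" "p \<in> set vs" "y \<in> set vs" using adjacent_tl[OF py] adjacent_in[OF py] by auto
        then have ne: "y \<noteq> y1" "y \<notin> Op" "y \<noteq> x" using dist vs noOp by auto
        have "(p, y) \<in> adjacent (x # vs)" using py vs by simp
        then have "(p, y) \<in> adjacent (us @ x # vs)" unfolding adj_old by blast
        then have "st y = parity \<kappa> p y" using I3 ne by blast
        also have "\<dots> = 0" using ch_vs yt unfolding parity_def by simp
        finally have "st' y = 0" using new(1) vs ne by (auto split: if_splits)
        moreover have "y \<notin> Op'" using new(1) vs ne by (auto split: if_splits)
        moreover have "(p, y) \<in> adjacent (us @ vs)" using py \<open>adjacent (us @ vs) = _\<close> by blast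
        ultimately have "parity col p y = 0" using gap[of p y] by simp
        then show ?thesis unfolding parity_def by (auto split: if_splits)
      qed
      then have "col z = col y1" using adjacent_const[of vs col z] zv vs by simp
      moreover have "col x = (if col y1 = 1 then 0 else 1)" using Rx new(1) vs by simp
      ultimately show ?thesis using c1[rule_format, of y1] by (auto split: if_splits simp: le_Suc_eq)
    qed
    \<comment> \<open>The gap parities before the removal are recovered from the new records, so
      that the completeness part of the invariant applies to \<open>col\<close>.\<close>
    have gap_old: "st y = parity col p y" if py: "(p, y) \<in> adjacent (us @ x # vs)" "y \<notin> Op" for p y
    proof -
      consider "(p, y) \<in> adjacent us" | "us \<noteq> []" "p = last us" "y = x" | "vs \<noteq> []" "p = x" "y = hd vs" | "(p, y) \<in> adjacent vs"
        using py(1) unfolding adj_old by (cases us rule: rev_cases; cases vs) (auto simp: adjacent_snoc)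
      then show ?thesis
      proof cases
        case 1
        have "(p, y) \<in> adjacent (us @ vs)" using 1
          by (rule adjacent_prefix)
        moreover have "y \<in> set us" using adjacent_in[OF 1] by simp
        then have "y \<noteq> x" "y \<notin> set vs" using dist by auto
        moreover have "st' y = st y \<and> y \<notin> Op'"
          using new py(2) \<open>y \<noteq> x\<close> \<open>y \<notin> set vs\<close> by (cases "vs = []") (auto split: if_splits)
        ultimately show ?thesis using gap[of p y] by simp
      next
        case 2
        show ?thesis
        proof (cases vs)
          case Nil
          then have "rf' x = last us" "pr' x = st x" using new(2) 2 py(2) by auto
          moreover have "st x = parity \<kappa> p x" using I3[OF py(1)] py(2) 2 by simp
          then have "st x \<le> 1" unfolding parity_def by simp
          ultimately show ?thesis using Rx 2 c1[rule_format, of p] unfolding parity_def by (auto split: if_splits simp: le_Suc_eq)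
        next
          case (Cons y1 vs')
          have nx: "x \<notin> Op" using py 2 by simp
          then have s: "st' y1 = 1 - st x" "Op' = Op" using new(1) Cons by auto
          have "y1 \<notin> Op'" using s noOp Cons by simp
          moreover have "(p, y1) \<in> adjacent (us @ vs)"
            using 2 Cons adjacent_junction by simp
          ultimately have "1 - st x = parity col p y1" using gap[of p y1] s by simp
          moreover have "st x = parity \<kappa> p x" using I3[OF py(1)] py(2) 2 by simp
          then have "st x \<le> 1" unfolding parity_def by simp
          moreover have "col y1 = 1 - col x" using xvs Cons by simp
          ultimately show ?thesis using 2 c1[rule_format, of p] c1[rule_format, of x]
            unfolding parity_def by (auto split: if_splits simp: le_Suc_eq)
        qed
      next
        case 3
        then have "y \<in> set vs" by simp
        then have "st y = 1" using I3[OF py] ch_vs[of y] 3 ch(2)[of x] unfolding parity_def by (auto simp: le_Suc_eq)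
        then show ?thesis using xvs[OF \<open>y \<in> set vs\<close>] 3 c1[rule_format, of x] unfolding parity_def by (auto simp: le_Suc_eq)
      next
        case 4
        then have yv: "y \<in> set vs" "p \<in> set vs" using adjacent_in by fastforce+
        then have "st y = 0" using I3[OF py] ch_vs[of y] ch_vs[of p] unfolding parity_def by simp
        then show ?thesis using xvs yv unfolding parity_def by simp
      qed
    qed
    have "separated col i"
      using I4[OF c1 Rold] gap_old unfolding gaps_ok_def by blast
    moreover have "col x \<noteq> col b" if "b \<in> X" "interlaced fi la x b" for b
      using xvs[OF cross_vs[OF that]] c1[rule_format, of x] by (auto simp: le_Suc_eq)
    ultimately show ?thesis using laS unfolding separated_def by blast
  qed
  have "gaps_ok \<kappa> (us @ vs) Op' st'" "refs_later (Suc i) rf'" using I3' I5' unfolding gaps_ok_def refs_later_def by blast+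
  then show ?thesis unfolding col_inv_def act' using I4' by blast
qed

text \<open>At the end no chord is active, so the gap conditions are vacuous and the references
  alone force a proper colouring.\<close>

lemma col_inv_final:
  assumes inv: "col_inv \<kappa> T Op st rf pr" and c: "\<forall>z. col z \<le> (1::nat)"
    and R: "\<forall>x\<in>X. col x = (if col (rf x) = pr x then 0 else 1)" and xy: "x \<in> X" "y \<in> X" "interlaced fi la x y"
  shows "col x \<noteq> col y"
proof -
  have "set (active T) = {}" unfolding set_active[OF order_refl] using wordD(2) by (auto simp: not_le)
  then have aT: "active T = []" by simp
  have "refs_ok col T rf pr" "gaps_ok col (active T) Op st" using R aT unfolding refs_ok_def gaps_ok_def by auto
  then have "separated col T" using inv c unfolding col_inv_def by blast
  then show ?thesis using xy wordD(2)[OF xy(1)] unfolding separated_def by blast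
qed

end

section \<open>Bucket sort with linked buckets\<close>

text \<open>A bucket is a linked list filled at its head, hence the reversal.\<close>

definition bucket_sort :: "(nat \<Rightarrow> nat) \<Rightarrow> nat \<Rightarrow> nat list \<Rightarrow> nat list" where
  "bucket_sort key K xs = concat (map (\<lambda>c. rev (filter (\<lambda>x. key x = c) xs)) [0..<K])"

lemma bucket_sort_0 [simp]: "bucket_sort key 0 xs = []"
  unfolding bucket_sort_def by simp

lemma bucket_sort_Suc: "bucket_sort key (Suc K) xs = bucket_sort key K xs @ rev (filter (\<lambda>x. key x = K) xs)"
  unfolding bucket_sort_def by simp

lemma set_bucket_sort_lt: "set (bucket_sort key K xs) = {x \<in> set xs. key x < K}"
  unfolding bucket_sort_def by auto

lemma set_bucket_sort: "(\<And>x. x \<in> set xs \<Longrightarrow> key x < K) \<Longrightarrow> set (bucket_sort key K xs) = set xs"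
  unfolding set_bucket_sort_lt by auto

lemma distinct_bucket_sort: "distinct xs \<Longrightarrow> distinct (bucket_sort key K xs)"
  by (induction K) (auto simp: bucket_sort_Suc set_bucket_sort_lt)

lemma length_bucket_sort:
  assumes "distinct xs" "\<And>x. x \<in> set xs \<Longrightarrow> key x < K"
  shows "length (bucket_sort key K xs) = length xs"
proof -
  have "length (bucket_sort key K xs) = card (set (bucket_sort key K xs))"
    by (rule distinct_card[OF distinct_bucket_sort[OF assms(1)], symmetric])
  also have "\<dots> = card (set xs)" using set_bucket_sort[of xs key K] assms(2) by simp
  finally show ?thesis using distinct_card[OF assms(1)] by simp
qed

lemma length_bucket_sort_le: assumes "distinct xs" shows "length (bucket_sort key K xs) \<le> length xs"
proof -
  have "card (set (bucket_sort key K xs)) \<le> card (set xs)" by (intro card_mono) (auto simp: set_bucket_sort_lt)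
  then show ?thesis using distinct_card[OF assms] distinct_card[OF distinct_bucket_sort[OF assms], of key K] by simp
qed

text \<open>Each pass reverses ties. After two passes the items are ordered by increasing second key
  and, for equal second keys, by decreasing first key, which is the order that the chord ends
  require.\<close>

lemma sorted_bucket_sort:
  assumes "sorted_wrt R xs"
  shows "sorted_wrt (\<lambda>x y. key x < key y \<or> (key x = key y \<and> R y x)) (bucket_sort key K xs)"
proof (induction K)
  case (Suc K)
  have "sorted_wrt R (filter (\<lambda>x. key x = K) xs)" using assms by (rule sorted_wrt_filter)
  then have "sorted_wrt (\<lambda>x y. key x < key y \<or> (key x = key y \<and> R y x)) (rev (filter (\<lambda>x. key x = K) xs))"
    unfolding sorted_wrt_rev by (rule sorted_wrt_mono_rel[rotated]) auto
  then show ?case using Suc by (auto simp: bucket_sort_Suc sorted_wrt_append set_bucket_sort_lt)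
qed simp

definition stores :: "(nat \<Rightarrow> nat) \<Rightarrow> nat list \<Rightarrow> bool" where
  "stores f xs \<longleftrightarrow> (\<forall>t<length xs. f t = xs ! t)"

lemma stores_Nil [simp]: "stores f []"
  unfolding stores_def by simp

lemma stores_snoc: "stores f xs \<Longrightarrow> n = length xs \<Longrightarrow> stores (f(n := y)) (xs @ [y])"
  unfolding stores_def by (simp add: nth_append)

fun chain :: "(nat \<Rightarrow> nat) \<Rightarrow> nat \<Rightarrow> nat list \<Rightarrow> bool" where
  "chain nx p [] \<longleftrightarrow> p = 0"
| "chain nx p (x # xs) \<longleftrightarrow> p = x \<and> x \<noteq> 0 \<and> chain nx (nx x) xs"

lemma chain_upd [simp]: "y \<notin> set xs \<Longrightarrow> chain (nx(y := z)) p xs = chain nx p xs"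
  by (induction xs arbitrary: p) auto

definition fill_buckets :: "string \<Rightarrow> string \<Rightarrow> string \<Rightarrow> string \<Rightarrow> com" where
  "fill_buckets hdn nx src key = for_loop ''i'' (Var ''T'') (seqs
    [Assign ''x'' (Get src (Var ''i'')), Assign ''c'' (Get key (Var ''x'')),
     Put nx (Var ''x'') (Get hdn (Var ''c'')), Put hdn (Var ''c'') (Var ''x'')])"

definition empty_buckets :: "string \<Rightarrow> string \<Rightarrow> string \<Rightarrow> aexp \<Rightarrow> com" where
  "empty_buckets hdn nx dst K = Seq (Assign ''L'' (Const 0)) (for_loop ''i'' K
    (Seq (Assign ''x'' (Get hdn (Var ''i''))) (While (Less (Const 0) (Var ''x'')) (seqs
      [Put dst (Var ''L'') (Var ''x''), inc ''L'', Assign ''x'' (Get nx (Var ''x''))]))))"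

lemma wp_fill_buckets:
  assumes names: "distinct [hdn, nx, src, key]" and T: "r ''T'' = length xs" "length xs \<le> W"
    and src: "\<And>t. t < length xs \<Longrightarrow> h src t = xs ! t"
    and xs: "distinct xs" "\<And>x. x \<in> set xs \<Longrightarrow> 0 < x \<and> x \<le> W \<and> h key x \<le> W"
    and hd0: "\<And>c. h hdn c = 0"
    and Q: "\<And>r' h' a'. (\<forall>y. y \<notin> {''i'', ''x'', ''c''} \<longrightarrow> r' y = r y) \<Longrightarrow> (\<forall>y. y \<notin> {hdn, nx} \<longrightarrow> h' y = h y) \<Longrightarrow>
      (\<forall>c. chain (h' nx) (h' hdn c) (rev (filter (\<lambda>x. h key x = c) xs))) \<Longrightarrow>
      a' \<le> a + 6 * length xs + 2 \<Longrightarrow> Q (r', h') a'"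
  shows "wp W (fill_buckets hdn nx src key) Q (r, h) a"
  unfolding fill_buckets_def
proof (rule wp_for_loop[where n = "length xs" and J = "\<lambda>j s b. fst s ''i'' = j \<and> (\<forall>y. y \<notin> {''i'', ''x'', ''c''} \<longrightarrow> fst s y = r y) \<and>
    (\<forall>y. y \<notin> {hdn, nx} \<longrightarrow> snd s y = h y) \<and> j \<le> length xs \<and> (\<forall>c. snd s hdn c \<le> W) \<and>
    (\<forall>c. chain (snd s nx) (snd s hdn c) (rev (filter (\<lambda>x. h key x = c) (take j xs)))) \<and> b \<le> a + 1 + 6 * j"], goal_cases)
  case 1
  show ?case using hd0 by simp
next
  case (2 j r' h' b)
  then show ?case using T by auto
next
  case (3 j r' h' b)
  then have j: "j < length xs" by simp
  have n: "src \<noteq> hdn" "src \<noteq> nx" "key \<noteq> hdn" "key \<noteq> nx" "hdn \<noteq> nx" using names by auto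
  have ij: "r' ''i'' = j" and fr: "\<And>y. y \<notin> {''i'', ''x'', ''c''} \<Longrightarrow> r' y = r y" and fh: "\<And>y. y \<notin> {hdn, nx} \<Longrightarrow> h' y = h y"
    and hW: "\<And>c. h' hdn c \<le> W" and tm: "b \<le> a + 1 + 6 * j"
    and C: "\<And>c. chain (h' nx) (h' hdn c) (rev (filter (\<lambda>x. h key x = c) (take j xs)))"
    using 3(2) by simp_all
  have s: "h' src j = xs ! j" "h' key = h key" using fh n src j by simp_all
  have x: "0 < xs ! j" "xs ! j \<le> W" "h key (xs ! j) \<le> W" using xs(2)[of "xs ! j"] j by auto
  have fresh: "xs ! j \<notin> set (take j xs)" using xs(1) j by (auto simp: in_set_conv_nth nth_eq_iff_index_eq)
  have new: "chain ((h' nx)(xs ! j := h' hdn (h key (xs ! j)))) (((h' hdn)(h key (xs ! j) := xs ! j)) c)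
      (rev (filter (\<lambda>x. h key x = c) (take (Suc j) xs)))" for c
  proof (cases "c = h key (xs ! j)")
    case True
    then show ?thesis using C[of "h key (xs ! j)"] fresh x(1) by (simp add: take_Suc_conv_app_nth[OF j])
  next
    case False
    then show ?thesis using C[of c] fresh by (simp add: take_Suc_conv_app_nth[OF j])
  qed
  have new2: "chain (h' nx) (h' hdn c) (rev (filter (\<lambda>x. h key x = c) (take (Suc j) xs)))" if "c \<noteq> h key (xs ! j)" for c
    using C[of c] that by (simp add: take_Suc_conv_app_nth[OF j])
  have new1: "chain ((h' nx)(xs ! j := h' hdn (h key (xs ! j)))) (xs ! j) (rev (filter (\<lambda>x. h key x = h key (xs ! j)) (take (Suc j) xs)))"
    using new[of "h key (xs ! j)"] by simp
  show ?case
    using ij fr fh hW tm s x j n new1 new2 by (simp add: n[symmetric] n(5)[THEN not_sym])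
next
  case (4 r' h' b)
  then show ?case by (intro Q) auto
qed (use T in auto)

lemma wp_empty_buckets:
  assumes names: "dst \<notin> {hdn, nx}" and W: "length xs \<le> W" "kk \<le> W"
    and K: "\<And>r' h'. (\<forall>y. y \<notin> {''i'', ''x'', ''c'', ''L''} \<longrightarrow> r' y = r y) \<Longrightarrow> aval K (r', h') = kk"
    and xs: "distinct xs" "\<And>x. x \<in> set xs \<Longrightarrow> 0 < x \<and> x \<le> W"
    and ch: "\<And>c. chain (h nx) (h hdn c) (rev (filter (\<lambda>x. key x = c) xs))"
    and Q: "\<And>r' h' a'. (\<forall>y. y \<notin> {''i'', ''x'', ''L''} \<longrightarrow> r' y = r y) \<Longrightarrow> (\<forall>y. y \<noteq> dst \<longrightarrow> h' y = h y) \<Longrightarrow>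
      stores (h' dst) (bucket_sort key kk xs) \<Longrightarrow>
      a' \<le> a + 4 * length xs + 4 * kk + 3 \<Longrightarrow> Q (r', h') a'"
  shows "wp W (empty_buckets hdn nx dst K) Q (r, h) a"
proof -
  let ?b = "\<lambda>c. bucket_sort key c xs"
  have len: "length (?b c) \<le> length xs" for c by (rule length_bucket_sort_le[OF xs(1)])
  have inner: "wp W (Seq (Assign ''x'' (Get hdn (Var ''i''))) (While (Less (Const 0) (Var ''x'')) (seqs
      [Put dst (Var ''L'') (Var ''x''), inc ''L'', Assign ''x'' (Get nx (Var ''x''))])))
      (\<lambda>s' a'. fst s' ''i'' = j \<and> (\<forall>y. y \<notin> {''i'', ''x'', ''L''} \<longrightarrow> fst s' y = r y) \<and> (\<forall>y. y \<noteq> dst \<longrightarrow> snd s' y = h y) \<and>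
        fst s' ''L'' = length (?b (Suc j)) \<and> stores (snd s' dst) (?b (Suc j)) \<and>
        a' \<le> b + 2 + 4 * (length (?b (Suc j)) - length (?b j))) (r', h') b"
    if pre: "r' ''i'' = j" "\<forall>y. y \<notin> {''i'', ''x'', ''L''} \<longrightarrow> r' y = r y" "\<forall>y. y \<noteq> dst \<longrightarrow> h' y = h y"
        "r' ''L'' = length (?b j)" "stores (h' dst) (?b j)" for r' h' b j
    unfolding wp_Seq wp_Assign
  proof (intro conjI, goal_cases)
    case 1
    have "h hdn j \<le> W"
    proof (cases "rev (filter (\<lambda>x. key x = j) xs)")
      case Nil then show ?thesis using ch[of j] by simp
    next
      case (Cons x ys)
      then have "x \<in> set (rev (filter (\<lambda>x. key x = j) xs))" by simp
      then have "x \<in> set xs" by simp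
      then show ?thesis using ch[of j] Cons xs(2) by simp
    qed
    moreover have "h' hdn = h hdn" using pre(3) names by auto
    ultimately show ?case using pre(1) by simp
  next
    case 2
    show ?case
    \<comment> \<open>In the invariant \<open>zs\<close> is the part of the current bucket already
      written and \<open>ys\<close> the rest of its chain.\<close>
    proof (rule wp_While[where V = "\<lambda>s. length xs - fst s ''L''" and
        I = "\<lambda>s c. \<exists>zs ys. ?b (Suc j) = ?b j @ zs @ ys \<and> chain (h nx) (fst s ''x'') ys \<and> fst s ''i'' = j \<and>
          (\<forall>y. y \<notin> {''i'', ''x'', ''L''} \<longrightarrow> fst s y = r y) \<and> (\<forall>y. y \<noteq> dst \<longrightarrow> snd s y = h y) \<and>
          fst s ''L'' = length (?b j @ zs) \<and> stores (snd s dst) (?b j @ zs) \<and>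
          c \<le> b + 1 + 4 * length zs"], goal_cases)
      case 1
      have "h' hdn = h hdn" using pre(3) names by auto
      then show ?case using pre ch[of j]
        by (intro exI[of _ "[]"] exI[of _ "rev (filter (\<lambda>x. key x = j) xs)"]) (simp add: bucket_sort_Suc)
    next
      case (2 s c)
      then obtain zs ys where I: "?b (Suc j) = ?b j @ zs @ ys" "chain (h nx) (fst s ''x'') ys" "fst s ''i'' = j"
          "\<forall>y. y \<notin> {''i'', ''x'', ''L''} \<longrightarrow> fst s y = r y" "\<forall>y. y \<noteq> dst \<longrightarrow> snd s y = h y"
          "fst s ''L'' = length (?b j @ zs)" "stores (snd s dst) (?b j @ zs)" "c \<le> b + 1 + 4 * length zs"
        by auto
      obtain y ys' where ys: "ys = y # ys'" using 2(2) I(2) by (cases ys) auto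
      have y: "fst s ''x'' = y" "y \<noteq> 0" "chain (h nx) (h nx y) ys'" using I(2) ys by auto
      have "y \<in> set (?b (Suc j))" unfolding I(1) ys by simp
      then have yW: "y \<le> W" using xs(2)[of y] by (simp add: set_bucket_sort_lt)
      have nxW: "h nx y \<le> W"
      proof (cases ys')
        case (Cons z zs')
        then have "z \<in> set (?b (Suc j))" unfolding I(1) ys by simp
        then show ?thesis using xs(2)[of z] y(3) Cons by (simp add: set_bucket_sort_lt)
      qed (use y in simp)
      have lt: "length (?b j @ zs) < length xs" using len[of "Suc j"] unfolding I(1) ys by simp
      have nn: "nx \<noteq> dst" "dst \<noteq> nx" "hdn \<noteq> dst" using names by auto
      have e: "snd s nx = h nx" using I(5) nn by auto
      have "?b (Suc j) = ?b j @ (zs @ [y]) @ ys'" using I(1) ys by simp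
      then show ?case
        using I(3-6,8) y yW nxW lt W(1) e nn stores_snoc[OF I(7), of "length (?b j) + length zs" y]
        apply (simp del: append_assoc)
        apply (intro conjI)
         apply (rule exI[of _ "zs @ [y]"])
         apply (rule exI[of _ ys'])
         apply simp
        apply simp
        done
    next
      case (3 s c)
      then obtain zs ys where I: "?b (Suc j) = ?b j @ zs @ ys" "chain (h nx) (fst s ''x'') ys" "fst s ''i'' = j"
          "\<forall>y. y \<notin> {''i'', ''x'', ''L''} \<longrightarrow> fst s y = r y" "\<forall>y. y \<noteq> dst \<longrightarrow> snd s y = h y"
          "fst s ''L'' = length (?b j @ zs)" "stores (snd s dst) (?b j @ zs)" "c \<le> b + 1 + 4 * length zs"
        by auto
      have "ys = []" using I(2) 3(2) by (cases ys) auto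
      then show ?case using I by auto
    qed
  qed
  show ?thesis unfolding empty_buckets_def wp_Seq wp_Assign
  proof (intro conjI, goal_cases)
    case 2
    show ?case unfolding fst_conv snd_conv
    proof (rule wp_for_loop[where n = kk and J = "\<lambda>j s b. fst s ''i'' = j \<and> (\<forall>y. y \<notin> {''i'', ''x'', ''L''} \<longrightarrow> fst s y = r y) \<and>
        (\<forall>y. y \<noteq> dst \<longrightarrow> snd s y = h y) \<and> fst s ''L'' = length (?b j) \<and> stores (snd s dst) (?b j) \<and>
        b \<le> a + 2 + 4 * j + 4 * length (?b j)"], goal_cases)
      case (2 j r' h' b)
      then show ?case using K by auto
    next
      case (3 j r' h' b)
      have l: "length (?b j) \<le> length (?b (Suc j))" by (simp add: bucket_sort_Suc)
      have pre: "r' ''i'' = j" "\<forall>y. y \<notin> {''i'', ''x'', ''L''} \<longrightarrow> r' y = r y" "\<forall>y. y \<noteq> dst \<longrightarrow> h' y = h y"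
        "r' ''L'' = length (?b j)" "stores (h' dst) (?b j)" and tm: "b \<le> a + 2 + 4 * j + 4 * length (?b j)"
        using 3(2) by simp_all
      show ?case
      proof (rule wp_mono[OF inner[OF pre, of "b + 1"]], goal_cases)
        case (1 s c)
        then show ?case using tm l by (simp, linarith)
      qed
    next
      case (4 r' h' b)
      show ?case
      proof (rule Q)
        show "b + 1 \<le> a + 4 * length xs + 4 * kk + 3" using 4 len[of kk] by simp
      qed (use 4 in simp_all)
    next
      case 1
      show ?case by simp
    next
      case 5
      show ?case using W by simp
    qed
  qed simp
qed

lemma wp_sort_pass:
  assumes names: "distinct [hdn, nx, src, key, dst]" and T: "r ''T'' = length xs" "length xs \<le> W" "kk \<le> W"
    and src: "\<And>t. t < length xs \<Longrightarrow> h src t = xs ! t"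
    and xs: "distinct xs" "\<And>x. x \<in> set xs \<Longrightarrow> 0 < x \<and> x \<le> W \<and> h key x < kk"
    and hd0: "\<And>c. h hdn c = 0"
    and K: "\<And>r' h'. (\<forall>y. y \<notin> {''i'', ''x'', ''c'', ''L''} \<longrightarrow> r' y = r y) \<Longrightarrow> aval K (r', h') = kk"
    and Q: "\<And>r' h' a'. (\<forall>y. y \<notin> {''i'', ''x'', ''c'', ''L''} \<longrightarrow> r' y = r y) \<Longrightarrow> (\<forall>y. y \<notin> {hdn, nx, dst} \<longrightarrow> h' y = h y) \<Longrightarrow>
      stores (h' dst) (bucket_sort (h key) kk xs) \<Longrightarrow>
      a' \<le> a + 10 * length xs + 4 * kk + 5 \<Longrightarrow> Q (r', h') a'"
  shows "wp W (Seq (fill_buckets hdn nx src key) (empty_buckets hdn nx dst K)) Q (r, h) a"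
  unfolding wp_Seq
proof (rule wp_fill_buckets[where xs = xs], goal_cases)
  case (6 x)
  then show ?case using xs(2)[of x] T(3) by simp
next
  case (8 r1 h1 a1)
  note o = 8
  have len: "length (bucket_sort (h key) kk xs) = length xs" using xs by (intro length_bucket_sort) auto
  show ?case
  proof (rule wp_empty_buckets[where xs = xs and kk = kk and key = "h key"], goal_cases)
    case (4 r' h')
    show ?case by (rule K) (use 4 o(1) in simp)
  next
    case (7 c)
    show ?case using o(3) by simp
  next
    case (8 r2 h2 a2)
    show ?case
    proof (rule Q)
      show "\<forall>y. y \<notin> {''i'', ''x'', ''c'', ''L''} \<longrightarrow> r2 y = r y" using 8(1) o(1) by simp
      show "\<forall>y. y \<notin> {hdn, nx, dst} \<longrightarrow> h2 y = h y" using 8(2) o(2) by simp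
      show "stores (h2 dst) (bucket_sort (h key) kk xs)" using 8(3) by simp
      show "a2 \<le> a + 10 * length xs + 4 * kk + 5" using 8(4) o(4) by simp
    qed
  next
    case 1
    show ?case using names by auto
  next
    case 2 show ?case using T by simp
  next
    case 3 show ?case using T by simp
  next
    case 5 show ?case using xs by simp
  next
    case (6 x) then show ?case using xs(2)[of x] by simp
  qed
next
  case 1
  show ?case using names by auto
next
  case 2 show ?case using T by simp
next
  case 3 show ?case using T by simp
next
  case (4 t) then show ?case using src by simp
next
  case 5 show ?case using xs by simp
next
  case (7 c) show ?case using hd0 by simp
qed

section \<open>Reading the chords\<close>

text \<open>The second conjunct excludes the edge between the last and the first position of the
  Hamilton cycle, the first one all its other edges.\<close>

definition chord_pair :: "nat \<Rightarrow> nat \<times> nat \<Rightarrow> bool" where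
  "chord_pair n ab \<longleftrightarrow> fst ab + 1 < snd ab \<and> snd ab + 1 < fst ab + n"

definition ordered_ends :: "(nat \<Rightarrow> nat) \<Rightarrow> nat \<times> nat \<Rightarrow> nat \<times> nat" where
  "ordered_ends P uv = (min (P (fst uv)) (P (snd uv)), max (P (fst uv)) (P (snd uv)))"

definition chord_list :: "nat \<Rightarrow> (nat \<Rightarrow> nat) \<Rightarrow> (nat \<times> nat) list \<Rightarrow> (nat \<times> nat) list" where
  "chord_list n P es = filter (chord_pair n) (map (ordered_ends P) es)"

text \<open>Chord number \<open>x + 1\<close> has two ends, represented by the items \<open>2x + 1\<close> (closing end) and
  \<open>2x + 2\<close> (opening end).\<close>

definition item_arrays where
  "item_arrays ca cb it k1 k2 ce vx D \<longleftrightarrow> stores it [1..<2 * length D + 1] \<and>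
    (\<forall>x<length D. ca (Suc x) = fst (D ! x) \<and> cb (Suc x) = snd (D ! x) \<and>
      k1 (Suc (2 * x)) = fst (D ! x) \<and> k2 (Suc (2 * x)) = snd (D ! x) + snd (D ! x) \<and>
      ce (Suc (2 * x)) = Suc x \<and> vx (Suc (2 * x)) = snd (D ! x) \<and>
      k1 (Suc (Suc (2 * x))) = snd (D ! x) \<and> k2 (Suc (Suc (2 * x))) = Suc (fst (D ! x) + fst (D ! x)) \<and>
      ce (Suc (Suc (2 * x))) = Suc x \<and> vx (Suc (Suc (2 * x))) = fst (D ! x))"

lemma item_arrays_snoc:
  assumes I: "item_arrays ca cb it k1 k2 ce vx D"
  defines "q \<equiv> length D"
  shows "item_arrays (ca(Suc q := a)) (cb(Suc q := b)) (it(2 * q := Suc (2 * q), Suc (2 * q) := Suc (Suc (2 * q))))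
    (k1(Suc (2 * q) := a, Suc (Suc (2 * q)) := b)) (k2(Suc (2 * q) := b + b, Suc (Suc (2 * q)) := Suc (a + a)))
    (ce(Suc (2 * q) := Suc q, Suc (Suc (2 * q)) := Suc q)) (vx(Suc (2 * q) := b, Suc (Suc (2 * q)) := a)) (D @ [(a, b)])"
proof -
  have st: "stores it [1..<2 * q + 1]" using I unfolding item_arrays_def q_def by simp
  have "stores ((it(2 * q := Suc (2 * q)))(Suc (2 * q) := Suc (Suc (2 * q)))) (([1..<2 * q + 1] @ [Suc (2 * q)]) @ [Suc (Suc (2 * q))])"
    by (intro stores_snoc st) simp_all
  moreover have "[1..<2 * length (D @ [(a, b)]) + 1] = ([1..<2 * q + 1] @ [Suc (2 * q)]) @ [Suc (Suc (2 * q))]"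
    unfolding q_def by simp
  ultimately have "stores ((it(2 * q := Suc (2 * q)))(Suc (2 * q) := Suc (Suc (2 * q)))) [1..<2 * length (D @ [(a, b)]) + 1]" by simp
  moreover have "x < q \<or> x = q" if "x < length (D @ [(a, b)])" for x using that unfolding q_def by auto
  ultimately show ?thesis using I unfolding item_arrays_def q_def[symmetric]
    by (auto simp: nth_append q_def[symmetric])
qed

definition add_chord :: com where
  "add_chord = seqs [inc ''q'', Put ''ca'' (Var ''q'') (Var ''a''), Put ''cb'' (Var ''q'') (Var ''b''),
    Put ''it'' (Var ''T'') (Plus (Var ''T'') (Const 1)), inc ''T'',
    Put ''k1'' (Var ''T'') (Var ''a''), Put ''k2'' (Var ''T'') (Plus (Var ''b'') (Var ''b'')),
    Put ''ce'' (Var ''T'') (Var ''q''), Put ''vx'' (Var ''T'') (Var ''b''),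
    Put ''it'' (Var ''T'') (Plus (Var ''T'') (Const 1)), inc ''T'',
    Put ''k1'' (Var ''T'') (Var ''b''), Put ''k2'' (Var ''T'') (Plus (Plus (Var ''a'') (Var ''a'')) (Const 1)),
    Put ''ce'' (Var ''T'') (Var ''q''), Put ''vx'' (Var ''T'') (Var ''a'')]"

definition order_ends :: com where
  "order_ends = seqs [Assign ''u'' (Get ''pos'' (Get ''src'' (Var ''i''))), Assign ''v'' (Get ''pos'' (Get ''dst'' (Var ''i''))),
    If (Less (Var ''u'') (Var ''v'')) (seqs [Assign ''a'' (Var ''u''), Assign ''b'' (Var ''v'')])
      (seqs [Assign ''a'' (Var ''v''), Assign ''b'' (Var ''u'')])]"

definition load_chords :: com where
  "load_chords = for_loop ''i'' (Var ''m'') (Seq order_ends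
    (If (And (Less (Plus (Var ''a'') (Const 1)) (Var ''b'')) (Less (Plus (Var ''b'') (Const 1)) (Plus (Var ''a'') (Var ''n''))))
      add_chord Skip))"

definition chord_regs where "chord_regs = {''i'', ''u'', ''v'', ''a'', ''b'', ''q'', ''T''}"
definition chord_arrs where "chord_arrs = {''ca'', ''cb'', ''it'', ''k1'', ''k2'', ''ce'', ''vx''}"

definition load_inv where
  "load_inv r0 h0 a0 n es j r h (t::nat) \<longleftrightarrow> r ''i'' = j \<and> (\<forall>x. x \<notin> chord_regs \<longrightarrow> r x = r0 x) \<and> (\<forall>x. x \<notin> chord_arrs \<longrightarrow> h x = h0 x) \<and>
    r ''q'' = length (chord_list n (h0 ''pos'') (take j es)) \<and> r ''T'' = 2 * length (chord_list n (h0 ''pos'') (take j es)) \<and>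
    item_arrays (h ''ca'') (h ''cb'') (h ''it'') (h ''k1'') (h ''k2'') (h ''ce'') (h ''vx'') (chord_list n (h0 ''pos'') (take j es)) \<and>
    t \<le> a0 + 1 + 30 * j"

lemma chord_list_Suc:
  "j < length es \<Longrightarrow> chord_list n P (take (Suc j) es) = chord_list n P (take j es) @
    (if chord_pair n (ordered_ends P (es ! j)) then [ordered_ends P (es ! j)] else [])"
  unfolding chord_list_def by (simp add: take_Suc_conv_app_nth)

lemma length_chord_list_le: "length (chord_list n P es) \<le> length es"
  unfolding chord_list_def by (metis length_filter_le length_map)

lemma wp_order_ends:
  assumes "h ''pos'' (h ''src'' (r ''i'')) \<le> W" "h ''pos'' (h ''dst'' (r ''i'')) \<le> W"
    and uv: "ordered_ends (h ''pos'') (h ''src'' (r ''i''), h ''dst'' (r ''i'')) = (a, b)"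
    and Q: "\<And>u v. Q (r(''u'' := u, ''v'' := v, ''a'' := a, ''b'' := b), h) (t + 5)"
  shows "wp W order_ends Q (r, h) t"
  using assms(1,2) uv[symmetric] Q unfolding order_ends_def ordered_ends_def
  by (cases "h ''pos'' (h ''src'' (r ''i'')) < h ''pos'' (h ''dst'' (r ''i''))")
    (simp_all add: min_def max_def numeral_eq_Suc split: if_splits)

lemma wp_add_chord:
  assumes W: "r ''q'' + 1 \<le> W" "r ''T'' + 2 \<le> W" "r ''a'' \<le> W" "r ''b'' \<le> W" "r ''b'' + r ''b'' \<le> W" "r ''a'' + r ''a'' + 1 \<le> W"
    and q: "r ''q'' = length D" "r ''T'' = 2 * length D"
    and I: "item_arrays (h ''ca'') (h ''cb'') (h ''it'') (h ''k1'') (h ''k2'') (h ''ce'') (h ''vx'') D"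
    and Q: "\<And>r' h' t'. (\<forall>x. x \<notin> {''q'', ''T''} \<longrightarrow> r' x = r x) \<Longrightarrow> (\<forall>x. x \<notin> chord_arrs \<longrightarrow> h' x = h x) \<Longrightarrow>
      r' ''q'' = Suc (length D) \<Longrightarrow> r' ''T'' = 2 * Suc (length D) \<Longrightarrow>
      item_arrays (h' ''ca'') (h' ''cb'') (h' ''it'') (h' ''k1'') (h' ''k2'') (h' ''ce'') (h' ''vx'') (D @ [(r ''a'', r ''b'')]) \<Longrightarrow>
      t' \<le> t + 15 \<Longrightarrow> Q (r', h') t'"
  shows "wp W add_chord Q (r, h) t"
proof -
  have W': "Suc (length D) \<le> W" "Suc (2 * length D) \<le> W" "Suc (Suc (2 * length D)) \<le> W" "Suc (r ''a'' + r ''a'') \<le> W"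
    using W q by simp_all
  show ?thesis
    unfolding add_chord_def
    apply (simp add: q W(3-5) W')
    apply (rule Q)
    subgoal by simp
    subgoal by (simp add: chord_arrs_def)
    subgoal by simp
    subgoal by simp
    subgoal using item_arrays_snoc[OF I, of "r ''a''" "r ''b''"] by simp
    subgoal by simp
    done
qed

lemma wp_load_chords:
  assumes m: "r ''m'' = length es" and n: "r ''n'' = n" and q0: "r ''q'' = 0" "r ''T'' = 0"
    and src: "\<And>j. j < length es \<Longrightarrow> h ''src'' j = fst (es ! j)" "\<And>j. j < length es \<Longrightarrow> h ''dst'' j = snd (es ! j)"
    and pos: "\<And>j. j < length es \<Longrightarrow> h ''pos'' (fst (es ! j)) < n" "\<And>j. j < length es \<Longrightarrow> h ''pos'' (snd (es ! j)) < n"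
    and W: "2 * n + 2 * length es + 2 \<le> W"
    and Q: "\<And>r' h' a'. (\<forall>x. x \<notin> chord_regs \<longrightarrow> r' x = r x) \<Longrightarrow> (\<forall>x. x \<notin> chord_arrs \<longrightarrow> h' x = h x) \<Longrightarrow>
      r' ''q'' = length (chord_list n (h ''pos'') es) \<Longrightarrow> r' ''T'' = 2 * length (chord_list n (h ''pos'') es) \<Longrightarrow>
      item_arrays (h' ''ca'') (h' ''cb'') (h' ''it'') (h' ''k1'') (h' ''k2'') (h' ''ce'') (h' ''vx'') (chord_list n (h ''pos'') es) \<Longrightarrow>
      a' \<le> a + 30 * length es + 2 \<Longrightarrow> Q (r', h') a'"
  shows "wp W load_chords Q (r, h) a"
  unfolding load_chords_def
proof (rule wp_for_loop[where n = "length es" and J = "\<lambda>j s t. load_inv r h a n es j (fst s) (snd s) t"], goal_cases)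
  case 1
  show ?case using q0 by (simp add: load_inv_def chord_list_def item_arrays_def chord_regs_def)
next
  case (2 j r' h' t)
  then show ?case using m by (simp add: load_inv_def chord_regs_def)
next
  case (3 j r' h' t)
  note j = 3(1)
  let ?D = "chord_list n (h ''pos'') (take j es)"
  have I: "r' ''i'' = j" "\<And>x. x \<notin> chord_regs \<Longrightarrow> r' x = r x" "\<And>x. x \<notin> chord_arrs \<Longrightarrow> h' x = h x"
    "r' ''q'' = length ?D" "r' ''T'' = 2 * length ?D"
    "item_arrays (h' ''ca'') (h' ''cb'') (h' ''it'') (h' ''k1'') (h' ''k2'') (h' ''ce'') (h' ''vx'') ?D"
    "t \<le> a + 1 + 30 * j"
    using 3(2) unfolding load_inv_def by auto
  have arr: "h' ''pos'' = h ''pos''" "h' ''src'' j = fst (es ! j)" "h' ''dst'' j = snd (es ! j)"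
    using I(3) src[OF j] by (simp_all add: chord_arrs_def)
  have nn: "r' ''n'' = n" using I(2) n by (simp add: chord_regs_def)
  obtain A B where AB: "ordered_ends (h ''pos'') (es ! j) = (A, B)" by fastforce
  have bnd: "A < n" "B < n" using AB pos[OF j] unfolding ordered_ends_def by auto
  have lenD: "length ?D \<le> j" using length_chord_list_le[of n "h ''pos''" "take j es"] j by simp
  have ds: "chord_list n (h ''pos'') (take (Suc j) es) = ?D @ (if chord_pair n (A, B) then [(A, B)] else [])"
    using chord_list_Suc[OF j] AB by simp
  show ?case unfolding wp_Seq
  proof (rule wp_order_ends[of _ _ _ A B], goal_cases)
    case 1 then show ?case using I(1) arr pos(1)[OF j] W by simp
  next
    case 2 then show ?case using I(1) arr pos(2)[OF j] W by simp
  next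
    case 3 then show ?case using I(1) arr AB by simp
  next
    case (4 u v)
    let ?r = "r'(''u'' := u, ''v'' := v, ''a'' := A, ''b'' := B)"
    show ?case
    proof (cases "chord_pair n (A, B)")
      case True
      have b: "bval (And (Less (Plus (Var ''a'') (Const 1)) (Var ''b'')) (Less (Plus (Var ''b'') (Const 1)) (Plus (Var ''a'') (Var ''n'')))) (?r, h')"
        using True nn unfolding chord_pair_def by simp
      show ?thesis unfolding wp_If if_P[OF b]
      proof (rule wp_add_chord[where D = ?D], goal_cases)
        case (10 r2 h2 t2)
        have "load_inv r h a n es (Suc j) (r2(''i'' := Suc j)) h2 (t2 + 1)"
          unfolding load_inv_def ds if_P[OF True]
          using 10 I(2,3,7) by (simp add: chord_regs_def)
        then show ?case using 10(1) I(1) by simp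
      qed (use I W bnd lenD j in simp_all)
    next
      case False
      have b: "\<not> bval (And (Less (Plus (Var ''a'') (Const 1)) (Var ''b'')) (Less (Plus (Var ''b'') (Const 1)) (Plus (Var ''a'') (Var ''n'')))) (?r, h')"
        using False nn unfolding chord_pair_def by simp
      have "load_inv r h a n es (Suc j) (?r(''i'' := Suc j)) h' (t + 1 + 5 + 1 + 1 + 1)"
        unfolding load_inv_def ds if_not_P[OF False]
        using I(2-7) by (simp add: chord_regs_def)
      then show ?thesis unfolding wp_If if_not_P[OF b] using I(1) by simp
    qed
  qed
next
  case (4 r' h' t)
  then show ?case unfolding load_inv_def by (intro Q) auto
next
  case 5
  show ?case using W by simp
qed

section \<open>The scan program for the colouring\<close>

text \<open>A circular doubly linked list with 0 as its sentinel at both ends.\<close>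

definition linked :: "(nat \<Rightarrow> nat) \<Rightarrow> (nat \<Rightarrow> nat) \<Rightarrow> nat list \<Rightarrow> bool" where
  "linked nxt prv xs \<longleftrightarrow> (\<forall>p y. (p, y) \<in> adjacent (0 # xs @ [0]) \<longrightarrow> nxt p = y \<and> prv y = p)"

lemma linked_snoc:
  assumes "linked nxt prv xs" "distinct (0 # xs @ [x])"
  shows "linked (nxt(prv 0 := x, x := 0)) (prv(x := prv 0, 0 := x)) (xs @ [x])"
proof -
  have l: "(last (0 # xs), 0) \<in> adjacent (0 # xs @ [0])" using adjacent_junction[of "0 # xs" 0 "[]"] by simp
  then have p0: "prv 0 = last (0 # xs)" using assms(1) unfolding linked_def by blast
  have adj: "adjacent (0 # (xs @ [x]) @ [0]) = insert (x, 0) (insert (last (0 # xs), x) (adjacent (0 # xs)))"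
  proof -
    have "adjacent ((0 # xs) @ [x, 0]) = insert (x, 0) (adjacent ((0 # xs) @ [x]))" by (rule adjacent_snoc)
    moreover have "adjacent ((0 # xs) @ [x]) = insert (last (0 # xs), x) (adjacent (0 # xs))"
    proof (cases xs rule: rev_cases)
      case (snoc ys z)
      then show ?thesis using adjacent_snoc[of "0 # ys" z x] by simp
    qed simp
    ultimately show ?thesis by simp
  qed
  have old: "nxt p = y \<and> prv y = p \<and> p \<noteq> x \<and> y \<noteq> x \<and> p \<noteq> last (0 # xs) \<and> y \<noteq> 0" if py: "(p, y) \<in> adjacent (0 # xs)" for p y
  proof -
    have "(p, y) \<in> adjacent (0 # xs @ [0])" using adjacent_prefix[OF py, of "[0]"] by simp
    then have np: "nxt p = y" "prv y = p" using assms(1) unfolding linked_def by blast+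
    have "y \<in> set xs" using adjacent_tl[OF py] by simp
    moreover have "p \<in> set (butlast (0 # xs))" using adjacent_butlast[OF py] .
    moreover have "distinct (butlast (0 # xs) @ [last (0 # xs)])" using assms(2) by (metis append_butlast_last_id distinct_append list.distinct(1) append_Cons)
    then have "last (0 # xs) \<notin> set (butlast (0 # xs))" by simp
    moreover have "set (butlast (0 # xs)) \<subseteq> set (0 # xs)" by (meson in_set_butlastD subsetI)
    moreover have "0 \<notin> set xs" "x \<notin> set xs" "x \<noteq> 0" using assms(2) by auto
    ultimately have "p \<noteq> last (0 # xs)" "y \<noteq> 0" "y \<noteq> x" "p \<noteq> x" by (metis, metis, metis, (metis set_ConsD subsetD))
    then show ?thesis using np by simp
  qed
  have "last (0 # xs) \<in> set (0 # xs)" by (rule last_in_set) simp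
  then have lx: "last (0 # xs) \<noteq> x" "x \<noteq> 0" using assms(2) by auto
  show ?thesis unfolding linked_def adj p0
  proof (intro allI impI)
    fix p y assume "(p, y) \<in> insert (x, 0) (insert (last (0 # xs), x) (adjacent (0 # xs)))"
    then consider "p = x" "y = 0" | "p = last (0 # xs)" "y = x" | "(p, y) \<in> adjacent (0 # xs)" by blast
    then show "(nxt(last (0 # xs) := x, x := 0)) p = y \<and> (prv(x := last (0 # xs), 0 := x)) y = p"
    proof cases
      case 1 then show ?thesis using lx by simp
    next
      case 2 then show ?thesis using lx by simp
    next
      case 3 then show ?thesis using old[OF 3] by simp
    qed
  qed
qed

lemma linked_neighbours:
  assumes "linked nxt prv (us @ x # vs)"
  shows "nxt x = hd (vs @ [0])" "prv x = last (0 # us)"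
proof -
  have e: "0 # (us @ x # vs) @ [0] = (0 # us) @ x # (vs @ [0])" by simp
  have "(last (0 # us), x) \<in> adjacent (0 # (us @ x # vs) @ [0])" unfolding e by (rule adjacent_junction) simp
  moreover have "(x, hd (vs @ [0])) \<in> adjacent ((0 # us) @ x # (vs @ [0]))"
    by (subst adjacent_append) (cases vs; simp)
  ultimately show "nxt x = hd (vs @ [0])" "prv x = last (0 # us)" using assms unfolding linked_def e by blast+
qed

lemma linked_remove:
  assumes L: "linked nxt prv (us @ x # vs)" and d: "distinct (0 # us @ x # vs)"
  shows "linked (nxt(last (0 # us) := hd (vs @ [0]))) (prv(hd (vs @ [0]) := last (0 # us))) (us @ vs)"
proof -
  obtain y1 vs' where y1: "vs @ [0] = y1 # vs'" by (cases vs) auto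
  have e: "0 # (us @ x # vs) @ [0] = (0 # us) @ x # y1 # vs'" using y1 by simp
  have e': "0 # (us @ vs) @ [0] = (0 # us) @ y1 # vs'" using y1 by simp
  have a1: "adjacent (0 # (us @ vs) @ [0]) = insert (last (0 # us), y1) (adjacent (0 # us) \<union> adjacent (y1 # vs'))"
  proof -
    have "adjacent ((0 # us) @ [y1]) = insert (last (0 # us), y1) (adjacent (0 # us))"
    proof (cases us rule: rev_cases)
      case (snoc ys z)
      then show ?thesis using adjacent_snoc[of "0 # ys" z y1] by simp
    qed simp
    then show ?thesis unfolding e' adjacent_append[of "0 # us" y1 vs'] by simp
  qed
  have sub: "adjacent (0 # us) \<subseteq> adjacent (0 # (us @ x # vs) @ [0])" "adjacent (y1 # vs') \<subseteq> adjacent (0 # (us @ x # vs) @ [0])"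
  proof -
    show "adjacent (0 # us) \<subseteq> adjacent (0 # (us @ x # vs) @ [0])" unfolding e using adjacent_prefix by fastforce
    have "adjacent (y1 # vs') \<subseteq> adjacent (x # y1 # vs')" by auto
    then show "adjacent (y1 # vs') \<subseteq> adjacent (0 # (us @ x # vs) @ [0])"
      unfolding e using adjacent_append[of "0 # us" x "y1 # vs'"] by blast
  qed
  have dlast: "last (0 # us) \<notin> set (butlast (0 # us))"
  proof -
    have "distinct (butlast (0 # us) @ [last (0 # us)])" using d by (metis append_butlast_last_id distinct_append list.distinct(1) append_Cons)
    then show ?thesis by simp
  qed
  have lus: "last (0 # us) \<in> set (0 # us)" by (rule last_in_set) simp
  have tlvs: "set (y1 # vs') = insert 0 (set vs)" using arg_cong[OF y1, of set] by simp
  have bl: "set (butlast (y1 # vs')) = set vs" using arg_cong[OF y1, of butlast] by simp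
  have dy: "distinct (y1 # vs')" unfolding y1[symmetric] using d by simp
  show ?thesis unfolding linked_def a1
  proof (intro allI impI)
    fix p y assume "(p, y) \<in> insert (last (0 # us), y1) (adjacent (0 # us) \<union> adjacent (y1 # vs'))"
    then consider "p = last (0 # us)" "y = y1" | "(p, y) \<in> adjacent (0 # us)" | "(p, y) \<in> adjacent (y1 # vs')" by blast
    then show "(nxt(last (0 # us) := hd (vs @ [0]))) p = y \<and> (prv(hd (vs @ [0]) := last (0 # us))) y = p"
    proof cases
      case 1 then show ?thesis using y1 by simp
    next
      case 2
      have pn: "p \<noteq> last (0 # us)" using adjacent_butlast[OF 2] dlast by metis
      have "y \<in> set us" using adjacent_tl[OF 2] by simp
      moreover have "y1 \<in> insert 0 (set vs)" using tlvs by auto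
      ultimately have "y \<noteq> y1" using d by auto
      moreover have "nxt p = y \<and> prv y = p" using 2 sub L unfolding linked_def by blast
      ultimately show ?thesis using y1 pn by (simp del: last.simps)
    next
      case 3
      have "p \<in> set vs" using adjacent_butlast[OF 3] bl by simp
      then have "p \<noteq> last (0 # us)" using lus d by auto
      moreover have "y \<noteq> y1" using adjacent_tl[OF 3] dy by auto
      moreover have "nxt p = y \<and> prv y = p" using 3 sub L unfolding linked_def by blast
      ultimately show ?thesis using y1 by simp
    qed
  qed
qed

text \<open>\<open>opn\<close> stores the place plus one, so that 0 means not yet seen. The new
  chord is appended to the list and its gap, still open, is pushed on the stack
  \<open>G\<close>.\<close>

definition open_chord :: com where
  "open_chord = seqs [Put ''opn'' (Var ''x'') (Plus (Var ''i'') (Const 1)), Assign ''p'' (Get ''prv'' (Const 0)),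
    Put ''nxt'' (Var ''p'') (Var ''x''), Put ''prv'' (Var ''x'') (Var ''p''),
    Put ''nxt'' (Var ''x'') (Const 0), Put ''prv'' (Const 0) (Var ''x''),
    Put ''G'' (Var ''top'') (Var ''x''), inc ''top'']"

text \<open>The stack holds the open gaps in the order in which their chords opened, so the ones
  behind \<open>x\<close> are on top.\<close>

definition pop_gaps :: com where
  "pop_gaps = While (And (Less (Const 0) (Var ''top'')) (Less (Get ''opn'' (Var ''x'')) (Get ''opn'' (Get ''G'' (Minus (Var ''top'') (Const 1))))))
    (seqs [Assign ''top'' (Minus (Var ''top'') (Const 1)), Assign ''y'' (Get ''G'' (Var ''top'')),
      If (eq_test (Get ''prv'' (Var ''y'')) (Var ''x'')) (Put ''st'' (Var ''y'') (Const 1)) (Put ''st'' (Var ''y'') (Const 0))])"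

text \<open>All open gaps behind \<open>x\<close> have been popped, so the gap of \<open>x\<close>
  is open exactly if \<open>x\<close> is on top of the stack; \<open>f\<close> keeps the answer.
  Replacing the top by the right neighbour keeps the stack in list order.\<close>

definition close_chord :: com where
  "close_chord = seqs [Assign ''y'' (Get ''nxt'' (Var ''x'')), Assign ''p'' (Get ''prv'' (Var ''x'')),
    If (And (Less (Const 0) (Var ''top'')) (eq_test (Get ''G'' (Minus (Var ''top'') (Const 1))) (Var ''x''))) (Assign ''f'' (Const 1)) (Assign ''f'' (Const 0)),
    If (Less (Const 0) (Var ''y''))
      (seqs [Put ''ref'' (Var ''x'') (Var ''y''), Put ''par'' (Var ''x'') (Const 1),
        If (Less (Const 0) (Var ''f'')) (Put ''G'' (Minus (Var ''top'') (Const 1)) (Var ''y''))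
          (Put ''st'' (Var ''y'') (Minus (Const 1) (Get ''st'' (Var ''x''))))])
      (If (Less (Const 0) (Var ''f'')) (seqs [Assign ''top'' (Minus (Var ''top'') (Const 1)), Put ''ref'' (Var ''x'') (Const 0)])
        (seqs [Put ''ref'' (Var ''x'') (Var ''p''), Put ''par'' (Var ''x'') (Get ''st'' (Var ''x''))])),
    Put ''nxt'' (Var ''p'') (Var ''y''), Put ''prv'' (Var ''y'') (Var ''p'')]"

definition scan_chords :: com where
  "scan_chords = for_loop ''i'' (Var ''T'') (Seq (Assign ''x'' (Get ''ce'' (Get ''w'' (Var ''i''))))
    (If (eq_test (Get ''opn'' (Var ''x'')) (Const 0)) open_chord (Seq pop_gaps close_chord)))"

definition scan_regs where "scan_regs = {''i'', ''x'', ''y'', ''p'', ''f'', ''top''}"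
definition scan_arrs where "scan_arrs = {''opn'', ''nxt'', ''prv'', ''G'', ''st'', ''ref'', ''par''}"

context end_word_loc
begin

definition gap_stack where
  "gap_stack \<kappa> i Op r h \<longleftrightarrow> stores (h ''G'') (filter (\<lambda>z. z \<in> Op) (active i)) \<and> r ''top'' = length (filter (\<lambda>z. z \<in> Op) (active i)) \<and>
    col_inv \<kappa> i Op (h ''st'') (h ''ref'') (h ''par'') \<and> (\<forall>z. h ''st'' z \<le> (1::nat))"

definition scan_frame where
  "scan_frame r0 h0 r h \<longleftrightarrow> (\<forall>x::string. x \<notin> scan_regs \<longrightarrow> r x = (r0 x :: nat)) \<and> (\<forall>x::string. x \<notin> scan_arrs \<longrightarrow> h x = (h0 x :: nat \<Rightarrow> nat))"

definition scan_inv where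
  "scan_inv \<kappa> r0 h0 i r h \<longleftrightarrow> scan_frame r0 h0 r h \<and> linked (h ''nxt'') (h ''prv'') (active i) \<and>
    (\<forall>z\<in>X. h ''opn'' z = (if fi z < i then Suc (fi z) else 0)) \<and> (\<exists>Op. gap_stack \<kappa> i Op r h)"

lemma length_active: "i \<le> T \<Longrightarrow> length (active i) \<le> i"
proof (induction i)
  case (Suc i)
  then have "length (active i) \<le> i" by simp
  then show ?case using length_filter_le[of _ "active i"] by (auto intro: le_trans[OF length_filter_le] simp del: length_filter_le)
qed simp

lemma active_split:
  assumes "i < T" "i = la x" "x \<in> X"
  obtains us vs where "active i = us @ x # vs" "\<And>z. z \<in> set us \<Longrightarrow> fi z < fi x" "\<And>z. z \<in> set vs \<Longrightarrow> fi x < fi z"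
    "distinct (0 # us @ x # vs)" "active (Suc i) = us @ vs" "set us \<subseteq> X" "set vs \<subseteq> X"
proof -
  have iT: "i \<le> T" using assms by simp
  have "x \<in> set (active i)" using set_active[OF iT] assms wordD(1)[OF assms(3)] by simp
  then obtain us vs where s: "active i = us @ x # vs" by (meson split_list)
  have so: "sorted_wrt (\<lambda>a b. fi a < fi b) (us @ x # vs)" using sorted_active[OF iT] s by simp
  have d: "distinct (us @ x # vs)" using distinct_active[OF iT] s by simp
  have ex: "e i = x" using assms wordD(4) by simp
  have nfi: "i \<noteq> fi x" using ex assms wordD(1)[OF assms(3)] by simp
  have "active (Suc i) = filter (\<lambda>y. y \<noteq> x) (us @ x # vs)" unfolding active.simps ex if_not_P[OF nfi] s ..
  moreover have "filter (\<lambda>y. y \<noteq> x) us = us" "filter (\<lambda>y. y \<noteq> x) vs = vs" using d by (auto intro!: filter_True)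
  ultimately have "active (Suc i) = us @ vs" by simp
  moreover have "0 \<notin> set (us @ x # vs)" using active_pos[OF iT] s by force
  moreover have "set us \<subseteq> X" "set vs \<subseteq> X" using set_active[OF iT] s by auto
  ultimately show thesis using that[OF s] so d by (auto simp: sorted_wrt_append)
qed

lemma wp_open_chord:
  assumes i: "i < T" "i = fi (e i)" "r ''i'' = i" "r ''x'' = e i" and W: "T \<le> W" "\<And>z. z \<in> X \<Longrightarrow> z \<le> W"
    and I: "scan_inv \<kappa> r0 h0 i r h"
    and Q: "\<And>r' h' t'. scan_inv \<kappa> r0 h0 (Suc i) r' h' \<Longrightarrow> r' ''i'' = i \<Longrightarrow> r' ''top'' = Suc (r ''top'') \<Longrightarrow> t' \<le> t + 8 \<Longrightarrow> Q (r', h') t'"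
  shows "wp W open_chord Q (r, h) t"
proof -
  have iT: "i \<le> T" using i by simp
  define x where "x = e i"
  have x: "x \<in> X" "r ''x'' = x" "i = fi x" using wordD(5)[OF i(1)] i unfolding x_def by simp_all
  have xact: "x \<notin> set (active i)" using set_active[OF iT] x by auto
  have act: "active (Suc i) = active i @ [x]" unfolding active.simps if_P[OF i(2)] x_def ..
  obtain Op where O: "gap_stack \<kappa> i Op r h" using I unfolding scan_inv_def by blast
  let ?gs = "filter (\<lambda>z. z \<in> Op) (active i)"
  have L: "linked (h ''nxt'') (h ''prv'') (active i)" and opn: "\<And>z. z \<in> X \<Longrightarrow> h ''opn'' z = (if fi z < i then Suc (fi z) else 0)"
    and fr: "scan_frame r0 h0 r h" using I unfolding scan_inv_def by auto
  have x0: "x \<noteq> 0" using x(1) zero by metis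
  have d0: "distinct (0 # active i @ [x])"
  proof -
    have "0 \<notin> set (active i)" using active_pos[OF iT] by blast
    then show ?thesis using distinct_active[OF iT] xact x0 by simp
  qed
  have L': "linked ((h ''nxt'')(h ''prv'' 0 := x, x := 0)) ((h ''prv'')(x := h ''prv'' 0, 0 := x)) (active (Suc i))"
    unfolding act by (rule linked_snoc[OF L d0])
  have top: "r ''top'' = length ?gs" and G: "stores (h ''G'') ?gs" and C: "col_inv \<kappa> i Op (h ''st'') (h ''ref'') (h ''par'')"
    and st1: "\<And>z. h ''st'' z \<le> 1" using O unfolding gap_stack_def by auto
  have fl: "filter (\<lambda>z. z \<in> insert x Op) (active (Suc i)) = ?gs @ [x]"
  proof -
    have "filter (\<lambda>z. z \<in> insert x Op) (active i) = ?gs" using xact by (intro filter_cong) auto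
    then show ?thesis unfolding act by simp
  qed
  have C': "col_inv \<kappa> (Suc i) (insert x Op) (h ''st'') (h ''ref'') (h ''par'')"
    unfolding x_def by (rule col_inv_open[OF i(1,2) C])
  have lg: "length ?gs < T" using length_active[OF iT] i(1) length_filter_le[of "\<lambda>z. z \<in> Op" "active i"] by linarith
  have p: "h ''prv'' 0 \<in> X \<or> h ''prv'' 0 = 0"
  proof -
    have "(last (0 # active i), 0) \<in> adjacent ((0 # active i) @ 0 # [])" by (rule adjacent_junction) simp
    then have "(last (0 # active i), 0) \<in> adjacent (0 # active i @ [0])" by (simp only: append_Cons)
    then have "h ''prv'' 0 = last (0 # active i)" by (rule conjunct2[OF L[unfolded linked_def, rule_format]])
    moreover have "last (0 # active i) \<in> set (0 # active i)" by (rule last_in_set) simp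
    moreover have "set (active i) \<subseteq> X" unfolding set_active[OF iT] by blast
    ultimately show ?thesis by (metis set_ConsD subsetD)
  qed
  then have pW: "h ''prv'' 0 \<le> W" using W(2) by (metis le0)
  have opn': "((h ''opn'')(x := Suc i)) z = (if fi z < Suc i then Suc (fi z) else 0)" if "z \<in> X" for z
  proof (cases "z = x")
    case False
    then have "fi z \<noteq> i" using wordD(3)[OF that] wordD(3)[OF x(1)] x(3) by metis
    then show ?thesis using opn[OF that] False by (simp add: less_Suc_eq)
  qed (use x(3) in simp)
  have b: "Suc i \<le> W" "x \<le> W" "Suc (length ?gs) \<le> W" using W i(1) x(1) lg by auto
  have gst: "\<exists>Op. gap_stack \<kappa> (Suc i) Op r' h'" if "h' ''st'' = h ''st''" "h' ''ref'' = h ''ref''" "h' ''par'' = h ''par''"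
      "h' ''G'' = (h ''G'')(length ?gs := x)" "r' ''top'' = Suc (length ?gs)" for r' h'
    using C' stores_snoc[OF G refl, of x] st1 unfolding gap_stack_def that by (intro exI[of _ "insert x Op"]) (simp only: fl, simp)
  show ?thesis unfolding open_chord_def
    apply (simp add: x(2) i(3) b pW top del: active.simps)
    apply (rule Q)
    subgoal unfolding scan_inv_def
      apply (intro conjI)
      subgoal using fr by (simp add: scan_frame_def scan_regs_def scan_arrs_def)
      subgoal using L' by (simp del: active.simps)
      subgoal using opn' by simp
      subgoal by (rule gst) simp_all
      done
    subgoal by (simp add: i(3))
    subgoal by (simp add: top)
    subgoal by simp
    done
qed

lemma linked_prv:
  assumes L: "linked nxt prv (active i)" and y: "y \<in> set (active i)"
  shows "(prv y, y) \<in> adjacent (0 # active i)" "prv y \<in> set (0 # active i)"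
proof -
  obtain us vs where s: "active i = us @ y # vs" using split_list[OF y] by blast
  have p: "prv y = last (0 # us)" using linked_neighbours(2)[of nxt prv us y vs] L s by simp
  then show "(prv y, y) \<in> adjacent (0 # active i)" unfolding s using adjacent_junction[of "0 # us" y vs] by simp
  then show "prv y \<in> set (0 # active i)" using adjacent_in by metis
qed

text \<open>Every iteration takes five time units and lowers the stack by one, so the number of pops
  is paid by the potential \<open>5 * top\<close>.\<close>

lemma wp_pop_gaps:
  assumes i: "i < T" "i = la x" "x \<in> X" "r ''i'' = i" "r ''x'' = x" and W: "T \<le> W" "1 \<le> W" "\<And>z. z \<in> X \<Longrightarrow> z \<le> W"
    and ch: "\<And>a b. a \<in> X \<Longrightarrow> b \<in> X \<Longrightarrow> interlaced fi la a b \<Longrightarrow> \<kappa> a \<noteq> \<kappa> b" "\<And>z. \<kappa> z \<le> 1"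
    and I: "scan_inv \<kappa> r0 h0 i r h"
    and Q: "\<And>r' h' t' Op. scan_inv \<kappa> r0 h0 i r' h' \<Longrightarrow> gap_stack \<kappa> i Op r' h' \<Longrightarrow> (\<forall>z\<in>set (active i). fi x < fi z \<longrightarrow> z \<notin> Op) \<Longrightarrow>
      r' ''i'' = i \<Longrightarrow> r' ''x'' = x \<Longrightarrow> t' + 5 * r' ''top'' \<le> t + 5 * r ''top'' + 1 \<Longrightarrow> Q (r', h') t'"
  shows "wp W pop_gaps Q (r, h) t"
  unfolding pop_gaps_def
proof (rule wp_While[where V = "\<lambda>s. fst s ''top''" and
    I = "\<lambda>s a. scan_inv \<kappa> r0 h0 i (fst s) (snd s) \<and> fst s ''i'' = i \<and> fst s ''x'' = x \<and> a + 5 * fst s ''top'' \<le> t + 5 * r ''top''"], goal_cases)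
  case 1 then show ?case using I i by simp
next
  case (2 s a)
  obtain r1 h1 where s: "s = (r1, h1)" by fastforce
  have iT: "i \<le> T" using i by simp
  have inv: "scan_inv \<kappa> r0 h0 i r1 h1" and ri: "r1 ''i'' = i" "r1 ''x'' = x" and tm: "a + 5 * r1 ''top'' \<le> t + 5 * r ''top''"
    using 2(1) unfolding s by simp_all
  have cond: "0 < r1 ''top''" "h1 ''opn'' x < h1 ''opn'' (h1 ''G'' (r1 ''top'' - 1))" using 2(2) ri unfolding s by simp_all
  obtain Op where O: "gap_stack \<kappa> i Op r1 h1" using inv unfolding scan_inv_def by blast
  let ?gs = "filter (\<lambda>z. z \<in> Op) (active i)"
  have L: "linked (h1 ''nxt'') (h1 ''prv'') (active i)" and opn: "\<And>z. z \<in> X \<Longrightarrow> h1 ''opn'' z = (if fi z < i then Suc (fi z) else 0)"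
    and fr: "scan_frame r0 h0 r1 h1" using inv unfolding scan_inv_def by auto
  have top: "r1 ''top'' = length ?gs" and G: "stores (h1 ''G'') ?gs" and C: "col_inv \<kappa> i Op (h1 ''st'') (h1 ''ref'') (h1 ''par'')"
    and st1: "\<And>z. h1 ''st'' z \<le> 1" using O unfolding gap_stack_def by auto
  obtain gs y where gs: "?gs = gs @ [y]" using cond(1) top by (cases ?gs rule: rev_cases) auto
  have y: "y \<in> Op" "y \<in> set (active i)" using arg_cong[OF gs, of set] by auto
  have yX: "y \<in> X" "fi y < i" using y(2) set_active[OF iT] by auto
  have Gy: "h1 ''G'' (length gs) = y" using G unfolding gs stores_def by simp
  have tl: "r1 ''top'' = Suc (length gs)" using top gs by simp
  have fx: "fi x < fi y" using cond(2) opn[OF yX(1)] opn[OF i(3)] yX(2) Gy tl wordD(1)[OF i(3)] i(2) by simp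
  have dist: "distinct (gs @ [y])" using distinct_filter[OF distinct_active[OF iT], of "\<lambda>z. z \<in> Op"] gs by simp
  have fl: "filter (\<lambda>z. z \<in> Op - {y}) (active i) = gs"
  proof -
    have "filter (\<lambda>z. z \<in> Op - {y}) (active i) = filter (\<lambda>z. z \<noteq> y) ?gs" by (auto simp: filter_filter intro: filter_cong)
    also have "\<dots> = filter (\<lambda>z. z \<noteq> y) gs" unfolding gs by simp
    also have "\<dots> = gs" using dist by (auto intro: filter_True)
    finally show ?thesis .
  qed
  note pr = linked_prv[OF L y(2)]
  have C': "col_inv \<kappa> i (Op - {y}) ((h1 ''st'')(y := if h1 ''prv'' y = x then 1 else 0)) (h1 ''ref'') (h1 ''par'')"
    by (rule col_inv_pop[OF i(1-3) C ch y(1) fx pr(1)])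
  have Gs: "stores (h1 ''G'') gs" using G unfolding gs stores_def by (metis append_eq_conv_conj length_append less_add_Suc1 nth_append trans_less_add1)
  have yW: "y \<le> W" "length gs \<le> W"
  proof -
    show "y \<le> W" using W(3) yX by simp
    show "length gs \<le> W" using length_active[OF iT] length_filter_le[of "\<lambda>z. z \<in> Op" "active i"] gs W(1) iT by simp
  qed
  have inv': "scan_inv \<kappa> r0 h0 i r2 h2" if "scan_frame r0 h0 r2 h2" "h2 ''nxt'' = h1 ''nxt''" "h2 ''prv'' = h1 ''prv''" "h2 ''opn'' = h1 ''opn''"
    "h2 ''G'' = h1 ''G''" "h2 ''st'' = (h1 ''st'')(y := if h1 ''prv'' y = x then 1 else 0)" "h2 ''ref'' = h1 ''ref''" "h2 ''par'' = h1 ''par''"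
    "r2 ''top'' = length gs" for r2 h2
  proof -
    have "gap_stack \<kappa> i (Op - {y}) r2 h2" unfolding gap_stack_def fl that using Gs C' st1 by simp
    then show ?thesis using L opn that unfolding scan_inv_def by auto
  qed
  show ?case
  proof (cases "h1 ''prv'' y = x")
    case True
    show ?thesis unfolding s
      using W(2) apply (simp add: tl Gy yW ri True)
      apply (intro conjI inv')
               apply (use fr in \<open>simp add: scan_frame_def scan_regs_def scan_arrs_def\<close>)
              apply (use True tm tl W(2) fr in \<open>simp_all add: scan_frame_def scan_regs_def scan_arrs_def\<close>)
      done
  next
    case False
    have F': "h1 ''prv'' y < x \<or> x < h1 ''prv'' y" using False by linarith
    show ?thesis unfolding s
      apply (simp add: tl Gy yW ri F' not_less)
      apply (intro conjI impI inv')
      using F' False tm tl fr apply (simp_all add: scan_frame_def scan_regs_def scan_arrs_def)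
      done
  qed
next
  case (3 s a)
  obtain r1 h1 where s: "s = (r1, h1)" by fastforce
  have iT: "i \<le> T" using i by simp
  have inv: "scan_inv \<kappa> r0 h0 i r1 h1" and ri: "r1 ''i'' = i" "r1 ''x'' = x" and tm: "a + 5 * r1 ''top'' \<le> t + 5 * r ''top''"
    using 3(1) unfolding s by simp_all
  have cond: "\<not> (0 < r1 ''top'' \<and> h1 ''opn'' x < h1 ''opn'' (h1 ''G'' (r1 ''top'' - 1)))" using 3(2) ri unfolding s by simp
  obtain Op where O: "gap_stack \<kappa> i Op r1 h1" using inv unfolding scan_inv_def by blast
  let ?gs = "filter (\<lambda>z. z \<in> Op) (active i)"
  have opn: "\<And>z. z \<in> X \<Longrightarrow> h1 ''opn'' z = (if fi z < i then Suc (fi z) else 0)"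
    using inv unfolding scan_inv_def by auto
  have top: "r1 ''top'' = length ?gs" and G: "stores (h1 ''G'') ?gs" using O unfolding gap_stack_def by auto
  have no: "z \<notin> Op" if z: "z \<in> set (active i)" "fi x < fi z" for z
  proof
    assume "z \<in> Op"
    then have zg: "z \<in> set ?gs" using z by simp
    then obtain gs y where gs: "?gs = gs @ [y]" by (cases ?gs rule: rev_cases) auto
    have so: "sorted_wrt (\<lambda>a b. fi a < fi b) (gs @ [y])" using sorted_wrt_filter[OF sorted_active[OF iT], of "\<lambda>z. z \<in> Op"] gs by simp
    have "fi z \<le> fi y" using zg so unfolding gs by (auto simp: sorted_wrt_append)
    have y: "y \<in> set (active i)" using arg_cong[OF gs, of set] by auto
    have yX: "y \<in> X" "fi y < i" using y set_active[OF iT] by auto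
    have Gy: "h1 ''G'' (r1 ''top'' - 1) = y" using G top unfolding gs stores_def by simp
    have "h1 ''opn'' x < h1 ''opn'' y" using opn[OF yX(1)] opn[OF i(3)] yX(2) wordD(1)[OF i(3)] i(2) z(2) \<open>fi z \<le> fi y\<close> by simp
    then show False using cond Gy top gs by simp
  qed
  show ?case unfolding s by (rule Q[OF inv O]) (use no ri tm in auto)
qed

end

context end_word_loc
begin

lemma wp_close_chord:
  assumes i: "i < T" "i = la x" "x \<in> X" "r ''i'' = i" "r ''x'' = x" and W: "T \<le> W" "1 \<le> W" "\<And>z. z \<in> X \<Longrightarrow> z \<le> W"
    and ch: "\<And>a b. a \<in> X \<Longrightarrow> b \<in> X \<Longrightarrow> interlaced fi la a b \<Longrightarrow> \<kappa> a \<noteq> \<kappa> b" "\<And>z. \<kappa> z \<le> 1"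
    and I: "scan_inv \<kappa> r0 h0 i r h" and O: "gap_stack \<kappa> i Op r h" and no: "\<forall>z\<in>set (active i). fi x < fi z \<longrightarrow> z \<notin> Op"
    and Q: "\<And>r' h' t'. scan_inv \<kappa> r0 h0 (Suc i) r' h' \<Longrightarrow> r' ''i'' = i \<Longrightarrow> r' ''top'' \<le> r ''top'' \<Longrightarrow> t' \<le> t + 11 \<Longrightarrow> Q (r', h') t'"
  shows "wp W close_chord Q (r, h) t"
proof -
  have iT: "i \<le> T" using i by simp
  obtain us vs where s: "active i = us @ x # vs" and vs: "\<And>z. z \<in> set vs \<Longrightarrow> fi x < fi z"
    and d: "distinct (0 # us @ x # vs)" and act': "active (Suc i) = us @ vs" and X: "set us \<subseteq> X" "set vs \<subseteq> X"
    by (rule active_split[OF i(1-3)], rule that)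
  have noOp: "set vs \<inter> Op = {}" using no vs s by auto
  let ?gs = "filter (\<lambda>z. z \<in> Op) (active i)"
  let ?gu = "filter (\<lambda>z. z \<in> Op) us"
  define y where "y = hd (vs @ [0])"
  define p where "p = last (0 # us)"
  have L: "linked (h ''nxt'') (h ''prv'') (us @ x # vs)" and opn: "\<And>z. z \<in> X \<Longrightarrow> h ''opn'' z = (if fi z < i then Suc (fi z) else 0)"
    and fr: "scan_frame r0 h0 r h" using I s unfolding scan_inv_def by auto
  have top: "r ''top'' = length ?gs" and G: "stores (h ''G'') ?gs" and C: "col_inv \<kappa> i Op (h ''st'') (h ''ref'') (h ''par'')"
    and st1: "\<And>z. h ''st'' z \<le> 1" using O unfolding gap_stack_def by auto
  have nb: "h ''nxt'' x = y" "h ''prv'' x = p" using linked_neighbours[OF L] unfolding y_def p_def by simp_all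
  have L': "linked ((h ''nxt'')(p := y)) ((h ''prv'')(y := p)) (active (Suc i))"
    unfolding act' y_def p_def by (rule linked_remove[OF L d])
  have x0: "x \<noteq> 0" using i(3) zero by metis
  have fv: "filter (\<lambda>z. z \<in> Op) vs = []" using noOp by (auto simp: filter_empty_conv)
  have gs: "?gs = ?gu @ (if x \<in> Op then [x] else [])" unfolding s using fv by simp
  have Gu: "stores (h ''G'') ?gu" using G unfolding gs stores_def by (simp add: nth_append)
  have "p \<in> set (0 # us)" unfolding p_def by (rule last_in_set) simp
  then have pW: "p \<le> W" using X(1) W(3) by auto
  have yW: "y \<le> W" unfolding y_def using X(2) W(3) by (cases vs) auto
  have opn': "\<forall>z\<in>X. h ''opn'' z = (if fi z < Suc i then Suc (fi z) else 0)"
  proof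
    fix z assume z: "z \<in> X"
    have "fi z \<noteq> i"
    proof
      assume "fi z = i"
      then have "z = x" using wordD(3)[OF z] wordD(4)[OF i(3)] i(2) by metis
      then show False using \<open>fi z = i\<close> wordD(1)[OF i(3)] i(2) by simp
    qed
    then show "h ''opn'' z = (if fi z < Suc i then Suc (fi z) else 0)" using opn[OF z] by (simp add: less_Suc_eq)
  qed
  have lgs: "length ?gs \<le> W" using length_active[OF iT] length_filter_le[of "\<lambda>z. z \<in> Op" "active i"] W(1) iT by linarith
  have final: "scan_inv \<kappa> r0 h0 (Suc i) r' h'" if a: "scan_frame r0 h0 r' h'" "h' ''nxt'' = (h ''nxt'')(p := y)" "h' ''prv'' = (h ''prv'')(y := p)" "h' ''opn'' = h ''opn''"
      and b: "stores (h' ''G'') (filter (\<lambda>z. z \<in> Op') (us @ vs))" "r' ''top'' = length (filter (\<lambda>z. z \<in> Op') (us @ vs))" "\<And>z. h' ''st'' z \<le> 1"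
      and c: "vs \<noteq> [] \<Longrightarrow> h' ''ref'' = (h ''ref'')(x := hd vs) \<and> h' ''par'' = (h ''par'')(x := 1) \<and>
        (if x \<in> Op then h' ''st'' = h ''st'' \<and> Op' = insert (hd vs) (Op - {x}) else h' ''st'' = (h ''st'')(hd vs := 1 - h ''st'' x) \<and> Op' = Op)"
      "vs = [] \<Longrightarrow> h' ''st'' = h ''st'' \<and> Op' = Op - {x} \<and>
        (x \<in> Op \<longrightarrow> h' ''ref'' = (h ''ref'')(x := 0)) \<and> (x \<notin> Op \<longrightarrow> h' ''ref'' = (h ''ref'')(x := last (0 # us)) \<and> h' ''par'' = (h ''par'')(x := h ''st'' x))
        \<and> (\<forall>z. z \<noteq> x \<longrightarrow> h' ''par'' z = h ''par'' z)" for r' h' Op'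
  proof -
    have "col_inv \<kappa> (Suc i) Op' (h' ''st'') (h' ''ref'') (h' ''par'')"
      by (rule col_inv_close[OF i(1-3) C ch s noOp c])
    then have "gap_stack \<kappa> (Suc i) Op' r' h'" unfolding gap_stack_def act' using b by blast
    moreover have "linked (h' ''nxt'') (h' ''prv'') (active (Suc i))" unfolding a(2,3) by (rule L')
    ultimately show ?thesis unfolding scan_inv_def using a(1,4) opn' by auto
  qed
  have frame: "scan_frame r0 h0 r' h'" if "\<forall>x. x \<notin> scan_regs \<longrightarrow> r' x = r x" "\<forall>x. x \<notin> scan_arrs \<longrightarrow> h' x = h x" for r' h'
    using fr that unfolding scan_frame_def by simp
  have xg: "x \<notin> set ?gu" using d by auto
  have test: "(0 < r ''top'' \<and> h ''G'' (r ''top'' - 1) = x) \<longleftrightarrow> x \<in> Op"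
  proof (cases "x \<in> Op")
    case True
    then show ?thesis using G top unfolding gs stores_def by simp
  next
    case False
    then have e: "?gs = ?gu" using gs by simp
    have "h ''G'' (r ''top'' - 1) \<in> set ?gu" if "0 < r ''top''"
    proof -
      have l: "r ''top'' - 1 < length ?gu" using that top e by simp
      then have "h ''G'' (r ''top'' - 1) = ?gu ! (r ''top'' - 1)" using Gu unfolding stores_def by blast
      then show ?thesis using nth_mem[OF l] by (simp only:)
    qed
    then show ?thesis using False xg by auto
  qed
  have eqt: "bval (And (Less (Const 0) (Var ''top'')) (eq_test (Get ''G'' (Minus (Var ''top'') (Const 1))) (Var ''x''))) (r2, h) \<longleftrightarrow> x \<in> Op"
    if "r2 ''top'' = r ''top''" "r2 ''x'' = x" for r2 using test that by (auto simp: not_less)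
  have W1: "Suc 0 \<le> W" using W(2) by simp
  define ifc where "ifc = If (And (Less (Const 0) (Var ''top'')) (eq_test (Get ''G'' (Minus (Var ''top'') (Const 1))) (Var ''x''))) (Assign ''f'' (Const 1)) (Assign ''f'' (Const 0))"
  define rest where "rest = seqs [
    If (Less (Const 0) (Var ''y''))
      (seqs [Put ''ref'' (Var ''x'') (Var ''y''), Put ''par'' (Var ''x'') (Const 1),
        If (Less (Const 0) (Var ''f'')) (Put ''G'' (Minus (Var ''top'') (Const 1)) (Var ''y''))
          (Put ''st'' (Var ''y'') (Minus (Const 1) (Get ''st'' (Var ''x''))))])
      (If (Less (Const 0) (Var ''f'')) (seqs [Assign ''top'' (Minus (Var ''top'') (Const 1)), Put ''ref'' (Var ''x'') (Const 0)])
        (seqs [Put ''ref'' (Var ''x'') (Var ''p''), Put ''par'' (Var ''x'') (Get ''st'' (Var ''x''))])),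
    Put ''nxt'' (Var ''p'') (Var ''y''), Put ''prv'' (Var ''y'') (Var ''p'')]"
  have e: "close_chord = Seq (Assign ''y'' (Get ''nxt'' (Var ''x''))) (Seq (Assign ''p'' (Get ''prv'' (Var ''x''))) (Seq ifc rest))"
    unfolding close_chord_def rest_def ifc_def by simp
  have pre: "wp W close_chord Q (r, h) t" if R: "wp W rest Q (r(''y'' := y, ''p'' := p, ''f'' := if x \<in> Op then 1 else 0), h) (t + 1 + 1 + 1 + 1)"
  proof -
    have q: "bval (And (Less (Const 0) (Var ''top'')) (eq_test (Get ''G'' (Minus (Var ''top'') (Const 1))) (Var ''x''))) (r(''y'' := y, ''p'' := p), h) \<longleftrightarrow> x \<in> Op"
      by (rule eqt) (simp_all add: i(5))
    have W1: "Suc 0 \<le> W" using W(2) by simp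
    have "wp W ifc (\<lambda>s' a'. wp W rest Q s' a') (r(''y'' := y, ''p'' := p), h) (t + 1 + 1)"
      unfolding ifc_def wp_If q using R W1 by (cases "x \<in> Op") simp_all
    then show ?thesis unfolding e wp_Seq wp_Assign using nb i(5) yW pW by simp
  qed
  show ?thesis
  proof (cases vs)
    case (Cons y' vs')
    have y: "y = y'" "y \<noteq> 0" "0 < y" "y \<noteq> x" unfolding y_def using Cons d by auto
    have yOp: "y \<notin> Op" "filter (\<lambda>z. z \<in> Op) vs' = []" using noOp y Cons fv by auto
    have yu: "y \<notin> set us" "y \<notin> set vs'" using d Cons y by auto
    show ?thesis
    proof (cases "x \<in> Op")
      case True
      have fl: "filter (\<lambda>z. z \<in> insert y (Op - {x})) (us @ vs) = ?gu @ [y]"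
      proof -
        have "filter (\<lambda>z. z \<in> insert y (Op - {x})) us = ?gu" using yu d by (intro filter_cong) auto
        moreover have "filter (\<lambda>z. z \<in> insert y (Op - {x})) vs' = filter (\<lambda>z. z \<in> Op) vs'" using yu d Cons by (intro filter_cong) auto
        ultimately show ?thesis using Cons y(1) yOp(2) by simp
      qed
      have tp: "r ''top'' = Suc (length ?gu)" using top gs True by simp
      show ?thesis
        apply (rule pre)
        unfolding rest_def
        apply (simp add: y(3) i(5) True yW pW W1)
        apply (rule Q)
        subgoal
          apply (rule final[where Op' = "insert y (Op - {x})"])
          subgoal by (rule frame) (simp_all add: scan_regs_def scan_arrs_def)
          subgoal by simp
          subgoal by simp
          subgoal by simp
          subgoal unfolding fl using stores_snoc[OF Gu refl, of y] tp by simp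
          subgoal unfolding fl using tp by simp
          subgoal using st1 by simp
          subgoal using True Cons y(1) by simp
          subgoal using Cons by simp
          done
        subgoal using i(4) by simp
        subgoal by simp
        subgoal by simp
        done
    next
      case False
      have fl: "filter (\<lambda>z. z \<in> Op) (us @ vs) = ?gu" using fv by simp
      have tp: "r ''top'' = length ?gu" using top gs False by simp
      have sW: "Suc 0 - h ''st'' x \<le> W" using W(2) by simp
      show ?thesis
        apply (rule pre)
        unfolding rest_def
        apply (simp add: y(3) i(5) False yW pW W1 sW)
        apply (rule Q)
        subgoal
          apply (rule final[where Op' = Op])
          subgoal by (rule frame) (simp_all add: scan_regs_def scan_arrs_def)
          subgoal by simp
          subgoal by simp
          subgoal by simp
          subgoal unfolding fl using Gu by simp
          subgoal unfolding fl using tp by simp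
          subgoal using st1 by simp
          subgoal using False Cons y(1) by simp
          subgoal using Cons by simp
          done
        subgoal using i(4) by simp
        subgoal by simp
        subgoal by simp
        done
    qed
  next
    case Nil
    have y: "y = 0" unfolding y_def using Nil by simp
    have fl: "filter (\<lambda>z. z \<in> Op - {x}) (us @ vs) = ?gu" using d Nil by (auto intro!: filter_cong)
    show ?thesis
    proof (cases "x \<in> Op")
      case True
      have tp: "r ''top'' = Suc (length ?gu)" using top gs True by simp
      have tW: "length ?gu \<le> W" using lgs gs True by simp
      show ?thesis
        apply (rule pre)
        unfolding rest_def
        apply (simp add: y i(5) True pW tp tW)
        apply (rule Q)
        subgoal
          apply (rule final[where Op' = "Op - {x}"])
          subgoal by (rule frame) (simp_all add: scan_regs_def scan_arrs_def)
          subgoal using y by simp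
          subgoal using y by simp
          subgoal by simp
          subgoal unfolding fl using Gu by simp
          subgoal unfolding fl by simp
          subgoal using st1 by simp
          subgoal using Nil by simp
          subgoal using True by simp
          done
        subgoal using i(4) by simp
        subgoal using tp by simp
        subgoal by simp
        done
    next
      case False
      have tp: "r ''top'' = length ?gu" using top gs False by simp
      have sW: "h ''st'' x \<le> W" using W(2) st1[of x] by simp
      show ?thesis
        apply (rule pre)
        unfolding rest_def
        apply (simp add: y i(5) False pW sW)
        apply (rule Q)
        subgoal
          apply (rule final[where Op' = "Op - {x}"])
          subgoal by (rule frame) (simp_all add: scan_regs_def scan_arrs_def)
          subgoal using y by simp
          subgoal using y by simp
          subgoal by simp
          subgoal unfolding fl using Gu by simp
          subgoal unfolding fl using tp by simp
          subgoal using st1 by simp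
          subgoal using Nil by simp
          subgoal using False by (simp add: p_def)
          done
        subgoal using i(4) by simp
        subgoal by simp
        subgoal by simp
        done
    qed
  qed
qed

text \<open>Each end pushes at most one gap, so with the potential \<open>5 * top\<close> the total
  time is linear in \<open>T\<close>, however many crossings there are. \<open>\<kappa>\<close>
  occurs in the correctness argument only, not in the program.\<close>

lemma wp_scan_chords:
  assumes T: "r ''T'' = T" "r ''top'' = 0" "\<And>t. t < T \<Longrightarrow> h ''ce'' (h ''w'' t) = e t"
    and z: "\<And>c. h ''opn'' c = 0" "\<And>c. h ''st'' c = 0" "h ''nxt'' 0 = 0" "h ''prv'' 0 = 0"
    and W: "T \<le> W" "1 \<le> W" "\<And>z. z \<in> X \<Longrightarrow> z \<le> W"
    and ch: "\<And>a b. a \<in> X \<Longrightarrow> b \<in> X \<Longrightarrow> interlaced fi la a b \<Longrightarrow> \<kappa> a \<noteq> \<kappa> b" "\<And>z. \<kappa> z \<le> 1"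
    and Q: "\<And>r' h' t' Op. scan_frame r h r' h' \<Longrightarrow> (\<forall>z\<in>X. h' ''opn'' z = Suc (fi z)) \<Longrightarrow>
      col_inv \<kappa> T Op (h' ''st'') (h' ''ref'') (h' ''par'') \<Longrightarrow> t' \<le> t + 30 * T + 2 \<Longrightarrow> Q (r', h') t'"
  shows "wp W scan_chords Q (r, h) t"
  unfolding scan_chords_def
proof (rule wp_for_loop[where n = T and J = "\<lambda>j s a. fst s ''i'' = j \<and> scan_inv \<kappa> r h j (fst s) (snd s) \<and>
    a + 5 * fst s ''top'' \<le> t + 1 + 30 * j"], goal_cases)
  case 1
  have "gap_stack \<kappa> 0 {} (r(''i'' := 0)) h" unfolding gap_stack_def using T(2) z col_inv_0 by simp
  moreover have "linked (h ''nxt'') (h ''prv'') []" unfolding linked_def using z by simp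
  ultimately show ?case using T z unfolding scan_inv_def scan_frame_def by (auto simp: scan_regs_def)
next
  case (2 j r' h' a)
  then show ?case using T(1) unfolding scan_inv_def scan_frame_def by (simp add: scan_regs_def)
next
  case (3 j r' h' a)
  note j = 3(1)
  have I: "scan_inv \<kappa> r h j r' h'" and ij: "r' ''i'' = j" and tm: "a + 5 * r' ''top'' \<le> t + 1 + 30 * j" using 3(2) by simp_all
  have arr: "h' ''ce'' = h ''ce''" "h' ''w'' = h ''w''" using I unfolding scan_inv_def scan_frame_def by (simp_all add: scan_arrs_def)
  have ex: "h' ''ce'' (h' ''w'' j) = e j" using arr T(3)[OF j] by simp
  have eX: "e j \<in> X" using wordD(5)[OF j] .
  have eW: "e j \<le> W" using W(3) eX .
  let ?r = "r'(''x'' := e j)"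
  have I': "scan_inv \<kappa> r h j ?r h'"
  proof -
    have "gap_stack \<kappa> j Op ?r h' \<longleftrightarrow> gap_stack \<kappa> j Op r' h'" for Op unfolding gap_stack_def by simp
    moreover have "scan_frame r h ?r h'" using I unfolding scan_inv_def scan_frame_def by (simp add: scan_regs_def)
    ultimately show ?thesis using I unfolding scan_inv_def by simp
  qed
  have opn: "h' ''opn'' (e j) = (if fi (e j) < j then Suc (fi (e j)) else 0)" using I eX unfolding scan_inv_def by blast
  have J: "scan_inv \<kappa> r h (Suc j) (r2(''i'' := Suc j)) h2" if "scan_inv \<kappa> r h (Suc j) r2 h2" for r2 h2
  proof -
    have "gap_stack \<kappa> (Suc j) Op (r2(''i'' := Suc j)) h2 \<longleftrightarrow> gap_stack \<kappa> (Suc j) Op r2 h2" for Op unfolding gap_stack_def by simp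
    moreover have "scan_frame r h (r2(''i'' := Suc j)) h2" using that unfolding scan_inv_def scan_frame_def by (simp add: scan_regs_def)
    ultimately show ?thesis using that unfolding scan_inv_def by simp
  qed
  show ?case
  proof (cases "j = fi (e j)")
    case True
    then have o: "h' ''opn'' (e j) = 0" using opn by simp
    have "wp W open_chord (\<lambda>s' a'. fst s' ''i'' = j \<and> fst ((fst s')(''i'' := Suc j), snd s') ''i'' = Suc j \<and>
        scan_inv \<kappa> r h (Suc j) (fst ((fst s')(''i'' := Suc j), snd s')) (snd ((fst s')(''i'' := Suc j), snd s')) \<and>
        a' + 1 + 5 * fst ((fst s')(''i'' := Suc j), snd s') ''top'' \<le> t + 1 + 30 * Suc j) (?r, h') (a + 3)"
    proof (rule wp_open_chord[OF j True _ _ W(1) W(3) I'], goal_cases)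
      case (4 r2 h2 t2)
      then show ?case using J tm by simp
    qed (use ij in simp_all)
    then show ?thesis using ij ex o eW by (simp add: numeral_eq_Suc)
  next
    case False
    then have la: "j = la (e j)" using wordD(6)[OF j] by blast
    then have o: "h' ''opn'' (e j) \<noteq> 0" using opn wordD(1)[OF eX] by simp
    have "wp W (Seq pop_gaps close_chord) (\<lambda>s' a'. fst s' ''i'' = j \<and> fst ((fst s')(''i'' := Suc j), snd s') ''i'' = Suc j \<and>
        scan_inv \<kappa> r h (Suc j) (fst ((fst s')(''i'' := Suc j), snd s')) (snd ((fst s')(''i'' := Suc j), snd s')) \<and>
        a' + 1 + 5 * fst ((fst s')(''i'' := Suc j), snd s') ''top'' \<le> t + 1 + 30 * Suc j) (?r, h') (a + 3)"
      unfolding wp_Seq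
    proof (rule wp_pop_gaps[OF j la eX _ _ W ch I'], goal_cases)
      case (7 r1 h1 t1 Op)
      note P = this
      show ?case
      proof (rule wp_close_chord[OF j la eX P(4) P(5) W ch P(1-3)], goal_cases)
        case (5 r2 h2 t2)
        then show ?case using J P(6) tm by simp
      qed auto
    qed (use ij in simp_all)
    then show ?thesis using ij ex o eW by (simp add: numeral_eq_Suc)
  qed
next
  case (4 r' h' a)
  then obtain Op where "gap_stack \<kappa> T Op r' h'" unfolding scan_inv_def by auto
  moreover have "\<forall>z\<in>X. h' ''opn'' z = Suc (fi z)"
  proof
    fix z assume z: "z \<in> X"
    then have "fi z < T" using wordD(1,2)[OF z] by simp
    then show "h' ''opn'' z = Suc (fi z)" using 4 z unfolding scan_inv_def by simp
  qed
  ultimately show ?case using 4 by (intro Q[of r' h' Op]) (auto simp: scan_inv_def gap_stack_def)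
qed (use W in simp)

end

section \<open>The sorted chord ends form a word\<close>

definition position :: "nat list \<Rightarrow> nat \<Rightarrow> nat" where
  "position zs z = (SOME t. t < length zs \<and> zs ! t = z)"

lemma position_in: assumes "z \<in> set zs" shows "position zs z < length zs" "zs ! position zs z = z"
proof -
  have "\<exists>t. t < length zs \<and> zs ! t = z" using assms by (simp add: in_set_conv_nth)
  then have "position zs z < length zs \<and> zs ! position zs z = z" unfolding position_def by (rule someI_ex)
  then show "position zs z < length zs" "zs ! position zs z = z" by auto
qed

lemma position_nth: "distinct zs \<Longrightarrow> t < length zs \<Longrightarrow> position zs (zs ! t) = t"
  using position_in[of "zs ! t" zs] by (simp add: nth_eq_iff_index_eq)

locale chord_items =
  fixes D :: "(nat \<times> nat) list" and n :: nat and ca cb it k1 k2 ce vx :: "nat \<Rightarrow> nat"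
  assumes items: "item_arrays ca cb it k1 k2 ce vx D"
    and chords: "ab \<in> set D \<Longrightarrow> chord_pair n ab \<and> snd ab < n" and distinct_D: "distinct D"
begin

text \<open>The key \<open>k2\<close> is twice the vertex, plus one for an opening end;
  \<open>k1\<close> is the other end of the chord. Hence at a common vertex closing ends precede
  opening ends, and among ends of the same kind those with the larger other end come first.\<close>

definition item_less where
  "item_less x y \<longleftrightarrow> k2 x < k2 y \<or> (k2 x = k2 y \<and> k1 y \<le> k1 x)"

definition item_word where
  "item_word zs X \<longleftrightarrow> X \<subseteq> {1..length D} \<and> distinct zs \<and> set zs = (\<lambda>x. 2 * x) ` X \<union> (\<lambda>x. 2 * x - 1) ` X \<and> sorted_wrt item_less zs"

abbreviation fi where "fi zs x \<equiv> position zs (2 * x)"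
abbreviation la where "la zs x \<equiv> position zs (2 * x - 1)"

lemma item:
  assumes "x \<in> {1..length D}"
  shows "k1 (2 * x) = cb x" "k2 (2 * x) = Suc (2 * ca x)" "ce (2 * x) = x" "vx (2 * x) = ca x"
    "k1 (2 * x - 1) = ca x" "k2 (2 * x - 1) = 2 * cb x" "ce (2 * x - 1) = x" "vx (2 * x - 1) = cb x"
    "D ! (x - 1) = (ca x, cb x)" "ca x + 2 \<le> cb x" "cb x + 2 \<le> ca x + n" "cb x < n"
proof -
  obtain y where y: "x = Suc y" "y < length D" using assms by (cases x) auto
  have e: "2 * x = Suc (Suc (2 * y))" "2 * x - 1 = Suc (2 * y)" unfolding y by simp_all
  show "k1 (2 * x) = cb x" "k2 (2 * x) = Suc (2 * ca x)" "ce (2 * x) = x" "vx (2 * x) = ca x"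
    "k1 (2 * x - 1) = ca x" "k2 (2 * x - 1) = 2 * cb x" "ce (2 * x - 1) = x" "vx (2 * x - 1) = cb x"
    unfolding e unfolding y(1) using items y(2) unfolding item_arrays_def by (simp_all add: mult_2)
  show d: "D ! (x - 1) = (ca x, cb x)" using items y unfolding item_arrays_def by (simp add: prod_eq_iff)
  have "D ! (x - 1) \<in> set D" using y by simp
  then show "ca x + 2 \<le> cb x" "cb x + 2 \<le> ca x + n" "cb x < n" using chords d unfolding chord_pair_def by fastforce+
qed

lemma chord_eqI: assumes "x \<in> {1..length D}" "y \<in> {1..length D}" "ca x = ca y" "cb x = cb y" shows "x = y"
proof -
  have "D ! (x - 1) = D ! (y - 1)" using item(9)[OF assms(1)] item(9)[OF assms(2)] assms(3,4) by simp
  moreover have "x - 1 < length D" "y - 1 < length D" using assms(1,2) by auto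
  ultimately have "x - 1 = y - 1" using nth_eq_iff_index_eq[OF distinct_D] by blast
  moreover have "1 \<le> x" "1 \<le> y" using assms(1,2) by auto
  ultimately show ?thesis by linarith
qed

lemma item_wordD:
  assumes "item_word zs X" "x \<in> X"
  shows "x \<in> {1..length D}" "fi zs x < length zs" "zs ! fi zs x = 2 * x" "la zs x < length zs" "zs ! la zs x = 2 * x - 1"
proof -
  show "x \<in> {1..length D}" using assms unfolding item_word_def by auto
  have "2 * x \<in> set zs" "2 * x - 1 \<in> set zs" using assms unfolding item_word_def by auto
  then show "fi zs x < length zs" "zs ! fi zs x = 2 * x" "la zs x < length zs" "zs ! la zs x = 2 * x - 1"
    using position_in by blast+
qed

lemma item_word_less:
  assumes "item_word zs X" "s < t" "t < length zs" shows "item_less (zs ! s) (zs ! t)"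
  using assms unfolding item_word_def by (simp add: sorted_wrt_iff_nth_less)

lemma item_word_cases:
  assumes "item_word zs X" "t < length zs"
  obtains x where "x \<in> X" "zs ! t = 2 * x" "t = fi zs x" | x where "x \<in> X" "zs ! t = 2 * x - 1" "t = la zs x"
proof -
  have "zs ! t \<in> (\<lambda>x. 2 * x) ` X \<union> (\<lambda>x. 2 * x - 1) ` X"
    using nth_mem[OF assms(2)] assms(1) unfolding item_word_def by (simp only:)
  moreover have "position zs (zs ! t) = t" using assms position_nth unfolding item_word_def by blast
  ultimately consider x where "x \<in> X" "zs ! t = 2 * x" "position zs (zs ! t) = t" | x where "x \<in> X" "zs ! t = 2 * x - 1" "position zs (zs ! t) = t"
    by blast
  then show thesis
  proof cases
    case (1 x)
    have "t = fi zs x" using 1(3) unfolding 1(2) by (rule sym)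
    then show thesis using that(1)[OF 1(1,2)] by blast
  next
    case (2 x)
    have "t = la zs x" using 2(3) unfolding 2(2) by (rule sym)
    then show thesis using that(2)[OF 2(1,2)] by blast
  qed
qed

lemma end_word_items:
  assumes w: "item_word zs X" shows "end_word (length zs) X (\<lambda>t. ce (zs ! t)) (fi zs) (la zs)"
  unfolding end_word_def
proof (intro conjI ballI allI impI)
  fix x assume x: "x \<in> X"
  note d = item_wordD[OF w x]
  show "fi zs x < la zs x"
  proof (rule ccontr)
    assume "\<not> fi zs x < la zs x"
    moreover have "2 * x \<noteq> 2 * x - 1" using d(1) by auto
    then have "fi zs x \<noteq> la zs x" using d(3,5) by metis
    ultimately have "item_less (2 * x - 1) (2 * x)" using item_word_less[OF w, of "la zs x" "fi zs x"] d by simp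
    then show False using item(10)[OF d(1)] unfolding item_less_def item(2,6)[OF d(1)] by arith
  qed
  show "la zs x < length zs" "ce (zs ! fi zs x) = x" "ce (zs ! la zs x) = x"
    unfolding d(3,5) using d(4) item(3,7)[OF d(1)] by blast+
next
  fix t assume t: "t < length zs"
  have "ce (zs ! t) \<in> X \<and> (t = fi zs (ce (zs ! t)) \<or> t = la zs (ce (zs ! t)))"
  proof (cases rule: item_word_cases[OF w t])
    case (1 x)
    have "ce (zs ! t) = x" unfolding 1(2) by (rule item(3)[OF item_wordD(1)[OF w 1(1)]])
    then show ?thesis using 1(1) disjI1[OF 1(3)] by blast
  next
    case (2 x)
    have "ce (zs ! t) = x" unfolding 2(2) by (rule item(7)[OF item_wordD(1)[OF w 2(1)]])
    then show ?thesis using 2(1) disjI2[OF 2(3)] by blast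
  qed
  then show "ce (zs ! t) \<in> X" "t = fi zs (ce (zs ! t)) \<or> t = la zs (ce (zs ! t))" by blast+
qed

text \<open>The tie rules let a longer chord open first and a shorter one close first at a shared
  vertex, and chords meeting end to start do not overlap. So chords with a common vertex are never
  interlaced, and interlacing means four distinct vertices in crossing order.\<close>

lemma interlaced_items:
  assumes w: "item_word zs X" and xy: "x \<in> X" "y \<in> X" and i: "interlaced (fi zs) (la zs) x y"
  shows "ca x < ca y" "ca y < cb x" "cb x < cb y"
proof -
  note dx = item_wordD[OF w xy(1)] and dy = item_wordD[OF w xy(2)]
  have i: "fi zs x < fi zs y" "fi zs y < la zs x" "la zs x < la zs y" using i unfolding interlaced_def by auto
  have A: "item_less (2 * x) (2 * y)" "item_less (2 * y) (2 * x - 1)" "item_less (2 * x - 1) (2 * y - 1)"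
    using item_word_less[OF w i(1) dy(2)] item_word_less[OF w i(2) dx(4)] item_word_less[OF w i(3) dy(4)] dx dy by simp_all
  have ne: "\<not> (ca x = ca y \<and> cb x = cb y)" using chord_eqI[OF dx(1) dy(1)] i(1) by auto
  have 1: "ca x < ca y \<or> (ca x = ca y \<and> cb y \<le> cb x)"
    using A(1)[unfolded item_less_def item(1,2)[OF dx(1)] item(1,2)[OF dy(1)]] by arith
  have 2: "ca y < cb x"
    using A(2)[unfolded item_less_def item(6)[OF dx(1)] item(2)[OF dy(1)]] by arith
  have 3: "cb x < cb y \<or> (cb x = cb y \<and> ca y \<le> ca x)"
    using A(3)[unfolded item_less_def item(5,6)[OF dx(1)] item(5,6)[OF dy(1)]] by arith
  show "ca x < ca y" "ca y < cb x" "cb x < cb y" using 1 2 3 ne by arith+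
qed

lemma item_mono: assumes w: "item_word zs X" and t: "t \<le> t'" "t' < length zs" shows "vx (zs ! t) \<le> vx (zs ! t')"
proof (cases "t = t'")
  case False
  have k: "vx (zs ! s) = k2 (zs ! s) div 2" if s: "s < length zs" for s
  proof (cases rule: item_word_cases[OF w s])
    case (1 x)
    show ?thesis unfolding 1(2) using item(2,4)[OF item_wordD(1)[OF w 1(1)]] by simp
  next
    case (2 x)
    show ?thesis unfolding 2(2) item(6,8)[OF item_wordD(1)[OF w 2(1)]] by simp
  qed
  have "k2 (zs ! t) \<le> k2 (zs ! t')" using item_word_less[OF w, of t t'] t False unfolding item_less_def by auto
  then show ?thesis using k[of t] k[of t'] t by (simp add: div_le_mono)
qed simp

lemma item_word_filter:
  assumes w: "item_word zs X" shows "item_word (filter (\<lambda>z. P (ce z)) zs) {x\<in>X. P x}"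
  unfolding item_word_def
proof (intro conjI)
  have X: "X \<subseteq> {1..length D}" using w unfolding item_word_def by simp
  have c: "ce (2 * x) = x" "ce (2 * x - 1) = x" if "x \<in> X" for x using item[of x] X that by auto
  show "set (filter (\<lambda>z. P (ce z)) zs) = (\<lambda>x. 2 * x) ` {x\<in>X. P x} \<union> (\<lambda>x. 2 * x - 1) ` {x\<in>X. P x}"
  proof (rule set_eqI)
    fix z
    have "z \<in> set zs \<longleftrightarrow> (\<exists>x\<in>X. z = 2 * x) \<or> (\<exists>x\<in>X. z = 2 * x - 1)" using w unfolding item_word_def by auto
    then have "z \<in> set zs \<and> P (ce z) \<longleftrightarrow> (\<exists>x\<in>X. z = 2 * x \<and> P (ce z)) \<or> (\<exists>x\<in>X. z = 2 * x - 1 \<and> P (ce z))" by blast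
    also have "(\<exists>x\<in>X. z = 2 * x \<and> P (ce z)) \<longleftrightarrow> (\<exists>x\<in>X. z = 2 * x \<and> P x)" by (intro bex_cong refl conj_cong) (simp_all only: c)
    also have "(\<exists>x\<in>X. z = 2 * x - 1 \<and> P (ce z)) \<longleftrightarrow> (\<exists>x\<in>X. z = 2 * x - 1 \<and> P x)" by (intro bex_cong refl conj_cong) (simp_all only: c)
    finally show "z \<in> set (filter (\<lambda>z. P (ce z)) zs) \<longleftrightarrow> z \<in> (\<lambda>x. 2 * x) ` {x\<in>X. P x} \<union> (\<lambda>x. 2 * x - 1) ` {x\<in>X. P x}"
      unfolding set_filter mem_Collect_eq Un_iff image_iff by blast
  qed
  show "{x\<in>X. P x} \<subseteq> {1..length D}" using X by auto
  show "distinct (filter (\<lambda>z. P (ce z)) zs)" "sorted_wrt item_less (filter (\<lambda>z. P (ce z)) zs)"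
    using w unfolding item_word_def by (auto intro: sorted_wrt_filter)
qed

lemma set_items: "set [1..<2 * length D + 1] = (\<lambda>x. 2 * x) ` {1..length D} \<union> (\<lambda>x. 2 * x - 1) ` {1..length D}"
proof (rule set_eqI)
  fix z
  have "(\<exists>x\<in>{1..length D}. z = 2 * x) \<or> (\<exists>x\<in>{1..length D}. z = 2 * x - 1)" if z: "1 \<le> z" "z \<le> 2 * length D"
  proof (cases "even z")
    case True
    then obtain x where "z = 2 * x" by blast
    then show ?thesis using z by auto
  next
    case False
    then obtain x where "z = 2 * x + 1" by (metis oddE)
    then have "x + 1 \<in> {1..length D}" "z = 2 * (x + 1) - 1" using z by auto
    then show ?thesis by blast
  qed
  then show "z \<in> set [1..<2 * length D + 1] \<longleftrightarrow> z \<in> (\<lambda>x. 2 * x) ` {1..length D} \<union> (\<lambda>x. 2 * x - 1) ` {1..length D}"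
    by auto
qed

lemma key_bounds:
  assumes "z \<in> set [1..<2 * length D + 1]" shows "k1 z < n" "k2 z < n + n"
proof -
  obtain x where x: "x \<in> {1..length D}" "z = 2 * x \<or> z = 2 * x - 1" using assms unfolding set_items by auto
  note b = item(10-12)[OF x(1)]
  from x(2) have "k1 z < n \<and> k2 z < n + n"
  proof
    assume z: "z = 2 * x"
    show ?thesis unfolding z item(1,2)[OF x(1)] using b by linarith
  next
    assume z: "z = 2 * x - 1"
    show ?thesis unfolding z item(5,6)[OF x(1)] using b by linarith
  qed
  then show "k1 z < n" "k2 z < n + n" by auto
qed

abbreviation first_sort where "first_sort \<equiv> bucket_sort k1 n [1..<2 * length D + 1]"
abbreviation all_items where "all_items \<equiv> bucket_sort k2 (n + n) first_sort"

lemma set_first_sort: "set first_sort = set [1..<2 * length D + 1]"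
  using key_bounds(1) by (rule set_bucket_sort)

lemma length_first_sort: "length first_sort = 2 * length D"
proof -
  have "length first_sort = length [1..<2 * length D + 1]" using key_bounds(1) by (intro length_bucket_sort) auto
  also have "\<dots> = 2 * length D" by (simp del: upt_Suc)
  finally show ?thesis .
qed

lemma item_word_all: "item_word all_items {1..length D}"
  unfolding item_word_def
proof (intro conjI)
  have "set all_items = set first_sort" by (rule set_bucket_sort) (use key_bounds(2) set_first_sort in blast)
  then show "set all_items = (\<lambda>x. 2 * x) ` {1..length D} \<union> (\<lambda>x. 2 * x - 1) ` {1..length D}"
    using set_first_sort set_items by simp
  show "distinct all_items" by (intro distinct_bucket_sort) simp
  have "sorted_wrt (<) [1..<2 * length D + 1]" by (simp del: upt_Suc)
  then have "sorted_wrt (\<lambda>x y. k1 x < k1 y \<or> (k1 x = k1 y \<and> y < x)) first_sort" by (rule sorted_bucket_sort)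
  from sorted_bucket_sort[OF this, of k2 "n + n"] show "sorted_wrt item_less all_items"
    by (rule sorted_wrt_mono_rel[rotated]) (auto simp: item_less_def)
qed simp

end

section \<open>Reading off the colours and keeping one class\<close>

text \<open>The ends are visited backwards. An end \<open>t\<close> is a closing end exactly if
  \<open>opn x\<close>, which is the opening place plus one, is below \<open>t + 1\<close>. The
  references are coloured by then, because they close later.\<close>

definition paint_chords :: com where
  "paint_chords = for_loop ''j'' (Var ''T'') (seqs [Assign ''t'' (Minus (Var ''T'') (Plus (Var ''j'') (Const 1))),
    Assign ''x'' (Get ''ce'' (Get ''w'' (Var ''t''))),
    If (Less (Get ''opn'' (Var ''x'')) (Plus (Var ''t'') (Const 1)))
      (If (eq_test (Get ''col'' (Get ''ref'' (Var ''x''))) (Get ''par'' (Var ''x''))) Skip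
        (Seq (Put ''col'' (Var ''x'') (Const 1)) (inc ''c1''))) Skip])"

definition choose_colour :: com where
  "choose_colour = If (Less (Plus (Var ''c1'') (Var ''c1'')) (Var ''q'')) (Assign ''best'' (Const 0)) (Assign ''best'' (Const 1))"

context end_word_loc
begin

text \<open>Chords not yet reached, and the sentinel 0, have colour 0; the reference 0 therefore
  yields a definite colour.\<close>

definition painted where
  "painted u rf pr col \<longleftrightarrow> (\<forall>z. col z = (if z \<in> X \<and> u \<le> la z then (if col (rf z) = pr z then 0 else 1 :: nat) else 0))"

text \<open>Recolouring \<open>x\<close> disturbs no chord painted so far, since none of them refers
  to \<open>x\<close>: their references close after them, while \<open>x\<close> closes
  before.\<close>

lemma painted_step:
  assumes P: "painted (Suc t) rf pr col" and t: "t < T" "t = la x" "x \<in> X" and rf: "refs_later T rf"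
  shows "painted t rf pr (col(x := if col (rf x) = pr x then 0 else 1))"
  unfolding painted_def
proof
  fix z
  have later: "rf z \<noteq> x" if "z \<in> X" "t \<le> la z" for z
  proof
    assume a: "rf z = x"
    then have "rf z \<noteq> 0" using t(3) zero by metis
    then have "la z < la x" using rf that(1) wordD(2)[OF that(1)] a unfolding refs_later_def by metis
    then show False using that t by simp
  qed
  have "z = x \<or> la z \<noteq> t" if "z \<in> X" using wordD(4)[OF that] wordD(4)[OF t(3)] t(2) by metis
  then have e: "z \<in> X \<and> t \<le> la z \<longleftrightarrow> z = x \<or> (z \<in> X \<and> Suc t \<le> la z)" using t by (auto simp: Suc_le_eq le_less)
  show "(col(x := if col (rf x) = pr x then 0 else 1)) z = (if z \<in> X \<and> t \<le> la z
      then (if (col(x := if col (rf x) = pr x then 0 else 1)) (rf z) = pr z then 0 else 1 :: nat) else 0)"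
    using P[unfolded painted_def, rule_format, of z] later[of z] e t by auto
qed

lemma painted_skip:
  assumes P: "painted (Suc t) rf pr col" and t: "t < T" "t = fi x" "x \<in> X"
  shows "painted t rf pr col"
proof -
  have "z \<in> X \<and> t \<le> la z \<longleftrightarrow> z \<in> X \<and> Suc t \<le> la z" for z
  proof -
    have "la z \<noteq> t" if "z \<in> X" using wordD(1,4)[OF that] wordD(3)[OF t(3)] t(2) by (metis less_irrefl)
    then show ?thesis by (auto simp: Suc_le_eq le_less)
  qed
  then show ?thesis using P unfolding painted_def by simp
qed

lemma wp_paint_chords:
  assumes r: "r ''T'' = T" "r ''c1'' = 0" and w: "\<And>t. t < T \<Longrightarrow> h ''ce'' (h ''w'' t) = e t"
    and opn: "\<And>z. z \<in> X \<Longrightarrow> h ''opn'' z = Suc (fi z)" and col: "\<And>z. h ''col'' z = 0"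
    and rf: "refs_later T (h ''ref'')" and W: "T + 1 \<le> W" "\<And>z. z \<in> X \<Longrightarrow> z \<le> W" "finite X" "card X \<le> W"
    and Q: "\<And>r' h' t'. (\<forall>x. x \<notin> {''j'', ''t'', ''x'', ''c1''} \<longrightarrow> r' x = r x) \<Longrightarrow> (\<forall>x. x \<noteq> ''col'' \<longrightarrow> h' x = h x) \<Longrightarrow>
      painted 0 (h ''ref'') (h ''par'') (h' ''col'') \<Longrightarrow> r' ''c1'' = card {z\<in>X. h' ''col'' z = 1} \<Longrightarrow> t' \<le> a + 8 * T + 2 \<Longrightarrow> Q (r', h') t'"
  shows "wp W paint_chords Q (r, h) a"
  unfolding paint_chords_def
proof (rule wp_for_loop[where n = T and J = "\<lambda>j s b. fst s ''j'' = j \<and> (\<forall>x. x \<notin> {''j'', ''t'', ''x'', ''c1''} \<longrightarrow> fst s x = r x) \<and>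
    (\<forall>x. x \<noteq> ''col'' \<longrightarrow> snd s x = h x) \<and> painted (T - j) (h ''ref'') (h ''par'') (snd s ''col'') \<and>
    fst s ''c1'' = card {z\<in>X. snd s ''col'' z = 1} \<and> b \<le> a + 1 + 8 * j"], goal_cases)
  case 1
  have "painted (T - 0) (h ''ref'') (h ''par'') (h ''col'')" unfolding painted_def using col wordD(2) by (auto simp: not_le)
  then show ?case using r col by simp
next
  case (2 j r' h' b)
  then show ?case using r by simp
next
  case (3 j r' h' b)
  note j = 3(1)
  have I: "r' ''j'' = j" "\<And>x. x \<notin> {''j'', ''t'', ''x'', ''c1''} \<Longrightarrow> r' x = r x" "\<And>x. x \<noteq> ''col'' \<Longrightarrow> h' x = h x"
    "painted (T - j) (h ''ref'') (h ''par'') (h' ''col'')" "r' ''c1'' = card {z\<in>X. h' ''col'' z = 1}" "b \<le> a + 1 + 8 * j" using 3(2) by auto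
  define t where "t = T - Suc j"
  have t: "t < T" "T - j = Suc t" "T - Suc j = t" "Suc (T - Suc j) = Suc t" unfolding t_def using j by auto
  have P: "painted (Suc t) (h ''ref'') (h ''par'') (h' ''col'')" using I(4) t by simp
  define x where "x = e t"
  have x: "x \<in> X" "h ''ce'' (h ''w'' t) = x" using wordD(5)[OF t(1)] w[OF t(1)] unfolding x_def by auto
  have xW: "x \<le> W" "t \<le> W" using W t x by auto
  have arr: "h' ''ce'' = h ''ce''" "h' ''w'' = h ''w''" "h' ''opn'' = h ''opn''" "h' ''ref'' = h ''ref''" "h' ''par'' = h ''par''" "r' ''T'' = T"
    using I(2,3) r by simp_all
  note fx = wordD(1)[OF x(1)] opn[OF x(1)]
  show ?case
  proof (cases "t = fi x")
    case True
    have "painted t (h ''ref'') (h ''par'') (h' ''col'')" by (rule painted_skip[OF P t(1) True x(1)])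
    then show ?thesis using I(1,2,3,5,6) x(2) xW arr fx True t by simp
  next
    case False
    then have la: "t = la x" using wordD(6)[OF t(1)] unfolding x_def by auto
    have ne: "h ''opn'' x < Suc t" using fx la by simp
    have P': "painted t (h ''ref'') (h ''par'') ((h' ''col'')(x := if h' ''col'' (h ''ref'' x) = h ''par'' x then 0 else 1))"
      by (rule painted_step[OF P t(1) la x(1) rf])
    have c0: "h' ''col'' x = 0" using P la unfolding painted_def by (metis not_less_eq_eq order_refl)
    show ?thesis
    proof (cases "h' ''col'' (h ''ref'' x) = h ''par'' x")
      case True
      have "(h' ''col'')(x := 0) = h' ''col''" using c0 by (simp add: fun_upd_idem)
      then have "painted t (h ''ref'') (h ''par'') (h' ''col'')" using P' True by simp
      then show ?thesis using I(1,2,3,5,6) x(2) xW arr ne True t by simp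
    next
      case False
      then have F: "h' ''col'' (h ''ref'' x) < h ''par'' x \<or> h ''par'' x < h' ''col'' (h ''ref'' x)" by linarith
      have "{z\<in>X. ((h' ''col'')(x := 1)) z = 1} = insert x {z\<in>X. h' ''col'' z = 1}" using x(1) by auto
      moreover have xn: "x \<notin> {z\<in>X. h' ''col'' z = 1}" using c0 by simp
      ultimately have cd: "card {z\<in>X. ((h' ''col'')(x := 1)) z = 1} = Suc (card {z\<in>X. h' ''col'' z = 1})" using W(3) by simp
      have "card (insert x {z\<in>X. h' ''col'' z = 1}) \<le> card X" using W(3) x(1) by (intro card_mono) auto
      then have cW: "Suc (card {z\<in>X. h' ''col'' z = 1}) \<le> W" using xn W(3,4) by simp
      have P2: "painted t (h ''ref'') (h ''par'') ((h' ''col'')(x := 1))" using P' False by simp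
      have W1: "Suc 0 \<le> W" using W(1) by simp
      show ?thesis by (rule disjE[OF F]) (use I(1,2,3,6) x(2) xW arr ne False t P2 cd cW I(5) W1 in simp_all)
    qed
  qed
next
  case (4 r' h' b)
  then show ?case by (intro Q) auto
qed (use W in simp)

lemma painted_final:
  assumes "col_inv \<kappa> T Op st rf pr" "painted 0 rf pr col"
  shows "\<And>z. col z \<le> 1" "\<And>x y. x \<in> X \<Longrightarrow> y \<in> X \<Longrightarrow> col x = col y \<Longrightarrow> \<not> interlaced fi la x y"
proof -
  show c: "col z \<le> 1" for z using assms(2)[unfolded painted_def, rule_format, of z] by (auto split: if_splits)
  have "\<forall>x\<in>X. col x = (if col (rf x) = pr x then 0 else 1)"
    using assms(2) unfolding painted_def by (metis le0)
  then show "\<not> interlaced fi la x y" if "x \<in> X" "y \<in> X" "col x = col y" for x y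
    using col_inv_final[OF assms(1) _ _ that(1,2)] c that(3) by blast
qed

end

lemma wp_choose_colour:
  assumes "r ''c1'' = card {z\<in>X. h ''col'' z = (1::nat)}" "r ''q'' = card X" "finite X" "\<And>z. h ''col'' z \<le> 1" "1 \<le> W"
    and Q: "\<And>b t'. card X \<le> 2 * card {z\<in>X. h ''col'' z = b} \<Longrightarrow> t' \<le> a + 2 \<Longrightarrow> Q (r(''best'' := b), h) t'"
  shows "wp W choose_colour Q (r, h) a"
proof -
  have "X = {z\<in>X. h ''col'' z = 0} \<union> {z\<in>X. h ''col'' z = 1}" using assms(4) by (auto simp: le_Suc_eq)
  moreover have "card ({z\<in>X. h ''col'' z = 0} \<union> {z\<in>X. h ''col'' z = 1}) = card {z\<in>X. h ''col'' z = 0} + card {z\<in>X. h ''col'' z = 1}"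
    using assms(3) by (intro card_Un_disjoint) auto
  ultimately have s: "card X = card {z\<in>X. h ''col'' z = 0} + card {z\<in>X. h ''col'' z = 1}" by simp
  have W1: "Suc 0 \<le> W" using assms(5) by simp
  show ?thesis
  proof (cases "2 * card {z\<in>X. h ''col'' z = 1} < card X")
    case True
    then have "wp W choose_colour Q (r, h) a \<longleftrightarrow> Q (r(''best'' := 0), h) (Suc (Suc a))"
      unfolding choose_colour_def using assms(1,2) by (simp add: mult_2)
    then show ?thesis using Q[of 0 "Suc (Suc a)"] True s by simp
  next
    case False
    then have "wp W choose_colour Q (r, h) a \<longleftrightarrow> Q (r(''best'' := 1), h) (Suc (Suc a))"
      unfolding choose_colour_def using assms(1,2) W1 by (simp add: mult_2)
    then show ?thesis using Q[of 1 "Suc (Suc a)"] False s by simp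
  qed
qed

definition filter_word :: com where
  "filter_word = for_loop ''i'' (Var ''T'') (seqs [Assign ''x'' (Get ''w'' (Var ''i'')),
    If (eq_test (Get ''col'' (Get ''ce'' (Var ''x''))) (Var ''best''))
      (seqs [Put ''e'' (Var ''N'') (Get ''ce'' (Var ''x'')), Put ''l'' (Var ''N'') (Get ''vx'' (Var ''x'')), inc ''N'']) Skip])"

lemma wp_filter_word:
  assumes r: "r ''T'' = length ws" "r ''N'' = 0" and w: "stores (h ''w'') ws" and W: "length ws \<le> W"
      "\<And>z. z \<in> set ws \<Longrightarrow> z \<le> W \<and> h ''ce'' z \<le> W \<and> h ''vx'' z \<le> W"
    and zs: "zs = filter (\<lambda>z. h ''col'' (h ''ce'' z) = r ''best'') ws"
    and Q: "\<And>r' h' t'. (\<forall>x. x \<notin> {''i'', ''x'', ''N''} \<longrightarrow> r' x = r x) \<Longrightarrow> (\<forall>x. x \<notin> {''e'', ''l''} \<longrightarrow> h' x = h x) \<Longrightarrow>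
      r' ''N'' = length zs \<Longrightarrow> stores (h' ''e'') (map (h ''ce'') zs) \<Longrightarrow> stores (h' ''l'') (map (h ''vx'') zs) \<Longrightarrow>
      t' \<le> a + 7 * length ws + 2 \<Longrightarrow> Q (r', h') t'"
  shows "wp W filter_word Q (r, h) a"
  unfolding filter_word_def
proof (rule wp_for_loop[where n = "length ws" and J = "\<lambda>j s b. \<exists>ys. ys = filter (\<lambda>z. h ''col'' (h ''ce'' z) = r ''best'') (take j ws) \<and>
    fst s ''i'' = j \<and> (\<forall>x. x \<notin> {''i'', ''x'', ''N''} \<longrightarrow> fst s x = r x) \<and> (\<forall>x. x \<notin> {''e'', ''l''} \<longrightarrow> snd s x = h x) \<and>
    fst s ''N'' = length ys \<and> stores (snd s ''e'') (map (h ''ce'') ys) \<and> stores (snd s ''l'') (map (h ''vx'') ys) \<and> b \<le> a + 1 + 7 * j"], goal_cases)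
  case 1
  then show ?case using r by simp
next
  case (2 j r' h' b)
  then show ?case using r by auto
next
  case (3 j r' h' b)
  note j = 3(1)
  define ys where "ys = filter (\<lambda>z. h ''col'' (h ''ce'' z) = r ''best'') (take j ws)"
  have I: "r' ''i'' = j" "\<And>x. x \<notin> {''i'', ''x'', ''N''} \<Longrightarrow> r' x = r x" "\<And>x. x \<notin> {''e'', ''l''} \<Longrightarrow> h' x = h x"
    "r' ''N'' = length ys" "stores (h' ''e'') (map (h ''ce'') ys)" "stores (h' ''l'') (map (h ''vx'') ys)" "b \<le> a + 1 + 7 * j"
    using 3(2) unfolding ys_def by auto
  have arr: "h' ''w'' = h ''w''" "h' ''ce'' = h ''ce''" "h' ''vx'' = h ''vx''" "h' ''col'' = h ''col''" "r' ''best'' = r ''best''"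
    using I(2,3) by simp_all
  define x where "x = ws ! j"
  have x: "h ''w'' j = x" "x \<in> set ws" using w j unfolding x_def stores_def by simp_all
  have xW: "x \<le> W" "h ''ce'' x \<le> W" "h ''vx'' x \<le> W" using W(2)[OF x(2)] by auto
  have ysS: "filter (\<lambda>z. h ''col'' (h ''ce'' z) = r ''best'') (take (Suc j) ws) = ys @ (if h ''col'' (h ''ce'' x) = r ''best'' then [x] else [])"
    unfolding ys_def x_def by (simp add: take_Suc_conv_app_nth[OF j])
  show ?case
  proof (cases "h ''col'' (h ''ce'' x) = r ''best''")
    case True
    have len: "length ys \<le> j" unfolding ys_def using j by (metis length_filter_le length_take min.absorb4)
    have s: "stores ((h' ''e'')(length ys := h ''ce'' x)) (map (h ''ce'') ys @ [h ''ce'' x])"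
      "stores ((h' ''l'')(length ys := h ''vx'' x)) (map (h ''vx'') ys @ [h ''vx'' x])"
      using stores_snoc[OF I(5)] stores_snoc[OF I(6)] by simp_all
    have "Suc (length ys) \<le> W" using len j W(1) by simp
    then show ?thesis using I(1-4,7) arr x(1) xW True s unfolding ysS by simp
  next
    case False
    then have F: "h ''col'' (h ''ce'' x) < r ''best'' \<or> r ''best'' < h ''col'' (h ''ce'' x)" by linarith
    show ?thesis unfolding ysS by (rule disjE[OF F]) (use I arr x(1) xW False in simp_all)
  qed
next
  case (4 r' h' b)
  then show ?case using zs by (intro Q) auto
qed (use W in simp)

context end_word_loc
begin

lemma set_active_step:
  assumes t: "t < T" shows "x \<in> set (active (Suc t)) \<longleftrightarrow> (x \<in> set (active t)) \<noteq> (e t = x)"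
proof -
  have inX: "e t \<in> X" using wordD(5)[OF t] .
  have mem: "e t \<in> set (active t) \<longleftrightarrow> fi (e t) < t \<and> t \<le> la (e t)" using set_active[of t] t inX by simp
  show ?thesis
  proof (cases "t = fi (e t)")
    case True
    have "active (Suc t) = active t @ [e t]" unfolding active.simps by (rule if_P[OF True])
    moreover have "e t \<notin> set (active t)" unfolding mem using True by (metis less_irrefl)
    ultimately show ?thesis by auto
  next
    case False
    have "active (Suc t) = filter (\<lambda>y. y \<noteq> e t) (active t)" unfolding active.simps by (rule if_not_P[OF False])
    moreover have "t = la (e t)" using wordD(6)[OF t] False by blast
    then have "e t \<in> set (active t)" unfolding mem using wordD(1)[OF inX] by (metis order_refl)
    ultimately show ?thesis by auto
  qed
qed

lemma active_T: "active T = []"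
proof -
  have "set (active T) = {}" unfolding set_active[OF order_refl] using wordD(2) by (auto simp: not_le)
  then show ?thesis by simp
qed

lemma inj_ends: "inj_on fi X" "inj_on la X"
  by (intro inj_onI; metis wordD(3,4))+

lemma fi_la: "x \<in> X \<Longrightarrow> y \<in> X \<Longrightarrow> fi x \<noteq> la y"
  by (metis wordD(1,3,4) less_irrefl)

lemma T_card: assumes "finite X" shows "T = 2 * card X"
proof -
  have "{..<T} = fi ` X \<union> la ` X"
  proof
    show "{..<T} \<subseteq> fi ` X \<union> la ` X"
    proof
      fix t assume "t \<in> {..<T}"
      then have "e t \<in> X" "t = fi (e t) \<or> t = la (e t)" using wordD(5,6) by auto
      then show "t \<in> fi ` X \<union> la ` X" by (metis UnI1 UnI2 imageI)
    qed
    show "fi ` X \<union> la ` X \<subseteq> {..<T}" using wordD(1,2) by (auto intro: less_trans)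
  qed
  moreover have "fi ` X \<inter> la ` X = {}" using fi_la by auto
  ultimately have "card {..<T} = card (fi ` X) + card (la ` X)" using assms by (simp add: card_Un_disjoint)
  then show ?thesis using inj_ends by (simp add: card_image)
qed

end

section \<open>The subdivided polygon: faces, weights and boundary lengths\<close>

text \<open>\<open>l t\<close> is the vertex of end t, given as a position on the Hamilton cycle;
  \<open>ca x\<close> and \<open>cb x\<close> are the two end vertices of chord x. \<open>X\<close>
  is the colour class kept.\<close>

locale polygon = end_word_loc T X e fi la for T X e fi la +
  fixes n :: nat and l ca cb :: "nat \<Rightarrow> nat"
  assumes T_pos: "0 < T" and finX: "finite X"
    and l_mono: "t \<le> t' \<Longrightarrow> t' < T \<Longrightarrow> l t \<le> l t'"
    and l_ends: "x \<in> X \<Longrightarrow> l (fi x) = ca x" "x \<in> X \<Longrightarrow> l (la x) = cb x"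
    and chord: "x \<in> X \<Longrightarrow> ca x + 2 \<le> cb x" "x \<in> X \<Longrightarrow> cb x + 2 \<le> ca x + n" "x \<in> X \<Longrightarrow> cb x < n"
    and chord_inj: "x \<in> X \<Longrightarrow> y \<in> X \<Longrightarrow> ca x = ca y \<Longrightarrow> cb x = cb y \<Longrightarrow> x = y"
    and not_interlaced: "x \<in> X \<Longrightarrow> y \<in> X \<Longrightarrow> \<not> interlaced fi la x y"
begin

abbreviation "L \<equiv> int T"

definition ps :: "int \<Rightarrow> nat" where "ps i = nat (i mod L)"

definition ei where "ei i = e (ps i)"

definition mi where "mi i = (if ps i = fi (ei i) then i + (int (la (ei i)) - int (fi (ei i)))
    else i + L - (int (la (ei i)) - int (fi (ei i))))"

text \<open>A face is identified with the set of chords that are open there, that is, the chords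
  separating it from the face at place 0.\<close>

definition vi where "vi i = set (active (ps i))"

lemma ps_less: "ps i < T" unfolding ps_def using T_pos by (simp add: nat_less_iff)

lemma ps_int: "int (ps i) = i mod L" unfolding ps_def using T_pos by simp

lemma decomp: "i = L * (i div L) + int (ps i)" by (simp add: ps_int)

lemma ps_per: "ps (i + L) = ps i" unfolding ps_def by simp

lemma ps_eqI: "i = L * q + int t \<Longrightarrow> t < T \<Longrightarrow> ps i = t"
  unfolding ps_def by simp

lemma div_eqI: "i = L * q + int t \<Longrightarrow> t < T \<Longrightarrow> i div L = q"
  by simp

lemma ei_in: "ei i \<in> X" unfolding ei_def using wordD(5)[OF ps_less] .

lemma cases_open:
  obtains (fst_end) "ps i = fi (ei i)" "mi i = i + (int (la (ei i)) - int (fi (ei i)))" "ps (mi i) = la (ei i)" "mi i div L = i div L"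
  | (snd_end) "ps i = la (ei i)" "mi i = i + L - (int (la (ei i)) - int (fi (ei i)))" "ps (mi i) = fi (ei i)" "mi i div L = i div L + 1"
proof (cases "ps i = fi (ei i)")
  case True
  have m: "mi i = i + (int (la (ei i)) - int (fi (ei i)))" unfolding mi_def using True by simp
  then have "mi i = L * (i div L) + int (la (ei i))" using decomp[of i] arg_cong[OF True, of int] by linarith
  then have "ps (mi i) = la (ei i)" "mi i div L = i div L" using wordD(2)[OF ei_in[of i]] ps_eqI by simp_all
  then show thesis using fst_end True m by blast
next
  case False
  have p: "ps i = la (ei i)" using wordD(6)[OF ps_less[of i]] False unfolding ei_def by blast
  have m: "mi i = i + L - (int (la (ei i)) - int (fi (ei i)))" unfolding mi_def using False by simp
  then have e: "mi i = L * (i div L + 1) + int (fi (ei i))"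
    unfolding distrib_left using decomp[of i] arg_cong[OF p, of int] by linarith
  have "fi (ei i) < T" using wordD(1,2)[OF ei_in[of i]] by simp
  then have "ps (mi i) = fi (ei i)" "mi i div L = i div L + 1" unfolding e using ps_eqI[OF refl] by simp_all
  then show thesis using snd_end p m by blast
qed

lemma mi_range: "i < mi i" "mi i < i + L"
proof -
  have "fi (ei i) < la (ei i)" "la (ei i) < T" using wordD(1,2)[OF ei_in[of i]] .
  then show "i < mi i" "mi i < i + L" by (cases i rule: cases_open; simp)+
qed

lemma ei_mi: "ei (mi i) = ei i"
proof -
  have "e (ps (mi i)) = ei i" by (cases i rule: cases_open) (metis wordD(3,4) ei_in)+
  then show ?thesis unfolding ei_def[of "mi i"] .
qed

lemma same_ps: assumes a: "ps i = ps j" "\<bar>i - j\<bar> < L" shows "i = j"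
proof -
  have "i mod L = j mod L" using a(1) ps_int by metis
  then have "L dvd i - j" by (simp add: mod_eq_dvd_iff)
  then show ?thesis using dvd_imp_le_int[of "i - j" L] a(2) by (cases "i = j") auto
qed

lemma polygon_circular: "circular_word ei L mi vi"
proof
  show "0 < L" using T_pos by simp
  show "i < mi i" "mi i < i + L" for i by (rule mi_range)+
  show "ei (mi i) = ei i" for i by (rule ei_mi)
  show "ei (i + L) = ei i" for i unfolding ei_def ps_per ..
  show "vi (i + L) = vi i" for i unfolding vi_def ps_per ..
  show "j = mi i" if eq: "ei j = ei i" and ij: "i < j" "j < i + L" for i j
  proof -
    have "ps j \<noteq> ps i" using same_ps[of j i] ij by auto
    moreover have "ps j = fi (ei i) \<or> ps j = la (ei i)" using wordD(6)[OF ps_less[of j]] eq unfolding ei_def by metis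
    ultimately have "ps j = ps (mi i)" by (cases i rule: cases_open) auto
    then show ?thesis using same_ps[of j "mi i"] ij mi_range[of i] by (simp add: abs_less_iff)
  qed
  show "x \<in> vi (i + 1) \<longleftrightarrow> (x \<in> vi i) \<noteq> (ei i = x)" for x i
  proof (cases "Suc (ps i) < T")
    case True
    have "i + 1 = L * (i div L) + int (Suc (ps i))" using decomp[of i] by linarith
    then have "ps (i + 1) = Suc (ps i)" using True by (rule ps_eqI)
    then show ?thesis unfolding vi_def ei_def using set_active_step[OF ps_less[of i]] by simp
  next
    case False
    then have S: "Suc (ps i) = T" using ps_less[of i] by simp
    have "int (ps i) + 1 = L" using S by simp
    then have "i + 1 = L * (i div L + 1) + int 0"
      unfolding distrib_left using decomp[of i] by linarith
    then have "ps (i + 1) = 0" using T_pos by (rule ps_eqI)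
    then show ?thesis unfolding vi_def ei_def using set_active_step[OF ps_less[of i], of x] S active_T by simp
  qed
  show "\<not> mi j < i + L" if o: "i < j" "j < mi i" "mi i < mi j" for i j
  proof
    assume a: "mi j < i + L"
    \<comment> \<open>\<open>j\<close> lies in the period of \<open>i\<close> or in the next one,
      and each of the two places is a first or a last end. Every combination is either
      arithmetically impossible or an interlacing of the two chords.\<close>
    let ?x = "ei i" and ?y = "ei j"
    have xy: "?x \<in> X" "?y \<in> X" by (rule ei_in)+
    note w = wordD(1)[OF xy(1)] wordD(2)[OF xy(1)] wordD(1)[OF xy(2)] wordD(2)[OF xy(2)]
    have ni: "\<not> interlaced fi la ?x ?y" "\<not> interlaced fi la ?y ?x" using not_interlaced xy by auto
    have dl: "i div L \<le> j div L" using o(1) T_pos by (intro zdiv_mono1) auto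
    have "j div L \<le> (i + L) div L" using o a mi_range[of j] T_pos by (intro zdiv_mono1) auto
    then have du: "j div L \<le> i div L + 1" using T_pos by simp
    have "j div L = i div L \<or> j div L = i div L + 1" using dl du by linarith
    then have dj: "L * (j div L) = L * (i div L) \<or> L * (j div L) = L * (i div L) + L" by (auto simp: algebra_simps)
    define D where "D = L * (i div L)"
    have di: "i = D + int (ps i)" and j_dec: "j = D + int (ps j) \<or> j = D + L + int (ps j)"
      using decomp[of i] decomp[of j] dj unfolding D_def by linarith+
    have w: "int (fi ?x) < int (la ?x)" "int (la ?x) < L" "int (fi ?y) < int (la ?y)" "int (la ?y) < L" using w by simp_all
    have inter: "interlaced fi la a b" if "int (fi a) < int (fi b)" "int (fi b) < int (la a)" "int (la a) < int (la b)" for a b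
      using that unfolding interlaced_def by simp
    show False
    proof (cases i rule: cases_open)
      case fst_end
      note fi = this
      have pi: "int (ps i) = int (fi ?x)" using fi(1) by simp
      show False
      proof (cases j rule: cases_open)
        case fst_end
        have pj: "int (ps j) = int (fi ?y)" using fst_end(1) by simp
        from j_dec show False
        proof
          assume "j = D + int (ps j)"
          then have "interlaced fi la ?x ?y" using di pi pj fst_end(2) fi(2) o a by (intro inter) linarith+
          then show False using ni by simp
        qed (use di pi pj fst_end(2) fi(2) o a w in linarith)
      next
        case snd_end
        have pj: "int (ps j) = int (la ?y)" using snd_end(1) by simp
        from j_dec show False
        proof
          assume "j = D + int (ps j)"
          then have "interlaced fi la ?y ?x" using di pi pj snd_end(2) fi(2) o a by (intro inter) linarith+
          then show False using ni by simp
        qed (use di pi pj snd_end(2) fi(2) o a w in linarith)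
      qed
    next
      case snd_end
      note fi = this
      have pi: "int (ps i) = int (la ?x)" using fi(1) by simp
      show False
      proof (cases j rule: cases_open)
        case fst_end
        have pj: "int (ps j) = int (fi ?y)" using fst_end(1) by simp
        from j_dec show False
        proof
          assume "j = D + L + int (ps j)"
          then have "interlaced fi la ?y ?x" using di pi pj fst_end(2) fi(2) o a by (intro inter) linarith+
          then show False using ni by simp
        qed (use di pi pj fst_end(2) fi(2) o a w in linarith)
      next
        case snd_end
        have pj: "int (ps j) = int (la ?y)" using snd_end(1) by simp
        from j_dec show False
        proof
          assume "j = D + int (ps j)"
          then have "interlaced fi la ?x ?y" using di pi pj snd_end(2) fi(2) o a by (intro inter) linarith+
          then show False using ni by simp
        qed (use di pi pj snd_end(2) fi(2) o a w in linarith)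
      qed
    qed
  qed
qed

sublocale circular_word ei L mi vi by (rule polygon_circular)

sublocale tour: tree_tour L mi vi by (rule tree_tour)

lemma card_faces_X: "int (card tour.faces) = int (card X) + 1"
  using tour.L_card_faces T_card[OF finX] by simp

definition loc :: "int \<Rightarrow> int" where "loc i = int (l (ps i)) + int n * (i div L)"

lemma loc_per: "loc (i + L) = loc i + int n"
  unfolding loc_def ps_per using T_pos by (simp add: algebra_simps)

lemma loc_Suc: "loc i \<le> loc (i + 1)"
proof (cases "Suc (ps i) < T")
  case True
  have "i + 1 = L * (i div L) + int (Suc (ps i))" using decomp[of i] by linarith
  then have "ps (i + 1) = Suc (ps i)" "(i + 1) div L = i div L" using True by (rule ps_eqI, rule div_eqI)
  then show ?thesis unfolding loc_def using l_mono[of "ps i" "Suc (ps i)"] True by simp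
next
  case False
  then have S: "Suc (ps i) = T" using ps_less[of i] by simp
  have "int (ps i) + 1 = L" using S by simp
  then have e: "i + 1 = L * (i div L + 1) + int 0"
      unfolding distrib_left using decomp[of i] by linarith
  then have d: "(i + 1) div L = i div L + 1" using T_pos by simp
  have "e (ps i) \<in> X" "ps i = fi (e (ps i)) \<or> ps i = la (e (ps i))" using wordD(5,6)[OF ps_less] by auto
  then have "l (ps i) \<le> n" using l_ends[of "e (ps i)"] chord(1,3)[of "e (ps i)"] by (metis add_leD1 less_imp_le order_trans)
  then show ?thesis unfolding loc_def d by (simp add: algebra_simps)
qed

lemma loc_mono: "i \<le> j \<Longrightarrow> loc i \<le> loc j"
proof (induction j rule: int_ge_induct)
  case (step j) then show ?case using loc_Suc[of j] by simp
qed simp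

lemma loc_mi: "loc i + 2 \<le> loc (mi i)"
proof (cases i rule: cases_open)
  case fst_end
  then show ?thesis unfolding loc_def using l_ends[OF ei_in[of i]] chord[OF ei_in[of i]] by simp
next
  case snd_end
  then show ?thesis unfolding loc_def using l_ends[OF ei_in[of i]] chord[OF ei_in[of i]] by (simp add: algebra_simps)
qed

text \<open>The number of Hamilton edges walked along face \<open>vi i\<close> between the ends
  \<open>i - 1\<close> and \<open>i\<close>.\<close>

definition gap where "gap i = loc i - loc (i - 1)"

lemma gap_nonneg: "0 \<le> gap i" unfolding gap_def using loc_Suc[of "i - 1"] by simp

lemma gap_per: "gap (i + L) = gap i" unfolding gap_def using loc_per[of i] loc_per[of "i - 1"] by (simp add: algebra_simps)

definition occ where "occ f i j = {t\<in>{i..<j}. vi t = f}"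

lemma finite_occ [simp]: "finite (occ f i j)"
  unfolding occ_def by (rule finite_subset[of _ "{i..<j}"]) auto

text \<open>Each visit contributes \<open>gap t\<close> Hamilton edges and the chord at which it
  ends, so the sum is the number of sides of the face. Two is subtracted to make the quantity
  additive under gluing along a chord.\<close>

definition cw where "cw f = (\<Sum>t\<in>occ f 0 L. 1 + gap t) - 2"

lemma sum_occ_shift: "(\<Sum>t\<in>occ f x (x + L). 1 + gap t) = cw f + 2"
proof -
  have gm: "gap (i mod L) = gap i" for i
    using tour.per_mult[of gap, OF gap_per, of i "- (i div L)"] by (simp add: minus_div_mult_eq_mod)
  have "(\<Sum>t\<in>occ f x (x + L). 1 + gap t) = (\<Sum>t\<in>occ f 0 L. 1 + gap t)"
  proof (rule sum.reindex_bij_witness[where j = "\<lambda>t. t mod L" and i = "\<lambda>t. x + (t - x) mod L"])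
    fix t assume t: "t \<in> occ f x (x + L)"
    then show "x + (t mod L - x) mod L = t" unfolding occ_def by (auto simp: mod_diff_left_eq)
    show "t mod L \<in> occ f 0 L" using t T_pos unfolding occ_def by (simp add: tour.v_mod)
    show "1 + gap (t mod L) = 1 + gap t" using gm by simp
  next
    fix t assume t: "t \<in> occ f 0 L"
    then show "(x + (t - x) mod L) mod L = t" unfolding occ_def by (auto simp: mod_add_right_eq)
    have "vi (x + (t - x) mod L) = vi ((x + (t - x) mod L) mod L)" by (simp add: tour.v_mod)
    also have "(x + (t - x) mod L) mod L = t mod L" by (simp add: mod_add_right_eq)
    finally have "vi (x + (t - x) mod L) = vi t" by (simp add: tour.v_mod)
    then show "x + (t - x) mod L \<in> occ f x (x + L)" using t T_pos unfolding occ_def by simp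
  qed
  then show ?thesis unfolding cw_def by simp
qed

lemma sum_gap: "x \<le> y \<Longrightarrow> (\<Sum>t\<in>{x..<y}. gap t) = loc (y - 1) - loc (x - 1)"
proof (induction y rule: int_ge_induct)
  case (step y)
  have "{x..<y + 1} = insert y {x..<y}" using step(1) by auto
  then show ?case using step unfolding gap_def by simp
qed simp

lemma sum_cw: "sum cw tour.faces = int n - 2"
proof -
  have "(\<Sum>f\<in>tour.faces. \<Sum>t\<in>occ f 0 L. 1 + gap t) = (\<Sum>t\<in>{0..<L}. 1 + gap t)"
    unfolding occ_def by (rule sum.group) auto
  also have "\<dots> = L + (loc (L - 1) - loc (- 1))" using sum_gap[of 0 L] by (simp add: sum.distrib)
  also have "loc (L - 1) = loc (- 1) + int n" using loc_per[of "- 1"] by simp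
  finally have "(\<Sum>f\<in>tour.faces. \<Sum>t\<in>occ f 0 L. 1 + gap t) = L + int n" by simp
  moreover have "sum cw tour.faces = (\<Sum>f\<in>tour.faces. \<Sum>t\<in>occ f 0 L. 1 + gap t) - 2 * int (card tour.faces)"
    unfolding cw_def by (simp add: sum_subtractf)
  ultimately show ?thesis using tour.L_card_faces by simp
qed

lemma cw_ge:
  assumes "S \<subseteq> occ f x (x + L)" shows "(\<Sum>t\<in>S. 1 + gap t) \<le> cw f + 2"
  unfolding sum_occ_shift[symmetric, of f x]
  by (rule sum_mono2) (use assms gap_nonneg in \<open>auto intro: add_nonneg_nonneg\<close>)

text \<open>Every face has at least three sides. If the tour visits it once, its only chord is no
  Hamilton edge and spans at least two of them; if twice, its two chords are not parallel; three
  visits already give three chords.\<close>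

lemma cw_pos: assumes "f \<in> tour.faces" shows "1 \<le> cw f"
proof -
  obtain t where f: "f = vi t" using assms unfolding tour.faces_def by (elim imageE)
  define t1 where "t1 = mi t + 1"
  have v1: "vi t1 = f" unfolding t1_def f by (rule v_next)
  have t1: "t < t1" "t1 \<le> t + L" unfolding t1_def using mi_range[of t] by auto
  show ?thesis
  proof (cases "t1 = t + L")
    case True
    then have "mi t = (t - 1) + L" unfolding t1_def by simp
    then have "mi (mi t) = mi (t - 1) + L" using m_per by simp
    then have "mi (t - 1) = t" using m_m[of t] by simp
    then have "2 \<le> gap t" using loc_mi[of "t - 1"] unfolding gap_def by simp
    moreover have "{t} \<subseteq> occ f t (t + L)" unfolding occ_def using f T_pos by simp
    then have "1 + gap t \<le> cw f + 2" using cw_ge[of "{t}" f t] by simp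
    ultimately show ?thesis by simp
  next
    case False
    then have t1L: "t1 < t + L" using t1 by simp
    define t2 where "t2 = mi t1 + 1"
    have v2: "vi t2 = f" unfolding t2_def v_next v1 ..
    have "t1 < t2" unfolding t2_def using mi_range[of t1] by simp
    have "t2 \<le> t + L"
    proof (rule ccontr)
      assume "\<not> t2 \<le> t + L"
      then have "vi (t + L) \<noteq> vi t1" using tour.v_neq[of t1 "t + L"] t1L unfolding t2_def by simp
      then show False using v1 f v_per by simp
    qed
    show ?thesis
    proof (cases "t2 = t + L")
      case True
      \<comment> \<open>If both gaps vanished, the two chords of the face would have the same end
        vertices and coincide by \<open>chord_inj\<close>.\<close>
      have "1 \<le> gap t + gap t1"
      proof (rule ccontr)
        assume "\<not> 1 \<le> gap t + gap t1"
        then have g: "gap t = 0" "gap t1 = 0" using gap_nonneg[of t] gap_nonneg[of t1] by linarith+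
        have l1: "loc t1 = loc (mi t)" using g(2) unfolding gap_def t1_def by simp
        have "gap (t + L) = 0" using g(1) gap_per by simp
        moreover have "t + L - 1 = mi t1" using True unfolding t2_def by simp
        ultimately have l2: "loc (mi t1) = loc t + int n" unfolding gap_def using loc_per[of t] by simp
        have ends: "loc i mod int n = int (l (ps i))" for i
        proof -
          have "e (ps i) \<in> X" "ps i = fi (e (ps i)) \<or> ps i = la (e (ps i))" using wordD(5,6)[OF ps_less] by auto
          then have "l (ps i) < n" using l_ends[of "e (ps i)"] chord(1,3)[of "e (ps i)"] by (metis add_leD1 le_less_trans)
          then show ?thesis unfolding loc_def by simp
        qed
        have e1: "l (ps t1) = l (ps (mi t))" using ends[of t1] ends[of "mi t"] l1 by simp
        have e2: "l (ps (mi t1)) = l (ps t)" using ends[of "mi t1"] ends[of t] l2 by simp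
        have "ca (ei t1) = ca (ei t) \<and> cb (ei t1) = cb (ei t)"
          using e1 e2 l_ends[OF ei_in[of t]] l_ends[OF ei_in[of t1]] chord(1)[OF ei_in[of t]] chord(1)[OF ei_in[of t1]]
          by (cases t rule: cases_open; cases t1 rule: cases_open) simp_all
        then have "ei t1 = ei t" using chord_inj ei_in by blast
        then have "t1 = mi t" using e_eqD[of t1 t] t1 t1L by simp
        then show False unfolding t1_def by simp
      qed
      moreover have "{t, t1} \<subseteq> occ f t (t + L)" unfolding occ_def using f v1 t1 t1L T_pos by simp
      then have "(1 + gap t) + (1 + gap t1) \<le> cw f + 2" using cw_ge[of "{t, t1}" f t] t1 by simp
      ultimately show ?thesis by simp
    next
      case False
      then have "{t, t1, t2} \<subseteq> occ f t (t + L)" unfolding occ_def using f v1 v2 t1 t1L T_pos \<open>t1 < t2\<close> \<open>t2 \<le> t + L\<close> by auto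
      then have "(1 + gap t) + ((1 + gap t1) + (1 + gap t2)) \<le> cw f + 2" using cw_ge[of "{t, t1, t2}" f t] t1 \<open>t1 < t2\<close> by simp
      then show ?thesis using gap_nonneg[of t] gap_nonneg[of t1] gap_nonneg[of t2] by linarith
    qed
  qed
qed

text \<open>The total is \<open>n - 2\<close> and each of the other \<open>card X\<close> faces
  weighs at least one. This provides the bound of a single weight by \<open>k\<close> in the double
  count.\<close>

lemma cw_le: assumes "f \<in> tour.faces" shows "cw f \<le> int n - 2 - int (card X)"
proof -
  have "(\<Sum>f\<in>tour.faces - {f}. 1) \<le> sum cw (tour.faces - {f})" by (intro sum_mono) (auto intro: cw_pos)
  moreover have "sum cw tour.faces = cw f + sum cw (tour.faces - {f})" using assms by (intro sum.remove) auto
  moreover have "int (card (tour.faces - {f})) = int (card X)" using assms card_faces_X by simp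
  ultimately show ?thesis using sum_cw by simp
qed

text \<open>The positions met by a walk from \<open>loc (t - 1)\<close> to \<open>loc E\<close> that
  shortcuts along chords with both ends in \<open>t..E\<close>: those not strictly underneath such a
  chord. The start itself is left out.\<close>

definition unc where
  "unc t E = {p\<in>{loc (t - 1)<..loc E}. \<not> (\<exists>s. t \<le> s \<and> mi s \<le> E \<and> loc s < p \<and> p < loc (mi s))}"

lemma finite_unc [simp]: "finite (unc t E)"
  unfolding unc_def by (rule finite_subset[of _ "{loc (t - 1)<..loc E}"]) auto

text \<open>The chord at \<open>t\<close> has its other end beyond the range, so it covers nothing
  and only the gap in front of \<open>t\<close> is walked.\<close>

lemma unc_skip:
  assumes "t \<le> E" "E < mi t" shows "int (card (unc t E)) = gap t + int (card (unc (t + 1) E))"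
proof -
  have "unc t E = {loc (t - 1)<..loc t} \<union> unc (t + 1) E"
  proof (rule set_eqI)
    fix p
    have A: "(\<exists>s. t \<le> s \<and> mi s \<le> E \<and> loc s < p \<and> p < loc (mi s)) \<longleftrightarrow> (\<exists>s. t + 1 \<le> s \<and> mi s \<le> E \<and> loc s < p \<and> p < loc (mi s))"
      using assms(2) by (metis add1_zle_eq le_less not_le)
    have B: "loc t < p" if "t \<le> s" "loc s < p" for s using loc_mono[OF that(1)] that(2) by simp
    show "p \<in> unc t E \<longleftrightarrow> p \<in> {loc (t - 1)<..loc t} \<union> unc (t + 1) E"
      unfolding unc_def using A B loc_mono[of "t - 1" t] loc_mono[OF assms(1)] by auto
  qed
  moreover have "{loc (t - 1)<..loc t} \<inter> unc (t + 1) E = {}" unfolding unc_def by auto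
  ultimately show ?thesis using loc_Suc[of "t - 1"] unfolding gap_def by (simp add: card_Un_disjoint)
qed

text \<open>Chords starting underneath the one at \<open>t\<close> also end there, so the chord at
  \<open>t\<close> is outermost. It contributes its far end, and nothing in between is met.\<close>

lemma unc_jump:
  assumes "mi t \<le> E" "E < t + L" shows "int (card (unc t E)) = gap t + 1 + int (card (unc (mi t + 1) E))"
proof -
  have lt: "loc t + 2 \<le> loc (mi t)" by (rule loc_mi)
  have inner: "mi s < mi t" if s: "t < s" "s < mi t" "mi s \<le> E" for s
  proof -
    have "\<not> mi t < mi s" using noncrossing[OF s(1,2)] s(3) assms(2) by auto
    moreover have "mi s \<noteq> mi t" using m_m[of s] m_m[of t] s(1) by auto
    ultimately show ?thesis by simp
  qed
  have "unc t E = ({loc (t - 1)<..loc t} \<union> {loc (mi t)}) \<union> unc (mi t + 1) E"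
  proof (rule set_eqI)
    fix p
    consider "p \<le> loc t" | "loc t < p" "p < loc (mi t)" | "p = loc (mi t)" | "loc (mi t) < p" by linarith
    then show "p \<in> unc t E \<longleftrightarrow> p \<in> ({loc (t - 1)<..loc t} \<union> {loc (mi t)}) \<union> unc (mi t + 1) E"
    proof cases
      case 1
      have "\<not> loc s < p" if "t \<le> s" for s using loc_mono[OF that] 1 by simp
      then show ?thesis unfolding unc_def using 1 lt loc_mono[OF assms(1)] by auto
    next
      case 2
      then show ?thesis unfolding unc_def using assms(1) by auto
    next
      case 3
      have "\<not> (loc s < p \<and> p < loc (mi s))" if s: "t \<le> s" "mi s \<le> E" for s
      proof
        assume a: "loc s < p \<and> p < loc (mi s)"
        then have "s < mi t" using loc_mono[of "mi t" s] 3 by force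
        moreover have "s \<noteq> t" using a 3 by auto
        ultimately have "mi s < mi t" using inner s by simp
        then show False using loc_mono[of "mi s" "mi t"] a 3 by simp
      qed
      then show ?thesis unfolding unc_def using 3 lt loc_mono[OF assms(1)] loc_Suc[of "t - 1"] by auto
    next
      case 4
      have "mi t + 1 \<le> s" if s: "t \<le> s" "mi s \<le> E" "loc s < p" "p < loc (mi s)" for s
      proof (rule ccontr)
        assume "\<not> mi t + 1 \<le> s"
        then consider "s = t" | "t < s" "s < mi t" | "s = mi t" using s(1) by linarith
        then show False
        proof cases
          case 1 then show False using s 4 by simp
        next
          case 2
          then have "mi s < mi t" using inner s by simp
          then show False using loc_mono[of "mi s" "mi t"] s 4 by simp
        next
          case 3 then show False using s(2) m_m[of t] assms(2) by simp
        qed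
      qed
      moreover have "t \<le> s" if "mi t + 1 \<le> s" for s using that mi_range[of t] by simp
      ultimately have "(\<exists>s. t \<le> s \<and> mi s \<le> E \<and> loc s < p \<and> p < loc (mi s)) \<longleftrightarrow>
          (\<exists>s. mi t + 1 \<le> s \<and> mi s \<le> E \<and> loc s < p \<and> p < loc (mi s))" by meson
      then show ?thesis unfolding unc_def using 4 lt loc_Suc[of "t - 1"] by auto
    qed
  qed
  moreover have "({loc (t - 1)<..loc t} \<union> {loc (mi t)}) \<inter> unc (mi t + 1) E = {}" unfolding unc_def using lt by auto
  moreover have "card ({loc (t - 1)<..loc t} \<union> {loc (mi t)}) = nat (loc t - loc (t - 1)) + 1"
    using lt by (subst card_Un_disjoint) auto
  ultimately have "card (unc t E) = nat (loc t - loc (t - 1)) + 1 + card (unc (mi t + 1) E)"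
    by (metis card_Un_disjoint finite_Un finite_unc finite.emptyI finite_insert finite_greaterThanAtMost_int)
  then show ?thesis using loc_Suc[of "t - 1"] unfolding gap_def by simp
qed

lemma unc_empty: "unc (E + 1) E = {}" unfolding unc_def by simp

text \<open>Repeated use of \<open>unc_jump\<close>: between returns to the same face, every
  excursion is replaced by the one chord that leads into it, so exactly the sides of that face are
  walked.\<close>

lemma unc_orbit:
  assumes "t \<le> w" "w \<le> E + 1" "vi w = vi t" "E < t + L"
  shows "int (card (unc t E)) = (\<Sum>x\<in>occ (vi t) t w. 1 + gap x) + int (card (unc w E))"
  using assms
proof (induction "nat (w - t)" arbitrary: t rule: less_induct)
  case less
  show ?case
  proof (cases "t = w")
    case True then show ?thesis unfolding occ_def by simp
  next
    case False
    then have tw: "t < w" using less.prems by simp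
    have mw: "mi t + 1 \<le> w"
    proof (rule ccontr)
      assume "\<not> mi t + 1 \<le> w"
      then have "vi w \<noteq> vi t" using tour.v_neq[of t w] tw by simp
      then show False using less.prems by simp
    qed
    have "occ (vi t) t w = insert t (occ (vi t) (mi t + 1) w)"
    proof (rule set_eqI)
      fix x
      have "vi x \<noteq> vi t" if "t < x" "x \<le> mi t" using tour.v_neq[OF that] .
      then show "x \<in> occ (vi t) t w \<longleftrightarrow> x \<in> insert t (occ (vi t) (mi t + 1) w)"
        unfolding occ_def using mw tw mi_range[of t] by (auto simp: not_le) (metis le_less not_less zless_imp_add1_zle)+
    qed
    moreover have "t \<notin> occ (vi t) (mi t + 1) w" unfolding occ_def using mi_range[of t] by simp
    ultimately have s: "(\<Sum>x\<in>occ (vi t) t w. 1 + gap x) = 1 + gap t + (\<Sum>x\<in>occ (vi t) (mi t + 1) w. 1 + gap x)" by simp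
    have "int (card (unc t E)) = gap t + 1 + int (card (unc (mi t + 1) E))"
      using mw less.prems by (intro unc_jump) auto
    moreover have "int (card (unc (mi t + 1) E)) = (\<Sum>x\<in>occ (vi (mi t + 1)) (mi t + 1) w. 1 + gap x) + int (card (unc w E))"
      using mw less.prems v_next[of t] mi_range[of t] by (intro less.hyps) auto
    ultimately show ?thesis using s by (simp add: v_next)
  qed
qed

text \<open>The left side is the length of the boundary walk of the faces in the window: along the
  Hamilton cycle up to end \<open>j - 1\<close>, then with all shortcuts until the turn is complete.
  When the window grows into a known face the walk is unchanged; growing into a new face replaces
  the chord shared with it by the remaining sides of the face.\<close>

lemma window_size:
  assumes "i \<le> j" "j < i + L"
  shows "loc (j - 1) - loc (i - 1) + int (card (unc j (i + L - 1))) = sum cw (vi ` {i..j}) + 2"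
  using assms
proof (induction j rule: int_ge_induct)
  case base
  have "int (card (unc i (i + L - 1))) = (\<Sum>x\<in>occ (vi i) i (i + L). 1 + gap x) + int (card (unc (i + L) (i + L - 1)))"
    using T_pos v_per by (intro unc_orbit) auto
  then show ?case using sum_occ_shift[of "vi i" i] unc_empty[of "i + L - 1"] by simp
next
  case (step j)
  let ?E = "i + L - 1"
  have ins: "{i..j + 1} = insert (j + 1) {i..j}" using step by auto
  have g: "loc (j + 1 - 1) - loc (i - 1) = loc (j - 1) - loc (i - 1) + gap j" unfolding gap_def by simp
  show ?case
  proof (cases "mi j \<le> ?E")
    case False
    have u: "int (card (unc j ?E)) = gap j + int (card (unc (j + 1) ?E))" using False step by (intro unc_skip) auto
    have "mi (mi j - L) = j" using m_per[of "mi j - L"] m_m[of j] by simp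
    then have "vi (mi j - L) = vi (j + 1)" using v_next[of "mi j - L"] by simp
    moreover have "mi j - L \<in> {i..j}" using False mi_range[of j] by simp
    ultimately have "vi (j + 1) \<in> vi ` {i..j}" by (metis imageI)
    then have "vi ` {i..j + 1} = vi ` {i..j}" unfolding ins by auto
    then show ?thesis using step u g by simp
  next
    case True
    have u: "int (card (unc j ?E)) = gap j + 1 + int (card (unc (mi j + 1) ?E))" using True step by (intro unc_jump) auto
    \<comment> \<open>Without the shortcut at \<open>j\<close> the walk passes once around the new
      face, from \<open>j + 1\<close> to the other end \<open>mi j\<close>. There it goes on, since
      the partner of \<open>mi j\<close> is \<open>j + L\<close>, beyond the turn.\<close>
    have "int (card (unc (j + 1) ?E)) = (\<Sum>x\<in>occ (vi (j + 1)) (j + 1) (mi j). 1 + gap x) + int (card (unc (mi j) ?E))"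
      using True step mi_range[of j] tour.v_m[of j] by (intro unc_orbit) auto
    also have "int (card (unc (mi j) ?E)) = gap (mi j) + int (card (unc (mi j + 1) ?E))"
      using True m_m[of j] step by (intro unc_skip) auto
    also have "(\<Sum>x\<in>occ (vi (j + 1)) (j + 1) (mi j). 1 + gap x) = cw (vi (j + 1)) + 2 - (1 + gap (mi j))"
    proof -
      have "occ (vi (j + 1)) (j + 1) (j + 1 + L) = insert (mi j) (occ (vi (j + 1)) (j + 1) (mi j))"
      proof (rule set_eqI)
        fix x
        have "vi x \<noteq> vi (j + 1)" if "mi j < x" "x \<le> j + L"
          using tour.v_neq_sides[of j "j + 1" x] that mi_range[of j] by simp
        then show "x \<in> occ (vi (j + 1)) (j + 1) (j + 1 + L) \<longleftrightarrow> x \<in> insert (mi j) (occ (vi (j + 1)) (j + 1) (mi j))"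
          unfolding occ_def using mi_range[of j] tour.v_m[of j] by (cases "x \<le> mi j") (auto simp: not_le)
      qed
      moreover have "mi j \<notin> occ (vi (j + 1)) (j + 1) (mi j)" unfolding occ_def by simp
      ultimately show ?thesis using sum_occ_shift[of "vi (j + 1)" "j + 1"] by simp
    qed
    finally have u2: "int (card (unc (j + 1) ?E)) = cw (vi (j + 1)) + 1 + int (card (unc (mi j + 1) ?E))" by simp
    have "vi (j + 1) \<notin> vi ` {i..j}"
    proof
      assume "vi (j + 1) \<in> vi ` {i..j}"
      then obtain x where x: "i \<le> x" "x \<le> j" "vi (j + 1) = vi x" by auto
      have "vi (j + 1) \<noteq> vi (x + L)" using tour.v_neq_sides[of j "j + 1" "x + L"] x True mi_range[of j] by simp
      then show False using x v_per by simp
    qed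
    then have "sum cw (vi ` {i..j + 1}) = cw (vi (j + 1)) + sum cw (vi ` {i..j})" unfolding ins by simp
    then show ?thesis using step u u2 g by simp
  qed
qed

end

section \<open>Computing faces and their sizes\<close>

text \<open>\<open>fid\<close> numbers the face in front of each end, \<open>cnt\<close> counts
  sides, \<open>d\<close> is the distance to the partner end, and \<open>fo\<close> is the place of
  the first end plus one, with 0 for unseen. The last command adds the Hamilton edges from the last
  end up to position \<open>n\<close>; they belong to the face numbered 0.\<close>

definition scan_faces :: com where
  "scan_faces = Seq (for_loop ''t'' (Var ''N'') (seqs [Assign ''x'' (Get ''e'' (Var ''t'')), Assign ''y'' (Get ''fid'' (Var ''t'')),
    Put ''cnt'' (Var ''y'') (Plus (Get ''cnt'' (Var ''y'')) (Plus (Const 1) (Minus (Get ''l'' (Var ''t'')) (Var ''lst'')))),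
    Assign ''lst'' (Get ''l'' (Var ''t'')),
    If (Less (Const 0) (Get ''fo'' (Var ''x'')))
      (seqs [Assign ''s'' (Minus (Get ''fo'' (Var ''x'')) (Const 1)), Put ''d'' (Var ''s'') (Minus (Var ''t'') (Var ''s'')),
        Put ''d'' (Var ''t'') (Minus (Plus (Var ''N'') (Var ''s'')) (Var ''t'')),
        Put ''fid'' (Plus (Var ''t'') (Const 1)) (Get ''fid'' (Var ''s''))])
      (Seq (Put ''fo'' (Var ''x'') (Plus (Var ''t'') (Const 1))) (Put ''fid'' (Plus (Var ''t'') (Const 1)) (Var ''x'')))]))
    (Put ''cnt'' (Const 0) (Plus (Get ''cnt'' (Const 0)) (Minus (Var ''n'') (Var ''lst''))))"

context polygon
begin

text \<open>The innermost open chord, or 0 for the face outside all chords.\<close>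

definition fid where "fid t = last (0 # active t)"

lemma fid_0 [simp]: "fid 0 = 0" unfolding fid_def by simp

lemma fid_T [simp]: "fid T = 0" unfolding fid_def active_T by simp

lemma fid_cases:
  assumes "t \<le> T"
  obtains "active t = []" "fid t = 0" | us where "active t = us @ [fid t]" "fid t \<in> X" "fid t \<noteq> 0"
proof (cases "active t" rule: rev_cases)
  case Nil then show thesis using that(1) unfolding fid_def by simp
next
  case (snoc us x)
  then have "fid t = x" unfolding fid_def by simp
  moreover have "x \<in> set (active t)" using snoc by simp
  then have "x \<in> X" using set_active[OF assms] by blast
  moreover have "x \<noteq> 0" using \<open>x \<in> X\<close> zero by metis
  ultimately show thesis using that(2) snoc by blast
qed

lemma fid_le: assumes "t \<le> T" "\<And>z. z \<in> X \<Longrightarrow> z \<le> W" shows "fid t \<le> W"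
  by (cases rule: fid_cases[OF assms(1)]) (use assms(2) in auto)

text \<open>Without interlacing the open chords are nested, so everything below the innermost chord
  was open when it opened and still is.\<close>

lemma active_below:
  assumes t: "t \<le> T" and a: "active t = us @ [x]" shows "set us = set (active (fi x))"
proof -
  have xm: "x \<in> X" "fi x < t" "t \<le> la x" using set_active[OF t] a by auto
  have fT: "fi x \<le> T" using xm t by simp
  have so: "\<And>u. u \<in> set us \<Longrightarrow> fi u < fi x" using sorted_active[OF t] a by (simp add: sorted_wrt_append)
  have su: "u \<in> X \<and> t \<le> la u" if "u \<in> set us" for u using that set_active[OF t] a by auto
  show ?thesis
  proof
    show "set us \<subseteq> set (active (fi x))"
    proof
      fix u assume u: "u \<in> set us"
      then show "u \<in> set (active (fi x))" unfolding set_active[OF fT] using so[OF u] su[OF u] xm by simp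
    qed
    show "set (active (fi x)) \<subseteq> set us"
    proof
      fix y assume "y \<in> set (active (fi x))"
      then have y: "y \<in> X" "fi y < fi x" "fi x \<le> la y" unfolding set_active[OF fT] by auto
      have "la y \<noteq> fi x" using fi_la[OF xm(1) y(1)] by metis
      moreover have "\<not> interlaced fi la y x" using not_interlaced[OF y(1) xm(1)] .
      ultimately have "la x \<le> la y" using y unfolding interlaced_def by simp
      then have "y \<in> set (active t)" unfolding set_active[OF t] using y xm by simp
      moreover have "y \<noteq> x" using y(2) by auto
      ultimately show "y \<in> set us" using a by simp
    qed
  qed
qed

text \<open>Since by \<open>active_below\<close> the innermost chord determines the whole stack, the
  program can represent a face, a set of chords in the proof, by a single number.\<close>

lemma fid_eq_iff: assumes s: "s \<le> T" and t: "t \<le> T" shows "fid s = fid t \<longleftrightarrow> set (active s) = set (active t)"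
proof (cases rule: fid_cases[OF s])
  case 1
  show ?thesis by (cases rule: fid_cases[OF t]) (use 1 in simp_all)
next
  case s: (2 us)
  show ?thesis
  proof (cases rule: fid_cases[OF t])
    case 1 then show ?thesis using s by simp
  next
    case t: (2 vs)
    have A: "set us = set (active (fi (fid s)))" "set vs = set (active (fi (fid t)))"
      using active_below[OF assms(1) s(1)] active_below[OF assms(2) t(1)] .
    have sets: "set (active s) = insert (fid s) (set us)" "set (active t) = insert (fid t) (set vs)"
      using arg_cong[OF s(1), of set] arg_cong[OF t(1), of set] by simp_all
    have so: "\<And>u. u \<in> set us \<Longrightarrow> fi u < fi (fid s)" "\<And>u. u \<in> set vs \<Longrightarrow> fi u < fi (fid t)"
      using sorted_active[OF assms(1)] sorted_active[OF assms(2)] s(1) t(1) by (metis UnCI set_append sorted_wrt_append list.set_intros(1))+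
    show ?thesis
    proof
      assume "fid s = fid t"
      then show "set (active s) = set (active t)" using A sets by simp
    next
      assume eq: "set (active s) = set (active t)"
      have c: "fid s = fid t \<or> fid s \<in> set vs" "fid t = fid s \<or> fid t \<in> set us" using eq sets by blast+
      have "fi (fid s) \<le> fi (fid t)" using c(1) by (rule disjE) (simp, rule less_imp_le[OF so(2)])
      moreover have "fi (fid t) \<le> fi (fid s)" using c(2) by (rule disjE) (simp, rule less_imp_le[OF so(1)])
      ultimately have "fi (fid s) = fi (fid t)" by simp
      then show "fid s = fid t" using inj_onD[OF inj_ends(1) _ s(2) t(2)] by blast
    qed
  qed
qed

lemma ps_of: "t < T \<Longrightarrow> ps (int t) = t" using ps_eqI[of "int t" 0 t] by simp

lemma vi_of: "t < T \<Longrightarrow> vi (int t) = set (active t)" unfolding vi_def by (simp add: ps_of)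

lemma fid_open: assumes "t < T" "t = fi (e t)" shows "fid (Suc t) = e t"
proof -
  have "active (Suc t) = active t @ [e t]" unfolding active.simps by (rule if_P[OF assms(2)])
  then show ?thesis unfolding fid_def by simp
qed

lemma fid_close: assumes x: "x \<in> X" shows "fid (Suc (la x)) = fid (fi x)"
proof -
  have lt: "fi x < la x" "la x < T" using wordD(1,2)[OF x] .
  have f: "fi x < T" using lt by simp
  have ex: "e (fi x) = x" using wordD(3)[OF x] .
  have pf: "ps (int (fi x)) = fi x" using ps_of[OF f] .
  have m: "mi (int (fi x)) = int (la x)" unfolding mi_def ei_def pf ex using lt by simp
  have v: "vi (int (la x) + 1) = vi (int (fi x))" using v_next[of "int (fi x)"] unfolding m .
  show ?thesis
  proof (cases "Suc (la x) < T")
    case True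
    have "int (la x) + 1 = int (Suc (la x))" by simp
    then have "vi (int (Suc (la x))) = vi (int (fi x))" using v by metis
    then have "set (active (Suc (la x))) = set (active (fi x))" unfolding vi_of[OF True] vi_of[OF f] .
    then show ?thesis using fid_eq_iff[of "Suc (la x)" "fi x"] True f by simp
  next
    case False
    then have S: "Suc (la x) = T" using lt by simp
    have "int (la x) + 1 = L * 1 + int 0" using S by simp
    then have "ps (int (la x) + 1) = 0" using T_pos by (rule ps_eqI)
    then have "set (active (fi x)) = {}" using v unfolding vi_def pf by simp
    then have "set (active (fi x)) = set (active T)" unfolding active_T by simp
    then have "fid (fi x) = fid T" using fid_eq_iff[of "fi x" T] f by simp
    then show ?thesis unfolding S by simp
  qed
qed

definition dist where "dist t = (if t = fi (e t) then la (e t) - fi (e t) else T + fi (e t) - la (e t))"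

lemma mi_dist: "mi i = i + int (dist (ps i))"
proof -
  have w: "fi (ei i) < la (ei i)" "la (ei i) < T" using wordD(1,2)[OF ei_in] .
  show ?thesis unfolding mi_def dist_def ei_def[symmetric] using w by simp
qed

lemma dist_first: "x \<in> X \<Longrightarrow> dist (fi x) = la x - fi x"
  unfolding dist_def by (simp add: wordD(3))

lemma dist_last: assumes x: "x \<in> X" shows "dist (la x) = T + fi x - la x"
proof -
  have "la x \<noteq> fi (e (la x))" using wordD(1)[OF x] wordD(4)[OF x] by simp
  then show ?thesis unfolding dist_def by (simp add: wordD(4)[OF x])
qed

lemma l_less: assumes "t < T" shows "l t < n"
proof -
  have x: "e t \<in> X" "t = fi (e t) \<or> t = la (e t)" using wordD(5,6)[OF assms] .
  have "l t = ca (e t) \<or> l t = cb (e t)" using x(2) l_ends[OF x(1)] by metis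
  then show ?thesis using chord(1,3)[OF x(1)] by auto
qed

definition gapn where "gapn t = l t - (if t = 0 then 0 else l (t - 1))"

definition cntn where "cntn y t = (\<Sum>s | s < t \<and> fid s = y. 1 + gapn s)"

lemma cntn_Suc: "cntn y (Suc t) = (if fid t = y then cntn y t + (1 + gapn t) else cntn y t)"
proof -
  have "{s. s < Suc t \<and> fid s = y} = (if fid t = y then insert t {s. s < t \<and> fid s = y} else {s. s < t \<and> fid s = y})"
    by (auto simp: less_Suc_eq)
  then show ?thesis unfolding cntn_def by simp
qed

lemma cntn_le: assumes "j \<le> T" shows "cntn y j \<le> j + (if j = 0 then 0 else l (j - 1))"
  using assms
proof (induction j)
  case 0 then show ?case unfolding cntn_def by simp
next
  case (Suc j)
  have "l (j - 1) \<le> l j" if "0 < j" using l_mono[of "j - 1" j] Suc that by simp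
  then show ?case using Suc unfolding cntn_Suc gapn_def by (auto split: if_splits)
qed

lemma loc_of: assumes "t < T" shows "loc (int t) = int (l t)"
  unfolding loc_def by (simp add: ps_of[OF assms] assms)

lemma loc_neg: "loc (- 1) = int (l (T - 1)) - int n"
proof -
  have e: "- 1 = L * (- 1) + int (T - 1)" using T_pos by (simp add: of_nat_diff)
  have "ps (- 1) = T - 1" by (rule ps_eqI[OF e]) (use T_pos in simp)
  moreover have "(- 1) div L = - 1" by (rule div_eqI[OF e]) (use T_pos in simp)
  ultimately show ?thesis unfolding loc_def by simp
qed

text \<open>The program measures the gap at place 0 from position 0, while the gap of the cyclic
  word starts at the last end of the previous turn; the correction term is that missing
  piece.\<close>

lemma gap_of: assumes "t < T" shows "gap (int t) = int (gapn t) + (if t = 0 then int n - int (l (T - 1)) else 0)"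
proof (cases "t = 0")
  case True
  then show ?thesis unfolding gap_def gapn_def using loc_of[of 0] loc_neg T_pos by simp
next
  case False
  have e: "int t - 1 = int (t - 1)" using False by simp
  have "t - 1 < T" using assms by simp
  then have "loc (int t - 1) = int (l (t - 1))" unfolding e by (rule loc_of)
  then have "gap (int t) = int (l t) - int (l (t - 1))" unfolding gap_def loc_of[OF assms] by simp
  moreover have "l (t - 1) \<le> l t" using l_mono[of "t - 1" t] assms by simp
  ultimately show ?thesis unfolding gapn_def using False by simp
qed

lemma cnt_final: assumes t: "t < T"
  shows "int (cntn (fid t) T + (if fid t = 0 then n - l (T - 1) else 0)) = cw (vi (int t)) + 2"
proof -
  let ?A = "{s. s < T \<and> fid s = fid t}"
  have "occ (vi (int t)) 0 L = int ` ?A"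
  proof
    show "occ (vi (int t)) 0 L \<subseteq> int ` ?A"
    proof
      fix x assume "x \<in> occ (vi (int t)) 0 L"
      then have x: "0 \<le> x" "x < L" "vi x = vi (int t)" unfolding occ_def by auto
      have "nat x < T" "int (nat x) = x" using x by auto
      moreover from this have "fid (nat x) = fid t" using fid_eq_iff[of "nat x" t] vi_of[of "nat x"] vi_of[OF t] x(3) t by simp
      ultimately have "nat x \<in> ?A" "x = int (nat x)" by simp_all
      then show "x \<in> int ` ?A" by (metis imageI)
    qed
    show "int ` ?A \<subseteq> occ (vi (int t)) 0 L"
    proof
      fix x assume "x \<in> int ` ?A"
      then obtain s where s: "x = int s" "s < T" "fid s = fid t" by auto
      then have "vi (int s) = vi (int t)" using fid_eq_iff[of s t] vi_of[of s] vi_of[OF t] t by simp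
      then show "x \<in> occ (vi (int t)) 0 L" unfolding occ_def using s by simp
    qed
  qed
  then have "(\<Sum>s\<in>occ (vi (int t)) 0 L. 1 + gap s) = (\<Sum>s\<in>?A. 1 + gap (int s))" by (simp add: sum.reindex)
  also have "\<dots> = (\<Sum>s\<in>?A. int (1 + gapn s) + (if s = 0 then int n - int (l (T - 1)) else 0))"
    using gap_of by (intro sum.cong) auto
  also have "\<dots> = int (\<Sum>s\<in>?A. 1 + gapn s) + (\<Sum>s\<in>?A. if s = 0 then int n - int (l (T - 1)) else 0)"
    unfolding of_nat_sum by (rule sum.distrib)
  also have "(\<Sum>s\<in>?A. if s = 0 then int n - int (l (T - 1)) else 0) = (if 0 \<in> ?A then int n - int (l (T - 1)) else 0)"
    by (subst sum.delta) auto
  also have "0 \<in> ?A \<longleftrightarrow> fid t = 0" using T_pos by auto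
  finally have s: "(\<Sum>s\<in>occ (vi (int t)) 0 L. 1 + gap s) = int (cntn (fid t) T) + (if fid t = 0 then int n - int (l (T - 1)) else 0)"
    unfolding cntn_def .
  have "l (T - 1) < n" using l_less T_pos by simp
  then show ?thesis using s unfolding cw_def by (auto simp: of_nat_diff)
qed

definition faces_stored where
  "faces_stored h \<longleftrightarrow> (\<forall>t\<le>T. h ''fid'' t = fid t) \<and> (\<forall>t<T. int (h ''cnt'' (fid t)) = cw (vi (int t)) + 2) \<and> (\<forall>t<T. h ''d'' t = dist t)"

lemma wp_scan_faces:
  assumes r: "r ''N'' = T" "r ''n'' = n" "r ''lst'' = 0" and arr: "\<And>t. t < T \<Longrightarrow> h ''e'' t = e t" "\<And>t. t < T \<Longrightarrow> h ''l'' t = l t"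
    and z: "\<And>c. h ''fid'' c = 0" "\<And>c. h ''cnt'' c = 0" "\<And>c. h ''fo'' c = 0"
    and W: "2 * T + n + 1 \<le> W" "\<And>z. z \<in> X \<Longrightarrow> z \<le> W"
    and Q: "\<And>r' h' t'. (\<forall>x. x \<notin> {''t'', ''x'', ''y'', ''s'', ''lst''} \<longrightarrow> r' x = r x) \<Longrightarrow>
      (\<forall>x. x \<notin> {''cnt'', ''fid'', ''fo'', ''d''} \<longrightarrow> h' x = h x) \<Longrightarrow> faces_stored h' \<Longrightarrow> t' \<le> a + 12 * T + 3 \<Longrightarrow> Q (r', h') t'"
  shows "wp W scan_faces Q (r, h) a"
  unfolding scan_faces_def wp_Seq
proof (rule wp_for_loop[where n = T and J = "\<lambda>j s b. fst s ''t'' = j \<and> j \<le> T \<and> (\<forall>x. x \<notin> {''t'', ''x'', ''y'', ''s'', ''lst''} \<longrightarrow> fst s x = r x) \<and>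
    (\<forall>x. x \<notin> {''cnt'', ''fid'', ''fo'', ''d''} \<longrightarrow> snd s x = h x) \<and> (\<forall>t\<le>j. snd s ''fid'' t = fid t) \<and> (\<forall>y. snd s ''cnt'' y = cntn y j) \<and>
    fst s ''lst'' = (if j = 0 then 0 else l (j - 1)) \<and> (\<forall>x\<in>X. snd s ''fo'' x = (if fi x < j then Suc (fi x) else 0)) \<and>
    (\<forall>x\<in>X. la x < j \<longrightarrow> snd s ''d'' (fi x) = la x - fi x \<and> snd s ''d'' (la x) = T + fi x - la x) \<and> b \<le> a + 1 + 12 * j"], goal_cases)
  case 1
  show ?case using r z by (simp add: cntn_def)
next
  case (2 j r' h' b)
  then show ?case using r by simp
next
  case (3 j r' h' b)
  note j = 3(1)
  have I: "r' ''t'' = j" "\<And>x. x \<notin> {''t'', ''x'', ''y'', ''s'', ''lst''} \<Longrightarrow> r' x = r x"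
    "\<And>x. x \<notin> {''cnt'', ''fid'', ''fo'', ''d''} \<Longrightarrow> h' x = h x" "\<And>t. t \<le> j \<Longrightarrow> h' ''fid'' t = fid t" "\<And>y. h' ''cnt'' y = cntn y j"
    "r' ''lst'' = (if j = 0 then 0 else l (j - 1))" "\<And>x. x \<in> X \<Longrightarrow> h' ''fo'' x = (if fi x < j then Suc (fi x) else 0)"
    "\<And>x. x \<in> X \<Longrightarrow> la x < j \<Longrightarrow> h' ''d'' (fi x) = la x - fi x \<and> h' ''d'' (la x) = T + fi x - la x" "b \<le> a + 1 + 12 * j"
    using 3(2) by auto
  define x where "x = e j"
  have x: "x \<in> X" "h' ''e'' j = x" "h' ''l'' j = l j" using wordD(5)[OF j] I(3) arr j unfolding x_def by simp_all
  have bx: "x \<le> W" "fid j \<le> W" "l j \<le> W" "Suc j \<le> W" "fid (Suc j) \<le> W"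
    using W x(1) fid_le[of j W] fid_le[of "Suc j" W] l_less[OF j] j by simp_all
  have gp: "l j - r' ''lst'' = gapn j" unfolding gapn_def I(6) by simp
  have cn: "Suc (cntn (fid j) j + gapn j) = cntn (fid j) (Suc j)" unfolding cntn_Suc by simp
  have cW: "Suc (cntn (fid j) j + gapn j) \<le> W" unfolding cn using cntn_le[of "Suc j" "fid j"] l_less[OF j] W(1) j by simp
  have cnt': "((h' ''cnt'')(fid j := Suc (cntn (fid j) j + gapn j))) y = cntn y (Suc j)" for y
    using I(5) by (simp add: cntn_Suc)
  have rN: "r' ''N'' = T" using I(2) r by simp
  show ?case
  proof (cases "j = fi x")
    case True
    have fo: "h' ''fo'' x = 0" using I(7)[OF x(1)] True by simp
    have fS: "fid (Suc j) = x" using fid_open[OF j] True unfolding x_def by simp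
    have fo': "((h' ''fo'')(x := Suc j)) y = (if fi y < Suc j then Suc (fi y) else 0)" if "y \<in> X" for y
    proof (cases "y = x")
      case False
      then have "fi y \<noteq> j" using inj_ends(1) that x(1) True by (metis inj_onD)
      then show ?thesis using I(7)[OF that] False by (simp add: less_Suc_eq)
    qed (use True in simp)
    have d': "h' ''d'' (fi y) = la y - fi y \<and> h' ''d'' (la y) = T + fi y - la y" if "y \<in> X" "la y < Suc j" for y
    proof -
      have "la y \<noteq> j" using fi_la[OF x(1) that(1)] True by simp
      then show ?thesis using I(8)[OF that(1)] that(2) by simp
    qed
    have fid': "h' ''fid'' t = fid t" if "t \<le> Suc j" "t \<noteq> Suc j" for t using I(4) that by simp
    show ?thesis using I(1,2,3,9) j x(2,3) bx(1-4) I(4)[of j] I(5) gp cW fo cnt' fo' d' fid' fS by simp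
  next
    case False
    then have la: "j = la x" using wordD(6)[OF j] unfolding x_def by auto
    have fl: "fi x < j" using wordD(1)[OF x(1)] la by simp
    have fo: "h' ''fo'' x = Suc (fi x)" using I(7)[OF x(1)] fl by simp
    have fS: "fid (Suc j) = fid (fi x)" using fid_close[OF x(1)] la by simp
    have fo': "h' ''fo'' y = (if fi y < Suc j then Suc (fi y) else 0)" if "y \<in> X" for y
    proof -
      have "fi y \<noteq> j" using fi_la[OF that x(1)] la by simp
      then show ?thesis using I(7)[OF that] by (simp add: less_Suc_eq)
    qed
    have d': "((h' ''d'')(fi x := j - fi x, j := T + fi x - j)) (fi y) = la y - fi y \<and>
        ((h' ''d'')(fi x := j - fi x, j := T + fi x - j)) (la y) = T + fi y - la y" if y: "y \<in> X" "la y < Suc j" for y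
    proof (cases "y = x")
      case True then show ?thesis using la fl by simp
    next
      case False
      have "fi y \<noteq> fi x" "la y \<noteq> la x" using inj_ends False y(1) x(1) by (meson inj_onD)+
      moreover have "fi y \<noteq> la x" "la y \<noteq> fi x" using fi_la y(1) x(1) by metis+
      moreover have "la y < j" using y(2) \<open>la y \<noteq> la x\<close> la by simp
      ultimately show ?thesis using I(8)[OF y(1)] la by simp
    qed
    have fid': "((h' ''fid'')(Suc j := fid (fi x))) t = fid t" if "t \<le> Suc j" for t using I(4) fS that by (cases "t = Suc j") auto
    have fidx: "h' ''fid'' (fi x) = fid (fi x)" using I(4) fl by simp
    have bd: "fi x \<le> W" "j - fi x \<le> W" "T + fi x - j \<le> W" "fid (fi x) \<le> W" using bx fl W(1) j fS by simp_all
    show ?thesis using I(1,2,3,9) j x(2,3) bx(1-4) I(4)[of j] I(5) gp cW fo cnt' fo' d' fid' fidx bd rN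
      by (simp del: fun_upd_apply add: fun_upd_same fun_upd_other)
  qed
next
  case (4 r' h' b)
  have I: "\<And>x. x \<notin> {''t'', ''x'', ''y'', ''s'', ''lst''} \<Longrightarrow> r' x = r x"
    "\<And>x. x \<notin> {''cnt'', ''fid'', ''fo'', ''d''} \<Longrightarrow> h' x = h x" "\<And>t. t \<le> T \<Longrightarrow> h' ''fid'' t = fid t" "\<And>y. h' ''cnt'' y = cntn y T"
    "r' ''lst'' = l (T - 1)"
    "\<And>x. x \<in> X \<Longrightarrow> la x < T \<Longrightarrow> h' ''d'' (fi x) = la x - fi x \<and> h' ''d'' (la x) = T + fi x - la x" "b \<le> a + 1 + 12 * T"
    using 4 T_pos by auto
  have lW: "cntn 0 T + (n - l (T - 1)) \<le> W" using cntn_le[of T 0] l_less[of "T - 1"] T_pos W(1) by simp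
  have dd: "h' ''d'' t = dist t" if t: "t < T" for t
  proof -
    have x: "e t \<in> X" "t = fi (e t) \<or> t = la (e t)" using wordD(5,6)[OF t] .
    note D = I(6)[OF x(1) wordD(2)[OF x(1)]]
    from x(2) show ?thesis
    proof
      assume a: "t = fi (e t)"
      have "h' ''d'' (fi (e t)) = dist (fi (e t))" using D dist_first[OF x(1)] by simp
      then show ?thesis unfolding a[symmetric] .
    next
      assume a: "t = la (e t)"
      have "h' ''d'' (la (e t)) = dist (la (e t))" using D dist_last[OF x(1)] by simp
      then show ?thesis unfolding a[symmetric] .
    qed
  qed
  have "faces_stored (h'(''cnt'' := (h' ''cnt'')(0 := cntn 0 T + (n - l (T - 1)))))"
    unfolding faces_stored_def
  proof (intro conjI allI impI)
    fix t assume t: "t < T"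
    show "int ((h'(''cnt'' := (h' ''cnt'')(0 := cntn 0 T + (n - l (T - 1))))) ''cnt'' (fid t)) = cw (vi (int t)) + 2"
      unfolding cnt_final[OF t, symmetric] using I(4) by simp
  qed (use I(3) dd in simp_all)
  then show ?case using I(1,2,4,5,7) r(2) lW
    apply simp
    apply (rule Q)
       apply simp_all
    done
next
  case 5
  show ?case using W(1) by simp
qed

abbreviation weight where "weight i j \<equiv> sum cw (vi ` {i..j})"

text \<open>In a tree the step \<open>j\<close> leads back to a known face only if its edge has been
  crossed within the window, that is, if \<open>mi j - L\<close> lies in it. The test on
  \<open>mi j\<close> decides this from the stored distance.\<close>

lemma weight_grow:
  assumes "i \<le> j" "j < i + L"
  shows "weight i (j + 1) = weight i j + (if mi j < i + L then cw (vi (j + 1)) else 0)"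
proof -
  have ins: "{i..j + 1} = insert (j + 1) {i..j}" using assms by auto
  show ?thesis
  proof (cases "mi j < i + L")
    case False
    have "mi (mi j - L) = j" using m_per[of "mi j - L"] m_m[of j] by simp
    then have "vi (mi j - L) = vi (j + 1)" using v_next[of "mi j - L"] by simp
    moreover have "mi j - L \<in> {i..j}" using False mi_range[of j] by simp
    ultimately have "vi (j + 1) \<in> vi ` {i..j}" by (metis imageI)
    then have "vi ` {i..j + 1} = vi ` {i..j}" unfolding ins by auto
    then show ?thesis using False by simp
  next
    case True
    have "vi (j + 1) \<notin> vi ` {i..j}"
    proof
      assume "vi (j + 1) \<in> vi ` {i..j}"
      then obtain x where x: "i \<le> x" "x \<le> j" "vi (j + 1) = vi x" by auto
      have "vi (j + 1) \<noteq> vi (x + L)" using tour.v_neq_sides[of j "j + 1" "x + L"] x True mi_range[of j] by simp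
      then show False using x v_per by simp
    qed
    then show ?thesis unfolding ins using True by simp
  qed
qed

text \<open>The first return to \<open>vi i\<close> is at \<open>mi i + 1\<close>, so the face
  survives the removal of i exactly if that place is still in the window.\<close>

lemma weight_shrink:
  assumes "i < j"
  shows "weight i j = weight (i + 1) j + (if mi i < j then 0 else cw (vi i))"
proof -
  have ins: "{i..j} = insert i {i + 1..j}" using assms by auto
  show ?thesis
  proof (cases "mi i < j")
    case True
    then have "mi i + 1 \<in> {i + 1..j}" using mi_range[of i] by simp
    then have "vi i \<in> vi ` {i + 1..j}" using v_next[of i] by (metis imageI)
    then have "vi ` {i..j} = vi ` {i + 1..j}" unfolding ins by auto
    then show ?thesis using True by simp
  next
    case False
    have "vi i \<notin> vi ` {i + 1..j}"
    proof
      assume "vi i \<in> vi ` {i + 1..j}"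
      then obtain x where x: "i + 1 \<le> x" "x \<le> j" "vi i = vi x" by auto
      then show False using tour.v_neq[of i x] False by simp
    qed
    then show ?thesis unfolding ins using False by simp
  qed
qed

lemma weight_total: "weight i (i + L - 1) = int n - 2"
proof -
  have e: "{i..i + L - 1} = {(i - 1) + 1..(i - 1) + L}" by auto
  show ?thesis unfolding e tour.faces_period by (rule sum_cw)
qed

lemma weight_mono: assumes "i' \<le> i" "j \<le> j'" shows "weight i j \<le> weight i' j'"
proof (rule sum_mono2)
  show "vi ` {i..j} \<subseteq> vi ` {i'..j'}" using assms by auto
  fix f assume "f \<in> vi ` {i'..j'} - vi ` {i..j}"
  then have "f \<in> tour.faces" by auto
  then show "0 \<le> cw f" using cw_pos by fastforce
qed simp

lemma weight_le: "weight i j \<le> int n - 2"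
proof -
  have "weight i j \<le> sum cw tour.faces"
  proof (rule sum_mono2)
    fix f assume "f \<in> tour.faces - vi ` {i..j}"
    then show "0 \<le> cw f" using cw_pos by fastforce
  qed auto
  then show ?thesis using sum_cw by simp
qed

definition jumps where
  "jumps k g i \<longleftrightarrow> (\<exists>p>i. int k - 2 < weight i p \<and> weight i (p - 1) \<le> int k - 2 - int g)"

text \<open>The double count is applied with \<open>N = card X + 1\<close> faces, total weight
  \<open>M = n - 2\<close> and upper bound \<open>k - 2\<close>; its four inequalities are then the
  numerical assumptions. Jumps from one period extend to all integers by shifting.\<close>

lemma jumps_contradiction:
  assumes J: "\<And>i. 0 \<le> i \<Longrightarrow> i < L \<Longrightarrow> jumps k g i" and g: "1 \<le> g"
    and num: "k \<le> n" "n \<le> 2 * card X + g + 1" "k \<le> card X + 2 * g + 1" "n \<le> card X + k"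
  shows False
proof -
  have shift: "weight (i + L * q) (j + L * q) = weight i j" for i j q
  proof -
    have "vi (x + L * q) = vi x" for x using tour.v_per_mult[of x q] by (simp add: mult.commute)
    then have "vi ` {i + L * q..j + L * q} = vi ` {i..j}"
    proof -
      assume v: "\<And>x. vi (x + L * q) = vi x"
      have e: "{i + L * q..j + L * q} = (\<lambda>x. x + L * q) ` {i..j}" by simp
      have "vi ` {i + L * q..j + L * q} = (\<lambda>x. vi (x + L * q)) ` {i..j}" unfolding e image_image ..
      then show ?thesis using v by simp
    qed
    then show ?thesis by simp
  qed
  have all: "jumps k g i" for i
  proof -
    have "jumps k g (i mod L)" using J T_pos by simp
    then obtain p where p: "i mod L < p" "int k - 2 < weight (i mod L) p" "weight (i mod L) (p - 1) \<le> int k - 2 - int g"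
      unfolding jumps_def by auto
    have i: "i = i mod L + L * (i div L)" by simp
    have a: "weight i (p + L * (i div L)) = weight (i mod L) p" using shift[of "i mod L" "i div L" p] by simp
    have b: "weight i (p + L * (i div L) - 1) = weight (i mod L) (p - 1)" using shift[of "i mod L" "i div L" "p - 1"] by (simp add: algebra_simps)
    have "i < p + L * (i div L)" using p(1) i by linarith
    then show ?thesis unfolding jumps_def using p(2,3) a b by metis
  qed
  then obtain p where p: "\<And>i. i < p i" "\<And>i. int k - 2 < weight i (p i)" "\<And>i. weight i (p i - 1) \<le> int k - 2 - int g"
    unfolding jumps_def by metis
  define q where "q = card X"
  have "int k \<le> int n" "int n \<le> int (2 * q + g + 1)" "int k \<le> int (q + 2 * g + 1)" "int n \<le> int (q + k)" "int 1 \<le> int g"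
    using num g unfolding q_def by (simp_all only: of_nat_le_iff)
  then have b: "int k - 2 \<le> int n - 2" "int n - 2 \<le> 2 * (int q + 1) + int g - 3" "int k - 2 \<le> (int q + 1) + 2 * int g - 2"
    "2 * (int n - 2) \<le> 2 * (int k - 2) + 2 * (int q + 1) + int g - 2"
    by (simp_all add: algebra_simps)
  interpret unbalanced_weights L mi vi cw "int k - 2" "int g" p
  proof
    show "cw f \<le> int k - 2" if "f \<in> tour.faces" for f using cw_le[OF that] num(4) by linarith
  qed (use cw_pos g p in auto)
  show False
    by (rule contradiction; unfold sum_cw card_faces_X q_def[symmetric]; rule b)
qed

end

section \<open>Search for a window in the required range\<close>

text \<open>Two pointers: the window consists of the places from \<open>i\<close> to
  \<open>i + z\<close>, \<open>j\<close> is its last place modulo \<open>N\<close>, and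
  \<open>S\<close> is the length of its boundary. There is no test for the end of the search: that
  it succeeds before \<open>i\<close> reaches \<open>N\<close> is exactly the impossibility of jumps
  everywhere.\<close>

definition search_window :: com where
  "search_window = seqs [Assign ''S'' (Get ''cnt'' (Const 0)), Assign ''i'' (Const 0), Assign ''j'' (Const 0), Assign ''z'' (Const 0),
    While (Not (And (Not (Less (Var ''k'') (Var ''S''))) (Less (Var ''k'') (Plus (Var ''S'') (Var ''g'')))))
      (If (Less (Var ''k'') (Var ''S''))
        (seqs [If (Less (Get ''d'' (Var ''i'')) (Var ''z'')) Skip
            (Assign ''S'' (Minus (Var ''S'') (Minus (Get ''cnt'' (Get ''fid'' (Var ''i''))) (Const 2)))),
          inc ''i'', Assign ''z'' (Minus (Var ''z'') (Const 1))])
        (seqs [Assign ''y'' (Get ''d'' (Var ''j'')), inc ''j'', If (Less (Var ''j'') (Var ''N'')) Skip (Assign ''j'' (Const 0)),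
          If (Less (Plus (Var ''y'') (Var ''z'')) (Var ''N''))
            (Assign ''S'' (Plus (Var ''S'') (Minus (Get ''cnt'' (Get ''fid'' (Var ''j''))) (Const 2)))) Skip, inc ''z'']))]"

context polygon
begin

lemma wp_search_window:
  assumes r: "r ''N'' = T" "r ''k'' = k" "r ''g'' = g" and F: "faces_stored h" and g: "1 \<le> g"
    and num: "k \<le> n" "n \<le> 2 * card X + g + 1" "k \<le> card X + 2 * g + 1" "n \<le> card X + k"
    and W: "2 * T + n + 1 \<le> W"
    and Q: "\<And>r' t' i z. (\<forall>x. x \<notin> {''S'', ''i'', ''j'', ''z'', ''y''} \<longrightarrow> r' x = r x) \<Longrightarrow> r' ''i'' = i \<Longrightarrow> r' ''z'' = z \<Longrightarrow>
      i < T \<Longrightarrow> z < T \<Longrightarrow> weight (int i) (int i + int z) + 2 \<le> int k \<Longrightarrow> int k < weight (int i) (int i + int z) + 2 + int g \<Longrightarrow>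
      t' \<le> a + 30 * T + 6 \<Longrightarrow> Q (r', h) t'"
  shows "wp W search_window Q (r, h) a"
proof -
  \<comment> \<open>Besides the meaning of the variables, the invariant says that the window without
    its last place is too light and that all earlier starts jump. An iteration raises
    \<open>i\<close> at fixed \<open>i + z\<close> or raises \<open>i + z\<close> at fixed
    \<open>i\<close>, so either pays 10 from the potential.\<close>
  let ?I = "\<lambda>s b. \<exists>i z j S. fst s ''i'' = i \<and> fst s ''z'' = z \<and> fst s ''j'' = j \<and> fst s ''S'' = S \<and>
    (\<forall>x. x \<notin> {''S'', ''i'', ''j'', ''z'', ''y''} \<longrightarrow> fst s x = r x) \<and> snd s = h \<and> i < T \<and> z < T \<and> j = ps (int i + int z) \<and>
    int S = weight (int i) (int i + int z) + 2 \<and> (z = 0 \<or> weight (int i) (int i + int z - 1) \<le> int k - 2 - int g) \<and>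
    (\<forall>i'. 0 \<le> i' \<longrightarrow> i' < int i \<longrightarrow> jumps k g i') \<and> b + 10 * (T - i) + 10 * (2 * T - (i + z)) \<le> a + 4 + 30 * T"
  have fid_W: "h ''fid'' (ps i) = fid (ps i)" "int (h ''cnt'' (fid (ps i))) = cw (vi i) + 2" "h ''d'' (ps i) = dist (ps i)" for i
  proof -
    have p: "ps i < T" by (rule ps_less)
    have v: "vi (int (ps i)) = vi i" unfolding vi_def ps_of[OF p] ..
    show "h ''fid'' (ps i) = fid (ps i)" "h ''d'' (ps i) = dist (ps i)" using F p unfolding faces_stored_def by auto
    show "int (h ''cnt'' (fid (ps i))) = cw (vi i) + 2" using F p v unfolding faces_stored_def by metis
  qed
  have ds: "dist (ps i) < T" for i using mi_dist[of i] mi_range[of i] by simp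
  have cwp: "1 \<le> cw (vi i)" "cw (vi i) \<le> int k - 2" for i using cw_pos[of "vi i"] cw_le[of "vi i"] num(4) by auto
  define body where "body = If (Less (Var ''k'') (Var ''S''))
        (seqs [If (Less (Get ''d'' (Var ''i'')) (Var ''z'')) Skip
            (Assign ''S'' (Minus (Var ''S'') (Minus (Get ''cnt'' (Get ''fid'' (Var ''i''))) (Const 2)))),
          inc ''i'', Assign ''z'' (Minus (Var ''z'') (Const 1))])
        (seqs [Assign ''y'' (Get ''d'' (Var ''j'')), inc ''j'', If (Less (Var ''j'') (Var ''N'')) Skip (Assign ''j'' (Const 0)),
          If (Less (Plus (Var ''y'') (Var ''z'')) (Var ''N''))
            (Assign ''S'' (Plus (Var ''S'') (Minus (Get ''cnt'' (Get ''fid'' (Var ''j''))) (Const 2)))) Skip, inc ''z''])"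
  define lp where "lp = While (Not (And (Not (Less (Var ''k'') (Var ''S''))) (Less (Var ''k'') (Plus (Var ''S'') (Var ''g''))))) body"
  have sw: "search_window = Seq (Assign ''S'' (Get ''cnt'' (Const 0))) (Seq (Assign ''i'' (Const 0)) (Seq (Assign ''j'' (Const 0)) (Seq (Assign ''z'' (Const 0)) lp)))"
    unfolding search_window_def lp_def body_def by simp
  show ?thesis unfolding sw
  proof (simp, intro conjI, goal_cases)
    case 1
    show ?case using fid_W(1,2)[of 0] weight_le[of 0 0] W ps_of[OF T_pos] by simp
  next
    case 2
    show ?case unfolding lp_def
    proof (rule wp_While[where I = ?I and V = "\<lambda>s. (T - fst s ''i'') + (2 * T - (fst s ''i'' + fst s ''z''))"], goal_cases)
      case 1
      have "int (h ''cnt'' 0) = weight 0 0 + 2" using fid_W(1,2)[of 0] ps_of[OF T_pos] by simp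
      then show ?case using r T_pos ps_of[OF T_pos] by simp
    next
      case (2 s b)
      obtain r1 where s: "s = (r1, h)" using 2(1) by (metis prod.collapse)
      obtain i z j S where I: "r1 ''i'' = i" "r1 ''z'' = z" "r1 ''j'' = j" "r1 ''S'' = S"
        "\<And>x. x \<notin> {''S'', ''i'', ''j'', ''z'', ''y''} \<Longrightarrow> r1 x = r x" "i < T" "z < T" "j = ps (int i + int z)"
        "int S = weight (int i) (int i + int z) + 2" "z = 0 \<or> weight (int i) (int i + int z - 1) \<le> int k - 2 - int g"
        "\<And>i'. 0 \<le> i' \<Longrightarrow> i' < int i \<Longrightarrow> jumps k g i'" "b + 10 * (T - i) + 10 * (2 * T - (i + z)) \<le> a + 4 + 30 * T"
        using 2(1) unfolding s by auto
      have rr: "r1 ''N'' = T" "r1 ''k'' = k" "r1 ''g'' = g" using I(5) r by simp_all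
      have bad: "k < S \<or> \<not> k < S + g" using 2(2) rr I(4) unfolding s by auto
      have SW: "S \<le> W" using I(9) weight_le[of "int i" "int i + int z"] W by simp
      have pi: "ps (int i) = i" using ps_of[OF I(6)] .
      note fi = fid_W[of "int i", unfolded pi] and dsi = ds[of "int i", unfolded pi] and mdi = mi_dist[of "int i", unfolded pi]
      have step: "?I s' b' \<and> (T - fst s' ''i'') + (2 * T - (fst s' ''i'' + fst s' ''z'')) < (T - fst s ''i'') + (2 * T - (fst s ''i'' + fst s ''z''))"
        if A: "fst s' ''i'' = i' \<and> fst s' ''z'' = z' \<and> fst s' ''j'' = ps (int i' + int z') \<and> fst s' ''S'' = S' \<and>
            (\<forall>x. x \<notin> {''S'', ''i'', ''j'', ''z'', ''y''} \<longrightarrow> fst s' x = r1 x) \<and> snd s' = h \<and> b' \<le> b + 10"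
          and B: "i' < T" "z' < T" "int S' = weight (int i') (int i' + int z') + 2" "z' = 0 \<or> weight (int i') (int i' + int z' - 1) \<le> int k - 2 - int g"
            "\<And>x. 0 \<le> x \<Longrightarrow> x < int i' \<Longrightarrow> jumps k g x" "10 * (T - i') + 10 * (2 * T - (i' + z')) + 10 = 10 * (T - i) + 10 * (2 * T - (i + z))"
        for s' b' i' z' S'
      proof
        have fr: "fst s' x = r x" if "x \<notin> {''S'', ''i'', ''j'', ''z'', ''y''}" for x using A I(5)[OF that] that by simp
        have tm: "b' + 10 * (T - i') + 10 * (2 * T - (i' + z')) \<le> a + 4 + 30 * T" using A B(6) I(12) by linarith
        show "?I s' b'"
          by (rule exI[of _ i'], rule exI[of _ z'], rule exI[of _ "ps (int i' + int z')"], rule exI[of _ S'], intro conjI allI impI)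
            (use A B(1-5) fr tm in simp_all)
        show "(T - fst s' ''i'') + (2 * T - (fst s' ''i'' + fst s' ''z'')) < (T - fst s ''i'') + (2 * T - (fst s ''i'' + fst s ''z''))"
          using A B(6) I(1,2) unfolding s by simp
      qed
      have W1: "T \<le> W" "Suc 0 \<le> W" using W by simp_all
      show ?case
      proof (cases "k < S")
        case True
        have z0: "z \<noteq> 0"
        proof
          assume "z = 0"
          then have "int S \<le> int k" using I(9) cwp(2)[of "int i"] by simp
          then show False using True by simp
        qed
        then have z1: "0 < z" "int (z - 1) = int z - 1" by auto
        \<comment> \<open>The window is too heavy, and without its last place it was too light: a
          jump at i.\<close>
        have jm: "jumps k g (int i)"
        proof -
          have "int i < int i + int z" using z1 by simp
          moreover have "int k - 2 < weight (int i) (int i + int z)" using I(9) True by simp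
          moreover have "weight (int i) (int i + int z - 1) \<le> int k - 2 - int g" using I(10) z0 by simp
          ultimately show ?thesis unfolding jumps_def by blast
        qed
        have J': "jumps k g i'" if "0 \<le> i'" "i' < int (Suc i)" for i'
          using I(11)[of i'] jm that by (cases "i' = int i") auto
        \<comment> \<open>If \<open>i\<close> were the last start, all starts of the period would
          jump.\<close>
        have iS: "Suc i < T"
        proof (rule ccontr)
          assume "\<not> Suc i < T"
          then have "Suc i = T" using I(6) by simp
          then show False using jumps_contradiction[OF _ g num] J' by blast
        qed
        have eS: "int (Suc i) + int (z - 1) = int i + int z" using z1 by simp
        have w2: "z - 1 = 0 \<or> weight (int (Suc i)) (int (Suc i) + int (z - 1) - 1) \<le> int k - 2 - int g"
        proof -
          have "weight (int (Suc i)) (int i + int z - 1) \<le> weight (int i) (int i + int z - 1)" by (rule weight_mono) auto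
          then show ?thesis unfolding eS using I(10) z0 by auto
        qed
        have ws: "weight (int i) (int i + int z) = weight (int (Suc i)) (int (Suc i) + int (z - 1)) + (if dist i < z then 0 else cw (vi (int i)))"
        proof -
          have e1: "int i + 1 = int (Suc i)" by simp
          show ?thesis using weight_shrink[of "int i" "int i + int z"] z1 unfolding e1 mdi eS by simp
        qed
        have time: "10 * (T - Suc i) + 10 = 10 * (T - i)" "Suc i + (z - 1) = i + z" using I(6) z1 by auto
        have zb: "z - Suc 0 \<le> W" "z - Suc 0 < T" using W I(7) by simp_all
        have w2': "z \<le> Suc 0 \<or> weight (1 + int i) (int i + (int z - 1)) \<le> int k - 2 - int g"
        proof -
          have "z - 1 = 0 \<longleftrightarrow> z \<le> Suc 0" by auto
          moreover have "int (Suc i) + int (z - 1) - 1 = int i + (int z - 1)" "int (Suc i) = 1 + int i" using z1 by simp_all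
          ultimately show ?thesis using w2 by metis
        qed
        have vd: "3 * T - Suc (i + (i + z)) < 3 * T - (i + (i + z))" using I(6,7) by simp
        define S' where "S' = (if dist i < z then S else S - (h ''cnt'' (fid i) - 2))"
        have S': "int S' = weight (int (Suc i)) (int (Suc i) + int (z - 1)) + 2"
        proof -
          have "0 \<le> weight (int (Suc i)) (int (Suc i) + int (z - 1))"
          proof (rule sum_nonneg)
            fix x assume "x \<in> vi ` {int (Suc i)..int (Suc i) + int (z - 1)}"
            then obtain t where "x = vi t" by blast
            then show "0 \<le> cw x" using cwp(1)[of t] by simp
          qed
          then show ?thesis using I(9) ws fi(2) cwp(1)[of "int i"] unfolding S'_def by auto
        qed
        have SW': "S' \<le> W" using SW le_trans[OF diff_le_self[of S "h ''cnt'' (fid i) - 2"] SW] unfolding S'_def by simp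
        have iW: "Suc i \<le> W" "z - Suc 0 \<le> W" using iS zb W1 by simp_all
        have run: "wp W (seqs [If (Less (Get ''d'' (Var ''i'')) (Var ''z'')) Skip
            (Assign ''S'' (Minus (Var ''S'') (Minus (Get ''cnt'' (Get ''fid'' (Var ''i''))) (Const 2)))),
          inc ''i'', Assign ''z'' (Minus (Var ''z'') (Const 1))]) (\<lambda>s' b'. fst s' ''i'' = Suc i \<and> fst s' ''z'' = z - 1 \<and> fst s' ''j'' = ps (int i + int z) \<and> fst s' ''S'' = S' \<and>
            (\<forall>x. x \<notin> {''S'', ''i'', ''j'', ''z'', ''y''} \<longrightarrow> fst s' x = r1 x) \<and> snd s' = h \<and> b' \<le> b + 10) (r1, h) (b + 1 + 1)"
          using I(1-4) I(8) fi(1,3) iW SW' unfolding S'_def by (cases "dist i < z") simp_all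
        have kS: "bval (Less (Var ''k'') (Var ''S'')) (r1, h)" using rr I(4) True by simp
        show ?thesis unfolding s body_def wp_If if_P[OF kS]
          by (rule wp_mono[OF run], rule step[unfolded s, where i' = "Suc i" and z' = "z - 1" and S' = S'])
            (use iS zb S' w2 J' time eS I(6) z1 in \<open>simp_all add: eS\<close>)
      next
        case False
        then have Sg: "\<not> k < S + g" using bad by simp
        then have wle: "weight (int i) (int i + int z) \<le> int k - 2 - int g" using I(9) by simp
        \<comment> \<open>A window of a full turn contains all faces and weighs
          \<open>n - 2\<close>, which is not too light because \<open>k\<close> is at most
          \<open>n\<close>.\<close>
        have zS: "Suc z < T"
        proof (rule ccontr)
          assume "\<not> Suc z < T"
          then have "int z = L - 1" using I(7) by simp
          then have e: "int i + int z = int i + L - 1" by linarith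
          have "weight (int i) (int i + int z) = int n - 2" unfolding e by (rule weight_total)
          then show False using wle num(1) g by simp
        qed
        have fj: "h ''d'' j = dist j" "dist j < T" using fid_W(3) ds unfolding I(8) by auto
        have pj: "(if Suc j < T then Suc j else 0) = ps (int i + int (Suc z))"
        proof (cases "Suc j < T")
          case True
          have "int i + int (Suc z) = L * ((int i + int z) div L) + int (Suc j)" using decomp[of "int i + int z"] unfolding I(8) by linarith
          then have "ps (int i + int (Suc z)) = Suc j" using True by (rule ps_eqI)
          then show ?thesis using True by simp
        next
          case False
          have "int j + 1 = L" using False ps_less[of "int i + int z"] unfolding I(8) by simp
          then have "int i + int (Suc z) = L * ((int i + int z) div L + 1) + int 0"
            unfolding distrib_left using decomp[of "int i + int z"] unfolding I(8) by linarith
          then have "ps (int i + int (Suc z)) = 0" using T_pos by (rule ps_eqI)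
          then show ?thesis using False by simp
        qed
        have wg: "weight (int i) (int i + int (Suc z)) = weight (int i) (int i + int z) + (if dist j + z < T then cw (vi (int i + int (Suc z))) else 0)"
        proof -
          have e1: "int i + int z + 1 = int i + int (Suc z)" by simp
          have m: "mi (int i + int z) < int i + L \<longleftrightarrow> dist j + z < T" unfolding mi_dist[of "int i + int z"] I(8)[symmetric] by auto
          show ?thesis using weight_grow[of "int i" "int i + int z"] I(7) unfolding e1 m by simp
        qed
        have w2: "weight (int i) (int i + int (Suc z) - 1) \<le> int k - 2 - int g" using wle by simp
        define j' where "j' = ps (int i + int (Suc z))"
        have fj': "h ''fid'' j' = fid j'" "int (h ''cnt'' (fid j')) = cw (vi (int i + int (Suc z))) + 2"
          using fid_W(1,2) unfolding j'_def by auto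
        have jW: "Suc j \<le> W" "j' < T" using ps_less[of "int i + int z"] ps_less[of "int i + int (Suc z)"] W unfolding I(8) j'_def by linarith+
        have time: "10 * (2 * T - (i + Suc z)) + 10 = 10 * (2 * T - (i + z))" using I(6) zS by simp
        have W': "T \<le> W" using W by simp
        define S' where "S' = (if dist j + z < T then S + (h ''cnt'' (fid j') - 2) else S)"
        have S': "int S' = weight (int i) (int i + int (Suc z)) + 2"
          using I(9) wg fj'(2) cwp(1)[of "int i + int (Suc z)"] unfolding S'_def by auto
        have S'W: "S' \<le> W" using S' weight_le[of "int i" "int i + int (Suc z)"] W by simp
        have zW: "Suc z \<le> W" using zS W by simp
        have run: "wp W (seqs [Assign ''y'' (Get ''d'' (Var ''j'')), inc ''j'', If (Less (Var ''j'') (Var ''N'')) Skip (Assign ''j'' (Const 0)),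
          If (Less (Plus (Var ''y'') (Var ''z'')) (Var ''N''))
            (Assign ''S'' (Plus (Var ''S'') (Minus (Get ''cnt'' (Get ''fid'' (Var ''j''))) (Const 2)))) Skip, inc ''z''])
            (\<lambda>s' b'. fst s' ''i'' = i \<and> fst s' ''z'' = Suc z \<and> fst s' ''j'' = j' \<and> fst s' ''S'' = S' \<and>
            (\<forall>x. x \<notin> {''S'', ''i'', ''j'', ''z'', ''y''} \<longrightarrow> fst s' x = r1 x) \<and> snd s' = h \<and> b' \<le> b + 10) (r1, h) (b + 1 + 1)"
        proof (cases "Suc j < T")
          case True
          then have jj: "Suc j = j'" using pj unfolding j'_def by simp
          show ?thesis using I(1-4) rr(1) fj jW(1) zW fj'(1) S'W True W1 unfolding S'_def
            by (cases "dist j + z < T") (simp_all add: jj)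
        next
          case F: False
          then have jj: "j' = 0" using pj unfolding j'_def by simp
          show ?thesis using I(1-4) rr(1) fj jW(1) zW fj'(1) S'W F W1 unfolding S'_def
            by (cases "dist j + z < T") (simp_all add: jj)
        qed
        have kS: "\<not> bval (Less (Var ''k'') (Var ''S'')) (r1, h)" using rr I(4) False by simp
        show ?thesis unfolding s body_def wp_If if_not_P[OF kS]
          by (rule wp_mono[OF run], rule step[unfolded s, where i' = i and z' = "Suc z" and S' = S'])
            (use zS S' w2 I(6,11) time in \<open>simp_all add: j'_def\<close>)
      qed
    next
      case (3 s b)
      obtain r1 where s: "s = (r1, h)" using 3(1) by (metis prod.collapse)
      obtain i z j S where I: "r1 ''i'' = i" "r1 ''z'' = z" "r1 ''S'' = S"
        "\<And>x. x \<notin> {''S'', ''i'', ''j'', ''z'', ''y''} \<Longrightarrow> r1 x = r x" "i < T" "z < T"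
        "int S = weight (int i) (int i + int z) + 2" "b \<le> a + 4 + 30 * T"
        using 3(1) unfolding s by auto
      have rr: "r1 ''k'' = k" "r1 ''g'' = g" using I(4) r by simp_all
      have "\<not> k < S" "k < S + g" using 3(2) rr I(3) unfolding s by auto
      then show ?case unfolding s using I by (intro Q[of r1 i z]) auto
    qed
  qed
qed

end

section \<open>Writing the boundary cycle of the window\<close>

definition write_gap :: com where
  "write_gap = While (Not (eq_test (Var ''v'') (Get ''l'' (Var ''t''))))
    (seqs [inc ''v'', If (Less (Var ''v'') (Var ''n'')) Skip (Assign ''v'' (Const 0)),
      Put ''out'' (Var ''len'') (Get ''ham'' (Var ''v'')), inc ''len''])"

definition write_jump :: com where
  "write_jump = seqs [Assign ''y'' (Get ''d'' (Var ''t'')), Assign ''t'' (Plus (Var ''t'') (Var ''y'')),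
    If (Less (Var ''t'') (Var ''N'')) Skip (Assign ''t'' (Minus (Var ''t'') (Var ''N''))),
    Assign ''c'' (Minus (Var ''c'') (Var ''y'')), Assign ''v'' (Get ''l'' (Var ''t'')),
    Put ''out'' (Var ''len'') (Get ''ham'' (Var ''v'')), inc ''len'']"

text \<open>\<open>c\<close> is the number of tour places left in the turn, including the current
  one. The test \<open>c + z \<le> N\<close> says that the walk has reached the last place of the
  window, from which on shortcuts are taken; the test on \<open>d\<close> says that the chord ends
  within the turn.\<close>

definition write_cycle :: com where
  "write_cycle = seqs [If (Less (Const 0) (Var ''i'')) (Assign ''v'' (Get ''l'' (Minus (Var ''i'') (Const 1))))
      (Assign ''v'' (Get ''l'' (Minus (Var ''N'') (Const 1)))),
    Assign ''t'' (Var ''i''), Assign ''c'' (Var ''N''),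
    While (Less (Const 0) (Var ''c'')) (seqs [write_gap,
      If (And (Not (Less (Var ''N'') (Plus (Var ''c'') (Var ''z'')))) (Less (Get ''d'' (Var ''t'')) (Var ''c''))) write_jump Skip,
      inc ''t'', If (Less (Var ''t'') (Var ''N'')) Skip (Assign ''t'' (Const 0)), Assign ''c'' (Minus (Var ''c'') (Const 1))])]"

lemma adjacent_nth: "Suc k < length xs \<Longrightarrow> (xs ! k, xs ! Suc k) \<in> adjacent xs"
proof (induction xs arbitrary: k rule: adjacent.induct)
  case (1 x y zs)
  then show ?case by (cases k) auto
qed auto

context polygon
begin

definition link where "link a b \<longleftrightarrow> b = a + 1 \<or> (\<exists>t. a = loc t \<and> b = loc (mi t))"

text \<open>Positions are lifted to the integers. Strict increase makes the vertices distinct as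
  long as the walk advances by no more than \<open>n\<close> and its start is not counted.\<close>

definition walk_path where
  "walk_path qs \<longleftrightarrow> sorted_wrt (<) qs \<and> (\<forall>a b. (a, b) \<in> adjacent qs \<longrightarrow> link a b)"

lemma walk_path_snoc:
  assumes w: "walk_path (q0 # qs)" and l: "link (last (q0 # qs)) b" "last (q0 # qs) < b"
  shows "walk_path (q0 # qs @ [b])"
proof -
  obtain us a where s: "q0 # qs = us @ [a]" by (metis append_butlast_last_id list.distinct(1))
  have la: "link a b" "a < b" using l unfolding s by simp_all
  have "walk_path (us @ [a, b])"
    using w la unfolding s walk_path_def by (force simp: sorted_wrt_append adjacent_snoc)
  moreover have "q0 # qs @ [b] = us @ [a, b]" using arg_cong[OF s, of "\<lambda>zs. zs @ [b]"] by simp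
  ultimately show ?thesis by (simp only:)
qed

lemma n_pos: "0 < n" using l_less[OF T_pos] by simp

lemma loc_mod: "nat (loc t mod int n) = l (ps t)"
proof -
  have "loc t mod int n = int (l (ps t)) mod int n" unfolding loc_def by simp
  also have "\<dots> = int (l (ps t))" using l_less[OF ps_less[of t]] by simp
  finally show ?thesis by simp
qed

lemma ps_add: assumes "d < T" shows "ps (a + int d) = (if ps a + d < T then ps a + d else ps a + d - T)"
proof (cases "ps a + d < T")
  case True
  have "a + int d = L * (a div L) + int (ps a + d)" using decomp[of a] by linarith
  then have "ps (a + int d) = ps a + d" using True by (rule ps_eqI)
  then show ?thesis using True by simp
next
  case False
  have lt: "ps a + d - T < T" using ps_less[of a] assms by linarith
  have "int (ps a + d - T) = int (ps a) + int d - L" using False by simp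
  then have "a + int d = L * (a div L + 1) + int (ps a + d - T)"
    unfolding distrib_left using decomp[of a] by linarith
  then have "ps (a + int d) = ps a + d - T" using lt by (rule ps_eqI)
  then show ?thesis using False by simp
qed

lemma T_gt_1: "1 < T"
proof -
  have "fi (e 0) < la (e 0)" "la (e 0) < T" using wordD(1,2)[OF wordD(5)[OF T_pos]] .
  then show ?thesis by simp
qed

text \<open>The writing loop stops when the current vertex equals the target vertex. As a gap is
  shorter than a full turn, this cannot happen too early.\<close>

lemma gap_less: "gap t < int n"
proof -
  have "loc t + 2 \<le> loc (mi t)" by (rule loc_mi)
  also have "\<dots> \<le> loc (t - 1 + L)" using mi_range[of t] by (intro loc_mono) simp
  finally show ?thesis unfolding loc_per gap_def by simp
qed

lemma mod_eq_near: assumes "a mod int n = b mod int n" "\<bar>a - b\<bar> < int n" shows "a = b"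
proof -
  have "int n dvd a - b" using assms(1) by (simp add: mod_eq_dvd_iff)
  then show ?thesis using dvd_imp_le_int[of "a - b" "int n"] assms(2) by (cases "a = b") auto
qed

lemma nat_mod_Suc: "nat ((p + 1) mod int n) = (if Suc (nat (p mod int n)) < n then Suc (nat (p mod int n)) else 0)"
proof -
  have p: "0 \<le> p mod int n" "p mod int n < int n" using n_pos by simp_all
  have "(p + 1) mod int n = (p mod int n + 1) mod int n" by (simp add: mod_add_left_eq)
  also have "\<dots> = (if p mod int n + 1 < int n then p mod int n + 1 else 0)"
  proof (cases "p mod int n + 1 < int n")
    case False
    then have "p mod int n + 1 = int n" using p by simp
    then show ?thesis by simp
  qed (use p in simp)
  finally show ?thesis using p by (auto simp: nat_add_distrib)
qed

definition vertex_at where "vertex_at H p = H ! nat (p mod int n)"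

text \<open>The start \<open>q0\<close> is not written: the walk ends one turn later at the same
  vertex, which is written then.\<close>

definition written where
  "written H q0 r h qs p \<longleftrightarrow> r ''len'' = length qs \<and> stores (h ''out'') (map (vertex_at H) qs) \<and> walk_path (q0 # qs) \<and>
    last (q0 # qs) = p \<and> r ''v'' = nat (p mod int n)"

lemma wp_write_gap:
  assumes Wr: "written H q0 r h qs (loc (\<tau> - 1))" and r: "r ''t'' = ps \<tau>" "r ''n'' = n"
    and arr: "\<And>t. t < T \<Longrightarrow> h ''l'' t = l t" "\<And>p. p < n \<Longrightarrow> h ''ham'' p = H ! p" "\<And>p. p < n \<Longrightarrow> H ! p \<le> W"
    and W: "n \<le> W" "int (length qs) + gap \<tau> \<le> int W"
    and Q: "\<And>r' h' t' qs'. written H q0 r' h' qs' (loc \<tau>) \<Longrightarrow> int (length qs') = int (length qs) + gap \<tau> \<Longrightarrow>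
      (\<forall>x. x \<notin> {''v'', ''len''} \<longrightarrow> r' x = r x) \<Longrightarrow> (\<forall>x. x \<noteq> ''out'' \<longrightarrow> h' x = h x) \<Longrightarrow> t' + 6 * length qs \<le> a + 6 * length qs' + 1 \<Longrightarrow> Q (r', h') t'"
  shows "wp W write_gap Q (r, h) a"
  unfolding write_gap_def
proof (rule wp_While[where V = "\<lambda>s. nat (int (length qs) + gap \<tau>) - fst s ''len''" and
    I = "\<lambda>s b. \<exists>qs' p. written H q0 (fst s) (snd s) qs' p \<and> loc (\<tau> - 1) \<le> p \<and> p \<le> loc \<tau> \<and>
      int (length qs') = int (length qs) + (p - loc (\<tau> - 1)) \<and>
      (\<forall>x. x \<notin> {''v'', ''len''} \<longrightarrow> fst s x = r x) \<and> (\<forall>x. x \<noteq> ''out'' \<longrightarrow> snd s x = h x) \<and> b + 6 * length qs \<le> a + 6 * length qs'"], goal_cases)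
  case 1
  then show ?case using Wr loc_Suc[of "\<tau> - 1"] by (intro exI[of _ qs] exI[of _ "loc (\<tau> - 1)"]) simp
next
  case (2 s b)
  then obtain qs' p where I: "written H q0 (fst s) (snd s) qs' p" "loc (\<tau> - 1) \<le> p" "p \<le> loc \<tau>"
      "int (length qs') = int (length qs) + (p - loc (\<tau> - 1))" "\<And>x. x \<notin> {''v'', ''len''} \<Longrightarrow> fst s x = r x"
      "\<And>x. x \<noteq> ''out'' \<Longrightarrow> snd s x = h x" "b + 6 * length qs \<le> a + 6 * length qs'" by auto
  obtain r1 h1 where s: "s = (r1, h1)" by fastforce
  have wr: "r1 ''len'' = length qs'" "stores (h1 ''out'') (map (vertex_at H) qs')" "walk_path (q0 # qs')" "last (q0 # qs') = p"
    "r1 ''v'' = nat (p mod int n)" using I(1) unfolding s written_def by auto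
  have rr: "r1 ''t'' = ps \<tau>" "r1 ''n'' = n" and hh: "h1 ''l'' (ps \<tau>) = l (ps \<tau>)" "h1 ''ham'' = h ''ham''"
    using I(5,6) r arr(1)[OF ps_less] unfolding s by simp_all
  have "nat (p mod int n) \<noteq> l (ps \<tau>)" using 2(2) rr hh wr(5) unfolding s by auto
  then have "p \<noteq> loc \<tau>" using loc_mod[of \<tau>] by auto
  then have pl: "p + 1 \<le> loc \<tau>" using I(3) by simp
  define v' where "v' = nat ((p + 1) mod int n)"
  have v': "v' < n" unfolding v'_def using n_pos by (simp add: nat_less_iff)
  have vS: "(if Suc (r1 ''v'') < n then Suc (r1 ''v'') else 0) = v'" unfolding v'_def nat_mod_Suc wr(5) ..
  have vW: "Suc (r1 ''v'') \<le> W" using W(1) n_pos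
  proof -
    have "nat (p mod int n) < n" using n_pos by (simp add: nat_less_iff)
    then show ?thesis using W(1) unfolding wr(5) by linarith
  qed
  have lW: "Suc (length qs') \<le> W" using I(4) pl W(2) unfolding gap_def by simp
  have hv: "h1 ''ham'' v' = vertex_at H (p + 1)" "H ! v' \<le> W" unfolding hh(2) vertex_at_def v'_def[symmetric] using arr v' by simp_all
  have hvW: "h1 ''ham'' v' \<le> W" using hv unfolding vertex_at_def v'_def by simp
  have wp: "walk_path (q0 # qs' @ [p + 1])" by (rule walk_path_snoc[OF wr(3)]) (simp_all del: last.simps add: wr(4) link_def)
  have st: "stores ((h1 ''out'')(length qs' := h1 ''ham'' v')) (map (vertex_at H) (qs' @ [p + 1]))"
    using stores_snoc[OF wr(2), of "length qs'" "h1 ''ham'' v'"] hv by simp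
  have dec: "nat (int (length qs) + gap \<tau>) - Suc (length qs') < nat (int (length qs) + gap \<tau>) - length qs'"
    using I(4) pl unfolding gap_def by simp
  have new: "written H q0 (r2(''v'' := v', ''len'' := Suc (length qs'))) (h1(''out'' := (h1 ''out'')(length qs' := h1 ''ham'' v'))) (qs' @ [p + 1]) (p + 1)" for r2
    unfolding written_def using st wp v'_def by simp
  have fin: "\<exists>qs'' p'. written H q0 (r2(''v'' := v', ''len'' := Suc (length qs'))) (h1(''out'' := (h1 ''out'')(length qs' := h1 ''ham'' v'))) qs'' p' \<and>
      loc (\<tau> - 1) \<le> p' \<and> p' \<le> loc \<tau> \<and> int (length qs'') = int (length qs) + (p' - loc (\<tau> - 1)) \<and>
      (\<forall>x. x \<notin> {''v'', ''len''} \<longrightarrow> (r2(''v'' := v', ''len'' := Suc (length qs'))) x = r x) \<and>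
      (\<forall>x. x \<noteq> ''out'' \<longrightarrow> (h1(''out'' := (h1 ''out'')(length qs' := h1 ''ham'' v'))) x = h x) \<and> b' + 6 * length qs \<le> a + 6 * length qs''"
    if "b' \<le> b + 6" "\<And>x. x \<notin> {''v'', ''len''} \<Longrightarrow> r2 x = r1 x" for r2 b'
    by (rule exI[of _ "qs' @ [p + 1]"], rule exI[of _ "p + 1"]) (use new pl I(2,4-7) that in \<open>simp add: s\<close>)
  define h3 where "h3 = h1(''out'' := (h1 ''out'')(length qs' := h1 ''ham'' v'))"
  have run: "wp W (seqs [inc ''v'', If (Less (Var ''v'') (Var ''n'')) Skip (Assign ''v'' (Const 0)),
      Put ''out'' (Var ''len'') (Get ''ham'' (Var ''v'')), inc ''len''])
    (\<lambda>s' a'. s' = (r1(''v'' := v', ''len'' := Suc (length qs')), h3) \<and> a' \<le> b + 6) (r1, h1) (b + 1)"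
  proof (cases "Suc (r1 ''v'') < n")
    case True
    then have e: "Suc (r1 ''v'') = v'" using vS by simp
    have "v' < n" "v' \<le> W" using True vW e by simp_all
    then show ?thesis using lW hvW rr(2) wr(1) by (simp add: e h3_def)
  next
    case False
    then have e: "v' = 0" using vS by simp
    show ?thesis using False vW lW hvW rr(2) wr(1) by (simp add: e h3_def)
  qed
  show ?case unfolding s
  proof (rule wp_mono[OF run])
    fix s' a' assume A: "s' = (r1(''v'' := v', ''len'' := Suc (length qs')), h3) \<and> a' \<le> b + 6"
    then have A1: "s' = (r1(''v'' := v', ''len'' := Suc (length qs')), h3)" and A2: "a' \<le> b + 6" by auto
    have "\<exists>qs' p. written H q0 (fst s') (snd s') qs' p \<and> loc (\<tau> - 1) \<le> p \<and> p \<le> loc \<tau> \<and>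
      int (length qs') = int (length qs) + (p - loc (\<tau> - 1)) \<and>
      (\<forall>x. x \<notin> {''v'', ''len''} \<longrightarrow> fst s' x = r x) \<and> (\<forall>x. x \<noteq> ''out'' \<longrightarrow> snd s' x = h x) \<and> a' + 6 * length qs \<le> a + 6 * length qs'"
      unfolding A1 h3_def fst_conv snd_conv by (rule fin[OF A2]) simp
    moreover have "nat (int (length qs) + gap \<tau>) - fst s' ''len'' < nat (int (length qs) + gap \<tau>) - fst (r1, h1) ''len''"
      unfolding A1 using dec wr(1) by simp
    ultimately show "(\<exists>qs' p. written H q0 (fst s') (snd s') qs' p \<and> loc (\<tau> - 1) \<le> p \<and> p \<le> loc \<tau> \<and>
      int (length qs') = int (length qs) + (p - loc (\<tau> - 1)) \<and>
      (\<forall>x. x \<notin> {''v'', ''len''} \<longrightarrow> fst s' x = r x) \<and> (\<forall>x. x \<noteq> ''out'' \<longrightarrow> snd s' x = h x) \<and> a' + 6 * length qs \<le> a + 6 * length qs') \<and>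
      nat (int (length qs) + gap \<tau>) - fst s' ''len'' < nat (int (length qs) + gap \<tau>) - fst (r1, h1) ''len''" by (rule conjI)
  qed
next
  case (3 s b)
  then obtain qs' p where I: "written H q0 (fst s) (snd s) qs' p" "loc (\<tau> - 1) \<le> p" "p \<le> loc \<tau>"
      "int (length qs') = int (length qs) + (p - loc (\<tau> - 1))" "\<And>x. x \<notin> {''v'', ''len''} \<Longrightarrow> fst s x = r x"
      "\<And>x. x \<noteq> ''out'' \<Longrightarrow> snd s x = h x" "b + 6 * length qs \<le> a + 6 * length qs'" by auto
  obtain r1 h1 where s: "s = (r1, h1)" by fastforce
  have rr: "r1 ''t'' = ps \<tau>" and hh: "h1 ''l'' (ps \<tau>) = l (ps \<tau>)" and rv: "r1 ''v'' = nat (p mod int n)"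
    using I(1,5,6) r arr(1)[OF ps_less] unfolding s written_def by simp_all
  have "nat (p mod int n) = l (ps \<tau>)" using 3(2) rr hh rv unfolding s by auto
  then have "nat (p mod int n) = nat (loc \<tau> mod int n)" unfolding loc_mod .
  then have "p mod int n = loc \<tau> mod int n" using n_pos by (simp add: nat_eq_iff2)
  \<comment> \<open>The test compares vertices, that is positions modulo \<open>n\<close>; being
    less than \<open>n\<close> apart, the positions themselves agree.\<close>
  moreover have "\<bar>p - loc \<tau>\<bar> < int n" using gap_less[of \<tau>] I(2,3) unfolding gap_def by simp
  ultimately have pe: "p = loc \<tau>" by (rule mod_eq_near)
  have w1: "written H q0 r1 h1 qs' (loc \<tau>)" using I(1) pe unfolding s by simp
  have l1: "int (length qs') = int (length qs) + gap \<tau>" using I(4) pe unfolding gap_def by simp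
  have x1: "\<forall>x. x \<notin> {''v'', ''len''} \<longrightarrow> r1 x = r x" "\<forall>x. x \<noteq> ''out'' \<longrightarrow> h1 x = h x" using I(5,6) unfolding s by simp_all
  have t1: "b + 1 + 6 * length qs \<le> a + 6 * length qs' + 1" using I(7) by simp
  show ?case unfolding s by (rule Q[OF w1 l1 x1 t1])
qed

text \<open>The number of vertices still to be written when the tour is at \<open>t\<close>; at the
  start it is the boundary length of \<open>window_size\<close>.\<close>

definition need where
  "need i j t = (if t \<le> j then loc (j - 1) - loc (t - 1) + int (card (unc j (i + L - 1))) else int (card (unc t (i + L - 1))))"

lemma need_skip: assumes "i \<le> t" "t < i + L" "t < j \<or> \<not> mi t < i + L" shows "need i j t = gap t + need i j (t + 1)"
proof (cases "t < j")
  case True then show ?thesis unfolding need_def gap_def by simp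
next
  case False
  then have "int (card (unc t (i + L - 1))) = gap t + int (card (unc (t + 1) (i + L - 1)))" using assms by (intro unc_skip) auto
  then show ?thesis unfolding need_def using False by auto
qed

lemma need_jump: assumes "i \<le> t" "j \<le> t" "mi t < i + L" shows "need i j t = gap t + 1 + need i j (mi t + 1)"
proof -
  have "int (card (unc t (i + L - 1))) = gap t + 1 + int (card (unc (mi t + 1) (i + L - 1)))" using assms by (intro unc_jump) auto
  then show ?thesis unfolding need_def using assms mi_range[of t] by auto
qed

lemma need_nonneg: "i \<le> t \<Longrightarrow> 0 \<le> need i j t"
  unfolding need_def using loc_mono[of "t - 1" "j - 1"] by simp

lemma wp_write_cycle:
  assumes r: "r ''N'' = T" "r ''n'' = n" "r ''i'' = i" "r ''z'' = z" "r ''len'' = 0" and iz: "i < T" "z < T"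
    and F: "faces_stored h" and arr: "\<And>t. t < T \<Longrightarrow> h ''l'' t = l t" "\<And>p. p < n \<Longrightarrow> h ''ham'' p = H ! p" "\<And>p. p < n \<Longrightarrow> H ! p \<le> W"
    and W: "2 * T + n + 1 \<le> W"
    and Q: "\<And>r' h' t' qs. walk_path (loc (int i - 1) # qs) \<Longrightarrow> last (loc (int i - 1) # qs) = loc (int i - 1) + int n \<Longrightarrow>
      int (length qs) = weight (int i) (int i + int z) + 2 \<Longrightarrow> r' ''len'' = length qs \<Longrightarrow> stores (h' ''out'') (map (vertex_at H) qs) \<Longrightarrow>
      t' \<le> a + 16 * T + 8 * n + 6 \<Longrightarrow> Q (r', h') t'"
  shows "wp W write_cycle Q (r, h) a"
proof -
  let ?i = "int i" let ?j = "int i + int z" let ?q0 = "loc (int i - 1)"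
  define S where "S = weight ?i ?j + 2"
  have Sn: "S \<le> int n" unfolding S_def using weight_le[of ?i ?j] by simp
  have need0: "need ?i ?j ?i = S" unfolding S_def need_def using window_size[of ?i ?j] iz(2) by simp
  have dst: "h ''d'' (ps t) = dist (ps t)" "dist (ps t) < T" for t
    using F ps_less[of t] mi_dist[of t] mi_range[of t] unfolding faces_stored_def by auto
  \<comment> \<open>Time is charged as 16 for every tour place passed and 8 for every vertex
    written; a jump consumes \<open>c\<close> by the whole distance.\<close>
  let ?I = "\<lambda>s b. \<exists>qs \<tau>. written H ?q0 (fst s) (snd s) qs (loc (\<tau> - 1)) \<and> ?i \<le> \<tau> \<and> \<tau> \<le> ?i + L \<and>
      int (length qs) + need ?i ?j \<tau> = S \<and> fst s ''t'' = ps \<tau> \<and> int (fst s ''c'') = ?i + L - \<tau> \<and>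
      (\<forall>x. x \<notin> {''v'', ''len'', ''t'', ''c'', ''y''} \<longrightarrow> fst s x = r x) \<and> (\<forall>x. x \<noteq> ''out'' \<longrightarrow> snd s x = h x) \<and>
      b + 16 * fst s ''c'' \<le> a + 4 + 16 * T + 8 * length qs"
  define tailp where "tailp = seqs [If (And (Not (Less (Var ''N'') (Plus (Var ''c'') (Var ''z'')))) (Less (Get ''d'' (Var ''t'')) (Var ''c''))) write_jump Skip,
      inc ''t'', If (Less (Var ''t'') (Var ''N'')) Skip (Assign ''t'' (Const 0)), Assign ''c'' (Minus (Var ''c'') (Const 1))]"
  have body: "seqs [write_gap, If (And (Not (Less (Var ''N'') (Plus (Var ''c'') (Var ''z'')))) (Less (Get ''d'' (Var ''t'')) (Var ''c''))) write_jump Skip,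
      inc ''t'', If (Less (Var ''t'') (Var ''N'')) Skip (Assign ''t'' (Const 0)), Assign ''c'' (Minus (Var ''c'') (Const 1))] = Seq write_gap tailp"
    unfolding tailp_def by simp
  have loop: "wp W (While (Less (Const 0) (Var ''c'')) (seqs [write_gap,
      If (And (Not (Less (Var ''N'') (Plus (Var ''c'') (Var ''z'')))) (Less (Get ''d'' (Var ''t'')) (Var ''c''))) write_jump Skip,
      inc ''t'', If (Less (Var ''t'') (Var ''N'')) Skip (Assign ''t'' (Const 0)), Assign ''c'' (Minus (Var ''c'') (Const 1))])) Q
      (r(''v'' := l (ps (?i - 1)), ''t'' := i, ''c'' := T), h) (a + 4)"
  proof (rule wp_While[where I = ?I and V = "\<lambda>s. fst s ''c''"], goal_cases)
    case 1
    have "walk_path [?q0]" unfolding walk_path_def by simp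
    then have "written H ?q0 (r(''v'' := l (ps (?i - 1)), ''t'' := i, ''c'' := T)) h [] (loc (?i - 1))"
      unfolding written_def using r loc_mod by simp
    then show ?case using need0 ps_of[OF iz(1)] by (intro exI[of _ "[]"] exI[of _ ?i]) simp
  next
    case (2 s b)
    then obtain qs \<tau> where I: "written H ?q0 (fst s) (snd s) qs (loc (\<tau> - 1))" "?i \<le> \<tau>" "\<tau> \<le> ?i + L"
      "int (length qs) + need ?i ?j \<tau> = S" "fst s ''t'' = ps \<tau>" "int (fst s ''c'') = ?i + L - \<tau>"
      "\<And>x. x \<notin> {''v'', ''len'', ''t'', ''c'', ''y''} \<Longrightarrow> fst s x = r x" "\<And>x. x \<noteq> ''out'' \<Longrightarrow> snd s x = h x"
      "b + 16 * fst s ''c'' \<le> a + 4 + 16 * T + 8 * length qs" by auto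
    obtain r1 h1 where s: "s = (r1, h1)" by fastforce
    have c0: "0 < r1 ''c''" using 2(2) unfolding s by simp
    then have tl: "\<tau> < ?i + L" using I(6) unfolding s by simp
    define c where "c = r1 ''c''"
    have ic: "int c = ?i + L - \<tau>" "0 < c" "c \<le> T" using I(6,2) c0 unfolding s c_def by simp_all
    let ?jump = "?j \<le> \<tau> \<and> mi \<tau> < ?i + L"
    have nn: "int (length qs) + gap \<tau> + (if ?jump then 1 else 0) \<le> S"
      using need_skip[of ?i \<tau> ?j] need_jump[of ?i \<tau> ?j] need_nonneg[of ?i "\<tau> + 1" ?j] need_nonneg[of ?i "mi \<tau> + 1" ?j] mi_range[of \<tau>] I(2,4) tl
      by (cases ?jump) auto
    have SW: "S \<le> int W" using Sn W by simp
    show ?case unfolding s body wp_Seq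
    proof (rule wp_write_gap[where H = H and ?q0.0 = ?q0 and qs = qs and \<tau> = \<tau>], goal_cases)
      case 1 show ?case using I(1) unfolding s by simp
    next
      case 2 show ?case using I(5) unfolding s by simp
    next
      case 3 show ?case using I(7) r(2) unfolding s by simp
    next
      case (4 t) then show ?case using I(8) arr(1) unfolding s by simp
    next
      case (5 p) then show ?case using I(8) arr(2) unfolding s by simp
    next
      case (6 p) then show ?case using arr(3) by simp
    next
      case 7 show ?case using W by simp
    next
      case 8
      show ?case using nn SW by (simp split: if_splits)
    next
      case (9 r2 h2 b2 qs2)
      have wr: "r2 ''len'' = length qs2" "stores (h2 ''out'') (map (vertex_at H) qs2)" "walk_path (?q0 # qs2)" "last (?q0 # qs2) = loc \<tau>"
        "r2 ''v'' = nat (loc \<tau> mod int n)" using 9(1) unfolding written_def by auto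
      have r2: "r2 x = r1 x" if "x \<notin> {''v'', ''len''}" for x using 9(3) that by simp
      have rr: "r2 ''N'' = T" "r2 ''n'' = n" "r2 ''z'' = z" "r2 ''c'' = c" "r2 ''t'' = ps \<tau>"
        using r2 I(5,7) r unfolding s c_def by simp_all
      have fr: "r2 x = r x" if "x \<notin> {''v'', ''len'', ''t'', ''c'', ''y''}" for x using r2[of x] I(7)[of x] that unfolding s by simp
      have hh: "h2 x = h x" if "x \<noteq> ''out''" for x using 9(4) I(8) that unfolding s by simp
      have h2: "h2 ''d'' (ps \<tau>) = dist (ps \<tau>)" using hh dst(1) by simp
      have cond: "(\<not> T < c + z \<and> dist (ps \<tau>) < c) \<longleftrightarrow> ?jump"
        using ic mi_dist[of \<tau>] by auto
      have b2: "b2 + 16 * c \<le> a + 4 + 16 * T + 2 * length qs + 6 * length qs2 + 2" using 9(5) I(9) unfolding s c_def by simp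
      have len: "length qs \<le> length qs2" using 9(2) gap_nonneg[of \<tau>] by simp
      have W': "T \<le> W" "Suc (ps \<tau>) \<le> W" "ps \<tau> + dist (ps \<tau>) \<le> W" using W ps_less[of \<tau>] dst(2)[of \<tau>] by simp_all
      show ?case
      proof (cases ?jump)
        case False
        have nd: "int (length qs2) + need ?i ?j (\<tau> + 1) = S" using 9(2) I(4) need_skip[of ?i \<tau> ?j] False I(2) tl by auto
        have pS: "(if Suc (ps \<tau>) < T then Suc (ps \<tau>) else 0) = ps (\<tau> + 1)" using ps_add[OF T_gt_1, of \<tau>] ps_less[of \<tau>] by simp
        have nb: "\<not> (\<not> T < c + z \<and> dist (ps \<tau>) < c)" using cond False by simp
        have cW: "c - Suc 0 \<le> W" using ic(3) W'(1) by simp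
        have "wp W tailp (\<lambda>s' a'. fst s' ''t'' = ps (\<tau> + 1) \<and> fst s' ''c'' = c - 1 \<and> (\<forall>x. x \<notin> {''t'', ''c''} \<longrightarrow> fst s' x = r2 x) \<and> snd s' = h2 \<and> a' \<le> b2 + 6) (r2, h2) b2"
        proof (cases "Suc (ps \<tau>) < T")
          case True
          then have e: "ps (\<tau> + 1) = Suc (ps \<tau>)" using pS by simp
          show ?thesis unfolding tailp_def using nb rr h2 W' True cW by (cases "T < c + z") (simp_all add: e)
        next
          case F: False
          then have e: "ps (\<tau> + 1) = 0" using pS by simp
          show ?thesis unfolding tailp_def using nb rr h2 W' F cW by (cases "T < c + z") (simp_all add: e)
        qed
        then show ?thesis
        proof (rule wp_mono)
          fix s' a' assume A: "fst s' ''t'' = ps (\<tau> + 1) \<and> fst s' ''c'' = c - 1 \<and> (\<forall>x. x \<notin> {''t'', ''c''} \<longrightarrow> fst s' x = r2 x) \<and> snd s' = h2 \<and> a' \<le> b2 + 6"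
          have wn: "written H ?q0 (fst s') (snd s') qs2 (loc (\<tau> + 1 - 1))" using 9(1) A unfolding written_def by simp
          have ho: "snd s' x = h x" if "x \<noteq> ''out''" for x using A hh[OF that] by simp
          have cc: "int (fst s' ''c'') = ?i + L - (\<tau> + 1)" using A ic by simp
          have rx: "fst s' x = r x" if "x \<notin> {''v'', ''len'', ''t'', ''c'', ''y''}" for x using A fr[OF that] that by simp
          have A5: "fst s' ''c'' = c - 1" "a' \<le> b2 + 6" by (simp_all only: A)
          have "16 * (c - 1) + 16 = 16 * c" using ic(2) by simp
          then have tm: "a' + 16 * fst s' ''c'' \<le> a + 4 + 16 * T + 8 * length qs2" unfolding A5(1) using A5(2) b2 len by linarith
          have "?I s' a'"
            by (rule exI[of _ qs2], rule exI[of _ "\<tau> + 1"], intro conjI allI impI, rule wn, use I(2) in linarith, use tl in linarith,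
              rule nd, rule conjunct1[OF A], rule cc, rule rx, assumption, rule ho, assumption, rule tm)
          then show "?I s' a' \<and> fst s' ''c'' < fst (r1, h1) ''c''" using A ic by (simp add: c_def)
        qed
      next
        case True
        let ?D = "dist (ps \<tau>)"
        have nd: "int (length (qs2 @ [loc (mi \<tau>)])) + need ?i ?j (mi \<tau> + 1) = S"
          using 9(2) I(4) need_jump[of ?i \<tau> ?j] True I(2) by auto
        have pm: "(if ps \<tau> + ?D < T then ps \<tau> + ?D else ps \<tau> + ?D - T) = ps (mi \<tau>)" using ps_add[OF dst(2), of \<tau> \<tau>] unfolding mi_dist[of \<tau>] by simp
        have pS: "(if Suc (ps (mi \<tau>)) < T then Suc (ps (mi \<tau>)) else 0) = ps (mi \<tau> + 1)" using ps_add[OF T_gt_1, of "mi \<tau>"] ps_less[of "mi \<tau>"] by simp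
        have lm: "h2 ''l'' (ps (mi \<tau>)) = l (ps (mi \<tau>))" "l (ps (mi \<tau>)) < n" using hh arr(1)[OF ps_less] l_less[OF ps_less] by simp_all
        have hm: "h2 ''ham'' (l (ps (mi \<tau>))) = vertex_at H (loc (mi \<tau>))" unfolding vertex_at_def loc_mod using hh arr(2)[OF lm(2)] by simp
        have hmW: "vertex_at H (loc (mi \<tau>)) \<le> W" unfolding vertex_at_def loc_mod using arr(3)[OF lm(2)] .
        have wpn: "walk_path (?q0 # qs2 @ [loc (mi \<tau>)])"
          by (rule walk_path_snoc[OF wr(3)]) (use wr(4) loc_mi[of \<tau>] in \<open>auto simp: link_def\<close>)
        have st: "stores ((h2 ''out'')(length qs2 := vertex_at H (loc (mi \<tau>)))) (map (vertex_at H) (qs2 @ [loc (mi \<tau>)]))"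
          using stores_snoc[OF wr(2), of "length qs2" "vertex_at H (loc (mi \<tau>))"] by simp
        have lW: "Suc (length qs2) \<le> W" using nn True 9(2) SW by simp
        have Dc: "?D < c" using cond True by simp
        have cm: "int (c - ?D - 1) = ?i + L - (mi \<tau> + 1)" using Dc ic mi_dist[of \<tau>] by simp
        let ?h = "h2(''out'' := (h2 ''out'')(length qs2 := vertex_at H (loc (mi \<tau>))))"
        have yb: "\<not> T < c + z" "?D < c" using cond True by auto
        have bd: "?D \<le> W" "c \<le> W" "ps \<tau> + ?D - T \<le> W" "l (ps (mi \<tau>)) \<le> W" "Suc (ps (mi \<tau>)) \<le> W" "c - ?D - Suc 0 \<le> W" "c - ?D \<le> W"
          using W ic(3) dst(2)[of \<tau>] lm(2) ps_less[of "mi \<tau>"] ps_less[of \<tau>] by simp_all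
        have t1: "Suc (ps (mi \<tau>)) < T \<Longrightarrow> ps (mi \<tau> + 1) = Suc (ps (mi \<tau>))" "\<not> Suc (ps (mi \<tau>)) < T \<Longrightarrow> ps (mi \<tau> + 1) = 0" using pS by simp_all
        have "wp W tailp (\<lambda>s' a'. fst s' ''t'' = ps (mi \<tau> + 1) \<and> fst s' ''c'' = c - ?D - Suc 0 \<and> fst s' ''v'' = l (ps (mi \<tau>)) \<and> fst s' ''len'' = Suc (length qs2) \<and>
            (\<forall>x. x \<notin> {''t'', ''c'', ''v'', ''len'', ''y''} \<longrightarrow> fst s' x = r2 x) \<and> snd s' = ?h \<and> a' \<le> b2 + 14) (r2, h2) b2"
        proof (cases "ps \<tau> + ?D < T")
          case A: True
          then have e: "ps \<tau> + ?D = ps (mi \<tau>)" using pm by simp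
          show ?thesis unfolding tailp_def write_jump_def using yb rr h2 W' bd lm hm hmW lW wr(1) A t1
            by (cases "Suc (ps (mi \<tau>)) < T") (simp_all add: e)
        next
          case A: False
          then have e: "ps \<tau> + ?D - T = ps (mi \<tau>)" using pm by simp
          show ?thesis unfolding tailp_def write_jump_def using yb rr h2 W' bd lm hm hmW lW wr(1) A t1
            by (cases "Suc (ps (mi \<tau>)) < T") (simp_all add: e)
        qed
        then show ?thesis
        proof (rule wp_mono)
          fix s' a' assume A: "fst s' ''t'' = ps (mi \<tau> + 1) \<and> fst s' ''c'' = c - ?D - Suc 0 \<and> fst s' ''v'' = l (ps (mi \<tau>)) \<and> fst s' ''len'' = Suc (length qs2) \<and>
            (\<forall>x. x \<notin> {''t'', ''c'', ''v'', ''len'', ''y''} \<longrightarrow> fst s' x = r2 x) \<and> snd s' = ?h \<and> a' \<le> b2 + 14"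
          have wn: "written H ?q0 (fst s') (snd s') (qs2 @ [loc (mi \<tau>)]) (loc (mi \<tau> + 1 - 1))" unfolding written_def using A st wpn loc_mod by simp
          have ho: "snd s' x = h x" if "x \<noteq> ''out''" for x using A hh[OF that] that by simp
          have cc: "int (fst s' ''c'') = ?i + L - (mi \<tau> + 1)" using A cm by simp
          have rx: "fst s' x = r x" if "x \<notin> {''v'', ''len'', ''t'', ''c'', ''y''}" for x using A fr[OF that] that by simp
          have A5: "fst s' ''c'' = c - ?D - Suc 0" "a' \<le> b2 + 14" by (simp_all only: A)
          have "16 * (c - ?D - Suc 0) + 16 \<le> 16 * c" using ic(2) by simp
          moreover have "length (qs2 @ [loc (mi \<tau>)]) = length qs2 + 1" by simp
          ultimately have tm: "a' + 16 * fst s' ''c'' \<le> a + 4 + 16 * T + 8 * length (qs2 @ [loc (mi \<tau>)])" unfolding A5(1) using A5(2) b2 len by linarith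
          have "?I s' a'"
            by (rule exI[of _ "qs2 @ [loc (mi \<tau>)]"], rule exI[of _ "mi \<tau> + 1"], intro conjI allI impI, rule wn, use I(2) mi_range[of \<tau>] in linarith,
              use True in linarith, rule nd, rule conjunct1[OF A], rule cc, rule rx, assumption, rule ho, assumption, rule tm)
          then show "?I s' a' \<and> fst s' ''c'' < fst (r1, h1) ''c''" using A ic by (simp add: c_def)
        qed
      qed
    qed
  next
    case (3 s b)
    then obtain qs \<tau> where I: "written H ?q0 (fst s) (snd s) qs (loc (\<tau> - 1))" "\<tau> = ?i + L"
      "int (length qs) + need ?i ?j \<tau> = S" "b \<le> a + 4 + 16 * T + 8 * length qs" by auto
    have "need ?i ?j (?i + L) = 0" unfolding need_def using iz(2) unc_empty[of "?i + L - 1"] by simp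
    then have len: "int (length qs) = S" using I(2,3) by simp
    obtain r1 h1 where s: "s = (r1, h1)" by fastforce
    have "loc (\<tau> - 1) = ?q0 + int n" using loc_per[of "?i - 1"] unfolding I(2) by (simp add: algebra_simps)
    then show ?case unfolding s using I(1,4) len Sn unfolding s written_def S_def by (intro Q[of qs]) auto
  qed
  have v0: "(if 0 < i then l (i - 1) else l (T - 1)) = l (ps (?i - 1))"
  proof (cases "0 < i")
    case True
    then have e: "?i - 1 = int (i - 1)" by simp
    have "ps (?i - 1) = i - 1" unfolding e by (rule ps_of) (use iz(1) in simp)
    then show ?thesis using True by simp
  next
    case False
    have "?i - 1 = L * (- 1) + int (T - 1)" using False T_pos by (simp add: of_nat_diff)
    then have "ps (?i - 1) = T - 1" by (rule ps_eqI) (use T_pos in simp)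
    then show ?thesis using False by simp
  qed
  have lW: "l (ps (?i - 1)) \<le> W" "i \<le> W" "T \<le> W" using l_less[OF ps_less[of "?i - 1"]] W iz by simp_all
  define lp where "lp = While (Less (Const 0) (Var ''c'')) (seqs [write_gap,
      If (And (Not (Less (Var ''N'') (Plus (Var ''c'') (Var ''z'')))) (Less (Get ''d'' (Var ''t'')) (Var ''c''))) write_jump Skip,
      inc ''t'', If (Less (Var ''t'') (Var ''N'')) Skip (Assign ''t'' (Const 0)), Assign ''c'' (Minus (Var ''c'') (Const 1))])"
  have sw: "write_cycle = Seq (If (Less (Const 0) (Var ''i'')) (Assign ''v'' (Get ''l'' (Minus (Var ''i'') (Const 1))))
      (Assign ''v'' (Get ''l'' (Minus (Var ''N'') (Const 1))))) (Seq (Assign ''t'' (Var ''i'')) (Seq (Assign ''c'' (Var ''N'')) lp))"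
    unfolding write_cycle_def lp_def by simp
  have "a + 4 = Suc (Suc (Suc (Suc a)))" by simp
  then have loop': "wp W lp Q (r(''v'' := l (ps (?i - 1)), ''t'' := i, ''c'' := T), h) (Suc (Suc (Suc (Suc a))))"
    using loop unfolding lp_def by (simp only:)
  have e: "0 < i \<Longrightarrow> h ''l'' (i - Suc 0) = l (ps (?i - 1))" "\<not> 0 < i \<Longrightarrow> h ''l'' (T - Suc 0) = l (ps (?i - 1))"
    using v0 arr(1)[of "i - 1"] arr(1)[of "T - 1"] iz(1) T_pos by (simp_all split: if_splits)
  show ?thesis
  proof (cases "0 < i")
    case True
    show ?thesis unfolding sw using loop' e(1)[OF True] lW r True by simp
  next
    case False
    show ?thesis unfolding sw using loop' e(2)[OF False] lW r False by simp
  qed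
qed

text \<open>All positions in \<open>qs\<close> lie within one turn after \<open>q0\<close>, so they
  give distinct vertices, and since the last one is \<open>q0\<close> plus a full turn the walk
  closes up.\<close>

lemma walk_cycle:
  assumes w: "walk_path (q0 # qs)" and last: "last (q0 # qs) = q0 + int n" and len: "3 \<le> length qs"
    and H: "distinct H" "length H = n" "set H \<subseteq> V" and ham: "\<And>p. p < n \<Longrightarrow> {H ! p, H ! (Suc p mod n)} \<in> E"
    and ch: "\<And>x. x \<in> X \<Longrightarrow> {H ! ca x, H ! cb x} \<in> E"
  shows "is_cycle V E (map (vertex_at H) qs)"
proof -
  let ?v = "vertex_at H"
  have idx: "nat (p mod int n) < n" for p using n_pos by (simp add: nat_less_iff)
  have link_edge: "{?v a, ?v b} \<in> E" if "link a b" for a b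
    using that unfolding link_def
  proof
    assume b: "b = a + 1"
    have "nat ((a + 1) mod int n) = Suc (nat (a mod int n)) mod n"

    proof -
      have "Suc (nat (a mod int n)) = n \<or> Suc (nat (a mod int n)) < n" using idx[of a] by linarith
      then show ?thesis unfolding nat_mod_Suc by (elim disjE) simp_all
    qed
    then show ?thesis using ham[OF idx[of a]] unfolding b vertex_at_def by simp
  next
    assume "\<exists>t. a = loc t \<and> b = loc (mi t)"
    then obtain t where t: "a = loc t" "b = loc (mi t)" by blast
    have x: "ei t \<in> X" by (rule ei_in)
    have "{l (ps t), l (ps (mi t))} = {ca (ei t), cb (ei t)}"
      by (cases t rule: cases_open) (use l_ends[OF x] in \<open>simp_all add: insert_commute\<close>)
    then have "{H ! l (ps t), H ! l (ps (mi t))} = {H ! ca (ei t), H ! cb (ei t)}" by (auto simp: doubleton_eq_iff)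
    then show ?thesis using ch[OF x] unfolding t vertex_at_def loc_mod by simp
  qed
  have so: "sorted_wrt (<) (q0 # qs)" and adj: "\<And>a b. (a, b) \<in> adjacent (q0 # qs) \<Longrightarrow> link a b" using w unfolding walk_path_def by auto
  have ne: "qs \<noteq> []" using len by auto
  have range: "q0 < p \<and> p \<le> q0 + int n" if "p \<in> set qs" for p
  proof -
    obtain us a where s: "qs = us @ [a]" using ne by (metis append_butlast_last_id)
    have "a = q0 + int n" using last s by simp
    then show ?thesis using so that unfolding s by (auto simp: sorted_wrt_append)
  qed
  have dq: "distinct qs" using so by (auto simp: strict_sorted_iff)
  have inj: "inj_on ?v (set qs)"
  proof (rule inj_onI)
    fix a b assume ab: "a \<in> set qs" "b \<in> set qs" "?v a = ?v b"
    then have "nat (a mod int n) = nat (b mod int n)" using nth_eq_iff_index_eq[OF H(1)] idx H(2) unfolding vertex_at_def by simp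
    then have "a mod int n = b mod int n" using n_pos by (simp add: nat_eq_iff2)
    moreover have "\<bar>a - b\<bar> < int n" using range[OF ab(1)] range[OF ab(2)] by linarith
    ultimately show "a = b" by (rule mod_eq_near)
  qed
  show ?thesis unfolding is_cycle_def
  proof (intro conjI allI impI)
    show "3 \<le> length (map ?v qs)" using len by simp
    show "distinct (map ?v qs)" using dq inj by (simp add: distinct_map)
    show "set (map ?v qs) \<subseteq> V" using H idx unfolding vertex_at_def by auto
    fix k assume "k < length (map ?v qs)"
    then have k: "k < length qs" by simp
    show "{map ?v qs ! k, map ?v qs ! (Suc k mod length (map ?v qs))} \<in> E"
    proof (cases "Suc k < length qs")
      case True
      have "(qs ! k, qs ! Suc k) \<in> adjacent (q0 # qs)" using adjacent_nth[of "Suc k" "q0 # qs"] True by simp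
      then show ?thesis using link_edge[OF adj] True k by simp
    next
      case False
      then have kl: "Suc k = length qs" using k by simp
      have "k = length qs - 1" using kl by simp
      then have "qs ! k = last qs" using last_conv_nth[OF ne] by simp
      \<comment> \<open>The closing edge is the first link of the walk, from \<open>q0\<close>, read
        with the last vertex in place of \<open>q0\<close>.\<close>
      then have "qs ! k = q0 + int n" using last ne by simp
      then have "?v (qs ! k) = ?v q0" unfolding vertex_at_def by simp
      moreover have "(q0, qs ! 0) \<in> adjacent (q0 # qs)" using adjacent_nth[of 0 "q0 # qs"] ne by simp
      moreover have "map ?v qs ! 0 = ?v (qs ! 0)" using ne by (cases qs) simp_all
      ultimately show ?thesis using link_edge[OF adj, of q0 "qs ! 0"] k kl by simp
    qed
  qed
qed

end

section \<open>Numerical hypotheses and the input graph\<close>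

text \<open>Here \<open>d\<close> is the number of chords and \<open>q\<close> the size of the
  larger colour class. The edge bound becomes \<open>(1 + \<gamma>) * n \<le> 2 * q\<close>, which
  eliminates \<open>\<gamma>\<close> from each hypothesis; as \<open>q\<close> is an integer, the
  floor and ceilings can be bounded by integers directly.\<close>

lemma admissible_bounds:
  assumes "admissible n m \<gamma> k g" "m \<le> n + d" "d \<le> 2 * q"
  shows "n \<le> 2 * q + g + 1" "k \<le> q + 2 * g + 1" "n \<le> q + k" "3 \<le> k" "k \<le> n" "1 \<le> g"
proof -
  have A: "(2 + \<gamma>) * real n \<le> real m" "int g + \<lceil>\<gamma> * real n\<rceil> + 2 > 0"
    "\<lfloor>(1 - \<gamma>) * real n / 2\<rfloor> \<le> int k" "real k \<le> real_of_int \<lceil>(1 + \<gamma>) * real n\<rceil> / 2 + 2 * real g + 3 / 2"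
    and B: "3 \<le> k" "k \<le> n" "0 < g"
    using assms(1) unfolding admissible_def by auto
  have "real m \<le> real n + 2 * real q" using assms(2,3) by (metis (no_types, opaque_lifting) add_left_mono le_trans of_nat_add of_nat_le_iff of_nat_mult of_nat_numeral)
  then have c: "(1 + \<gamma>) * real n \<le> 2 * real q" using A(1) by (simp add: algebra_simps)
  have "\<lceil>\<gamma> * real n\<rceil> \<le> 2 * int q - int n" using c by (intro ceiling_le) (simp add: algebra_simps)
  then show "n \<le> 2 * q + g + 1" using A(2) by linarith
  have "\<lceil>(1 + \<gamma>) * real n\<rceil> \<le> 2 * int q" using c by (intro ceiling_le) simp
  then have "real_of_int \<lceil>(1 + \<gamma>) * real n\<rceil> \<le> 2 * real q" by linarith
  then have "real k \<le> real q + 2 * real g + 3 / 2" using A(4) by linarith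
  then show "k \<le> q + 2 * g + 1" by linarith
  have "real n - real q \<le> (1 - \<gamma>) * real n / 2" using c by (simp add: algebra_simps)
  then have "int n - int q \<le> \<lfloor>(1 - \<gamma>) * real n / 2\<rfloor>" by (intro le_floor_iff[THEN iffD2]) simp
  then show "n \<le> q + k" using A(3) by linarith
  show "3 \<le> k" "k \<le> n" "1 \<le> g" using B by auto
qed

text \<open>Dropping items preserves the order of the remaining ones, so an interlacing in the kept
  class is one in the full word, where the colouring forbids it.\<close>

lemma (in chord_items) interlaced_filter:
  assumes w: "item_word ws X" and z: "item_word zs Y" and zs: "zs = filter P ws" and xy: "x \<in> Y" "y \<in> Y"
    and i: "interlaced (fi zs) (la zs) x y"
  shows "interlaced (fi ws) (la ws) x y"
proof -
  have d: "distinct ws" using w unfolding item_word_def by blast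
  have mono: "position ws (zs ! s) < position ws (zs ! t)" if st: "s < t" "t < length zs" for s t
  proof -
    have "sorted_wrt (\<lambda>a b. position ws a < position ws b) ws"
      unfolding sorted_wrt_iff_nth_less using position_nth[OF d] by simp
    then have "sorted_wrt (\<lambda>a b. position ws a < position ws b) zs" unfolding zs by (rule sorted_wrt_filter)
    then show ?thesis using st unfolding sorted_wrt_iff_nth_less by blast
  qed
  note dx = item_wordD[OF z xy(1)] and dy = item_wordD[OF z xy(2)]
  have i: "fi zs x < fi zs y" "fi zs y < la zs x" "la zs x < la zs y" using i unfolding interlaced_def by auto
  show ?thesis unfolding interlaced_def
    using mono[OF i(1) dy(2)] mono[OF i(2) dx(4)] mono[OF i(3) dy(4)] unfolding dx(3,5) dy(3,5) by blast
qed

locale ham_graph =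
  fixes n :: nat and E :: "nat set set" and es :: "(nat \<times> nat) list" and H :: "nat list"
  assumes simple: "simple_graph {..<n} E" and edges: "edge_list E es" and ham: "hamilton_cycle {..<n} E H"
begin

lemma H_facts: "distinct H" "set H = {..<n}" "length H = n" "3 \<le> n"
  "p < n \<Longrightarrow> {H ! p, H ! (Suc p mod n)} \<in> E" "p < n \<Longrightarrow> H ! p < n"
proof -
  show d: "distinct H" "set H = {..<n}" using ham unfolding hamilton_cycle_def is_cycle_def by auto
  show l: "length H = n" using distinct_card[OF d(1)] d(2) by simp
  show "3 \<le> n" "p < n \<Longrightarrow> {H ! p, H ! (Suc p mod n)} \<in> E" using ham l unfolding hamilton_cycle_def is_cycle_def by auto
  show "p < n \<Longrightarrow> H ! p < n" using nth_mem[of p H] l d(2) by auto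
qed

lemma pos_H: assumes "u < n" shows "position H u < n" "H ! position H u = u"
  using position_in[of u H] assms H_facts(2,3) by auto

lemma distinct_edges: "distinct (map (\<lambda>uv. {fst uv, snd uv}) es)" "set (map (\<lambda>uv. {fst uv, snd uv}) es) = E"
proof -
  have eq: "(\<lambda>(u, v). {u, v}) = (\<lambda>uv :: nat \<times> nat. {fst uv, snd uv})" by (simp add: fun_eq_iff)
  show "distinct (map (\<lambda>uv. {fst uv, snd uv}) es)" "set (map (\<lambda>uv. {fst uv, snd uv}) es) = E"
    using edges unfolding edge_list_def eq by blast+
qed

lemma edge_ends:
  assumes "uv \<in> set es" shows "{fst uv, snd uv} \<in> E" "fst uv < n" "snd uv < n" "fst uv \<noteq> snd uv"
proof -
  show e: "{fst uv, snd uv} \<in> E" using imageI[OF assms, of "\<lambda>uv. {fst uv, snd uv}"] unfolding distinct_edges(2)[symmetric] set_map .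
  have c: "{fst uv, snd uv} \<subseteq> {..<n} \<and> card {fst uv, snd uv} = 2"
    by (rule bspec[OF conjunct2[OF simple[unfolded simple_graph_def]] e])
  then show "fst uv < n" "snd uv < n" by simp_all
  show "fst uv \<noteq> snd uv"
  proof
    assume "fst uv = snd uv"
    then show False using c by simp
  qed
qed

definition D where "D = chord_list n (position H) es"

lemma ends_order:
  assumes "uv \<in> set es" and o: "ordered_ends (position H) uv = (a, b)"
  shows "a < b" "b < n" "{H ! a, H ! b} = {fst uv, snd uv}"
proof -
  note e = edge_ends[OF assms(1)]
  note p = pos_H[OF e(2)] pos_H[OF e(3)]
  have ne: "position H (fst uv) \<noteq> position H (snd uv)" using p e(4) by metis
  have ab: "a = min (position H (fst uv)) (position H (snd uv))" "b = max (position H (fst uv)) (position H (snd uv))"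
    using o unfolding ordered_ends_def by simp_all
  show "a < b" "b < n" unfolding ab using ne p by auto
  show "{H ! a, H ! b} = {fst uv, snd uv}" unfolding ab min_def max_def using p by auto
qed

lemma D_facts:
  assumes "ab \<in> set D" shows "chord_pair n ab" "snd ab < n" "{H ! fst ab, H ! snd ab} \<in> E"
proof -
  obtain uv where uv: "uv \<in> set es" "ab = ordered_ends (position H) uv" "chord_pair n ab"
    using assms unfolding D_def chord_list_def by auto
  note o = ends_order[OF uv(1), of "fst ab" "snd ab"]
  have "ordered_ends (position H) uv = (fst ab, snd ab)" using uv(2) by simp
  then show "chord_pair n ab" "snd ab < n" "{H ! fst ab, H ! snd ab} \<in> E" using uv(3) o edge_ends(1)[OF uv(1)] by simp_all
qed

lemma distinct_D: "distinct D"
proof -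
  let ?o = "ordered_ends (position H)"
  have inj: "inj_on ?o (set es)"
  proof (rule inj_onI)
    fix x y assume xy: "x \<in> set es" "y \<in> set es" "?o x = ?o y"
    obtain a b where o: "?o x = (a, b)" by fastforce
    have "{fst x, snd x} = {fst y, snd y}" using ends_order(3)[OF xy(1) o] ends_order(3)[OF xy(2)] o xy(3) by metis
    then show "x = y" using distinct_edges(1) xy(1,2) unfolding distinct_map inj_on_def by blast
  qed
  have "distinct es" using distinct_edges(1) by (simp add: distinct_map)
  then show ?thesis unfolding D_def chord_list_def using inj by (simp add: distinct_map)
qed

lemma length_es: "length es = card E"
  using distinct_card[OF distinct_edges(1)] unfolding distinct_edges(2) by simp

text \<open>An edge that is not a chord joins cyclically consecutive positions, so it is one of the
  at most \<open>n\<close> edges of the Hamilton cycle.\<close>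

lemma few_hamilton_edges: "card E \<le> n + length D"
proof -
  let ?o = "ordered_ends (position H)" and ?e = "\<lambda>uv. {fst uv, snd uv}"
  let ?F = "filter (\<lambda>uv. \<not> chord_pair n (?o uv)) es"
  have "length D = length (filter (\<lambda>uv. chord_pair n (?o uv)) es)" unfolding D_def chord_list_def by (simp add: filter_map o_def)
  then have "length es = length D + length ?F" using sum_length_filter_compl[of "\<lambda>uv. chord_pair n (?o uv)" es] by simp
  moreover have "length ?F \<le> n"
  proof -
    have "distinct (map ?e ?F)" using distinct_edges(1) by (rule distinct_map_filter)
    then have "length ?F = card (set (map ?e ?F))" using distinct_card by fastforce
    also have "\<dots> \<le> card ((\<lambda>p. {H ! p, H ! (Suc p mod n)}) ` {..<n})"
    proof (rule card_mono)
      show "set (map ?e ?F) \<subseteq> (\<lambda>p. {H ! p, H ! (Suc p mod n)}) ` {..<n}"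
      proof
        fix e assume "e \<in> set (map ?e ?F)"
        then obtain uv where uv: "uv \<in> set es" "\<not> chord_pair n (?o uv)" "e = ?e uv" by auto
        obtain a b where o: "?o uv = (a, b)" by fastforce
        note ab = ends_order[OF uv(1) o]
        have "b = a + 1 \<or> (a = 0 \<and> b = n - 1)" using uv(2) ab(1,2) unfolding o chord_pair_def fst_conv snd_conv by linarith
        then show "e \<in> (\<lambda>p. {H ! p, H ! (Suc p mod n)}) ` {..<n}"
        proof
          assume "b = a + 1"
          then have "Suc a mod n = b" using ab(2) by simp
          then have "e = {H ! a, H ! (Suc a mod n)}" using uv(3) ab(3) by (simp only:)
          then show ?thesis by (rule image_eqI) (use ab(1,2) in simp)
        next
          assume c: "a = 0 \<and> b = n - 1"
          then have "Suc b mod n = 0" using H_facts(4) by simp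
          then have "e = {H ! b, H ! (Suc b mod n)}" using uv(3) ab(3) c by (simp only: insert_commute)
          then show ?thesis by (rule image_eqI) (use ab(2) in simp)
        qed
      qed
    qed simp
    also have "\<dots> \<le> n" using card_image_le[of "{..<n}"] by (metis card_lessThan finite_lessThan)
    finally show ?thesis .
  qed
  ultimately show ?thesis using length_es by simp
qed

lemma chord_list_D:
  assumes "\<And>j. j < n \<Longrightarrow> P (H ! j) = j" shows "chord_list n P es = D"
proof -
  have "P u = position H u" if "u < n" for u using assms[OF pos_H(1)[OF that]] pos_H(2)[OF that] by simp
  then have e: "map (ordered_ends P) es = map (ordered_ends (position H)) es"
    using edge_ends(2,3) unfolding ordered_ends_def by simp
  show ?thesis unfolding D_def chord_list_def e ..
qed

end

lemma edge_list_exists: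
  assumes "simple_graph V E" shows "\<exists>es. edge_list E es"
proof -
  have "finite V" "E \<subseteq> Pow V" using assms unfolding simple_graph_def by auto
  then have "finite E" by (meson finite_Pow_iff finite_subset)
  then obtain xs where xs: "set xs = E" "distinct xs" using finite_distinct_list by blast
  have "\<forall>e. \<exists>uv. e \<in> E \<longrightarrow> {fst uv, snd uv} = e"
  proof
    fix e
    show "\<exists>uv. e \<in> E \<longrightarrow> {fst uv, snd uv} = e"
    proof (cases "e \<in> E")
      case True
      then have "card e = 2" using assms unfolding simple_graph_def by blast
      then obtain u v where "e = {u, v}" by (auto simp: card_2_iff)
      then show ?thesis by (intro exI[of _ "(u, v)"]) simp
    qed simp
  qed
  then obtain f where f: "\<And>e. e \<in> E \<Longrightarrow> {fst (f e), snd (f e)} = e" by metis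
  have "map (\<lambda>(u, v). {u, v}) (map f xs) = map (\<lambda>e. {fst (f e), snd (f e)}) xs" by (simp add: case_prod_beta o_def)
  also have "\<dots> = xs" by (rule map_idI) (use f xs(1) in blast)
  finally have "map (\<lambda>(u, v). {u, v}) (map f xs) = xs" .
  then show ?thesis unfolding edge_list_def using xs by metis
qed

text \<open>The program works on \<open>{..<n}\<close>. Renaming vertex \<open>C ! i\<close> to i
  transports graph and drawing there, and its output cycle back, so existence over an arbitrary
  vertex type can use the program.\<close>

lemma relabel:
  assumes G: "simple_graph V E" "planar V E" and C: "hamilton_cycle V E C"
  obtains E' where "simple_graph {..<card V} E'" "planar {..<card V} E'" "hamilton_cycle {..<card V} E' [0..<card V]" "card E' = card E"
    "\<And>K. is_cycle {..<card V} E' K \<Longrightarrow> is_cycle V E (map ((!) C) K)" "\<And>K. is_cycle {..<card V} E' K \<Longrightarrow> card (set (map ((!) C) K)) = card (set K)"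
proof -
  define n where "n = card V"
  have d: "distinct C" "set C = V" and len3: "3 \<le> length C" and ce: "\<And>i. i < length C \<Longrightarrow> {C ! i, C ! (Suc i mod length C)} \<in> E"
    using C unfolding hamilton_cycle_def is_cycle_def by auto
  have len: "length C = n" unfolding n_def using distinct_card[OF d(1)] d(2) by simp
  let ?f = "(!) C"
  have fV: "?f ` {..<n} = V" using d(2) len by (auto simp: set_conv_nth)
  have inj: "inj_on ?f {..<n}" using d(1) len by (simp add: inj_on_nth)
  define E' where "E' = {e. e \<subseteq> {..<n} \<and> ?f ` e \<in> E}"
  have E: "e \<subseteq> V" "card e = 2" if "e \<in> E" for e using G(1) that unfolding simple_graph_def by auto
  have s': "simple_graph {..<n} E'"
    unfolding simple_graph_def
  proof (intro conjI ballI)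
    fix e assume e: "e \<in> E'"
    show "e \<subseteq> {..<n}" using e unfolding E'_def by simp
    then have "card (?f ` e) = card e" using inj by (meson card_image inj_on_subset)
    then show "card e = 2" using e E(2) unfolding E'_def by simp
  qed simp
  have inj': "inj_on ((`) ?f) E'" unfolding E'_def by (rule inj_onI) (use inj in \<open>auto simp: inj_on_image_eq_iff\<close>)
  have "(`) ?f ` E' = E"
  proof
    show "E \<subseteq> (`) ?f ` E'"
    proof
      fix e assume e: "e \<in> E"
      then have "e \<subseteq> ?f ` {..<n}" using E(1) fV by simp
      then obtain e' where "e' \<subseteq> {..<n}" "e = ?f ` e'" by (elim subset_imageE)
      then show "e \<in> (`) ?f ` E'" using e unfolding E'_def by blast
    qed
  qed (auto simp: E'_def)
  then have c': "card E' = card E" using card_image[OF inj'] by simp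
  have p': "planar {..<n} E'"
  proof -
    obtain pos :: "'a \<Rightarrow> complex" and crv :: "'a set \<Rightarrow> real \<Rightarrow> complex" where P0: "inj_on pos V \<and>
      (\<forall>e\<in>E. arc (crv e) \<and> {pathstart (crv e), pathfinish (crv e)} = pos ` e \<and> path_image (crv e) \<inter> pos ` V = pos ` e) \<and>
      (\<forall>e\<in>E. \<forall>f\<in>E. e \<noteq> f \<longrightarrow> path_image (crv e) \<inter> path_image (crv f) \<subseteq> pos ` (e \<inter> f))"
      using G(2) unfolding planar_def by (elim exE)
    note P1 = P0[THEN conjunct1] and P2 = P0[THEN conjunct2, THEN conjunct1, THEN bspec]
      and P3 = P0[THEN conjunct2, THEN conjunct2, THEN bspec, THEN bspec, THEN mp]
    show ?thesis unfolding planar_def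
    proof (intro exI[of _ "pos \<circ> ?f"] exI[of _ "\<lambda>e. crv (?f ` e)"] conjI ballI impI)
      show "inj_on (pos \<circ> ?f) {..<n}" by (rule comp_inj_on[OF inj]) (simp only: fV P1)
    next
      fix e assume "e \<in> E'"
      then have "?f ` e \<in> E" unfolding E'_def by simp
      note Q = P2[OF this]
      show "arc (crv (?f ` e))" "{pathstart (crv (?f ` e)), pathfinish (crv (?f ` e))} = (pos \<circ> ?f) ` e"
        "path_image (crv (?f ` e)) \<inter> (pos \<circ> ?f) ` {..<n} = (pos \<circ> ?f) ` e"
        using Q unfolding image_comp[symmetric] fV by blast+
    next
      fix e1 e2 assume e: "e1 \<in> E'" "e2 \<in> E'" "e1 \<noteq> e2"
      then have "?f ` e1 \<noteq> ?f ` e2" using inj' by (meson inj_onD)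
      then have "path_image (crv (?f ` e1)) \<inter> path_image (crv (?f ` e2)) \<subseteq> pos ` (?f ` e1 \<inter> ?f ` e2)"
        using e unfolding E'_def by (intro P3) simp_all
      also have "?f ` e1 \<inter> ?f ` e2 = ?f ` (e1 \<inter> e2)"
        using inj e unfolding E'_def by (intro inj_on_image_Int[symmetric, OF inj]) auto
      finally show "path_image (crv (?f ` e1)) \<inter> path_image (crv (?f ` e2)) \<subseteq> (pos \<circ> ?f) ` (e1 \<inter> e2)" by (simp add: image_comp)
    qed
  qed
  have h': "hamilton_cycle {..<n} E' [0..<n]"
    unfolding hamilton_cycle_def is_cycle_def
  proof (intro conjI allI impI)
    fix i assume "i < length [0..<n]"
    then have i: "i < n" by simp
    then have "Suc i mod n < n" by simp
    then show "{[0..<n] ! i, [0..<n] ! (Suc i mod length [0..<n])} \<in> E'"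
      using i ce[of i] len unfolding E'_def by simp
  qed (use len len3 in auto)
  have K: "is_cycle V E (map ?f K) \<and> card (set (map ?f K)) = card (set K)" if K: "is_cycle {..<n} E' K" for K
  proof -
    have k: "3 \<le> length K" "distinct K" "set K \<subseteq> {..<n}" "\<And>i. i < length K \<Longrightarrow> {K ! i, K ! (Suc i mod length K)} \<in> E'"
      using K unfolding is_cycle_def by auto
    have ik: "inj_on ?f (set K)" using inj k(3) by (rule inj_on_subset)
    have "{map ?f K ! i, map ?f K ! (Suc i mod length (map ?f K))} \<in> E" if i: "i < length (map ?f K)" for i
    proof -
      have i': "i < length K" using i by simp
      then have "Suc i mod length K < length K" by (metis mod_less_divisor not_less_zero gr0I)
      then show ?thesis using k(4)[OF i'] i' unfolding E'_def by simp
    qed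
    moreover have "set (map ?f K) \<subseteq> V" using k(3) fV by auto
    moreover have "distinct (map ?f K)" using k(2) ik by (simp add: distinct_map)
    ultimately have "is_cycle V E (map ?f K)" unfolding is_cycle_def using k(1) by simp
    then show ?thesis using card_image[OF ik] by simp
  qed
  show thesis by (rule that[of E']) (use s' p' h' c' K in \<open>simp_all add: n_def\<close>)
qed

section \<open>The complete program\<close>

definition copy_cycle :: com where
  "copy_cycle = for_loop ''len'' (Var ''n'') (Put ''out'' (Var ''len'') (Get ''ham'' (Var ''len'')))"

definition output_phase :: com where
  "output_phase = If (Less (Const 0) (Var ''N'')) (Seq scan_faces (Seq search_window write_cycle)) copy_cycle"

definition sort_phase :: com where
  "sort_phase = Seq (Seq (fill_buckets ''h1'' ''x1'' ''it'' ''k1'') (empty_buckets ''h1'' ''x1'' ''it1'' (Var ''n'')))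
    (Seq (fill_buckets ''h2'' ''x2'' ''it1'' ''k2'') (empty_buckets ''h2'' ''x2'' ''w'' (Plus (Var ''n'') (Var ''n''))))"

definition colour_phase :: com where
  "colour_phase = Seq scan_chords (Seq paint_chords (Seq choose_colour filter_word))"

definition cycle_program :: com where
  "cycle_program = Seq load_positions (Seq load_chords (Seq sort_phase (Seq colour_phase output_phase)))"

lemma output_list_stores:
  assumes "r ''len'' = length xs" "stores (h ''out'') xs" shows "output_list (r, h) = xs"
  unfolding output_list_def by (rule nth_equalityI) (use assms in \<open>simp_all add: stores_def\<close>)

lemma wp_copy_cycle:
  assumes r: "r ''n'' = n" and H: "length H = n" "\<And>p. p < n \<Longrightarrow> h ''ham'' p = H ! p" "\<And>p. p < n \<Longrightarrow> H ! p \<le> W" and W: "n \<le> W"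
    and Q: "\<And>r' h' t'. output_list (r', h') = H \<Longrightarrow> t' \<le> a + 3 * n + 2 \<Longrightarrow> Q (r', h') t'"
  shows "wp W copy_cycle Q (r, h) a"
  unfolding copy_cycle_def
proof (rule wp_for_loop[where n = n and J = "\<lambda>j s b. fst s ''len'' = j \<and> fst s ''n'' = n \<and> snd s ''ham'' = h ''ham'' \<and>
    stores (snd s ''out'') (take j H) \<and> b \<le> a + 1 + 3 * j"], goal_cases)
  case (3 j r' h' b)
  then have j: "j < n" and I: "r' ''len'' = j" "r' ''n'' = n" "h' ''ham'' = h ''ham''" "stores (h' ''out'') (take j H)" "b \<le> a + 1 + 3 * j" by auto
  have "stores ((h' ''out'')(j := H ! j)) (take (Suc j) H)"
    using stores_snoc[OF I(4), of j "H ! j"] j H(1) by (simp add: take_Suc_conv_app_nth)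
  then show ?case using I j H(2,3)[OF j] by simp
next
  case (4 r' h' b)
  then show ?case using H(1) by (intro Q output_list_stores) auto
qed (use r W in auto)

lemma (in polygon) wp_output_phase:
  assumes r: "r ''N'' = T" "r ''n'' = n" "r ''k'' = k" "r ''g'' = g" "r ''lst'' = 0" "r ''len'' = 0"
    and arr: "\<And>t. t < T \<Longrightarrow> h ''e'' t = e t" "\<And>t. t < T \<Longrightarrow> h ''l'' t = l t"
    and H: "distinct H" "length H = n" "set H \<subseteq> V" "\<And>p. p < n \<Longrightarrow> {H ! p, H ! (Suc p mod n)} \<in> E" "\<And>x. x \<in> X \<Longrightarrow> {H ! ca x, H ! cb x} \<in> E"
    and hh: "\<And>p. p < n \<Longrightarrow> h ''ham'' p = H ! p" "\<And>p. p < n \<Longrightarrow> H ! p \<le> W"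
    and z: "\<And>c. h ''fid'' c = 0" "\<And>c. h ''cnt'' c = 0" "\<And>c. h ''fo'' c = 0"
    and W: "2 * T + n + 1 \<le> W" "\<And>z. z \<in> X \<Longrightarrow> z \<le> W"
    and g: "1 \<le> g" and num: "k \<le> n" "n \<le> 2 * card X + g + 1" "k \<le> card X + 2 * g + 1" "n \<le> card X + k"
    and Q: "\<And>s' t'. cycle_in_range V E k g (output_list s') \<Longrightarrow> t' \<le> a + 58 * T + 8 * n + 20 \<Longrightarrow> Q s' t'"
  shows "wp W output_phase Q (r, h) a"
proof -
  have b: "bval (Less (Const 0) (Var ''N'')) (r, h)" using r(1) T_pos by simp
  show ?thesis unfolding output_phase_def wp_If if_P[OF b] wp_Seq
  proof (rule wp_scan_faces[OF r(1,2,5)], goal_cases)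
    case (1 t) then show ?case by (rule arr(1))
  next
    case (2 t) then show ?case by (rule arr(2))
  next
    case (3 c) show ?case by (rule z)
  next
    case (4 c) show ?case by (rule z)
  next
    case (5 c) show ?case by (rule z)
  next
    case 6 show ?case by (rule W(1))
  next
    case (7 c) then show ?case by (rule W(2))
  next
    case (8 r1 h1 t1)
    note A = this
    have r1: "r1 ''N'' = T" "r1 ''n'' = n" "r1 ''k'' = k" "r1 ''g'' = g" "r1 ''len'' = 0" using A(1) r by simp_all
    have h1: "h1 ''l'' = h ''l''" "h1 ''ham'' = h ''ham''" using A(2) by simp_all
    show ?case
    proof (rule wp_search_window[OF r1(1,3,4) A(3) g num W(1)], goal_cases)
      case (1 r2 t2 i z)
      note B = this
      have r2: "r2 ''N'' = T" "r2 ''n'' = n" "r2 ''len'' = 0" using B(1) r1 by simp_all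
      show ?case
      proof (rule wp_write_cycle[OF r2(1,2) B(2,3) r2(3) B(4,5) A(3), where H = H], goal_cases)
        case (1 t) then show ?case using arr(2) h1 by simp
      next
        case (2 p) then show ?case using hh(1) h1 by simp
      next
        case (3 p) then show ?case by (rule hh(2))
      next
        case 4 show ?case by (rule W(1))
      next
        case (5 r3 h3 t3 qs)
        note C = this
        have w1: "1 \<le> weight (int i) (int i + int z)"
        proof -
          have "1 \<le> cw (vi (int i))" by (rule cw_pos) simp
          also have "\<dots> = weight (int i) (int i)" by simp
          also have "\<dots> \<le> weight (int i) (int i + int z)" by (rule weight_mono) simp_all
          finally show ?thesis .
        qed
        have l3: "3 \<le> length qs" using C(3) w1 by linarith
        have cyc: "is_cycle V E (map (vertex_at H) qs)" by (rule walk_cycle[OF C(1,2) l3 H])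
        have out: "output_list (r3, h3) = map (vertex_at H) qs" by (rule output_list_stores) (use C(4,5) in simp_all)
        have "card (set (map (vertex_at H) qs)) = length qs" using cyc distinct_card unfolding is_cycle_def by fastforce
        then have "cycle_in_range V E k g (map (vertex_at H) qs)"
          unfolding cycle_in_range_def using cyc C(3) B(6,7) by linarith
        then show ?case using out C(6) B(8) A(4) by (intro Q) simp_all
      qed
    qed
  qed
qed

context ham_graph
begin

text \<open>The program is followed phase by phase. Each phase provides the interpretation of the
  locale that the next one is verified in: sorted items, the word of all chord ends, and the polygon
  cut by the kept class.\<close>

lemma wp_cycle_program:
  assumes pl: "planar {..<n} E" and adm: "admissible n (card E) \<gamma> k g" and W: "W = 400 * (n + card E + k + g)"
  shows "wp W cycle_program (\<lambda>s t. t \<le> 400 * (n + card E) \<and> cycle_in_range {..<n} E k g (output_list s)) (input_state n es H k g) 0"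
proof -
  let ?q = "length D"
  let ?Q = "\<lambda>s t. t \<le> 400 * (n + card E) \<and> cycle_in_range {..<n} E k g (output_list s)"
  have qm: "?q \<le> card E" using length_chord_list_le[of n "position H" es] length_es unfolding D_def by simp
  have n3: "3 \<le> n" by (rule H_facts(4))
  have WW: "2 * n + 2 * card E + 2 \<le> W" "4 * ?q + n + 1 \<le> W" "n + n \<le> W" "n \<le> W" "2 * ?q + 1 \<le> W" "1 \<le> W" "?q \<le> W" "2 * ?q \<le> W"
    using n3 qm unfolding W by simp_all
  have HW: "H ! p \<le> W" if "p < n" for p using H_facts(6)[OF that] WW(4) by simp
  obtain side :: "nat set \<Rightarrow> bool" where side: "\<And>a c b d. a < c \<Longrightarrow> c < b \<Longrightarrow> b < d \<Longrightarrow> d < n \<Longrightarrow>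
      {H ! a, H ! b} \<in> E \<Longrightarrow> {H ! c, H ! d} \<in> E \<Longrightarrow> side {H ! a, H ! b} \<noteq> side {H ! c, H ! d}"
    using planar_two_sides[OF simple pl ham] unfolding H_facts(3) by metis
  obtain r h where rh: "input_state n es H k g = (r, h)" by fastforce
  have r0: "r = (\<lambda>_. 0)(''n'' := n, ''m'' := length es, ''k'' := k, ''g'' := g)"
    and h0: "h = (\<lambda>_ _. 0)(''src'' := to_array (map fst es), ''dst'' := to_array (map snd es), ''ham'' := to_array H)"
    using rh unfolding input_state_def by simp_all
  have rv: "r ''n'' = n" "r ''m'' = length es" "r ''k'' = k" "r ''g'' = g" "r ''q'' = 0" "r ''T'' = 0" "r ''top'' = 0" "r ''c1'' = 0"
    "r ''N'' = 0" "r ''lst'' = 0" "r ''len'' = 0" unfolding r0 by simp_all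
  have hv: "h ''h1'' = (\<lambda>_. 0)" "h ''h2'' = (\<lambda>_. 0)" "h ''opn'' = (\<lambda>_. 0)" "h ''st'' = (\<lambda>_. 0)" "h ''nxt'' = (\<lambda>_. 0)" "h ''prv'' = (\<lambda>_. 0)"
    "h ''col'' = (\<lambda>_. 0)" "h ''fid'' = (\<lambda>_. 0)" "h ''cnt'' = (\<lambda>_. 0)" "h ''fo'' = (\<lambda>_. 0)"
    "\<And>j. j < n \<Longrightarrow> h ''ham'' j = H ! j" "\<And>j. j < length es \<Longrightarrow> h ''src'' j = fst (es ! j)" "\<And>j. j < length es \<Longrightarrow> h ''dst'' j = snd (es ! j)"
    unfolding h0 using H_facts(3) by (simp_all add: to_array_def)
  show ?thesis unfolding rh cycle_program_def wp_Seq
  proof (rule wp_load_positions[where H = H], goal_cases)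
    case 1 show ?case by (rule H_facts(1))
  next
    case 2 show ?case using rv H_facts(3) by simp
  next
    case (3 j) then show ?case using hv(11) rv by simp
  next
    case 4 show ?case using rv WW by simp
  next
    case (5 r1 h1 a1)
    have R1: "r1 x = r x" if "x \<noteq> ''i''" for x using 5(1) that by simp
    have G1: "h1 x = h x" if "x \<noteq> ''pos''" for x using 5(2) that by simp
    have P1: "h1 ''pos'' (H ! j) = j" if "j < n" for j using 5(3) rv that by simp
    have DD: "chord_list n (h1 ''pos'') es = D" using chord_list_D P1 by blast
    have pos1: "h1 ''pos'' u < n" if "u < n" for u using P1[OF pos_H(1)[OF that]] pos_H[OF that] by simp
    have t1: "a1 \<le> 3 * n + 2" using 5(4) rv by simp
    have src1: "h1 ''src'' j = fst (es ! j)" "h1 ''dst'' j = snd (es ! j)" if "j < length es" for j using G1 hv(12,13) that by simp_all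
    show ?case
    proof (rule wp_load_chords[where es = es and n = n], goal_cases)
      case 1 show ?case using R1 rv by simp
    next
      case 2 show ?case using R1 rv by simp
    next
      case 3 show ?case using R1 rv by simp
    next
      case 4 show ?case using R1 rv by simp
    next
      case (5 j) then show ?case by (rule src1)
    next
      case (6 j) then show ?case by (rule src1)
    next
      case (7 j) then show ?case using pos1 edge_ends(2)[of "es ! j"] by simp
    next
      case (8 j) then show ?case using pos1 edge_ends(3)[of "es ! j"] by simp
    next
      case 9 show ?case using WW(1) length_es by simp
    next
      case (10 r2 h2 a2)
      have R2: "r2 x = r1 x" if "x \<notin> chord_regs" for x using 10(1) that by simp
      have G2: "h2 x = h1 x" if "x \<notin> chord_arrs" for x using 10(2) that by simp
      have q2: "r2 ''q'' = ?q" "r2 ''T'' = 2 * ?q" using 10(3,4) unfolding DD by simp_all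
      have ia: "item_arrays (h2 ''ca'') (h2 ''cb'') (h2 ''it'') (h2 ''k1'') (h2 ''k2'') (h2 ''ce'') (h2 ''vx'') D" using 10(5) unfolding DD .
      have t2: "a2 \<le> a1 + 30 * card E + 2" using 10(6) length_es by simp
      interpret it: chord_items D n "h2 ''ca''" "h2 ''cb''" "h2 ''it''" "h2 ''k1''" "h2 ''k2''" "h2 ''ce''" "h2 ''vx''"
      proof
        show "item_arrays (h2 ''ca'') (h2 ''cb'') (h2 ''it'') (h2 ''k1'') (h2 ''k2'') (h2 ''ce'') (h2 ''vx'') D" by (rule ia)
        show "chord_pair n ab \<and> snd ab < n" if "ab \<in> set D" for ab using D_facts(1,2)[OF that] by blast
        show "distinct D" by (rule distinct_D)
      qed
      have st2: "stores (h2 ''it'') [1..<2 * ?q + 1]" using ia unfolding item_arrays_def by (rule conjunct1)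
      have len0: "length [1..<2 * ?q + 1] = 2 * ?q" by (simp del: upt_Suc)
      have z2: "h2 ''h1'' c = 0" "h2 ''h2'' c = 0" for c using G2[of "''h1''"] G2[of "''h2''"] G1 hv by (simp_all add: chord_arrs_def)
      have n2: "r2 ''n'' = n" using R2[of "''n''"] R1 rv by (simp add: chord_regs_def)
      define ws where "ws = it.all_items"
      have iw: "it.item_word ws {1..?q}" unfolding ws_def by (rule it.item_word_all)
      have sf: "set it.first_sort = set [1..<2 * ?q + 1]" by (rule it.set_first_sort)
      have lf: "length it.first_sort = 2 * ?q" by (rule it.length_first_sort)
      have lw: "length ws = 2 * ?q"
      proof -
        have "length ws = length it.first_sort" unfolding ws_def
          by (rule length_bucket_sort) (use it.key_bounds(2) sf in \<open>auto intro: distinct_bucket_sort simp del: upt_Suc\<close>)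
        then show ?thesis using lf by simp
      qed
      have setw: "z \<in> set ws \<longleftrightarrow> z \<in> set [1..<2 * ?q + 1]" for z
        using iw it.set_items unfolding it.item_word_def by (simp only:)
      define p1 where "p1 = Seq (fill_buckets ''h1'' ''x1'' ''it'' ''k1'') (empty_buckets ''h1'' ''x1'' ''it1'' (Var ''n''))"
      define p2 where "p2 = Seq (fill_buckets ''h2'' ''x2'' ''it1'' ''k2'') (empty_buckets ''h2'' ''x2'' ''w'' (Plus (Var ''n'') (Var ''n'')))"
      have sp: "sort_phase = Seq p1 p2" unfolding sort_phase_def p1_def p2_def ..
      show ?case unfolding sp wp_Seq unfolding p1_def
      proof (rule wp_sort_pass[where xs = "[1..<2 * ?q + 1]" and kk = n], goal_cases)
        case 1 show ?case by simp
      next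
        case 2 show ?case using q2 len0 by simp
      next
        case 3 show ?case using len0 WW by simp
      next
        case 4 show ?case using WW by simp
      next
        case (5 t) then show ?case using st2 unfolding stores_def by blast
      next
        case 6 show ?case by (rule distinct_upt)
      next
        case (7 x)
        then have "1 \<le> x \<and> x < 2 * ?q + 1" by (simp only: set_upt atLeastLessThan_iff)
        then show ?case using it.key_bounds(1)[OF 7] WW(5) by (intro conjI; linarith)
      next
        case (8 c) show ?case by (rule z2)
      next
        case (9 r' h') then show ?case using n2 by simp
      next
        case (10 r3 h3 a3)
        have R3: "r3 x = r2 x" if "x \<notin> {''i'', ''x'', ''c'', ''L''}" for x using 10(1) that by simp
        have G3: "h3 x = h2 x" if "x \<notin> {''h1'', ''x1'', ''it1''}" for x using 10(2) that by simp
        have st3: "stores (h3 ''it1'') it.first_sort" by (rule 10(3))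
        have t3: "a3 \<le> a2 + 20 * ?q + 4 * n + 5" using 10(4) len0 by simp
        have k3: "h3 ''k2'' = h2 ''k2''" using G3 by simp
        have n3': "r3 ''n'' = n" using R3 n2 by simp
        show ?case unfolding p2_def
        proof (rule wp_sort_pass[where xs = it.first_sort and kk = "n + n"], goal_cases)
          case 1 show ?case by simp
        next
          case 2 show ?case using R3 q2 lf by simp
        next
          case 3 show ?case using lf WW by simp
        next
          case 4 show ?case using WW by simp
        next
          case (5 t) then show ?case using st3 unfolding stores_def by blast
        next
          case 6 show ?case by (rule distinct_bucket_sort, rule distinct_upt)
        next
          case (7 x)
          then have x: "x \<in> set [1..<2 * ?q + 1]" using sf by blast
          then have "1 \<le> x \<and> x < 2 * ?q + 1" by (simp only: set_upt atLeastLessThan_iff)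
          then show ?case unfolding k3 using it.key_bounds(2)[OF x] WW(5) by (intro conjI; linarith)
        next
          case (8 c) show ?case using G3[of "''h2''"] z2 by simp
        next
          case (9 r' h') then show ?case using n3' by simp
        next
          case (10 r4 h4 a4)
          have R4: "r4 x = r x" if "x \<notin> {''i'', ''x'', ''c'', ''L'', ''u'', ''v'', ''a'', ''b'', ''q'', ''T''}" for x
            using 10(1) R3[of x] R2[of x] R1[of x] that unfolding chord_regs_def by simp
          have G4: "h4 x = h2 x" if "x \<notin> {''h1'', ''x1'', ''it1'', ''h2'', ''x2'', ''w''}" for x using 10(2) G3[of x] that by simp
          have G4': "h4 x = h x" if "x \<notin> {''h1'', ''x1'', ''it1'', ''h2'', ''x2'', ''w'', ''pos''}" "x \<notin> chord_arrs" for x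
            using G4[of x] G2[of x] G1[of x] that by simp
          have q4: "r4 ''q'' = ?q" "r4 ''T'' = 2 * ?q" using 10(1) R3 q2 by simp_all
          have st4: "stores (h4 ''w'') ws" using 10(3) unfolding k3 ws_def .
          have t4: "a4 \<le> a3 + 20 * ?q + 8 * n + 5" using 10(4) lf by simp
          have ce4: "h4 ''ce'' = h2 ''ce''" "h4 ''vx'' = h2 ''vx''" using G4 by simp_all
          have z4: "h4 ''opn'' = (\<lambda>_. 0)" "h4 ''st'' = (\<lambda>_. 0)" "h4 ''nxt'' = (\<lambda>_. 0)" "h4 ''prv'' = (\<lambda>_. 0)" "h4 ''col'' = (\<lambda>_. 0)"
            "h4 ''fid'' = (\<lambda>_. 0)" "h4 ''cnt'' = (\<lambda>_. 0)" "h4 ''fo'' = (\<lambda>_. 0)" "h4 ''ham'' = h ''ham''"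
            using G4' hv by (simp_all add: chord_arrs_def)
          have rv4: "r4 ''n'' = n" "r4 ''k'' = k" "r4 ''g'' = g" "r4 ''top'' = 0" "r4 ''c1'' = 0" "r4 ''N'' = 0" "r4 ''lst'' = 0" "r4 ''len'' = 0"
            using R4 rv by simp_all
          define X where "X = {1..?q}"
          have iwX: "it.item_word ws X" using iw unfolding X_def .
          interpret w: end_word_loc "length ws" X "\<lambda>t. h2 ''ce'' (ws ! t)" "it.fi ws" "it.la ws"
            by unfold_locales (use it.end_word_items[OF iwX] in \<open>simp_all add: X_def\<close>)
          \<comment> \<open>The proper colouring needed by the scan: the side of the Hamilton cycle
            on which a chord is drawn. Interlaced ends are genuine crossings, so the sides
            differ.\<close>
          define \<kappa> where "\<kappa> x = (if side {H ! h2 ''ca'' x, H ! h2 ''cb'' x} then 1 else 0 :: nat)" for x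
          have chE: "{H ! h2 ''ca'' x, H ! h2 ''cb'' x} \<in> E" if "x \<in> X" for x
          proof -
            have x: "x \<in> {1..?q}" using that unfolding X_def .
            then have "1 \<le> x" "x \<le> ?q" by simp_all
            then have "x - 1 < ?q" by linarith
            then have "D ! (x - 1) \<in> set D" by (rule nth_mem)
            then show ?thesis using D_facts(3) it.item(9)[OF x] by fastforce
          qed
          have ch: "\<kappa> x \<noteq> \<kappa> y" if xy: "x \<in> X" "y \<in> X" "interlaced (it.fi ws) (it.la ws) x y" for x y
          proof -
            have y: "h2 ''cb'' y < n" using it.item(12)[of y] xy(2) unfolding X_def by blast
            have "side {H ! h2 ''ca'' x, H ! h2 ''cb'' x} \<noteq> side {H ! h2 ''ca'' y, H ! h2 ''cb'' y}"
              by (rule side[OF it.interlaced_items[OF iwX xy] y chE[OF xy(1)] chE[OF xy(2)]])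
            then show ?thesis unfolding \<kappa>_def by auto
          qed
          have XW: "z \<le> W" if "z \<in> X" for z using that WW(7) unfolding X_def by simp
          have wt4: "h4 ''ce'' (h4 ''w'' t) = h2 ''ce'' (ws ! t)" if "t < length ws" for t using st4 that unfolding stores_def ce4 by simp
          show ?case unfolding colour_phase_def wp_Seq
          proof (rule w.wp_scan_chords[where \<kappa> = \<kappa>], goal_cases)
            case 1 show ?case using q4 lw by simp
          next
            case 2 show ?case by (rule rv4)
          next
            case (3 t) then show ?case by (rule wt4)
          next
            case (4 c) show ?case using z4 by simp
          next
            case (5 c) show ?case using z4 by simp
          next
            case 6 show ?case using z4 by simp
          next
            case 7 show ?case using z4 by simp
          next
            case 8 show ?case using lw WW by simp
          next
            case 9 show ?case by (rule WW(6))
          next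
            case (10 z) then show ?case by (rule XW)
          next
            case (11 x y) then show ?case by (rule ch)
          next
            case (12 z) show ?case unfolding \<kappa>_def by simp
          next
            case (13 r5 h5 a5 Op)
            have R5: "r5 x = r4 x" if "x \<notin> scan_regs" for x using 13(1) that unfolding w.scan_frame_def by blast
            have G5: "h5 x = h4 x" if "x \<notin> scan_arrs" for x using 13(1) that unfolding w.scan_frame_def by blast
            have h5: "h5 ''ce'' = h2 ''ce''" "h5 ''vx'' = h2 ''vx''" "h5 ''w'' = h4 ''w''" "h5 ''col'' = (\<lambda>_. 0)"
              using G5 ce4 z4 by (simp_all add: scan_arrs_def)
            have r5: "r5 ''T'' = 2 * ?q" "r5 ''q'' = ?q" "r5 ''c1'' = 0" "r5 ''N'' = 0" using R5 q4 rv4 by (simp_all add: scan_regs_def)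
            have opn: "h5 ''opn'' z = Suc (it.fi ws z)" if "z \<in> X" for z using 13(2) that by blast
            have rl: "w.refs_later (length ws) (h5 ''ref'')" using 13(3) unfolding w.col_inv_def by blast
            have wt5: "h5 ''ce'' (h5 ''w'' t) = h2 ''ce'' (ws ! t)" if "t < length ws" for t using wt4[OF that] h5 ce4 by simp
            show ?case
            proof (rule w.wp_paint_chords, goal_cases)
              case 1 show ?case using r5 lw by simp
            next
              case 2 show ?case by (rule r5)
            next
              case (3 t) then show ?case by (rule wt5)
            next
              case (4 z) then show ?case by (rule opn)
            next
              case (5 z) show ?case using h5 by simp
            next
              case 6 show ?case by (rule rl)
            next
              case 7 show ?case using lw WW by simp
            next
              case (8 z) then show ?case by (rule XW)
            next
              case 9 show ?case unfolding X_def by simp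
            next
              case 10 show ?case using WW(7) unfolding X_def by simp
            next
              case (11 r6 h6 a6)
              note col = w.painted_final[OF 13(3) 11(3)]
              have h6: "h6 x = h5 x" if "x \<noteq> ''col''" for x using 11(2) that by simp
              have R6: "r6 x = r5 x" if "x \<notin> {''j'', ''t'', ''x'', ''c1''}" for x using 11(1) that by simp
              show ?case
              proof (rule wp_choose_colour[where X = X], goal_cases)
                case 1 show ?case by (rule 11(4))
              next
                case 2 show ?case using R6 r5 unfolding X_def by simp
              next
                case 3 show ?case unfolding X_def by simp
              next
                case (4 z) show ?case by (rule col(1))
              next
                case 5 show ?case by (rule WW(6))
              next
                case (6 b a7)
                define zs where "zs = filter (\<lambda>z. h6 ''col'' (h2 ''ce'' z) = b) ws"
                define X' where "X' = {x\<in>X. h6 ''col'' x = b}"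
                have iz: "it.item_word zs X'" unfolding zs_def X'_def by (rule it.item_word_filter[OF iwX, of "\<lambda>x. h6 ''col'' x = b"])
                have fX: "finite X'" unfolding X'_def X_def by simp
                have ce6: "h6 ''ce'' = h2 ''ce''" "h6 ''vx'' = h2 ''vx''" "h6 ''w'' = h4 ''w''" using h6 h5 by simp_all
                have q7: "?q \<le> 2 * card X'" using 6(1) unfolding X'_def X_def by simp
                note num = admissible_bounds[OF adm few_hamilton_edges q7]
                let ?r = "r6(''best'' := b)"
                have r6: "?r ''T'' = 2 * ?q" "?r ''N'' = 0" using R6 r5 by simp_all
                have bw: "z \<le> W \<and> h6 ''ce'' z \<le> W \<and> h6 ''vx'' z \<le> W" if z: "z \<in> set ws" for z
                proof -
                  have zq: "z \<in> set [1..<2 * ?q + 1]" using z setw by blast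
                  then obtain x where x: "x \<in> {1..?q}" "z = 2 * x \<or> z = 2 * x - 1" unfolding it.set_items by blast
                  have xv: "h2 ''ca'' x < n" "h2 ''cb'' x < n" "x \<le> ?q" using it.item(10,12)[OF x(1)] x(1) by auto
                  have "h2 ''ce'' z = x \<and> (h2 ''vx'' z = h2 ''ca'' x \<or> h2 ''vx'' z = h2 ''cb'' x)"
                    using x(2) it.item(3,4,7,8)[OF x(1)] by blast
                  moreover have "z < 2 * ?q + 1" using zq by (simp only: set_upt atLeastLessThan_iff)
                  ultimately show ?thesis unfolding ce6 using xv WW by auto
                qed
                show ?case
                proof (rule wp_filter_word[where ws = ws and zs = zs], goal_cases)
                  case 1 show ?case using r6 lw by simp
                next
                  case 2 show ?case by (rule r6)
                next
                  case 3 show ?case using st4 ce6 by simp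
                next
                  case 4 show ?case using lw WW by simp
                next
                  case (5 z) then show ?case by (rule bw)
                next
                  case 6 show ?case unfolding zs_def ce6 by simp
                next
                  case (7 r8 h8 a8)
                  have R8: "r8 x = r4 x" if "x \<notin> {''i'', ''x'', ''N'', ''best'', ''j'', ''t'', ''c1''}" "x \<notin> scan_regs" for x
                    using 7(1) R6[of x] R5[of x] that by simp
                  have G8: "h8 x = h4 x" if "x \<notin> {''e'', ''l'', ''col''}" "x \<notin> scan_arrs" for x
                    using 7(2) h6[of x] G5[of x] that by simp
                  have r8: "r8 ''n'' = n" "r8 ''k'' = k" "r8 ''g'' = g" "r8 ''lst'' = 0" "r8 ''len'' = 0"
                    using R8 rv4 by (simp_all add: scan_regs_def)
                  have h8: "h8 ''fid'' = (\<lambda>_. 0)" "h8 ''cnt'' = (\<lambda>_. 0)" "h8 ''fo'' = (\<lambda>_. 0)" "h8 ''ham'' = h ''ham''"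
                    using G8 z4 by (simp_all add: scan_arrs_def)
                  have ham8: "h8 ''ham'' p = H ! p" if "p < n" for p using h8(4) hv(11)[OF that] by simp
                  have lz: "length zs \<le> 2 * ?q" unfolding zs_def using length_filter_le[of _ ws] lw by metis
                  have t8: "a8 \<le> 15 * n + 30 * card E + 130 * ?q + 40"
                    using 7(6) 6(2) 11(5) 13(4) t4 t3 t2 t1 lw by simp
                  show ?case
                  proof (cases "X' = {}")
                    case True
                    then have "set zs = {}" using iz unfolding it.item_word_def by simp
                    then have N: "\<not> bval (Less (Const 0) (Var ''N'')) (r8, h8)" using 7(3) by simp
                    \<comment> \<open>With no chord kept, the bound \<open>n \<le> q + k\<close>
                      leaves only \<open>k = n\<close>, and the Hamilton cycle itself is the
                      answer.\<close>
                    have kn: "k = n" using num(3,5) True by simp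
                    show ?thesis unfolding output_phase_def wp_If if_not_P[OF N]
                    proof (rule wp_copy_cycle[where n = n and H = H], goal_cases)
                      case 1 show ?case by (rule r8(1))
                    next
                      case 2 show ?case by (rule H_facts(3))
                    next
                      case (3 p) then show ?case by (rule ham8)
                    next
                      case (4 p) then show ?case by (rule HW)
                    next
                      case 5 show ?case by (rule WW(4))
                    next
                      case (6 r9 h9 a9)
                      have "card (set H) = n" using H_facts(2) by simp
                      moreover have "is_cycle {..<n} E H" using ham unfolding hamilton_cycle_def by blast
                      ultimately have "cycle_in_range {..<n} E k g H" unfolding cycle_in_range_def using kn num(6) by simp
                      then show ?case using 6 t8 qm n3 by simp
                    qed
                  next
                    case False
                    interpret p: polygon "length zs" X' "\<lambda>t. h2 ''ce'' (zs ! t)" "it.fi zs" "it.la zs" n "\<lambda>t. h2 ''vx'' (zs ! t)" "h2 ''ca''" "h2 ''cb''"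
                    proof
                      show "end_word (length zs) X' (\<lambda>t. h2 ''ce'' (zs ! t)) (it.fi zs) (it.la zs)" by (rule it.end_word_items[OF iz])
                      show "0 \<notin> X'" unfolding X'_def X_def by simp
                      show "finite X'" by (rule fX)
                      obtain x where "x \<in> X'" using False by blast
                      then show "0 < length zs" using it.item_wordD(2)[OF iz] by fastforce
                      show "h2 ''vx'' (zs ! t) \<le> h2 ''vx'' (zs ! t')" if "t \<le> t'" "t' < length zs" for t t' by (rule it.item_mono[OF iz that])
                      fix x assume x: "x \<in> X'"
                      note d = it.item_wordD[OF iz x]
                      show "h2 ''vx'' (zs ! it.fi zs x) = h2 ''ca'' x" "h2 ''vx'' (zs ! it.la zs x) = h2 ''cb'' x"
                        unfolding d(3,5) by (rule it.item[OF d(1)])+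
                      show "h2 ''ca'' x + 2 \<le> h2 ''cb'' x" "h2 ''cb'' x + 2 \<le> h2 ''ca'' x + n" "h2 ''cb'' x < n" by (rule it.item[OF d(1)])+
                    next
                      fix x y assume xy: "x \<in> X'" "y \<in> X'"
                      note dx = it.item_wordD[OF iz xy(1)] and dy = it.item_wordD[OF iz xy(2)]
                      show "x = y" if "h2 ''ca'' x = h2 ''ca'' y" "h2 ''cb'' x = h2 ''cb'' y" by (rule it.chord_eqI[OF dx(1) dy(1) that])
                      show "\<not> interlaced (it.fi zs) (it.la zs) x y"
                      proof
                        assume "interlaced (it.fi zs) (it.la zs) x y"
                        then have "interlaced (it.fi ws) (it.la ws) x y" using it.interlaced_filter[OF iwX iz zs_def xy] by blast
                        moreover have "x \<in> X" "y \<in> X" "h6 ''col'' x = h6 ''col'' y" using xy unfolding X'_def by auto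
                        ultimately show False using col(2) by blast
                      qed
                    qed
                    have X'X: "x \<in> X" if "x \<in> X'" for x using that unfolding X'_def by simp
                    show ?thesis
                    proof (rule p.wp_output_phase[where H = H and V = "{..<n}" and E = E and k = k and g = g], goal_cases)
                      case 1 show ?case by (rule 7(3))
                    next
                      case (7 t) then show ?case using \<open>stores (h8 ''e'') (map (h6 ''ce'') zs)\<close> unfolding stores_def ce6 by simp
                    next
                      case (8 t) then show ?case using \<open>stores (h8 ''l'') (map (h6 ''vx'') zs)\<close> unfolding stores_def ce6 by simp
                    next
                      case 9 show ?case by (rule H_facts(1))
                    next
                      case 10 show ?case by (rule H_facts(3))
                    next
                      case 11 show ?case using H_facts(2) by simp
                    next
                      case (12 p) then show ?case by (rule H_facts(5))
                    next
                      case (13 x) then show ?case by (intro chE X'X)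
                    next
                      case (14 p) then show ?case by (rule ham8)
                    next
                      case (15 p) then show ?case by (rule HW)
                    next
                      case 19 show ?case using lz WW by simp
                    next
                      case (20 z) then show ?case by (intro XW X'X)
                    next
                      case (26 s' a9)
                      then show ?case using t8 lz qm n3 by simp
                    qed (use r8 h8 num in simp_all)
                  qed
                qed
              qed
            qed
          qed
        qed
      qed
    qed
  qed
qed

end

lemma cycle_program_correct:
  assumes "simple_graph {..<n} E" "planar {..<n} E" "edge_list E es" "hamilton_cycle {..<n} E H" "admissible n (card E) \<gamma> k g"
  shows "\<exists>t s. exec (400 * (n + card E + k + g)) cycle_program (input_state n es H k g) t s \<and>
    t \<le> 400 * (n + card E) \<and> cycle_in_range {..<n} E k g (output_list s)"
proof -
  interpret ham_graph n E es H by unfold_locales (rule assms)+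
  show ?thesis using wp_cycle_program[OF assms(2,5) refl] unfolding wp_def add_0 .
qed

theorem theorem8:
  shows "(\<forall>(V :: 'a set) E \<gamma> k g.
            simple_graph V E \<and> planar V E \<and> hamiltonian V E \<and>
            admissible (card V) (card E) \<gamma> k g \<longrightarrow>
            (\<exists>K. cycle_in_range V E k g K)) \<and>
         (\<exists>(p :: com) (c :: nat). \<forall>n E es H \<gamma> k g.
            simple_graph {..<n} E \<and> planar {..<n} E \<and> edge_list E es \<and>
            hamilton_cycle {..<n} E H \<and> admissible n (card E) \<gamma> k g \<longrightarrow>
            (\<exists>t s. exec (c * (n + card E + k + g)) p (input_state n es H k g) t s \<and>
                   t \<le> c * (n + card E) \<and>
                   cycle_in_range {..<n} E k g (output_list s)))"
proof (intro conjI)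
  show "\<exists>(p :: com) (c :: nat). \<forall>n E es H \<gamma> k g.
            simple_graph {..<n} E \<and> planar {..<n} E \<and> edge_list E es \<and>
            hamilton_cycle {..<n} E H \<and> admissible n (card E) \<gamma> k g \<longrightarrow>
            (\<exists>t s. exec (c * (n + card E + k + g)) p (input_state n es H k g) t s \<and>
                   t \<le> c * (n + card E) \<and>
                   cycle_in_range {..<n} E k g (output_list s))"
    \<comment> \<open>The constant 400 covers the sum of the phase bounds, the number of kept chord
      ends being at most twice the number of edges; the same factor bounds all numbers
      stored.\<close>
    by (rule exI[of _ cycle_program], rule exI[of _ 400], intro allI impI, elim conjE, rule cycle_program_correct)
next
  show "\<forall>(V :: 'a set) E \<gamma> k g.
            simple_graph V E \<and> planar V E \<and> hamiltonian V E \<and>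
            admissible (card V) (card E) \<gamma> k g \<longrightarrow>
            (\<exists>K. cycle_in_range V E k g K)"
  proof (intro allI impI, elim conjE)
    fix V :: "'a set" and E \<gamma> k g
    assume G: "simple_graph V E" "planar V E" "hamiltonian V E" "admissible (card V) (card E) \<gamma> k g"
    \<comment> \<open>Existence is read off from a run of the program on the relabelled graph, whose
      Hamilton cycle is the identity list.\<close>
    obtain C where C: "hamilton_cycle V E C" using G(3) unfolding hamiltonian_def by blast
    obtain E' where E': "simple_graph {..<card V} E'" "planar {..<card V} E'" "hamilton_cycle {..<card V} E' [0..<card V]" "card E' = card E"
      "\<And>K. is_cycle {..<card V} E' K \<Longrightarrow> is_cycle V E (map ((!) C) K)"
      "\<And>K. is_cycle {..<card V} E' K \<Longrightarrow> card (set (map ((!) C) K)) = card (set K)"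
      by (rule relabel[OF G(1,2) C], rule that)
    obtain es where es: "edge_list E' es" using edge_list_exists[OF E'(1)] by blast
    have "admissible (card V) (card E') \<gamma> k g" using G(4) E'(4) by simp
    then obtain K where K: "cycle_in_range {..<card V} E' k g K"
      using cycle_program_correct[OF E'(1,2) es E'(3)] by blast
    then have c: "is_cycle {..<card V} E' K" unfolding cycle_in_range_def by blast
    have "cycle_in_range V E k g (map ((!) C) K)"
      using K E'(5)[OF c] E'(6)[OF c] unfolding cycle_in_range_def by (simp only:)
    then show "\<exists>K. cycle_in_range V E k g K" by blast
  qed
qed

end
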